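(* Let $\pi:M\to\mathbf{T}^2$ be any origami. For every irreducible complex representation $\rho_\alpha$ of the group $\mathrm{Aut}(M)$, the multiplicity $\ell_\alpha$ of $\rho_\alpha$ in the $\mathrm{Aut}(M)$-module $H_1^{(0)}(M,\mathbf{C})$ is not equal to $1$.
   Context: An origami is a ramified covering $\pi:M\to \mathbf{T}^2=\mathbf{R}^2/\mathbf{Z}^2$ from a compact connected surface, unramified outside the point $0\in\mathbf{T}^2$. $\mathrm{Aut}(M)$ is the (finite) group of homeomorphisms $f$ of $M$ with $\pi\circ f=\pi$. $H_1^{(0)}(M,\mathbf{C})$ denotes the kernel of the map $\pi_*:H_1(M,\mathbf{C})\to H_1(\mathbf{T}^2,\mathbf{C})$; it is an $\mathrm{Aut}(M)$-submodule of $H_1(M,\mathbf{C})$. *)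

theory Defs
  imports "HOL-Analysis.Analysis" "HOL-Homology.Homology" "HOL-Algebra.Bij" "HOL-Algebra.Module"
begin

section \<open>The torus\<close>

definition torus_class :: "real \<times> real \<Rightarrow> (real \<times> real) set"
  where "torus_class x = {y. fst y - fst x \<in> \<int> \<and> snd y - snd x \<in> \<int>}"

definition torus :: "(real \<times> real) set topology"
  where "torus = topology (\<lambda>U. U \<subseteq> range torus_class \<and> open (torus_class -` U))"

lemma openin_torus: "openin torus U \<longleftrightarrow> U \<subseteq> range torus_class \<and> open (torus_class -` U)"
proof -
  have "istopology (\<lambda>U. U \<subseteq> range torus_class \<and> open (torus_class -` U))"
    unfolding istopology_def by (auto simp: vimage_Union)
  then show ?thesis
    by (simp add: torus_def)
qed

lemma topspace_torus: "topspace torus = range torus_class"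
proof
  show "topspace torus \<subseteq> range torus_class"
    using openin_topspace[of torus] unfolding openin_torus by (rule conjunct1)
  have "torus_class -` range torus_class = UNIV"
    by blast
  then show "range torus_class \<subseteq> topspace torus"
    by (intro openin_subset) (simp add: openin_torus)
qed

lemma quotient_map_torus_class: "quotient_map euclidean torus torus_class"
  by (simp add: quotient_map_def topspace_torus openin_torus vimage_def)

section \<open>Origamis\<close>

definition surface :: "'a topology \<Rightarrow> bool"
  where "surface M \<longleftrightarrow> Hausdorff_space M \<and> second_countable M \<and>
    (\<forall>x \<in> topspace M. \<exists>U. openin M U \<and> x \<in> U \<and>
       subtopology M U homeomorphic_space (euclidean :: (real \<times> real) topology))"

text \<open>
  A ramified covering of surfaces: every point \<open>y\<close> of the base has a disc neighbourhood \<open>V\<close>,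
  centred at \<open>y\<close>, whose preimage is a disjoint union of discs on each of which the map is
  \<open>z \<mapsto> z ^ k\<close> in suitable coordinates.  It is unramified over \<open>y\<close> if all the exponents
  over \<open>y\<close> are 1; this is required for all \<open>y\<close> outside \<open>B\<close>.
\<close>

definition ramified_covering_outside ::
    "'a topology \<Rightarrow> 'b topology \<Rightarrow> ('a \<Rightarrow> 'b) \<Rightarrow> 'b set \<Rightarrow> bool"
  where "ramified_covering_outside X Y f B \<longleftrightarrow>
    continuous_map X Y f \<and> f ` topspace X = topspace Y \<and>
    (\<forall>y \<in> topspace Y. \<exists>V \<psi> \<U>.
       openin Y V \<and> y \<in> V \<and>
       homeomorphic_map (subtopology Y V) (top_of_set (ball (0::complex) 1)) \<psi> \<and> \<psi> y = 0 \<and>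
       {x \<in> topspace X. f x \<in> V} = \<Union>\<U> \<and> pairwise disjnt \<U> \<and>
       (\<forall>U \<in> \<U>. openin X U \<and>
          (\<exists>\<phi> k. homeomorphic_map (subtopology X U) (top_of_set (ball (0::complex) 1)) \<phi> \<and>
             (1::nat) \<le> k \<and> (y \<notin> B \<longrightarrow> k = 1) \<and> (\<forall>x \<in> U. \<psi> (f x) = \<phi> x ^ k))))"

definition origami :: "'a topology \<Rightarrow> ('a \<Rightarrow> (real \<times> real) set) \<Rightarrow> bool"
  where "origami M \<pi> \<longleftrightarrow>
    surface M \<and> compact_space M \<and> connected_space M \<and> topspace M \<noteq> {} \<and>
    ramified_covering_outside M torus \<pi> {torus_class 0}"

text \<open>
  The automorphisms are represented by functions that are \<open>undefined\<close> off the topspace,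
  as in \<^const>\<open>BijGroup\<close>.
\<close>

definition origami_Aut :: "'a topology \<Rightarrow> ('a \<Rightarrow> (real \<times> real) set) \<Rightarrow> ('a \<Rightarrow> 'a) monoid"
  where "origami_Aut M \<pi> = (BijGroup (topspace M))
    \<lparr>carrier := {f \<in> Bij (topspace M).
       homeomorphic_map M M f \<and> (\<forall>x \<in> topspace M. \<pi> (f x) = \<pi> x)}\<rparr>"

section \<open>Singular homology with complex coefficients\<close>

text \<open>
  The construction of \<^theory>\<open>HOL-Homology.Simplices\<close>, which is for integer coefficients, over
  the complex numbers.
\<close>

type_synonym 'a cchain = "((nat \<Rightarrow> real) \<Rightarrow> 'a) \<Rightarrow>\<^sub>0 complex"

definition scale_fin :: "complex \<Rightarrow> ('b \<Rightarrow>\<^sub>0 complex) \<Rightarrow> ('b \<Rightarrow>\<^sub>0 complex)"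
  where "scale_fin a c = Poly_Mapping.map ((*) a) c"

definition linear_extend :: "('b \<Rightarrow> ('c \<Rightarrow>\<^sub>0 complex)) \<Rightarrow> ('b \<Rightarrow>\<^sub>0 complex) \<Rightarrow> ('c \<Rightarrow>\<^sub>0 complex)"
  where "linear_extend f c = (\<Sum>x \<in> Poly_Mapping.keys c. scale_fin (Poly_Mapping.lookup c x) (f x))"

definition cchains :: "nat \<Rightarrow> 'a topology \<Rightarrow> 'a cchain set"
  where "cchains p X = {c. Poly_Mapping.keys c \<subseteq> singular_simplex_set p X}"

definition cboundary :: "nat \<Rightarrow> 'a cchain \<Rightarrow> 'a cchain"
  where "cboundary p c = (if p = 0 then 0 else
    linear_extend (\<lambda>f. \<Sum>k\<le>p. Poly_Mapping.single (singular_face p k f) ((-1) ^ k)) c)"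

definition cchain_map :: "nat \<Rightarrow> ('a \<Rightarrow> 'b) \<Rightarrow> 'a cchain \<Rightarrow> 'b cchain"
  where "cchain_map p g = linear_extend (\<lambda>f. Poly_Mapping.single (simplex_map p g f) 1)"

definition ccycles :: "nat \<Rightarrow> 'a topology \<Rightarrow> 'a cchain set"
  where "ccycles p X = {c \<in> cchains p X. cboundary p c = 0}"

definition cboundaries :: "nat \<Rightarrow> 'a topology \<Rightarrow> 'a cchain set"
  where "cboundaries p X = cboundary (Suc p) ` cchains (Suc p) X"

text \<open>
  The record type of modules extends that of rings; the ring multiplication and unit play no
  role in a module, and are filled in with dummies.
\<close>

definition chomology :: "nat \<Rightarrow> 'a topology \<Rightarrow> (complex, 'a cchain set) module"
  where "chomology p X = \<lparr>
    carrier = (\<lambda>z. (+) z ` cboundaries p X) ` ccycles p X,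
    mult = undefined,
    one = undefined,
    zero = cboundaries p X,
    add = \<lambda>S T. {x + y |x y. x \<in> S \<and> y \<in> T},
    smult = \<lambda>a S. {scale_fin a x + b |x b. x \<in> S \<and> b \<in> cboundaries p X}\<rparr>"

definition chomology_map ::
    "nat \<Rightarrow> 'b topology \<Rightarrow> ('a \<Rightarrow> 'b) \<Rightarrow> 'a cchain set \<Rightarrow> 'b cchain set"
  where "chomology_map p Y g S = {cchain_map p g x + b |x b. x \<in> S \<and> b \<in> cboundaries p Y}"

definition origami_H10 ::
    "'a topology \<Rightarrow> ('a \<Rightarrow> (real \<times> real) set) \<Rightarrow> (complex, 'a cchain set) module"
  where "origami_H10 M \<pi> = (chomology 1 M)
    \<lparr>carrier := {S \<in> carrier (chomology 1 M).
       chomology_map 1 torus \<pi> S = \<zero>\<^bsub>chomology 1 torus\<^esub>}\<rparr>"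

section \<open>Complex representations\<close>

definition complex_ring :: "complex ring"
  where "complex_ring = \<lparr>carrier = UNIV, mult = (*), one = 1, zero = 0, add = (+)\<rparr>"

lemma field_complex_ring: "field complex_ring"
proof (rule cring.cring_fieldI2)
  show "cring complex_ring"
  proof (rule cringI)
    have "\<exists>y. y + x = 0" for x :: complex
      by (rule exI[of _ "- x"]) simp
    then show "abelian_group complex_ring"
      by (intro abelian_groupI) (auto simp: complex_ring_def)
    show "comm_monoid complex_ring"
      by (rule comm_monoidI) (auto simp: complex_ring_def)
  qed (simp add: complex_ring_def distrib_right)
  show "\<zero>\<^bsub>complex_ring\<^esub> \<noteq> \<one>\<^bsub>complex_ring\<^esub>"
    by (simp add: complex_ring_def)
  show "\<exists>b \<in> carrier complex_ring. a \<otimes>\<^bsub>complex_ring\<^esub> b = \<one>\<^bsub>complex_ring\<^esub>"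
    if "a \<noteq> \<zero>\<^bsub>complex_ring\<^esub>" for a
    using that by (auto simp: complex_ring_def intro: exI[of _ "inverse a"])
qed

definition linear_maps :: "(complex, 'v) module \<Rightarrow> (complex, 'w) module \<Rightarrow> ('v \<Rightarrow> 'w) set"
  where "linear_maps V W = {T \<in> carrier V \<rightarrow> carrier W.
    (\<forall>x \<in> carrier V. \<forall>y \<in> carrier V. T (x \<oplus>\<^bsub>V\<^esub> y) = T x \<oplus>\<^bsub>W\<^esub> T y) \<and>
    (\<forall>a. \<forall>x \<in> carrier V. T (a \<odot>\<^bsub>V\<^esub> x) = a \<odot>\<^bsub>W\<^esub> T x)}"

definition representation ::
    "'g monoid \<Rightarrow> (complex, 'v) module \<Rightarrow> ('g \<Rightarrow> 'v \<Rightarrow> 'v) \<Rightarrow> bool"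
  where "representation G V \<rho> \<longleftrightarrow>
    module complex_ring V \<and>
    (\<forall>g \<in> carrier G. \<rho> g \<in> linear_maps V V) \<and>
    (\<forall>x \<in> carrier V. \<rho> \<one>\<^bsub>G\<^esub> x = x) \<and>
    (\<forall>g \<in> carrier G. \<forall>h \<in> carrier G. \<forall>x \<in> carrier V. \<rho> (g \<otimes>\<^bsub>G\<^esub> h) x = \<rho> g (\<rho> h x))"

definition subrepresentation ::
    "'g monoid \<Rightarrow> (complex, 'v) module \<Rightarrow> ('g \<Rightarrow> 'v \<Rightarrow> 'v) \<Rightarrow> 'v set \<Rightarrow> bool"
  where "subrepresentation G V \<rho> U \<longleftrightarrow>
    submodule U complex_ring V \<and> (\<forall>g \<in> carrier G. \<rho> g ` U \<subseteq> U)"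

definition irreducible_representation ::
    "'g monoid \<Rightarrow> (complex, 'v) module \<Rightarrow> ('g \<Rightarrow> 'v \<Rightarrow> 'v) \<Rightarrow> bool"
  where "irreducible_representation G V \<rho> \<longleftrightarrow>
    representation G V \<rho> \<and> carrier V \<noteq> {\<zero>\<^bsub>V\<^esub>} \<and>
    (\<forall>U. subrepresentation G V \<rho> U \<longrightarrow> U = {\<zero>\<^bsub>V\<^esub>} \<or> U = carrier V)"

definition isomorphic_representations ::
    "'g monoid \<Rightarrow> (complex, 'v) module \<Rightarrow> ('g \<Rightarrow> 'v \<Rightarrow> 'v) \<Rightarrow>
     (complex, 'w) module \<Rightarrow> ('g \<Rightarrow> 'w \<Rightarrow> 'w) \<Rightarrow> bool"
  where "isomorphic_representations G V \<rho> W \<sigma> \<longleftrightarrow>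
    (\<exists>T \<in> linear_maps V W. bij_betw T (carrier V) (carrier W) \<and>
       (\<forall>g \<in> carrier G. \<forall>x \<in> carrier V. T (\<rho> g x) = \<sigma> g (T x)))"

definition irreducible_decomposition ::
    "'g monoid \<Rightarrow> (complex, 'w) module \<Rightarrow> ('g \<Rightarrow> 'w \<Rightarrow> 'w) \<Rightarrow> nat \<Rightarrow> (nat \<Rightarrow> 'w set) \<Rightarrow> bool"
  where "irreducible_decomposition G W \<sigma> m U \<longleftrightarrow>
    (\<forall>i<m. subrepresentation G W \<sigma> (U i) \<and>
       irreducible_representation G (W\<lparr>carrier := U i\<rparr>) \<sigma>) \<and>
    (\<forall>w \<in> carrier W. \<exists>!u. u \<in> (\<Pi>\<^sub>E i\<in>{..<m}. U i) \<and> w = finsum W u {..<m})"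

text \<open>
  The number of summands isomorphic to \<open>V\<close> in a decomposition of \<open>W\<close> as a finite direct sum of
  irreducible subrepresentations.  When \<open>W\<close> is a finite-dimensional representation of a finite
  group, such a decomposition exists and the number does not depend on its choice.
\<close>

definition multiplicity_in ::
    "'g monoid \<Rightarrow> (complex, 'v) module \<Rightarrow> ('g \<Rightarrow> 'v \<Rightarrow> 'v) \<Rightarrow>
     (complex, 'w) module \<Rightarrow> ('g \<Rightarrow> 'w \<Rightarrow> 'w) \<Rightarrow> nat"
  where "multiplicity_in G V \<rho> W \<sigma> = (THE n. \<exists>m U. irreducible_decomposition G W \<sigma> m U \<and>
    n = card {i. i < m \<and> isomorphic_representations G V \<rho> (W\<lparr>carrier := U i\<rparr>) \<sigma>})"

end

theory Submission
  imports Defs "HOL-Library.Function_Algebras" "Jordan_Normal_Form.Determinant"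
    "HOL-Computational_Algebra.Fundamental_Theorem_Algebra"
begin

text \<open>
  The idea. Cut \<open>M\<close> into unit squares, one for each point of the fibre over the centre of the torus.
  Two permutations \<open>right\<close> and \<open>up\<close> of that finite fibre \<open>Q\<close> describe how the squares are glued. They
  generate a transitive group, and the automorphisms act on \<open>Q\<close> and commute with them. On functions
  on \<open>Q\<close> write \<open>R f = f \<circ> right\<close> and \<open>U f = f \<circ> up\<close>. A singular 1-cocycle of \<open>M\<close> is determined up to
  coboundaries by its jumps \<open>a\<close> and \<open>b\<close> across the vertical and horizontal sides, and it closes up
  around the vertices iff \<open>(R - 1) b - (U - 1) a = (R U - U R) h\<close> for some \<open>h\<close>; it is exact iff
  \<open>a = (R - 1) f\<close> and \<open>b = (U - 1) f\<close>, and it comes from the torus iff \<open>a\<close> and \<open>b\<close> are constant up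
  to that (\<open>closed_cochain_normal_form\<close>, \<open>exact_jump\<close>, \<open>period_zero_imp_coboundary\<close>).

  Suppose that an irreducible representation occurs in the kernel \<open>W\<close> exactly once. A primitive
  idempotent \<open>e\<close> of the group algebra for it (\<open>primitive_idempotent\<close>) makes \<open>e W\<close> a line, because
  \<open>dim (e W)\<close> is the multiplicity (\<open>decomposition_basis\<close>). Pairing with this line turns the
  description of cocycles into linear algebra on the image \<open>A\<close> of \<open>e\<close> in the functions on \<open>Q\<close>, and
  counting dimensions gives \<open>dim (R U - U R) A = 1\<close> (\<open>commutator_rank_one\<close>). That cannot be. The
  operator \<open>C = R U R\<^sup>-\<^sup>1 U\<^sup>-\<^sup>1\<close> would move all vectors of \<open>A\<close> along one line; as a commutator it has
  determinant 1, so it would be a transvection and have infinite order, whereas \<open>C\<close> permutes the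
  values of a function on a finite set (\<open>commutator_not_rank_one\<close>).

  Singular homology is only reached through its linear functionals. Cocycles are built from local
  data, the germ cocycles, whose integrals along paths exist by subdivision; conversely the jumps
  of a closed cochain are read off on lifted segments between points of the fibre.
\<close>

section \<open>Linear functionals on complex chains\<close>

lemma lookup_scale_fin [simp]: "Poly_Mapping.lookup (scale_fin a c) x = a * Poly_Mapping.lookup c x"
 by (auto simp: scale_fin_def Poly_Mapping.map.rep_eq when_def)

interpretation fin: vector_space scale_fin by unfold_locales (auto intro!: poly_mapping_eqI simp: lookup_add algebra_simps)

interpretation fin_fin: vector_space_pair scale_fin scale_fin ..
interpretation fin_cplx: vector_space_pair scale_fin "(*) :: complex => complex => complex" ..
interpretation cplx_fin: vector_space_pair "(*) :: complex => complex => complex" scale_fin ..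

abbreviation fin_linear :: "(('b \<Rightarrow>\<^sub>0 complex) => ('c \<Rightarrow>\<^sub>0 complex)) => bool"
 where "fin_linear \<equiv> Vector_Spaces.linear scale_fin scale_fin"

abbreviation fin_functional :: "(('b \<Rightarrow>\<^sub>0 complex) => complex) => bool"
 where "fin_functional \<equiv> Vector_Spaces.linear scale_fin (*)"

lemma scale_fin_single [simp]: "scale_fin a (Poly_Mapping.single x b) = Poly_Mapping.single x (a * b)"
 by (rule poly_mapping_eqI) (auto simp: lookup_single when_def)

lemma fin_linearI:
 assumes "!!c d. f (c + d) = f c + f d" "!!a c. f (scale_fin a c) = scale_fin a (f c)"
 shows "fin_linear f" by unfold_locales (simp_all add: assms)

lemma fin_functionalI:
 assumes "!!c d. f (c + d) = f c + f d" "!!a c. f (scale_fin a c) = a * f c"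
 shows "fin_functional f" by unfold_locales (simp_all add: assms)

definition eval_fin :: "('b => complex) => ('b \<Rightarrow>\<^sub>0 complex) => complex"
 where "eval_fin \<phi> c = (\<Sum>x \<in> Poly_Mapping.keys c. Poly_Mapping.lookup c x * \<phi> x)"

lemma eval_fin_superset:
 assumes "finite S" "Poly_Mapping.keys c \<subseteq> S"
 shows "eval_fin \<phi> c = (\<Sum>x \<in> S. Poly_Mapping.lookup c x * \<phi> x)" unfolding eval_fin_def
 by (rule sum.mono_neutral_left) (use assms in \<open>auto simp: in_keys_iff\<close>)

lemma keys_scale_fin: "Poly_Mapping.keys (scale_fin a c) \<subseteq> Poly_Mapping.keys c" by (auto simp: in_keys_iff)

lemma fin_functional_eval_fin: "fin_functional (eval_fin \<phi>)"
proof (rule fin_functionalI)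
 fix c d :: "'a \<Rightarrow>\<^sub>0 complex" and a
 let ?S = "Poly_Mapping.keys c Un Poly_Mapping.keys d"
 show "eval_fin \<phi> (c + d) = eval_fin \<phi> c + eval_fin \<phi> d"
  using eval_fin_superset[of ?S c \<phi>] eval_fin_superset[of ?S d \<phi>]
   eval_fin_superset[of ?S "c + d" \<phi>] Poly_Mapping.keys_add[of c d] by (simp add: lookup_add algebra_simps sum.distrib)
 show "eval_fin \<phi> (scale_fin a c) = a * eval_fin \<phi> c"
  using eval_fin_superset[of "Poly_Mapping.keys c" "scale_fin a c" \<phi>] keys_scale_fin[of a c]
  by (simp add: eval_fin_def sum_distrib_left mult.assoc)
qed

lemmas eval_fin_add = fin_cplx.linear_add[OF fin_functional_eval_fin]
 and eval_fin_diff = fin_cplx.linear_diff[OF fin_functional_eval_fin]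
 and eval_fin_scale = fin_cplx.linear_scale[OF fin_functional_eval_fin]
 and eval_fin_sum = fin_cplx.linear_sum[OF fin_functional_eval_fin]
 and eval_fin_0 [simp] = fin_cplx.linear_0[OF fin_functional_eval_fin]

lemma eval_fin_single [simp]: "eval_fin \<phi> (Poly_Mapping.single x a) = a * \<phi> x"
 by (cases "a = 0") (auto simp: eval_fin_def)

lemma eval_fin_cong: "(!!x. x \<in> Poly_Mapping.keys c ==> \<phi> x = \<psi> x) ==> eval_fin \<phi> c = eval_fin \<psi> c"
 by (simp add: eval_fin_def)

lemma eval_fin_fun_add: "eval_fin (%x. \<phi> x + \<psi> x) c = eval_fin \<phi> c + eval_fin \<psi> c"
 by (simp add: eval_fin_def sum.distrib algebra_simps)

lemma eval_fin_fun_scale: "eval_fin (%x. a * \<phi> x) c = a * eval_fin \<phi> c"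
 by (simp add: eval_fin_def sum_distrib_left algebra_simps)

lemma poly_mapping_sum_single:
 "(\<Sum>x \<in> Poly_Mapping.keys c. Poly_Mapping.single x (Poly_Mapping.lookup c x)) = c" by (rule poly_mapping_eqI)
   (auto simp: lookup_sum lookup_single when_def if_distrib sum.delta in_keys_iff cong: if_cong)

lemma fin_single_eq_scale: "Poly_Mapping.single x a = scale_fin a (Poly_Mapping.single x 1)"
 by (rule poly_mapping_eqI) (auto simp: lookup_single when_def)

lemma fin_functional_eq_eval_fin:
 assumes "fin_functional f"
 shows "f c = eval_fin (%x. f (Poly_Mapping.single x 1)) c"
proof -
 have "f c = f (\<Sum>x \<in> Poly_Mapping.keys c. Poly_Mapping.single x (Poly_Mapping.lookup c x))"
  by (simp add: poly_mapping_sum_single)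
 also have "... = (\<Sum>x \<in> Poly_Mapping.keys c. Poly_Mapping.lookup c x * f (Poly_Mapping.single x 1))"
  unfolding fin_cplx.linear_sum[OF assms]
  by (rule sum.cong[OF refl], subst fin_single_eq_scale, rule fin_cplx.linear_scale[OF assms])
 finally show ?thesis by (simp add: eval_fin_def)
qed

lemma fin_linear_eqI:
 assumes f: "fin_linear f" and g: "fin_linear g"
  and eq: "!!x. x \<in> Poly_Mapping.keys c ==> f (Poly_Mapping.single x 1) = g (Poly_Mapping.single x 1)"
 shows "f c = g c"
proof -
 have *: "h c = (\<Sum>x \<in> Poly_Mapping.keys c. scale_fin (Poly_Mapping.lookup c x) (h (Poly_Mapping.single x 1)))"
  if "fin_linear h" for h :: "('a \<Rightarrow>\<^sub>0 complex) => ('b \<Rightarrow>\<^sub>0 complex)"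
 proof -
  have "h c = h (\<Sum>x \<in> Poly_Mapping.keys c. Poly_Mapping.single x (Poly_Mapping.lookup c x))"
   by (simp add: poly_mapping_sum_single)
  also have "... = (\<Sum>x \<in> Poly_Mapping.keys c. scale_fin (Poly_Mapping.lookup c x) (h (Poly_Mapping.single x 1)))"
   unfolding fin_fin.linear_sum[OF that]
   by (rule sum.cong[OF refl], subst fin_single_eq_scale, rule fin_fin.linear_scale[OF that])
  finally show ?thesis .
 qed
 show ?thesis unfolding *[OF f] *[OF g] by (rule sum.cong) (auto simp: eq)
qed

lemma linear_extend_superset:
 assumes "finite S" "Poly_Mapping.keys c \<subseteq> S"
 shows "linear_extend f c = (\<Sum>x \<in> S. scale_fin (Poly_Mapping.lookup c x) (f x))" unfolding linear_extend_def
 by (rule sum.mono_neutral_left) (use assms in \<open>auto simp: in_keys_iff fin.scale_zero_left\<close>)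

lemma fin_linear_linear_extend: "fin_linear (linear_extend f)"
proof (rule fin_linearI)
 fix c d :: "'a \<Rightarrow>\<^sub>0 complex" and a
 let ?S = "Poly_Mapping.keys c Un Poly_Mapping.keys d"
 show "linear_extend f (c + d) = linear_extend f c + linear_extend f d"
  using linear_extend_superset[of ?S c f] linear_extend_superset[of ?S d f]
   linear_extend_superset[of ?S "c + d" f] Poly_Mapping.keys_add[of c d]
  by (simp add: lookup_add fin.scale_left_distrib sum.distrib)
 show "linear_extend f (scale_fin a c) = scale_fin a (linear_extend f c)"
  using linear_extend_superset[of "Poly_Mapping.keys c" "scale_fin a c" f] keys_scale_fin[of a c]
  by (simp add: linear_extend_def fin.scale_sum_right)
qed

lemma linear_extend_single [simp]: "linear_extend f (Poly_Mapping.single x a) = scale_fin a (f x)"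
 by (cases "a = 0") (auto simp: linear_extend_def)

lemma eval_fin_linear_extend:
 "eval_fin \<phi> (linear_extend f c) = eval_fin (%x. eval_fin \<phi> (f x)) c"
 unfolding linear_extend_def eval_fin_sum eval_fin_scale by (simp add: eval_fin_def)

lemma fin_linear_zero: "fin_linear (%c. 0)" by (rule fin_linearI) (auto simp: fin.scale_zero_right)

lemma fin_linear_cboundary: "fin_linear (cboundary p :: 'a cchain => 'a cchain)"
proof (cases "p = 0")
 case True
 hence "(cboundary p :: 'a cchain => 'a cchain) = (%c. 0)" by (auto simp: cboundary_def)
 thus ?thesis by (simp add: fin_linear_zero)
next
 case False
 hence "(cboundary p :: 'a cchain => 'a cchain) = linear_extend (%f. \<Sum>k\<le>p. Poly_Mapping.single (singular_face p k f) ((-1) ^ k))"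
  by (auto simp: cboundary_def)
 thus ?thesis using fin_linear_linear_extend by simp
qed

lemma fin_linear_cchain_map: "fin_linear (cchain_map p g)" by (simp add: cchain_map_def fin_linear_linear_extend)

lemma cchain_map_single [simp]:
 "cchain_map p g (Poly_Mapping.single f a) = Poly_Mapping.single (simplex_map p g f) a" by (simp add: cchain_map_def)

lemma eval_fin_cchain_map:
 "eval_fin \<phi> (cchain_map p g c) = eval_fin (%f. \<phi> (simplex_map p g f)) c"
 by (simp add: cchain_map_def eval_fin_linear_extend)

lemma subspace_cchains: "fin.subspace (cchains p X)" unfolding fin.subspace_def cchains_def
 using Poly_Mapping.keys_add keys_scale_fin by fastforce

lemma single_in_cchains: "singular_simplex p X f ==> Poly_Mapping.single f a \<in> cchains p X" by (auto simp: cchains_def)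

lemma subspace_ccycles: "fin.subspace (ccycles p X)"
proof -
 have "ccycles p X = cchains p X Int {c. cboundary p c = 0}" by (auto simp: ccycles_def)
 thus ?thesis using fin.subspace_inter[OF subspace_cchains fin_fin.linear_subspace_kernel[OF fin_linear_cboundary]] by simp
qed

lemma subspace_cboundaries: "fin.subspace (cboundaries p X)" unfolding cboundaries_def
 by (rule fin_fin.linear_subspace_image[OF fin_linear_cboundary subspace_cchains])

lemma cchain_map_in_cchains:
 assumes "continuous_map X Y g" "c \<in> cchains p X"
 shows "cchain_map p g c \<in> cchains p Y" unfolding cchain_map_def linear_extend_def
 by (intro fin.subspace_sum subspace_cchains fin.subspace_scale single_in_cchains
   singular_simplex_simplex_map[OF _ assms(1)]) (use assms(2) in \<open>auto simp: cchains_def\<close>)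

lemma cboundary_cchain_map:
 "cboundary p (cchain_map p g c) = cchain_map (p - 1) g (cboundary p c)"
proof (cases "p = 0")
 case True
 thus ?thesis by (simp add: cboundary_def fin_fin.linear_0[OF fin_linear_cchain_map])
next
 case False
 have "(cboundary p o cchain_map p g) c = (cchain_map (p - 1) g o cboundary p) c"
 proof (rule fin_linear_eqI[where c = c])
  show "fin_linear (cboundary p o cchain_map p g)"
   by (rule Vector_Spaces.linear_compose[OF fin_linear_cchain_map fin_linear_cboundary])
  show "fin_linear (cchain_map (p - 1) g o cboundary p)"
   by (rule Vector_Spaces.linear_compose[OF fin_linear_cboundary fin_linear_cchain_map])
  fix f
  have face: "singular_face p k (simplex_map p g f) = simplex_map (p - Suc 0) g (singular_face p k f)"
   if "k <= p" for k
  proof -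
   have "simplical_face k x \<in> standard_simplex p" if "x \<in> standard_simplex (p - Suc 0)" for x
    using simplical_face_in_standard_simplex[of p k x] that \<open>k <= p\<close> False by auto
   thus ?thesis using that False by (auto simp: singular_face_simplex_map singular_face_def simplex_map_def fun_eq_iff)
  qed
  show "(cboundary p o cchain_map p g) (Poly_Mapping.single f 1)
    = (cchain_map (p - 1) g o cboundary p) (Poly_Mapping.single f 1)"
   using False by (simp add: cboundary_def fin_fin.linear_sum[OF fin_linear_cchain_map] face)
 qed
 thus ?thesis by simp
qed

lemma cchain_map_in_ccycles:
 assumes "continuous_map X Y g" "c \<in> ccycles p X"
 shows "cchain_map p g c \<in> ccycles p Y" using assms cchain_map_in_cchains[OF assms(1)]
 by (auto simp: ccycles_def cboundary_cchain_map fin_fin.linear_0[OF fin_linear_cchain_map])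

lemma cchain_map_in_cboundaries:
 assumes "continuous_map X Y g" "c \<in> cboundaries p X"
 shows "cchain_map p g c \<in> cboundaries p Y"
proof -
 obtain d where d: "d \<in> cchains (Suc p) X" "c = cboundary (Suc p) d" using assms(2) by (auto simp: cboundaries_def)
 hence "cchain_map p g c = cboundary (Suc p) (cchain_map (Suc p) g d)" by (simp add: cboundary_cchain_map)
 thus ?thesis using cchain_map_in_cchains[OF assms(1) d(1)] by (auto simp: cboundaries_def)
qed

lemma cchain_map_cong:
 assumes "c \<in> cchains p X" "!!x. x \<in> topspace X ==> f x = g x"
 shows "cchain_map p f c = cchain_map p g c" by (rule fin_linear_eqI[OF fin_linear_cchain_map fin_linear_cchain_map])
   (use assms in \<open>auto simp: cchains_def intro!: arg_cong2[where f=Poly_Mapping.single] simplex_map_eq\<close>)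

lemma cchain_map_compose: "cchain_map p (h o g) c = cchain_map p h (cchain_map p g c)"
 using fin_linear_eqI[OF fin_linear_cchain_map
   Vector_Spaces.linear_compose[OF fin_linear_cchain_map fin_linear_cchain_map],
   where c = c] by (metis (no_types, lifting) cchain_map_single comp_apply simplex_map_compose)

lemma cchain_map_id:
 assumes "c \<in> cchains p X" "!!x. x \<in> topspace X ==> f x = x"
 shows "cchain_map p f c = c"
proof -
 have "cchain_map p f c = id c" by (rule fin_linear_eqI[OF fin_linear_cchain_map fin.linear_id])
    (use assms in \<open>auto simp: cchains_def intro!: arg_cong2[where f=Poly_Mapping.single] simplex_map_id_gen\<close>)
 thus ?thesis by simp
qed

text \<open>
  The extension principle behind all functionals that are constructed here: a functional on a
  subspace that only depends on the class of \<open>L x\<close> modulo \<open>B\<close> extends to the whole target of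
  \<open>L\<close>, with no condition on the dimension.
\<close>

lemma functional_factors_through:
 fixes L :: "('b \<Rightarrow>\<^sub>0 complex) => ('c \<Rightarrow>\<^sub>0 complex)" and g :: "('b \<Rightarrow>\<^sub>0 complex) => complex"
 assumes L: "fin_linear L" and S: "fin.subspace S" and B: "fin.subspace B"
  and g: "fin_functional g" and ker: "!!x. x \<in> S ==> L x \<in> B ==> g x = 0"
 obtains \<mu> where "fin_functional \<mu>" "!!x. x \<in> S ==> \<mu> (L x) = g x" "!!y. y \<in> B ==> \<mu> y = 0"
proof -
 define W where "W = {L x + b | x b. x \<in> S & b \<in> B}"
 have W: "fin.subspace W"
 proof -
  have "W = {x + y | x y. x \<in> L ` S & y \<in> B}" by (auto simp: W_def)
  thus ?thesis using fin.subspace_sums[OF fin_fin.linear_subspace_image[OF L S] B] by simp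
 qed
 define h where "h w = g (SOME x. x \<in> S & w - L x \<in> B)" for w
 have h: "h (L x + b) = g x" if "x \<in> S" "b \<in> B" for x b
 proof -
  have ex: "x \<in> S & (L x + b) - L x \<in> B" using that by simp
  define y where "y = (SOME y. y \<in> S & (L x + b) - L y \<in> B)"
  have y: "y \<in> S" "(L x + b) - L y \<in> B"
   unfolding y_def using someI[of "%y. y \<in> S & (L x + b) - L y \<in> B", OF ex] by auto
  have "L (x - y) = ((L x + b) - L y) - b" by (simp add: fin_fin.linear_diff[OF L])
  hence "L (x - y) \<in> B" using fin.subspace_diff[OF B y(2) that(2)] by simp
  hence "g (x - y) = 0" using ker fin.subspace_diff[OF S that(1) y(1)] by blast
  thus ?thesis by (simp add: h_def y_def[symmetric] fin_cplx.linear_diff[OF g])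
 qed
 obtain P where P: "range P \<subseteq> W" "fin_linear P" "!!w. w \<in> W ==> P w = w"
  using fin_fin.linear_exists_left_inverse_on[OF fin.linear_id W] by auto
 have add: "h (v + w) = h v + h w" if vw: "v \<in> W" "w \<in> W" for v w
 proof -
  obtain x b where x: "v = L x + b" "x \<in> S" "b \<in> B" using vw(1) by (auto simp: W_def)
  obtain y b' where y: "w = L y + b'" "y \<in> S" "b' \<in> B" using vw(2) by (auto simp: W_def)
  note * = x y
  have eq: "v + w = L (x + y) + (b + b')" by (simp add: * fin_fin.linear_add[OF L])
  have "h (v + w) = g (x + y)" unfolding eq by (rule h) (use * fin.subspace_add[OF S] fin.subspace_add[OF B] in auto)
  moreover have "h v = g x" "h w = g y" using * h by simp_all
  ultimately show ?thesis by (simp add: fin_cplx.linear_add[OF g])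
 qed
 have scale: "h (scale_fin a v) = a * h v" if v: "v \<in> W" for v a
 proof -
  obtain x b where *: "v = L x + b" "x \<in> S" "b \<in> B" using v by (auto simp: W_def)
  have "scale_fin a v = L (scale_fin a x) + scale_fin a b" by (simp add: * fin_fin.linear_scale[OF L] fin.scale_right_distrib)
  thus ?thesis using * h fin.subspace_scale[OF S] fin.subspace_scale[OF B] by (simp add: fin_cplx.linear_scale[OF g])
 qed
 have PW: "P v \<in> W" for v using P(1) by auto
 show ?thesis
 proof
  show "fin_functional (%v. h (P v))" by (rule fin_functionalI)
     (simp_all add: add scale PW fin_fin.linear_add[OF P(2)] fin_fin.linear_scale[OF P(2)])
  show "h (P (L x)) = g x" if "x \<in> S" for x
  proof -
   have "L x = L x + 0" by simp
   hence "L x \<in> W" using that fin.subspace_0[OF B] unfolding W_def by blast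
   thus ?thesis using h[OF that fin.subspace_0[OF B]] P(3) by simp
  qed
  show "h (P y) = 0" if "y \<in> B" for y
  proof -
   have "y = L 0 + y" by (simp add: fin_fin.linear_0[OF L])
   hence "y \<in> W" using that fin.subspace_0[OF S] unfolding W_def by blast
   thus ?thesis using h[OF fin.subspace_0[OF S] that] P(3) by (simp add: fin_fin.linear_0[OF L] fin_cplx.linear_0[OF g])
  qed
 qed
qed

section \<open>Closed cochains and paths\<close>

abbreviation cpath :: "'a topology => (real => 'a) => bool"
 where "cpath X c \<equiv> continuous_map (top_of_set {0..1}) X c"

definition simplex1 :: "(real => 'a) => (nat => real) => 'a"
 where "simplex1 c = restrict (%t. c (t 1)) (standard_simplex 1)"

definition simplex2 :: "(real \<times> real => 'a) => (nat => real) => 'a"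
 where "simplex2 H = restrict (%t. H (t 1, t 2)) (standard_simplex 2)"

definition path_of :: "((nat => real) => 'a) => real => 'a"
 where "path_of \<sigma> u = \<sigma> (%i. if i = 0 then 1 - u else if i = 1 then u else 0)"

definition triangle_of :: "((nat => real) => 'a) => real \<times> real => 'a"
 where "triangle_of \<tau> z =
  \<tau> (%i. if i = 0 then 1 - fst z - snd z else if i = 1 then fst z else if i = 2 then snd z else 0)"

definition triangle :: "(real \<times> real) set"
 where "triangle = {z. 0 <= fst z & 0 <= snd z & fst z + snd z <= 1}"

lemma standard_simplex_1:
 "t \<in> standard_simplex 1 \<longleftrightarrow> (EX u:{0..1}. t = (%i. if i = 0 then 1 - u else if i = 1 then u else 0))"
proof
 assume t: "t \<in> standard_simplex 1"
 hence "t 0 + t 1 = 1" "ALL i>1. t i = 0" "0 <= t 1" "t 1 <= 1" by (auto simp: standard_simplex_def)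
 thus "EX u:{0..1}. t = (%i. if i = 0 then 1 - u else if i = 1 then u else 0)" by (intro bexI[of _ "t 1"]) (auto simp: fun_eq_iff)
qed (auto simp: standard_simplex_def)

lemma standard_simplex_2:
 "t \<in> standard_simplex 2 \<longleftrightarrow> (EX z:triangle. t = (%i. if i = 0 then 1 - fst z - snd z
   else if i = 1 then fst z else if i = 2 then snd z else 0))"
proof
 assume t: "t \<in> standard_simplex 2"
 hence *: "t 0 + t 1 + t 2 = 1" "ALL i>2. t i = 0" "ALL i. 0 <= t i" by (auto simp: standard_simplex_def numeral_2_eq_2)
 have "0 <= t 0" "0 <= t 1" "0 <= t 2" by (rule *(3)[rule_format])+
 with *(1) have "(t 1, t 2) \<in> triangle" unfolding triangle_def mem_Collect_eq fst_conv snd_conv by linarith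
 moreover have "t = (%i. if i = 0 then 1 - fst (t 1, t 2) - snd (t 1, t 2)
   else if i = 1 then fst (t 1, t 2) else if i = 2 then snd (t 1, t 2) else 0)" using * by (auto simp: fun_eq_iff algebra_simps)
 ultimately show "EX z:triangle. t = (%i. if i = 0 then 1 - fst z - snd z
   else if i = 1 then fst z else if i = 2 then snd z else 0)" by blast
qed (auto simp: standard_simplex_def triangle_def numeral_2_eq_2)

lemma continuous_map_coord:
 "continuous_map (subtopology (powertop_real UNIV) S) euclideanreal (%t. t i)"
 by (intro continuous_map_from_subtopology continuous_map_product_projection) auto

lemma singular_simplex1:
 assumes "cpath X c"
 shows "singular_simplex 1 X (simplex1 c)"
proof -
 have "continuous_map (subtopology (powertop_real UNIV) (standard_simplex 1)) (top_of_set {0..1}) (%t. t 1)"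
  by (auto simp: continuous_map_in_subtopology continuous_map_coord standard_simplex_def)
 from continuous_map_compose[OF this assms] show ?thesis unfolding singular_simplex_def simplex1_def
  by (auto intro: continuous_map_eq)
qed

lemma singular_simplex2:
 assumes "continuous_map (top_of_set triangle) X H"
 shows "singular_simplex 2 X (simplex2 H)"
proof -
 have "continuous_map (subtopology (powertop_real UNIV) (standard_simplex 2)) euclidean (%t. (t 1, t 2))"
  using continuous_map_coord[of "standard_simplex 2" 1] continuous_map_coord[of "standard_simplex 2" 2]
  by (auto simp flip: prod_topology_euclidean simp: continuous_map_pairwise o_def)
 hence "continuous_map (subtopology (powertop_real UNIV) (standard_simplex 2)) (top_of_set triangle) (%t. (t 1, t 2))"
  by (auto simp: continuous_map_in_subtopology standard_simplex_2)
 from continuous_map_compose[OF this assms] show ?thesis unfolding singular_simplex_def simplex2_def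
  by (auto intro: continuous_map_eq)
qed

lemma continuous_path_of:
 assumes "singular_simplex 1 X \<sigma>"
 shows "cpath X (path_of \<sigma>)"
proof -
 have "cpath (subtopology (powertop_real UNIV) (standard_simplex 1))
   (%u i. if i = 0 then 1 - u else if i = 1 then u else 0)"
  unfolding continuous_map_in_subtopology continuous_map_componentwise_UNIV
 proof (intro conjI allI)
  fix k :: nat
  show "cpath euclideanreal (%u. if k = 0 then 1 - u else if k = 1 then u else 0)"
   by (cases "k = 0"; cases "k = 1") (auto intro!: continuous_intros)
 next
  show "(%u i. if i = 0 then 1 - u else if i = 1 then u else 0) \<in> topspace (top_of_set {0..1}) \<rightarrow> standard_simplex 1"
   using standard_simplex_1 by fastforce
 qed
 moreover have "continuous_map (subtopology (powertop_real UNIV) (standard_simplex 1)) X \<sigma>"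
  using assms by (auto simp: singular_simplex_def)
 ultimately have "cpath X
   (\<sigma> o (%u i. if i = 0 then 1 - u else if i = 1 then u else 0))" by (rule continuous_map_compose)
 thus ?thesis by (simp add: path_of_def[abs_def] o_def)
qed

lemma continuous_triangle_of:
 assumes "singular_simplex 2 X \<tau>"
 shows "continuous_map (top_of_set triangle) X (triangle_of \<tau>)"
proof -
 have "continuous_map (top_of_set triangle) (subtopology (powertop_real UNIV) (standard_simplex 2))
   (%z i. if i = 0 then 1 - fst z - snd z else if i = 1 then fst z else if i = 2 then snd z else 0)"
  unfolding continuous_map_in_subtopology continuous_map_componentwise_UNIV
 proof (intro conjI allI)
  fix k :: nat
  show "continuous_map (top_of_set triangle) euclideanreal
    (%z. if k = 0 then 1 - fst z - snd z else if k = 1 then fst z else if k = 2 then snd z else 0)"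
   by (cases "k = 0"; cases "k = 1"; cases "k = 2") (auto intro!: continuous_intros)
 next
  show "(%z i. if i = 0 then 1 - fst z - snd z else if i = 1 then fst z else if i = 2 then snd z else 0)
    \<in> topspace (top_of_set triangle) \<rightarrow> standard_simplex 2" using standard_simplex_2 by fastforce
 qed
 moreover have "continuous_map (subtopology (powertop_real UNIV) (standard_simplex 2)) X \<tau>"
  using assms by (auto simp: singular_simplex_def)
 ultimately have "continuous_map (top_of_set triangle) X
   (\<tau> o (%z i. if i = 0 then 1 - fst z - snd z else if i = 1 then fst z else if i = 2 then snd z else 0))"
  by (rule continuous_map_compose)
 thus ?thesis by (simp add: triangle_of_def[abs_def] o_def)
qed

lemma simplex1_path_of:
 assumes "singular_simplex 1 X \<sigma>"
 shows "simplex1 (path_of \<sigma>) = \<sigma>"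
proof
 fix t show "simplex1 (path_of \<sigma>) t = \<sigma> t"
 proof (cases "t \<in> standard_simplex 1")
  case True
  then obtain u where "t = (%i. if i = 0 then 1 - u else if i = 1 then u else 0)" unfolding standard_simplex_1 by blast
  thus ?thesis using True by (auto simp: simplex1_def path_of_def)
 next
  case False
  thus ?thesis using assms by (auto simp: simplex1_def singular_simplex_def extensional_def)
 qed
qed

lemma simplex2_triangle_of:
 assumes "singular_simplex 2 X \<tau>"
 shows "simplex2 (triangle_of \<tau>) = \<tau>"
proof
 fix t show "simplex2 (triangle_of \<tau>) t = \<tau> t"
 proof (cases "t \<in> standard_simplex 2")
  case True
  then obtain z where z: "t = (%i. if i = 0 then 1 - fst z - snd z
    else if i = 1 then fst z else if i = 2 then snd z else 0)" unfolding standard_simplex_2 by blast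
  hence "(t 1, t 2) = z" by (cases z) simp
  moreover have "simplex2 (triangle_of \<tau>) t = triangle_of \<tau> (t 1, t 2)" using True by (simp add: simplex2_def)
  ultimately show ?thesis by (simp only: triangle_of_def z)
 next
  case False
  thus ?thesis using assms by (auto simp: simplex2_def singular_simplex_def extensional_def)
 qed
qed

lemma path_of_simplex1: "u \<in> {0..1} ==> path_of (simplex1 c) u = c u"
 using standard_simplex_1 by (fastforce simp: path_of_def simplex1_def)

lemma simplex1_cong: "(!!u. u \<in> {0..1} ==> c u = d u) ==> simplex1 c = simplex1 d"
 by (auto simp: simplex1_def standard_simplex_def fun_eq_iff)

lemma face_simplex2:
 "singular_face 2 0 (simplex2 H) = simplex1 (%u. H (1 - u, u))"
 "singular_face 2 1 (simplex2 H) = simplex1 (%u. H (0, u))"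
 "singular_face 2 2 (simplex2 H) = simplex1 (%u. H (u, 0))"
proof -
 have *: "singular_face 2 k (simplex2 H) =
   restrict (%t. H (simplical_face k t 1, simplical_face k t 2)) (standard_simplex 1)" if "k <= 2" for k
  using simplical_face_in_standard_simplex[of 2 k] that by (auto simp: singular_face_def simplex2_def fun_eq_iff)
 show "singular_face 2 0 (simplex2 H) = simplex1 (%u. H (1 - u, u))"
  "singular_face 2 1 (simplex2 H) = simplex1 (%u. H (0, u))"
  "singular_face 2 2 (simplex2 H) = simplex1 (%u. H (u, 0))"
  unfolding simplex1_def *[OF le0] *[OF one_le_numeral] *[OF order_refl]
  by (rule restrict_ext, unfold standard_simplex_1, auto simp: simplical_face_def)+
qed

text \<open>
  Closedness is only required on the boundaries of parametrised triangles; this is the form in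
  which it is used and verified, and it does not mention faces of simplices.
\<close>

definition closed_cochain :: "'a topology => (((nat => real) => 'a) => complex) => bool"
 where "closed_cochain X \<phi> \<longleftrightarrow> (ALL H. continuous_map (top_of_set triangle) X H -->
  \<phi> (simplex1 (%u. H (1 - u, u))) - \<phi> (simplex1 (%u. H (0, u))) + \<phi> (simplex1 (%u. H (u, 0))) = 0)"

lemma sum_upto_2: "sum f {..2::nat} = f 0 + f 1 + f 2" by (simp add: numeral_2_eq_2)

lemma eval_fin_boundary_simplex2:
 "eval_fin \<phi> (\<Sum>k\<le>2. Poly_Mapping.single (singular_face 2 k (simplex2 H)) ((- 1) ^ k)) =
  \<phi> (simplex1 (%u. H (1 - u, u))) - \<phi> (simplex1 (%u. H (0, u))) + \<phi> (simplex1 (%u. H (u, 0)))"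
 unfolding sum_upto_2 face_simplex2 eval_fin_add by simp

lemma closed_cochain_imp_eval_0:
 assumes "closed_cochain X \<phi>" "b \<in> cboundaries 1 X"
 shows "eval_fin \<phi> b = 0"
proof -
 obtain d where d: "d \<in> cchains 2 X" "b = cboundary 2 d" using assms(2) by (auto simp: cboundaries_def numeral_2_eq_2)
 have "eval_fin \<phi> (\<Sum>k\<le>2. Poly_Mapping.single (singular_face 2 k \<tau>) ((- 1) ^ k)) = 0"
  if "\<tau> \<in> Poly_Mapping.keys d" for \<tau>
 proof -
  have \<tau>: "singular_simplex 2 X \<tau>" using that d by (auto simp: cchains_def)
  show ?thesis using assms(1) continuous_triangle_of[OF \<tau>] using eval_fin_boundary_simplex2[of \<phi> "triangle_of \<tau>"]
   unfolding closed_cochain_def simplex2_triangle_of[OF \<tau>] by auto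
 qed
 hence "eval_fin (%\<tau>. eval_fin \<phi> (\<Sum>k\<le>2. Poly_Mapping.single (singular_face 2 k \<tau>) ((- 1) ^ k))) d
   = eval_fin (%_. 0) d" by (rule eval_fin_cong)
 moreover have "eval_fin \<phi> b =
   eval_fin (%\<tau>. eval_fin \<phi> (\<Sum>k\<le>2. Poly_Mapping.single (singular_face 2 k \<tau>) ((- 1) ^ k))) d"
  unfolding d cboundary_def by (simp add: eval_fin_linear_extend)
 ultimately show ?thesis by (simp add: eval_fin_def)
qed

lemma closed_cochainI:
 assumes "fin_functional \<mu>" "!!b. b \<in> cboundaries 1 X ==> \<mu> b = 0"
 shows "closed_cochain X (%\<sigma>. \<mu> (Poly_Mapping.single \<sigma> 1))" unfolding closed_cochain_def
proof (intro allI impI)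
 fix H assume H: "continuous_map (top_of_set triangle) X H"
 let ?b = "cboundary 2 (Poly_Mapping.single (simplex2 H) 1)"
 have b: "?b = (\<Sum>k\<le>2. Poly_Mapping.single (singular_face 2 k (simplex2 H)) ((- 1) ^ k))" by (simp add: cboundary_def)
 have "?b \<in> cboundaries 1 X" using single_in_cchains[OF singular_simplex2[OF H]]
  by (auto simp: cboundaries_def numeral_2_eq_2)
 hence "eval_fin (%\<sigma>. \<mu> (Poly_Mapping.single \<sigma> 1)) ?b = 0"
  using assms fin_functional_eq_eval_fin[OF assms(1)] by metis
 thus "\<mu> (Poly_Mapping.single (simplex1 (%u. H (1 - u, u))) 1) - \<mu> (Poly_Mapping.single (simplex1 (%u. H (0, u))) 1)
   + \<mu> (Poly_Mapping.single (simplex1 (%u. H (u, 0))) 1) = 0" unfolding b eval_fin_boundary_simplex2 by simp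
qed

definition point_simplex :: "'a => (nat => real) => 'a"
 where "point_simplex x = restrict (%_. x) (standard_simplex 0)"

lemma cboundary_single_1:
 "cboundary 1 (Poly_Mapping.single \<sigma> 1) =
  Poly_Mapping.single (point_simplex (path_of \<sigma> 1)) 1 - Poly_Mapping.single (point_simplex (path_of \<sigma> 0)) 1"
proof -
 have 0: "simplical_face 0 (%j. if j = 0 then 1 else 0) = (%i::nat. if i = 0 then 1 - 1 else if i = 1 then 1 else 0::real)"
  by (auto simp: simplical_face_def fun_eq_iff)
 have 1: "simplical_face (Suc 0) (%j. if j = 0 then 1 else 0) = (%i::nat. if i = 0 then 1 - 0 else if i = 1 then 0 else 0::real)"
  by (auto simp: simplical_face_def fun_eq_iff)
 have "singular_face 1 0 \<sigma> = point_simplex (path_of \<sigma> 1)"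
  "singular_face 1 (Suc 0) \<sigma> = point_simplex (path_of \<sigma> 0)"
  unfolding singular_face_def point_simplex_def path_of_def One_nat_def diff_self_eq_0
  by (auto simp only: standard_simplex_0 0 1 o_def singleton_iff One_nat_def intro!: restrict_ext)
 thus ?thesis by (simp add: cboundary_def single_uminus)
qed

lemma eval_fin_exact_cycle:
 assumes "z \<in> ccycles 1 X"
 shows "eval_fin (%\<sigma>. f (path_of \<sigma> 1) - f (path_of \<sigma> 0)) z = 0"
proof -
 define g where "g \<rho> = (f (\<rho> (%j. if j = 0 then 1 else 0)) :: complex)" for \<rho> :: "(nat => real) => 'a"
 have g: "g (point_simplex x) = f x" for x by (simp add: g_def point_simplex_def standard_simplex_0)
 have "fin_functional (%c. eval_fin g (cboundary 1 c))" by (rule fin_functionalI)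
    (simp_all add: fin_fin.linear_add[OF fin_linear_cboundary] fin_fin.linear_scale[OF fin_linear_cboundary]
     eval_fin_add eval_fin_scale)
 from fin_functional_eq_eval_fin[OF this, of z] show ?thesis
  using assms unfolding cboundary_single_1 eval_fin_diff eval_fin_single g by (simp add: ccycles_def)
qed

text \<open>
  The value of \<open>f\<close> at the endpoint of a simplex can be read off from its boundary, so
  a functional that vanishes on cycles factors through the boundary map.
\<close>

lemma exact_if_zero_on_cycles:
 assumes "!!z. z \<in> ccycles 1 X ==> eval_fin \<phi> z = 0"
 obtains f where "!!\<sigma>. singular_simplex 1 X \<sigma> ==> \<phi> \<sigma> = f (path_of \<sigma> 1) - f (path_of \<sigma> 0)"
proof -
 obtain \<mu> where \<mu>: "fin_functional \<mu>" "!!x. x \<in> cchains 1 X ==> \<mu> (cboundary 1 x) = eval_fin \<phi> x"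
 proof (rule functional_factors_through[OF fin_linear_cboundary subspace_cchains fin.subspace_single_0 fin_functional_eval_fin])
  show "eval_fin \<phi> x = 0" if "x \<in> cchains 1 X" "cboundary 1 x \<in> {0}" for x
   using assms that by (auto simp: ccycles_def)
 qed blast
 show ?thesis
 proof
  fix \<sigma> assume "singular_simplex 1 X \<sigma>"
  thus "\<phi> \<sigma> = \<mu> (Poly_Mapping.single (point_simplex (path_of \<sigma> 1)) 1)
    - \<mu> (Poly_Mapping.single (point_simplex (path_of \<sigma> 0)) 1)" using \<mu>(2)[OF single_in_cchains, of \<sigma> 1]
   by (simp only: cboundary_single_1 fin_cplx.linear_diff[OF \<mu>(1)] eval_fin_single) simp
 qed
qed

subsection \<open>Closed cochains on convex sets\<close>

lemma closed_cochain_triangle: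
 fixes H :: "'e::real_normed_vector => 'a"
 assumes \<phi>: "closed_cochain X \<phi>" and H: "continuous_map (top_of_set C) X H" and C: "convex C"
  and P: "P \<in> C" "Q \<in> C" "R \<in> C"
 shows "\<phi> (simplex1 (H o linepath P R)) = \<phi> (simplex1 (H o linepath P Q)) + \<phi> (simplex1 (H o linepath Q R))"
proof -
 define A where "A z = (1 - fst z - snd z) *\<^sub>R P + fst z *\<^sub>R Q + snd z *\<^sub>R R" for z :: "real \<times> real"
 have "A z \<in> C" if "z \<in> triangle" for z
 proof -
  have "0 <= 1 - fst z - snd z" "0 <= fst z" "0 <= snd z" "(1 - fst z - snd z) + fst z + snd z = 1"
   using that by (auto simp: triangle_def)
  hence "A z \<in> convex hull {P, Q, R}" unfolding A_def convex_hull_3 by blast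
  thus ?thesis using hull_minimal[of "{P, Q, R}" C convex] C P by blast
 qed
 hence "continuous_map (top_of_set triangle) (top_of_set C) A" by (auto simp: A_def intro!: continuous_intros)
 hence "continuous_map (top_of_set triangle) X (H o A)" using H continuous_map_compose by blast
 hence "\<phi> (simplex1 (%u. (H o A) (1 - u, u))) - \<phi> (simplex1 (%u. (H o A) (0, u)))
   + \<phi> (simplex1 (%u. (H o A) (u, 0))) = 0" using \<phi> unfolding closed_cochain_def by blast
 moreover have "(%u. (H o A) (1 - u, u)) = H o linepath Q R" "(%u. (H o A) (0, u)) = H o linepath P R"
  "(%u. (H o A) (u, 0)) = H o linepath P Q" by (auto simp: A_def linepath_def fun_eq_iff algebra_simps)
 ultimately show ?thesis by (simp add: algebra_simps)
qed

lemma closed_cochain_const: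
 assumes \<phi>: "closed_cochain X \<phi>" and "x \<in> topspace X"
 shows "\<phi> (simplex1 (%_. x)) = 0"
proof -
 have "continuous_map (top_of_set UNIV) X (%_::real. x)" using assms(2) by simp
 from closed_cochain_triangle[OF \<phi> this convex_UNIV, of 0 0 0]
 show ?thesis by (simp add: o_def)
qed

text \<open>
  The triangles with apex \<open>P\<close> over the pieces of the path fill the region between the
  path and the two segments.
\<close>

lemma closed_cochain_convex_path:
 fixes H :: "'e::real_normed_vector => 'a"
 assumes \<phi>: "closed_cochain X \<phi>" and H: "continuous_map (top_of_set C) X H" and C: "convex C"
  and P: "P \<in> C" and c: "continuous_on {0..1} c" "c ` {0..1} \<subseteq> C"
 shows "\<phi> (simplex1 (H o c)) = \<phi> (simplex1 (H o linepath P (c 1))) - \<phi> (simplex1 (H o linepath P (c 0)))"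
proof -
 define A where "A z = (1 - fst z) *\<^sub>R P + fst z *\<^sub>R c (snd z)" for z :: "real \<times> real"
 let ?S = "{0..1} \<times> {0..1} :: (real \<times> real) set"
 have "continuous_on ?S (%z. c (snd z))" by (rule continuous_on_compose2[OF c(1)]) (auto intro: continuous_intros)
 hence "continuous_on ?S A" unfolding A_def by (intro continuous_intros)
 moreover have "A z \<in> C" if "z \<in> ?S" for z
  unfolding A_def by (rule convexD_alt[OF C P]) (use that c(2) in \<open>auto simp: mem_Times_iff\<close>)
 ultimately have "continuous_map (top_of_set ?S) (top_of_set C) A"
  unfolding continuous_map_in_subtopology by (simp add: image_subset_iff_funcset[symmetric] image_subset_iff)
 hence A: "continuous_map (top_of_set ?S) X (H o A)" using H continuous_map_compose by blast
 have S: "convex ?S" by (intro convex_Times) auto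
 have 1: "\<phi> (simplex1 (H o A o linepath (0,0) (1,1))) =
  \<phi> (simplex1 (H o A o linepath (0,0) (1,0))) + \<phi> (simplex1 (H o A o linepath (1,0) (1,1)))"
  by (rule closed_cochain_triangle[OF \<phi> A S]) simp_all
 have 2: "\<phi> (simplex1 (H o A o linepath (0,0) (1,1))) =
  \<phi> (simplex1 (H o A o linepath (0,0) (0,1))) + \<phi> (simplex1 (H o A o linepath (0,1) (1,1)))"
  by (rule closed_cochain_triangle[OF \<phi> A S]) simp_all
 have "A (linepath (0,0) (0,1) u) = P" "A (linepath (1,0) (1,1) u) = c u"
  "A (linepath (0,0) (1,0) u) = linepath P (c 0) u" "A (linepath (0,1) (1,1) u) = linepath P (c 1) u" for u
  by (simp_all add: A_def linepath_def)
 hence "H o A o linepath (0,0) (0,1) = (%_. H P)" "H o A o linepath (1,0) (1,1) = H o c"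
  "H o A o linepath (0,0) (1,0) = H o linepath P (c 0)"
  "H o A o linepath (0,1) (1,1) = H o linepath P (c 1)" by (simp_all add: o_def)
 moreover have "H P \<in> topspace X" using H P by (auto simp: continuous_map_def)
 ultimately show ?thesis using 1 2 closed_cochain_const[OF \<phi>] by (metis add.left_neutral add_diff_cancel_left')
qed

section \<open>Bisection of convex sets in the plane\<close>

text \<open>
  Two overlapping halves of a convex compact set are again convex and compact, so a property that
  holds for small sets and can be glued spreads by repeated halving.
\<close>

lemma convex_bisection:
 fixes P :: "(real \<times> real) set => bool"
 assumes K: "compact K" "convex K" and \<delta>: "0 < \<delta>"
  and small: "!!L. [|compact L; convex L; L \<subseteq> K; diameter L < \<delta>|] ==> P L"
  and glue: "!!L1 L2. [|compact L1; convex L1; compact L2; convex L2; L1 Un L2 \<subseteq> K;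
   L1 Int L2 ~= {}; P L1; P L2|] ==> P (L1 Un L2)"
 shows "P K"
proof -
 have half: "compact (L Int {z. f z <= m})" "compact (L Int {z. m <= f z})"
  "convex (L Int {z. f z <= m})" "convex (L Int {z. m <= f z})"
  if L: "compact L" "convex L" and f: "continuous_on UNIV f" "linear f"
  for L m and f :: "real \<times> real => real"
 proof -
  have "closed {z. f z <= m}" "closed {z. m <= f z}" using f(1) by (auto intro!: closed_Collect_le continuous_intros)
  thus "compact (L Int {z. f z <= m})" "compact (L Int {z. m <= f z})" using L(1) by (auto intro: compact_Int_closed)
  have "{z. f z <= m} = f -` {..m}" "{z. m <= f z} = f -` {m..}" by auto
  hence "convex {z. f z <= m}" "convex {z. m <= f z}" using convex_linear_vimage[OF f(2)] by (auto simp: convex_real_interval)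
  thus "convex (L Int {z. f z <= m})" "convex (L Int {z. m <= f z})" using L(2) by (auto intro: convex_Int)
 qed
 have coord: "continuous_on UNIV (fst :: real \<times> real => real)" "linear (fst :: real \<times> real => real)"
  "continuous_on UNIV (snd :: real \<times> real => real)" "linear (snd :: real \<times> real => real)"
  by (auto intro: continuous_intros bounded_linear.linear bounded_linear_fst bounded_linear_snd)
 have split: "P L" if L: "compact L" "convex L" "L \<subseteq> K" and f: "continuous_on UNIV f" "linear f"
  and P: "P (L Int {z. f z <= m})" "P (L Int {z. m <= f z})" for L m and f :: "real \<times> real => real"
 proof -
  let ?L1 = "L Int {z. f z <= m}" and ?L2 = "L Int {z. m <= f z}"
  have un: "?L1 Un ?L2 = L" by auto
  note h = half[OF L(1,2) f, of m]
  show "P L"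
  proof (cases "?L1 = {} | ?L2 = {}")
   case True
   thus ?thesis using P un by auto
  next
   case False
   then obtain x y where xy: "x \<in> L" "f x <= m" "y \<in> L" "m <= f y" by auto
   have "connected (f ` L)" using convex_connected[OF L(2)] f(1) by (blast intro: connected_continuous_image continuous_on_subset)
   hence "m \<in> f ` L" using xy connectedD_interval[of "f ` L" "f x" "f y" m] by blast
   hence "?L1 Int ?L2 ~= {}" by auto
   thus ?thesis using glue[of ?L1 ?L2] h P un L(3) by auto
  qed
 qed
 define e where "e = \<delta> / 4"
 have e: "0 < e" using \<delta> by (simp add: e_def)
 have main: "P L" if "compact L" "convex L" "L \<subseteq> K" "L \<subseteq> {a..a + 2 ^ n * e} \<times> {b..b + 2 ^ k * e}"
  for L a b n k using that
 proof (induction n arbitrary: L a)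
  case 0
  thus ?case
  proof (induction k arbitrary: L b)
   case 0
   have "dist x y <= 2 * e" if "x \<in> L" "y \<in> L" for x y
   proof -
    have "x \<in> {a..a + e} \<times> {b..b + e}" "y \<in> {a..a + e} \<times> {b..b + e}" using 0(4) that by auto
    hence "dist (fst x) (fst y) <= e" "dist (snd x) (snd y) <= e" by (auto simp: dist_real_def mem_Times_iff)
    moreover have "dist x y <= dist (fst x) (fst y) + dist (snd x) (snd y)"
     unfolding dist_prod_def by (rule sqrt_sum_squares_le_sum_abs[THEN order_trans]) simp
    ultimately show ?thesis by linarith
   qed
   hence "diameter L <= 2 * e" using e by (intro diameter_le) (auto simp: dist_norm)
   thus ?case using small[of L] 0 \<delta> by (auto simp: e_def)
  next
   case (Suc k)
   note c = half[OF Suc(2,3) coord(3,4)]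
   show ?case
   proof (rule split[of L snd "b + 2 ^ k * e"])
    show "P (L Int {z. snd z <= b + 2 ^ k * e})"
     by (rule Suc(1)[of _ b]) (use Suc(2-5) c in \<open>auto simp: algebra_simps\<close>)
    show "P (L Int {z. b + 2 ^ k * e <= snd z})"
     by (rule Suc(1)[of _ "b + 2 ^ k * e"]) (use Suc(2-5) c in \<open>auto simp: algebra_simps\<close>)
   qed (use Suc in \<open>auto intro: coord\<close>)
  qed
 next
  case (Suc n)
  show ?case
  proof (rule split[of L fst "a + 2 ^ n * e"])
   note c = half[OF Suc(2,3) coord(1,2)]
   show "P (L Int {z. fst z <= a + 2 ^ n * e})"
    by (rule Suc(1)[of _ a]) (use Suc(2-5) c in \<open>auto simp: algebra_simps\<close>)
   show "P (L Int {z. a + 2 ^ n * e <= fst z})"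
    by (rule Suc(1)[of _ "a + 2 ^ n * e"]) (use Suc(2-5) c in \<open>auto simp: algebra_simps\<close>)
  qed (use Suc in \<open>auto intro: coord\<close>)
 qed
 obtain B where B: "!!x. x \<in> K ==> norm x <= B" using compact_imp_bounded[OF K(1)] by (auto simp: bounded_iff)
 obtain n where n: "2 * B / e < 2 ^ n" using real_arch_pow[of 2 "2 * B / e"] by auto
 have nB: "2 * B <= 2 ^ n * e" using n e by (metis pos_divide_less_eq less_imp_le)
 have "K \<subseteq> {- B..- B + 2 ^ n * e} \<times> {- B..- B + 2 ^ n * e}"
 proof
  fix x assume "x \<in> K"
  hence "norm x <= B" by (rule B)
  moreover have "\<bar>fst x\<bar> <= norm x" "\<bar>snd x\<bar> <= norm x"
   by (metis norm_fst_le norm_snd_le prod.collapse real_norm_def)+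
  ultimately have "\<bar>fst x\<bar> <= B" "\<bar>snd x\<bar> <= B" by linarith+
  thus "x \<in> {- B..- B + 2 ^ n * e} \<times> {- B..- B + 2 ^ n * e}" using nB by (auto simp: mem_Times_iff abs_le_iff)
 qed
 thus ?thesis using main K by blast
qed

section \<open>Germ cocycles\<close>

text \<open>
  The increment \<open>j x y\<close> of a multivalued primitive from \<open>x\<close> to a nearby
  point \<open>y\<close>. The neighbourhood in which the cocycle relation holds depends on
  \<open>y\<close> as well: this lets \<open>j x\<close> jump across the sides of squares when
  \<open>x\<close> is a vertex.
\<close>

definition germ_cocycle :: "'a topology => ('a => 'a => complex) => bool"
 where "germ_cocycle X j \<longleftrightarrow> (ALL x:topspace X. EX N. openin X N & x \<in> N &
  (ALL y:N. EX N'. openin X N' & y \<in> N' & (ALL z:N'. j x z = j x y + j y z)))"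

text \<open>A single-valued primitive of \<open>j\<close> along a map \<open>c\<close>.\<close>

definition primitive_along ::
  "('a => 'a => complex) => 'e::metric_space set => ('e => 'a) => ('e => complex) => bool"
 where "primitive_along j K c F \<longleftrightarrow>
  (ALL t:K. EX e>0. ALL s:K. dist t s < e --> F s - F t = j (c t) (c s))"

lemma continuous_map_ball:
 assumes "continuous_map (top_of_set K) X c" "openin X N" "t \<in> K" "c t \<in> N"
 obtains e where "0 < e" "!!s. s \<in> K ==> dist t s < e ==> c s \<in> N"
proof -
 have "openin (top_of_set K) {s \<in> K. c s \<in> N}" using openin_continuous_map_preimage[OF assms(1,2)] by simp
 then obtain e where "0 < e" "ALL s:K. dist s t < e --> s \<in> {s \<in> K. c s \<in> N}"
  unfolding openin_euclidean_subtopology_iff using assms(3,4) by blast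
 thus ?thesis using that by (auto simp: dist_commute)
qed

lemma primitive_along_unique:
 assumes F: "primitive_along j K c F" and G: "primitive_along j K c G" and K: "connected K"
  and xy: "x \<in> K" "y \<in> K"
 shows "F x - G x = F y - G y"
proof (rule connected_local_const[OF K xy], intro ballI)
 fix a assume a: "a \<in> K"
 obtain e1 where e1: "0 < e1" "!!s. s \<in> K ==> dist a s < e1 ==> F s - F a = j (c a) (c s)"
  using F a unfolding primitive_along_def by blast
 obtain e2 where e2: "0 < e2" "!!s. s \<in> K ==> dist a s < e2 ==> G s - G a = j (c a) (c s)"
  using G a unfolding primitive_along_def by blast
 have "F a - G a = F s - G s" if "s \<in> K" "dist s a < min e1 e2" for s
  using e1(2)[of s] e2(2)[of s] that by (simp add: dist_commute algebra_simps)
 thus "\<forall>\<^sub>F b in at a within K. F a - G a = F b - G b"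
  unfolding eventually_at using e1(1) e2(1) by (intro exI[of _ "min e1 e2"]) auto
qed

lemma primitive_along_compose:
 assumes "primitive_along j K c F" "continuous_on L g" "g ` L \<subseteq> K"
 shows "primitive_along j L (c o g) (F o g)" unfolding primitive_along_def
proof
 fix t assume t: "t \<in> L"
 then obtain e where e: "0 < e" "!!s. s \<in> K ==> dist (g t) s < e ==> F s - F (g t) = j (c (g t)) (c s)"
  using assms unfolding primitive_along_def by blast
 obtain d where "0 < d" "!!s. s \<in> L ==> dist s t < d ==> dist (g s) (g t) < e"
  using assms(2) t e(1) unfolding continuous_on_iff by blast
 thus "EX e>0. ALL s:L. dist t s < e --> (F o g) s - (F o g) t = j ((c o g) t) ((c o g) s)"
  using e(2) assms(3) by (intro exI[of _ d]) (auto simp: dist_commute image_subset_iff)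
qed

lemma primitive_along_subset: "primitive_along j K c F ==> L \<subseteq> K ==> primitive_along j L c F"
 unfolding primitive_along_def by (meson subsetD)

text \<open>
  Small pieces lie in one neighbourhood from the definition of a germ cocycle, and primitives on
  overlapping pieces agree up to a constant.
\<close>

lemma primitive_along_exists_plane:
 fixes K :: "(real \<times> real) set"
 assumes K: "compact K" "convex K" and c: "continuous_map (top_of_set K) X c" and j: "germ_cocycle X j"
 shows "EX F. primitive_along j K c F"
proof (cases "K = {}")
 case True
 thus ?thesis by (auto simp: primitive_along_def)
next
 case False
 define \<C> where "\<C> = {U. open U & (ALL L. L \<subseteq> K Int U --> (EX F. primitive_along j L c F))}"
 have "EX U:\<C>. t \<in> U" if t: "t \<in> K" for t
 proof -
  have "c t \<in> topspace X" using c t by (auto simp: continuous_map_def)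
  then obtain N where N: "openin X N" "c t \<in> N"
   and N': "!!y. y \<in> N ==> EX N'. openin X N' & y \<in> N' & (ALL z:N'. j (c t) z = j (c t) y + j y z)"
   using j unfolding germ_cocycle_def by meson
  obtain e where e: "0 < e" "!!s. s \<in> K ==> dist t s < e ==> c s \<in> N" using continuous_map_ball[OF c N(1) t N(2)] by blast
  have "primitive_along j L c (%s. j (c t) (c s))" if L: "L \<subseteq> K Int ball t e" for L unfolding primitive_along_def
  proof
   fix s assume s: "s \<in> L"
   hence "s \<in> ball t e" and sK: "s \<in> K" using L by blast+
   hence csN: "c s \<in> N" using e(2)[OF sK] by simp
   obtain N1 where N1: "openin X N1" "c s \<in> N1" "!!z. z \<in> N1 ==> j (c t) z = j (c t) (c s) + j (c s) z"
    using N'[OF csN] by blast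
   obtain d where "0 < d" "!!s'. s' \<in> K ==> dist s s' < d ==> c s' \<in> N1"
    using continuous_map_ball[OF c N1(1) sK N1(2)] by blast
   thus "EX e>0. ALL s':L. dist s s' < e --> j (c t) (c s') - j (c t) (c s) = j (c s) (c s')"
    using N1(3) L by (intro exI[of _ d]) auto
  qed
  hence "ball t e \<in> \<C>" unfolding \<C>_def by blast
  thus ?thesis using e(1) by (intro bexI[of _ "ball t e"]) auto
 qed
 hence cov: "K \<subseteq> \<Union>\<C>" by blast
 hence "\<C> ~= {}" using False by auto
 obtain \<delta> where \<delta>: "0 < \<delta>" "!!T. [|T \<subseteq> K; diameter T < \<delta>|] ==> EX B:\<C>. T \<subseteq> B"
  using Lebesgue_number_lemma[OF K(1) \<open>\<C> ~= {}\<close> cov] unfolding \<C>_def by blast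
 show ?thesis
 proof (rule convex_bisection[where P = "%L. EX F. primitive_along j L c F", OF K \<delta>(1)])
  fix L assume "compact L" "convex L" "L \<subseteq> K" "diameter L < \<delta>"
  thus "EX F. primitive_along j L c F" using \<delta>(2)[of L] unfolding \<C>_def by blast
 next
  fix L1 L2 :: "(real \<times> real) set"
  assume L: "compact L1" "convex L1" "compact L2" "convex L2" "L1 Un L2 \<subseteq> K" "L1 Int L2 ~= {}"
   and ex: "EX F. primitive_along j L1 c F" "EX F. primitive_along j L2 c F"
  obtain F1 F2 where F: "primitive_along j L1 c F1" "primitive_along j L2 c F2" using ex by blast
  obtain x0 where x0: "x0 \<in> L1" "x0 \<in> L2" using L(6) by blast
  define \<kappa> where "\<kappa> = F1 x0 - F2 x0"
  have agree: "F1 x = F2 x + \<kappa>" if "x \<in> L1" "x \<in> L2" for x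
  proof -
   have "connected (L1 Int L2)" using L by (intro convex_connected convex_Int)
   hence "F1 x - F2 x = F1 x0 - F2 x0"
    using primitive_along_unique[of j "L1 Int L2" c F1 F2 x x0] F primitive_along_subset x0 that by blast
   thus ?thesis by (simp add: \<kappa>_def algebra_simps)
  qed
  define F where "F x = (if x \<in> L1 then F1 x else F2 x + \<kappa>)" for x
  have F1: "x \<in> L1 ==> F x = F1 x" and F2: "x \<in> L2 ==> F x = F2 x + \<kappa>" for x using agree by (auto simp: F_def)
  have loc: "EX e>0. ALL s:L. dist t s < e --> F s - F t = j (c t) (c s)"
   if "L = L1 | L = L2" "t \<in> L1 Un L2" for L t
  proof (cases "t \<in> L")
   case True
   define G where "G = (if L = L1 then F1 else F2)"
   have G: "primitive_along j L c G" using that(1) F by (auto simp: G_def)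
   then obtain e where e: "0 < e" "!!s. s \<in> L ==> dist t s < e ==> G s - G t = j (c t) (c s)"
    using True unfolding primitive_along_def by blast
   have "F s - F t = G s - G t" if "s \<in> L" for s
    using \<open>L = L1 | L = L2\<close> that True F1 F2 by (cases "L = L1") (auto simp: G_def)
   thus ?thesis using e by metis
  next
   case False
   have "closed L" using that(1) L compact_imp_closed by auto
   then obtain e where "0 < e" "ball t e \<subseteq> - L" using False open_contains_ball_eq[of "- L"] by (auto simp: open_Compl)
   thus ?thesis by (intro exI[of _ e]) (auto simp: subset_iff)
  qed
  have "primitive_along j (L1 Un L2) c F" unfolding primitive_along_def
  proof
   fix t assume t: "t \<in> L1 Un L2"
   obtain e1 e2 where "0 < e1" "0 < e2"
    "ALL s:L1. dist t s < e1 --> F s - F t = j (c t) (c s)"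
    "ALL s:L2. dist t s < e2 --> F s - F t = j (c t) (c s)" using loc[of L1 t] loc[of L2 t] t by blast
   thus "EX e>0. ALL s:L1 Un L2. dist t s < e --> F s - F t = j (c t) (c s)" by (intro exI[of _ "min e1 e2"]) auto
  qed
  thus "EX F. primitive_along j (L1 Un L2) c F" by blast
 qed
qed

lemma primitive_along_exists_path:
 assumes c: "cpath X c" and j: "germ_cocycle X j"
 shows "EX F. primitive_along j {0..1} c F"
proof -
 let ?K = "{0..1} \<times> {0} :: (real \<times> real) set"
 have "continuous_map (top_of_set ?K) (top_of_set {0..1}) fst" by (auto intro: continuous_intros)
 hence "continuous_map (top_of_set ?K) X (c o fst)" using c continuous_map_compose by blast
 then obtain F where "primitive_along j ?K (c o fst) F" using primitive_along_exists_plane[of ?K X "c o fst" j] j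
  by (auto simp: compact_Times convex_Times)
 hence "primitive_along j {0..1} ((c o fst) o (%u. (u, 0::real))) (F o (%u. (u, 0)))"
  by (rule primitive_along_compose) (auto intro: continuous_intros)
 thus ?thesis by (auto simp: o_def)
qed

definition path_int :: "('a => 'a => complex) => (real => 'a) => complex"
 where "path_int j c = (SOME d. EX F. primitive_along j {0..1} c F & d = F 1 - F 0)"

lemma path_int_eq:
 assumes "primitive_along j {0..1} c F"
 shows "path_int j c = F 1 - F 0" unfolding path_int_def
proof (rule some_equality)
 show "EX G. primitive_along j {0..1} c G & F 1 - F 0 = G 1 - G 0" using assms by blast
 show "d = F 1 - F 0" if d: "EX G. primitive_along j {0..1} c G & d = G 1 - G 0" for d
 proof -
  obtain G where G: "primitive_along j {0..1} c G" "d = G 1 - G 0" using d by blast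
  have "F 0 - G 0 = F 1 - G 1" by (rule primitive_along_unique[OF assms G(1)]) auto
  thus ?thesis unfolding G(2) by (simp add: algebra_simps)
 qed
qed

lemma primitive_along_cong:
 "(!!t. t \<in> K ==> c t = d t) ==> primitive_along j K c F \<longleftrightarrow> primitive_along j K d F"
 by (simp add: primitive_along_def)

lemma path_int_cong: "(!!t. t \<in> {0..1} ==> c t = d t) ==> path_int j c = path_int j d"
 unfolding path_int_def using primitive_along_cong[of "{0..1}" c d j] by simp

lemma path_int_compose: "path_int j (g o c) = path_int (%x y. j (g x) (g y)) c" by (simp add: path_int_def primitive_along_def)

definition germ_cochain :: "('a => 'a => complex) => ((nat => real) => 'a) => complex"
 where "germ_cochain j \<sigma> = path_int j (path_of \<sigma>)"

lemma germ_cochain_simplex1: "germ_cochain j (simplex1 c) = path_int j c"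
 unfolding germ_cochain_def by (rule path_int_cong) (simp add: path_of_simplex1)

lemma compact_triangle: "compact triangle"
proof -
 have "triangle = ({0..1} \<times> {0..1}) Int {z. fst z + snd z <= 1}" by (auto simp: triangle_def)
 moreover have "compact (({0..1} \<times> {0..1}) Int {z :: real \<times> real. fst z + snd z <= 1})"
  by (intro compact_Int_closed compact_Times closed_Collect_le continuous_intros) auto
 ultimately show ?thesis by simp
qed

lemma convex_triangle: "convex triangle"
proof -
 have "triangle = {z. 0 <= fst z} Int {z. 0 <= snd z} Int {z. inner (1, 1) z <= 1}" by (auto simp: triangle_def inner_prod_def)
 moreover have "convex {z :: real \<times> real. 0 <= fst z}" "convex {z :: real \<times> real. 0 <= snd z}"
  by (auto simp: convex_alt)
 moreover have "convex {z :: real \<times> real. inner (1, 1) z <= 1}" by (rule convex_halfspace_le)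
 ultimately show ?thesis by (metis convex_Int)
qed

text \<open>
  A triangle is convex and compact, so the increments along its three sides come from one
  primitive.
\<close>

lemma closed_germ_cochain:
 assumes j: "germ_cocycle X j"
 shows "closed_cochain X (germ_cochain j)" unfolding closed_cochain_def germ_cochain_simplex1
proof (intro allI impI)
 fix H assume H: "continuous_map (top_of_set triangle) X H"
 obtain F where F: "primitive_along j triangle H F"
  using primitive_along_exists_plane[OF compact_triangle convex_triangle H j] by blast
 have edge: "path_int j (H o g) = F (g 1) - F (g 0)"
  if "continuous_on {0..1} g" "g ` {0..1} \<subseteq> triangle" for g
  using path_int_eq[OF primitive_along_compose[OF F that]] by simp
 have "path_int j (H o (%u. (1 - u, u))) = F (0, 1) - F (1, 0)"
  "path_int j (H o (%u. (0, u))) = F (0, 1) - F (0, 0)"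
  "path_int j (H o (%u. (u, 0))) = F (1, 0) - F (0, 0)" by (subst edge; (force intro!: continuous_intros simp: triangle_def)?)+
 thus "path_int j (%u. H (1 - u, u)) - path_int j (%u. H (0, u)) + path_int j (%u. H (u, 0)) = 0" by (simp add: o_def)
qed

text \<open>Germ cocycles that differ by increments of a function have cohomologous cochains.\<close>

lemma path_int_shift:
 assumes j: "germ_cocycle X j" and c: "cpath X c"
  and eq: "!!x. x \<in> topspace X ==> EX N. openin X N & x \<in> N & (ALL y:N. k x y = j x y + f y - f x)"
 shows "path_int k c = path_int j c + f (c 1) - f (c 0)"
proof -
 obtain F where F: "primitive_along j {0..1} c F" using primitive_along_exists_path[OF c j] by blast
 have "primitive_along k {0..1} c (%t. F t + f (c t))" unfolding primitive_along_def
 proof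
  fix t :: real assume t: "t \<in> {0..1}"
  have ct: "c t \<in> topspace X" using c t by (auto simp: continuous_map_def)
  obtain N where N: "openin X N" "c t \<in> N" "!!y. y \<in> N ==> k (c t) y = j (c t) y + f y - f (c t)" using eq[OF ct] by blast
  obtain e1 where e1: "0 < e1" "!!s. s \<in> {0..1} ==> dist t s < e1 ==> c s \<in> N"
   using continuous_map_ball[OF c N(1) t N(2)] by blast
  obtain e2 where e2: "0 < e2" "!!s. s \<in> {0..1} ==> dist t s < e2 ==> F s - F t = j (c t) (c s)"
   using F t unfolding primitive_along_def by blast
  show "EX e>0. ALL s:{0..1}. dist t s < e --> F s + f (c s) - (F t + f (c t)) = k (c t) (c s)"
   using e1 e2 N(3) by (intro exI[of _ "min e1 e2"]) (simp add: algebra_simps)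
 qed
 from path_int_eq[OF this] path_int_eq[OF F] show ?thesis by simp
qed

lemma path_int_add:
 assumes "germ_cocycle X j" "germ_cocycle X k" and c: "cpath X c"
 shows "path_int (%x y. j x y + k x y) c = path_int j c + path_int k c"
proof -
 obtain F where F: "primitive_along j {0..1} c F" using primitive_along_exists_path[OF c assms(1)] by blast
 obtain G where G: "primitive_along k {0..1} c G" using primitive_along_exists_path[OF c assms(2)] by blast
 have "primitive_along (%x y. j x y + k x y) {0..1} c (%t. F t + G t)" unfolding primitive_along_def
 proof
  fix t :: real assume t: "t \<in> {0..1}"
  obtain e1 where e1: "0 < e1" "!!s. s \<in> {0..1} ==> dist t s < e1 ==> F s - F t = j (c t) (c s)"
   using F t unfolding primitive_along_def by blast
  obtain e2 where e2: "0 < e2" "!!s. s \<in> {0..1} ==> dist t s < e2 ==> G s - G t = k (c t) (c s)"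
   using G t unfolding primitive_along_def by blast
  show "EX e>0. ALL s:{0..1}. dist t s < e --> F s + G s - (F t + G t) = j (c t) (c s) + k (c t) (c s)"
   using e1 e2 by (intro exI[of _ "min e1 e2"]) (simp add: algebra_simps)
 qed
 from path_int_eq[OF this] path_int_eq[OF F] path_int_eq[OF G] show ?thesis by simp
qed

lemma path_int_scale:
 assumes "germ_cocycle X j" and c: "cpath X c"
 shows "path_int (%x y. a * j x y) c = a * path_int j c"
proof -
 obtain F where F: "primitive_along j {0..1} c F" using primitive_along_exists_path[OF c assms(1)] by blast
 have "primitive_along (%x y. a * j x y) {0..1} c (%t. a * F t)"
  using F unfolding primitive_along_def by (fastforce simp flip: right_diff_distrib)
 from path_int_eq[OF this] path_int_eq[OF F] show ?thesis by (simp add: right_diff_distrib)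
qed

text \<open>
  The passage from local to global: subdividing a path is replaced by differentiating the value
  of the cochain on its initial segments.
\<close>

lemma closed_cochain_eq_path_int:
 assumes \<phi>: "closed_cochain X \<phi>"
  and loc: "!!x. x \<in> topspace X ==> EX N. openin X N & x \<in> N &
   (ALL c. cpath X c --> c ` {0..1} \<subseteq> N --> c 0 = x -->
    \<phi> (simplex1 c) = j x (c 1) + f (c 1) - f x)"
  and c: "cpath X c"
 shows "\<phi> (simplex1 c) = path_int j c + f (c 1) - f (c 0)"
proof -
 define F where "F t = \<phi> (simplex1 (c o linepath 0 t)) - f (c t)" for t
 have "primitive_along j {0..1} c F" unfolding primitive_along_def
 proof
  fix t :: real assume t: "t \<in> {0..1}"
  have ct: "c t \<in> topspace X" using c t by (auto simp: continuous_map_def)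
  obtain N where N: "openin X N" "c t \<in> N" and N':
   "!!d. cpath X d ==> d ` {0..1} \<subseteq> N ==> d 0 = c t ==>
    \<phi> (simplex1 d) = j (c t) (d 1) + f (d 1) - f (c t)" using loc[OF ct] by blast
  obtain e where e: "0 < e" "!!s. s \<in> {0..1} ==> dist t s < e ==> c s \<in> N"
   using continuous_map_ball[OF c N(1) t N(2)] by blast
  have "F s - F t = j (c t) (c s)" if s: "s \<in> {0..1}" "dist t s < e" for s
  proof -
   have 1: "linepath t s u \<in> {0..1}" if "u \<in> {0..1}" for u
    unfolding linepath_def using convexD_alt[of "{0..1::real}" t s u] t s(1) that by simp
   have "dist t (linepath t s u) <= dist t s" if "u \<in> {0..1}" for u
   proof -
    have "linepath t s u \<in> closed_segment t s" using that by (auto simp: linepath_image_01[symmetric])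
    thus ?thesis using dist_in_closed_segment[of "linepath t s u" t s] by (simp add: dist_commute)
   qed
   hence 2: "(c o linepath t s) ` {0..1} \<subseteq> N" using 1 e(2) s(2) by force
   have "cpath (top_of_set {0..1}) (linepath t s)" using 1 by (auto simp: continuous_on_linepath)
   hence 3: "cpath X (c o linepath t s)" using c continuous_map_compose by blast
   have "\<phi> (simplex1 (c o linepath 0 s)) = \<phi> (simplex1 (c o linepath 0 t)) + \<phi> (simplex1 (c o linepath t s))"
    by (rule closed_cochain_triangle[OF \<phi> c]) (use t s in auto)
   with N'[OF 3 2] show ?thesis by (simp add: F_def linepath_def algebra_simps)
  qed
  thus "EX e>0. ALL s:{0..1}. dist t s < e --> F s - F t = j (c t) (c s)" using e(1) by blast
 qed
 hence "path_int j c = F 1 - F 0" by (rule path_int_eq)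
 moreover have "c o linepath 0 1 = c" "c o linepath 0 0 = (%_. c 0)" by (auto simp: linepath_def fun_eq_iff)
 moreover have "\<phi> (simplex1 (%_. c 0)) = 0"
  using c by (intro closed_cochain_const[OF \<phi>]) (auto simp: continuous_map_def)
 ultimately show ?thesis by (simp add: F_def)
qed

section \<open>The torus and its lattice\<close>

definition lattice :: "(real \<times> real) set"
 where "lattice = {z. fst z \<in> \<int> & snd z \<in> \<int>}"

lemma torus_class_eq_iff: "torus_class x = torus_class y \<longleftrightarrow> x - y \<in> lattice"
proof
 assume "torus_class x = torus_class y"
 moreover have "x \<in> torus_class x" by (simp add: torus_class_def)
 ultimately have "x \<in> torus_class y" by simp
 thus "x - y \<in> lattice" by (simp add: torus_class_def lattice_def)
next
 assume xy: "x - y \<in> lattice"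
 have "fst z - fst x \<in> \<int> \<longleftrightarrow> fst z - fst y \<in> \<int>" "snd z - snd x \<in> \<int> \<longleftrightarrow> snd z - snd y \<in> \<int>" for z
 proof -
  have "fst z - fst y = (fst z - fst x) + fst (x - y)" "snd z - snd y = (snd z - snd x) + snd (x - y)"
   "fst z - fst x = (fst z - fst y) - fst (x - y)" "snd z - snd x = (snd z - snd y) - snd (x - y)" by simp_all
  with xy show "fst z - fst x \<in> \<int> \<longleftrightarrow> fst z - fst y \<in> \<int>" "snd z - snd x \<in> \<int> \<longleftrightarrow> snd z - snd y \<in> \<int>"
   unfolding lattice_def by (metis (no_types, lifting) Ints_add Ints_diff mem_Collect_eq)+
 qed
 thus "torus_class x = torus_class y" by (simp add: torus_class_def)
qed

lemma lattice_add: "x \<in> lattice ==> y \<in> lattice ==> x + y \<in> lattice"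
 and lattice_minus: "x \<in> lattice ==> - x \<in> lattice"
 and lattice_0: "0 \<in> lattice" and lattice_e: "(1, 0) \<in> lattice" "(0, 1) \<in> lattice" by (auto simp: lattice_def)

lemma lattice_translate: "v \<in> lattice ==> x + v \<in> lattice \<longleftrightarrow> x \<in> lattice"
 using lattice_add[of "x + v" "- v"] lattice_add[of x v] lattice_minus[of v] by auto

lemma torus_class_translate [simp]: "v \<in> lattice ==> torus_class (x + v) = torus_class x" by (simp add: torus_class_eq_iff)

lemma closed_lattice: "closed lattice"
proof -
 have eq: "lattice = (\<int> :: real set) \<times> \<int>" by (auto simp: lattice_def)
 show ?thesis unfolding eq by (intro closed_Times closed_Ints)
qed

lemma small_lattice_vector: "v \<in> lattice ==> norm v < 1 ==> v = 0"
proof -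
 assume v: "v \<in> lattice" "norm v < 1"
 have "\<bar>fst v\<bar> <= norm v" "\<bar>snd v\<bar> <= norm v" by (metis norm_fst_le norm_snd_le prod.collapse real_norm_def)+
 hence "\<bar>fst v\<bar> < 1" "\<bar>snd v\<bar> < 1" using v by auto
 hence "fst v = 0" "snd v = 0" using v(1) Ints_nonzero_abs_less1 by (auto simp: lattice_def)
 thus ?thesis by (simp add: prod_eq_iff)
qed

lemma inj_torus_class_ball: "inj_on torus_class (ball x (1/2))"
proof (rule inj_onI)
 fix y z assume yz: "y \<in> ball x (1/2)" "z \<in> ball x (1/2)" "torus_class y = torus_class z"
 have "dist y z < 1" using yz(1,2) dist_triangle3[of y z x] by (auto simp: dist_commute)
 hence "y - z = 0" using yz(3) small_lattice_vector[of "y - z"] by (simp add: torus_class_eq_iff dist_norm)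
 thus "y = z" by simp
qed

lemma open_torus_class_image: "open U ==> openin torus (torus_class ` U)"
proof -
 assume U: "open U"
 have "torus_class -` (torus_class ` U) = (\<Union>v\<in>lattice. (%x. v + x) ` U)"
 proof (rule Set.set_eqI, rule iffI)
  fix x assume "x \<in> torus_class -` (torus_class ` U)"
  then obtain y where "y \<in> U" "x - y \<in> lattice" by (auto simp: torus_class_eq_iff)
  thus "x \<in> (\<Union>v\<in>lattice. (%x. v + x) ` U)" by (intro UN_I[of "x - y"] image_eqI[of _ _ y]) auto
 next
  fix x assume "x \<in> (\<Union>v\<in>lattice. (%x. v + x) ` U)"
  then obtain v y where y: "v \<in> lattice" "y \<in> U" "x = v + y" by auto
  hence "torus_class x = torus_class y" by (simp add: torus_class_eq_iff)
  thus "x \<in> torus_class -` (torus_class ` U)" using y(2) by simp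
 qed
 thus ?thesis using U by (auto simp: openin_torus intro: open_translation)
qed

lemma continuous_map_torus_class: "continuous_map euclidean torus torus_class"
 by (rule quotient_imp_continuous_map[OF quotient_map_torus_class])

lemma torus_class_local_inverse:
 assumes "0 < d" "d <= 1/2"
 obtains g where "continuous_map (subtopology torus (torus_class ` ball x d)) (top_of_set (ball x d)) g"
  "!!z. z \<in> ball x d ==> g (torus_class z) = z"
proof -
 have "homeomorphic_map (top_of_set (ball x d)) (subtopology torus (torus_class ` ball x d)) torus_class"
 proof (rule bijective_open_imp_homeomorphic_map)
  show "continuous_map (top_of_set (ball x d)) (subtopology torus (torus_class ` ball x d)) torus_class"
   using continuous_map_torus_class by (auto simp: continuous_map_in_subtopology continuous_map_from_subtopology)
  show "open_map (top_of_set (ball x d)) (subtopology torus (torus_class ` ball x d)) torus_class" unfolding open_map_def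
  proof (intro allI impI)
   fix U assume "openin (top_of_set (ball x d)) U"
   hence U: "open U" "U \<subseteq> ball x d" by (auto simp: openin_open_eq)
   thus "openin (subtopology torus (torus_class ` ball x d)) (torus_class ` U)"
    using open_torus_class_image[OF U(1)] by (auto simp: openin_subtopology_alt)
  qed
  show "torus_class ` topspace (top_of_set (ball x d)) = topspace (subtopology torus (torus_class ` ball x d))"
   by (auto simp: topspace_torus)
  show "inj_on torus_class (topspace (top_of_set (ball x d)))"
   using inj_torus_class_ball[of x] assms by (auto intro: inj_on_subset simp: subset_ball)
 qed
 thus ?thesis using that unfolding homeomorphic_map_maps homeomorphic_maps_def by auto
qed

lemma small_ball_avoids_lattice:
 assumes "x \<notin> lattice"
 obtains d where "0 < d" "ball x d Int lattice = {}" using open_contains_ball_eq[of "- lattice"] closed_lattice assms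
 by (metis ComplI Compl_disjoint2 Int_absorb2 disjoint_eq_subset_Compl open_Compl)

text \<open>The fundamental domain is half open, so that every point has exactly one representative.\<close>

definition unit_square :: "(real \<times> real) set"
 where "unit_square = {0..<1} \<times> {0..<1}"

lemma unit_square_unique:
 assumes "x \<in> unit_square" "y \<in> unit_square" "torus_class x = torus_class y"
 shows "x = y"
proof -
 have "fst x - fst y \<in> \<int>" "snd x - snd y \<in> \<int>" using assms(3) by (auto simp: torus_class_eq_iff lattice_def)
 moreover have "\<bar>fst x - fst y\<bar> < 1" "\<bar>snd x - snd y\<bar> < 1" using assms(1,2) by (auto simp: unit_square_def)
 ultimately have "fst x - fst y = 0" "snd x - snd y = 0" using Ints_nonzero_abs_less1 by blast+
 thus ?thesis by (simp add: prod_eq_iff)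
qed

lemma unit_square_exists: "EX x:unit_square. torus_class x = torus_class y"
proof (intro bexI)
 show "(frac (fst y), frac (snd y)) \<in> unit_square" by (auto simp: unit_square_def frac_lt_1)
 show "torus_class (frac (fst y), frac (snd y)) = torus_class y" by (simp add: torus_class_eq_iff lattice_def frac_def)
qed

lemma convex_unit_square_minus_0: "convex (unit_square - {0})"
proof -
 have c: "convex unit_square" by (auto simp: unit_square_def intro!: convex_Times)
 show ?thesis
 proof (rule convexI)
  fix x y :: "real \<times> real" and u v :: real
  assume x: "x \<in> unit_square - {0}" and y: "y \<in> unit_square - {0}" and uv: "0 <= u" "0 <= v" "u + v = 1"
  have "u *\<^sub>R x + v *\<^sub>R y \<in> unit_square" using convexD[OF c _ _ uv] x y by blast
  moreover have "u *\<^sub>R x + v *\<^sub>R y ~= 0"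
  proof
   assume "u *\<^sub>R x + v *\<^sub>R y = 0"
   hence "u * fst x + v * fst y = 0" "u * snd x + v * snd y = 0" by (auto simp: prod_eq_iff)
   moreover have "0 <= fst x" "0 <= fst y" "0 <= snd x" "0 <= snd y" using x y by (auto simp: unit_square_def)
   ultimately have *: "u * fst x = 0" "v * fst y = 0" "u * snd x = 0" "v * snd y = 0"
    using uv by (metis add_nonneg_eq_0_iff mult_nonneg_nonneg)+
   show False using * uv x y by (cases "u = 0") (auto simp: prod_eq_iff)
  qed
  ultimately show "u *\<^sub>R x + v *\<^sub>R y \<in> unit_square - {0}" by simp
 qed
qed

lemma unit_square_lattice: "x \<in> unit_square ==> x \<in> lattice \<longleftrightarrow> x = 0"
 using unit_square_unique[of x 0] by (auto simp: torus_class_eq_iff unit_square_def lattice_def zero_prod_def)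

definition center :: "real \<times> real" where "center = (1/2, 1/2)"

lemma center_in: "center \<in> unit_square - {0}" by (auto simp: center_def unit_square_def zero_prod_def)

section \<open>Lifting through a ramified covering of the torus\<close>

locale torus_covering =
 fixes X :: "'a topology" and p :: "'a => (real \<times> real) set"
 assumes ramified: "ramified_covering_outside X torus p {torus_class 0}"
begin

lemma continuous_p: "continuous_map X torus p"
 and surj_p: "p ` topspace X = topspace torus" using ramified by (auto simp: ramified_covering_outside_def)

lemma chart_at:
 assumes "y \<in> topspace torus"
 obtains V \<psi> \<U> where "openin torus V" "y \<in> V"
  "homeomorphic_map (subtopology torus V) (top_of_set (ball (0::complex) 1)) \<psi>"
  "{x \<in> topspace X. p x \<in> V} = \<Union>\<U>" "pairwise disjnt \<U>" "\<psi> y = 0"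
  "ALL U:\<U>. openin X U & (EX \<phi> k. homeomorphic_map (subtopology X U) (top_of_set (ball (0::complex) 1)) \<phi> &
       (1::nat) <= k & (y \<notin> {torus_class 0} --> k = 1) & (ALL m:U. \<psi> (p m) = \<phi> m ^ k))"
 using bspec[OF conjunct2[OF conjunct2[OF ramified[unfolded ramified_covering_outside_def]]] assms] by (elim exE conjE)

definition sheets :: "(real \<times> real) set => 'a set set => bool"
 where "sheets W \<U> \<longleftrightarrow> open W & pairwise disjnt \<U> & {m \<in> topspace X. p m \<in> torus_class ` W} = \<Union>\<U> &
  (ALL U:\<U>. openin X U & inj_on p U &
   (EX s. continuous_map (top_of_set W) X s & (ALL w:W. s w \<in> U & p (s w) = torus_class w)))"

lemma sheetsD:
 assumes "sheets W \<U>"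
 shows "open W" "pairwise disjnt \<U>" "{m \<in> topspace X. p m \<in> torus_class ` W} = \<Union>\<U>"
  "U \<in> \<U> ==> openin X U" "U \<in> \<U> ==> inj_on p U"
  "U \<in> \<U> ==> EX s. continuous_map (top_of_set W) X s & (ALL w:W. s w \<in> U & p (s w) = torus_class w)"
 using assms unfolding sheets_def by simp_all

text \<open>
  Outside the vertices all ramification exponents are 1, so the power charts of the definition are
  homeomorphisms.
\<close>

lemma evenly_covered:
 assumes x: "x \<notin> lattice"
 shows "EX W \<U>. x \<in> W & sheets W \<U>"
proof -
 have "torus_class x \<in> topspace torus" by (simp add: topspace_torus)
 then obtain V \<psi> \<U> where V: "openin torus V" "torus_class x \<in> V"
  and \<psi>: "homeomorphic_map (subtopology torus V) (top_of_set (ball (0::complex) 1)) \<psi>"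
  and \<U>: "{x \<in> topspace X. p x \<in> V} = \<Union>\<U>" "pairwise disjnt \<U>"
  and U: "ALL U:\<U>. openin X U & (EX \<phi> k. homeomorphic_map (subtopology X U) (top_of_set (ball (0::complex) 1)) \<phi> &
       (1::nat) <= k & (torus_class x \<notin> {torus_class 0} --> k = 1) & (ALL m:U. \<psi> (p m) = \<phi> m ^ k))"
  by (rule chart_at)
 have x0: "torus_class x \<notin> {torus_class 0}" using x by (auto simp: torus_class_eq_iff)
 have Vsub: "V \<subseteq> range torus_class" and Vop: "open (torus_class -` V)" using V(1) by (simp_all add: openin_torus)
 have injV: "inj_on \<psi> V" using homeomorphic_imp_injective_map[OF \<psi>] openin_subset[OF V(1)] by (simp add: inf.absorb2)
 have \<psi>V: "\<psi> v \<in> ball 0 1" if "v \<in> V" for v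
 proof -
  have "\<psi> v \<in> \<psi> ` (topspace torus Int V)" using openin_subset[OF V(1)] that by blast
  thus ?thesis using homeomorphic_imp_surjective_map[OF \<psi>] by simp
 qed
 have \<psi>c: "continuous_map (top_of_set (torus_class -` V)) (top_of_set (ball 0 1)) (\<psi> o torus_class)"
 proof (rule continuous_map_compose)
  show "continuous_map (top_of_set (torus_class -` V)) (subtopology torus V) torus_class"
   using continuous_map_torus_class by (auto simp: continuous_map_in_subtopology continuous_map_from_subtopology)
  show "continuous_map (subtopology torus V) (top_of_set (ball 0 1)) \<psi>" using \<psi> homeomorphic_imp_continuous_map by blast
 qed
 have "sheets (torus_class -` V) \<U>" unfolding sheets_def
 proof (intro conjI ballI)
  show "open (torus_class -` V)" "pairwise disjnt \<U>" using Vop \<U>(2) by auto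
  have "torus_class ` (torus_class -` V) = V" using Vsub by auto
  thus "{m \<in> topspace X. p m \<in> torus_class ` (torus_class -` V)} = \<Union>\<U>" using \<U>(1) by simp
 next
  fix U assume "U \<in> \<U>"
  then obtain \<phi> where opU: "openin X U"
   and \<phi>: "homeomorphic_map (subtopology X U) (top_of_set (ball (0::complex) 1)) \<phi>"
   and eq: "!!m. m \<in> U ==> \<psi> (p m) = \<phi> m" using bspec[OF U \<open>U \<in> \<U>\<close>] x0 by auto
  have UX: "U \<subseteq> topspace X" by (rule openin_subset[OF opU])
  have pU: "p m \<in> V" if "m \<in> U" for m using \<U>(1) \<open>U \<in> \<U>\<close> that by auto
  have inj\<phi>: "inj_on \<phi> U" using homeomorphic_imp_injective_map[OF \<phi>] UX by (simp add: inf.absorb2)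
  show "openin X U" by (rule opU)
  show "inj_on p U" using inj\<phi> eq by (metis inj_on_def)
  obtain g where g: "homeomorphic_maps (subtopology X U) (top_of_set (ball 0 1)) \<phi> g"
   using \<phi> homeomorphic_map_maps by blast
  have gc: "continuous_map (top_of_set (ball 0 1)) (subtopology X U) g"
   and \<phi>g: "!!b. b \<in> ball 0 1 ==> \<phi> (g b) = b" using g by (auto simp: homeomorphic_maps_def)
  have gU: "g b \<in> U" if "b \<in> ball 0 1" for b using gc that UX by (auto simp: continuous_map_def Pi_iff)
  have "continuous_map (top_of_set (torus_class -` V)) (subtopology X U) (g o (\<psi> o torus_class))"
   by (rule continuous_map_compose[OF \<psi>c gc])
  hence 1: "continuous_map (top_of_set (torus_class -` V)) X (g o (\<psi> o torus_class))"
   by (simp add: continuous_map_in_subtopology)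
  have 2: "(g o (\<psi> o torus_class)) w \<in> U & p ((g o (\<psi> o torus_class)) w) = torus_class w"
   if w: "w \<in> torus_class -` V" for w
  proof -
   have b: "\<psi> (torus_class w) \<in> ball 0 1" using w \<psi>V by simp
   have "\<psi> (p (g (\<psi> (torus_class w)))) = \<psi> (torus_class w)" using eq[OF gU[OF b]] \<phi>g[OF b] by simp
   hence "p (g (\<psi> (torus_class w))) = torus_class w" using injV pU[OF gU[OF b]] w by (auto dest: inj_onD)
   thus ?thesis using gU[OF b] by simp
  qed
  show "EX s. continuous_map (top_of_set (torus_class -` V)) X s
    & (ALL w:torus_class -` V. s w \<in> U & p (s w) = torus_class w)" using 1 2 by blast
 qed
 thus ?thesis using V(2) by blast
qed

definition lift_on :: "(real \<times> real) set => (real \<times> real => 'a) => bool"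
 where "lift_on C s \<longleftrightarrow> continuous_map (top_of_set C) X s & (ALL z:C. p (s z) = torus_class z)"

lemma lift_onD: "lift_on C s ==> continuous_map (top_of_set C) X s" "lift_on C s ==> z \<in> C ==> p (s z) = torus_class z"
 "lift_on C s ==> z \<in> C ==> s z \<in> topspace X" by (auto simp: lift_on_def continuous_map_def)

lemma lift_on_subset: "lift_on C s ==> D \<subseteq> C ==> lift_on D s"
 unfolding lift_on_def by (meson continuous_map_from_subtopology_mono subsetD)

lemma lift_unique:
 assumes C: "connected C" "C Int lattice = {}" and s: "lift_on C s" "lift_on C s'"
  and z0: "z0 \<in> C" "s z0 = s' z0" and z: "z \<in> C"
 shows "s z = s' z"
proof -
 have "(s z0 = s' z0) = (s z = s' z)"
 proof (rule connected_local_const[OF C(1) z0(1) z, where f = "%z. s z = s' z"], intro ballI)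
  fix a assume a: "a \<in> C"
  hence "a \<notin> lattice" using C(2) by blast
  obtain W \<U> where aW: "a \<in> W" and W: "sheets W \<U>" using evenly_covered[OF \<open>a \<notin> lattice\<close>] by blast
  have "s a \<in> \<Union>\<U>" "s' a \<in> \<Union>\<U>"
   unfolding sheetsD(3)[OF W, symmetric] using lift_onD(2,3)[OF s(1) a] lift_onD(2,3)[OF s(2) a] aW by auto
  then obtain U U' where U: "U \<in> \<U>" "s a \<in> U" "U' \<in> \<U>" "s' a \<in> U'" by blast
  obtain e where e: "0 < e" "!!b. b \<in> C ==> dist a b < e ==> s b \<in> U"
   using continuous_map_ball[OF lift_onD(1)[OF s(1)] sheetsD(4)[OF W U(1)] a U(2)] by blast
  obtain e' where e': "0 < e'" "!!b. b \<in> C ==> dist a b < e' ==> s' b \<in> U'"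
   using continuous_map_ball[OF lift_onD(1)[OF s(2)] sheetsD(4)[OF W U(3)] a U(4)] by blast
  have iff: "s b = s' b \<longleftrightarrow> U = U'" if b: "b \<in> C" "dist a b < min e e'" for b
  proof
   have sb: "s b \<in> U" "s' b \<in> U'" using e(2)[of b] e'(2)[of b] b by simp_all
   assume "U = U'"
   hence "s b \<in> U" "s' b \<in> U" using sb by simp_all
   moreover have "p (s b) = p (s' b)" using lift_onD(2) s b(1) by metis
   ultimately show "s b = s' b" using sheetsD(5)[OF W U(1)] by (auto dest: inj_onD)
  next
   have sb: "s b \<in> U" "s' b \<in> U'" using e(2)[of b] e'(2)[of b] b by simp_all
   assume "s b = s' b"
   hence "s b \<in> U Int U'" using sb by simp
   thus "U = U'" using sheetsD(2)[OF W] U(1,3) unfolding pairwise_def disjnt_def by blast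
  qed
  have "(s a = s' a) = (s b = s' b)" if "b \<in> C" "dist b a < min e e'" for b
   using iff[of a] iff[of b] a that e(1) e'(1) by (simp add: dist_commute)
  thus "\<forall>\<^sub>F b in at a within C. (s a = s' a) = (s b = s' b)"
   unfolding eventually_at using e(1) e'(1) by (intro exI[of _ "min e e'"]) auto
 qed
 thus ?thesis using z0(2) by simp
qed

lemma lift_glue:
 assumes L: "closed L1" "closed L2" and s: "lift_on L1 s1" "lift_on L2 s2"
  and eq: "!!z. z \<in> L1 ==> z \<in> L2 ==> s1 z = s2 z"
 shows "lift_on (L1 Un L2) (%z. if z \<in> L1 then s1 z else s2 z)" unfolding lift_on_def
proof
 let ?s = "%z. if z \<in> L1 then s1 z else s2 z"
 show "ALL z:L1 Un L2. p (?s z) = torus_class z" using lift_onD(2) s by auto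
 show "continuous_map (top_of_set (L1 Un L2)) X ?s" unfolding continuous_map_closedin
 proof (intro conjI ballI allI impI funcsetI)
  fix z assume "z \<in> topspace (top_of_set (L1 Un L2))"
  thus "?s z \<in> topspace X" using lift_onD(3)[OF s(1), of z] lift_onD(3)[OF s(2), of z] by auto
 next
  fix C assume C: "closedin X C"
  have *: "closed {z \<in> L. s z \<in> C}" if "closed L" "lift_on L s" for L s
  proof -
   have "closedin (top_of_set L) {z \<in> L. s z \<in> C}"
    using closedin_continuous_map_preimage[OF lift_onD(1)[OF that(2)] C] by simp
   thus ?thesis using that(1) closedin_closed_trans by blast
  qed
  have "{z \<in> topspace (top_of_set (L1 Un L2)). ?s z \<in> C} = {z \<in> L1. s1 z \<in> C} Un {z \<in> L2. s2 z \<in> C}"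
   using eq by auto
  moreover have "closed ({z \<in> L1. s1 z \<in> C} Un {z \<in> L2. s2 z \<in> C})" using * L s by (intro closed_Un) auto
  ultimately show "closedin (top_of_set (L1 Un L2)) {z \<in> topspace (top_of_set (L1 Un L2)). ?s z \<in> C}"
   using closed_subset[of "{z \<in> topspace (top_of_set (L1 Un L2)). ?s z \<in> C}" "L1 Un L2"] by auto
 qed
qed

text \<open>Short lifts exist inside one sheet, and bisection glues them.\<close>

lemma lift_exists:
 assumes K: "compact K" "convex K" "K Int lattice = {}"
  and z0: "z0 \<in> K" and m: "m \<in> topspace X" "p m = torus_class z0"
 obtains s where "lift_on K s" "s z0 = m"
proof -
 define P where "P L \<longleftrightarrow> (ALL z:L. ALL m:topspace X. p m = torus_class z --> (EX s. lift_on L s & s z = m))" for L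
 define \<C> where "\<C> = {W. open W & (ALL L. L \<subseteq> W --> P L)}"
 have "EX W:\<C>. x \<in> W" if x: "x \<in> K" for x
 proof -
  have "x \<notin> lattice" using x K(3) by blast
  obtain W \<U> where xW: "x \<in> W" and W: "sheets W \<U>" using evenly_covered[OF \<open>x \<notin> lattice\<close>] by blast
  have "P W" unfolding P_def
  proof (intro ballI impI)
   fix z m assume z: "z \<in> W" and m: "m \<in> topspace X" "p m = torus_class z"
   hence "m \<in> \<Union>\<U>" unfolding sheetsD(3)[OF W, symmetric] by auto
   then obtain U where U: "U \<in> \<U>" "m \<in> U" by blast
   obtain s where s: "continuous_map (top_of_set W) X s" "!!w. w \<in> W ==> s w \<in> U & p (s w) = torus_class w"
    using sheetsD(6)[OF W U(1)] by blast
   hence "s z = m" using inj_onD[OF sheetsD(5)[OF W U(1)], of "s z" m] z U(2) m(2) by simp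
   thus "EX s. lift_on W s & s z = m" using s by (auto simp: lift_on_def)
  qed
  hence "P L" if "L \<subseteq> W" for L using that lift_on_subset unfolding P_def by (meson subsetD)
  thus ?thesis using sheetsD(1)[OF W] xW by (auto simp: \<C>_def)
 qed
 hence cov: "K \<subseteq> \<Union>\<C>" by blast
 have "\<C> ~= {}" using cov z0 by auto
 obtain \<delta> where \<delta>: "0 < \<delta>" "!!T. [|T \<subseteq> K; diameter T < \<delta>|] ==> EX B:\<C>. T \<subseteq> B"
  using Lebesgue_number_lemma[OF K(1) \<open>\<C> ~= {}\<close> cov] unfolding \<C>_def by blast
 have "P K"
 proof (rule convex_bisection[OF K(1,2) \<delta>(1)])
  show "P L" if "L \<subseteq> K" "diameter L < \<delta>" for L using \<delta>(2)[OF that] by (auto simp: \<C>_def)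
 next
  fix L1 L2 :: "(real \<times> real) set"
  assume L: "compact L1" "convex L1" "compact L2" "convex L2" "L1 Un L2 \<subseteq> K" "L1 Int L2 ~= {}" "P L1" "P L2"
  have one: "EX s. lift_on (A Un B) s & s z = m"
   if AB: "compact A" "convex A" "compact B" "convex B" "A Un B \<subseteq> K" "A Int B ~= {}" "P A" "P B"
    and z: "z \<in> A" and m: "m \<in> topspace X" "p m = torus_class z" for A B z m
  proof -
   obtain s1 where s1: "lift_on A s1" "s1 z = m" using AB(7) z m unfolding P_def by blast
   obtain w where w: "w \<in> A" "w \<in> B" using AB(6) by blast
   obtain s2 where s2: "lift_on B s2" "s2 w = s1 w" using AB(8) w lift_onD(2,3)[OF s1(1) w(1)] unfolding P_def by blast
   have "s1 x = s2 x" if "x \<in> A" "x \<in> B" for x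
   proof (rule lift_unique[of "A Int B"])
    show "connected (A Int B)" using AB by (intro convex_connected convex_Int)
    show "A Int B Int lattice = {}" using AB(5) K(3) by blast
    show "lift_on (A Int B) s1" "lift_on (A Int B) s2" using lift_on_subset s1(1) s2(1) by blast+
    show "w \<in> A Int B" "s1 w = s2 w" "x \<in> A Int B" using w s2(2) that by auto
   qed
   hence "lift_on (A Un B) (%z. if z \<in> A then s1 z else s2 z)" using lift_glue s1(1) s2(1) AB(1,3) compact_imp_closed by blast
   thus ?thesis using s1(2) z by (intro exI[of _ "%z. if z \<in> A then s1 z else s2 z"]) auto
  qed
  have comm: "L2 Un L1 = L1 Un L2" "L2 Int L1 = L1 Int L2" by auto
  show "P (L1 Un L2)" unfolding P_def
  proof (intro ballI impI)
   fix z m assume "z \<in> L1 Un L2" "m \<in> topspace X" "p m = torus_class z"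
   thus "EX s. lift_on (L1 Un L2) s & s z = m" using one[of L1 L2 z m] one[of L2 L1 z m] L comm by auto
  qed
 qed
 thus ?thesis using that z0 m unfolding P_def by blast
qed

lemma lift_segment:
 assumes m: "m \<in> topspace X" "p m = torus_class x" and C: "convex C" "C Int lattice = {}" "x \<in> C" "y \<in> C"
 shows "EX s. lift_on (closed_segment x y) s & s x = m"
proof -
 have "closed_segment x y \<subseteq> C" using C by (simp add: closed_segment_subset)
 hence "closed_segment x y Int lattice = {}" using C(2) by blast
 thus ?thesis using lift_exists[OF compact_segment convex_closed_segment _ ends_in_segment(1) m, of y] by metis
qed

text \<open>
  Analytic continuation along the straight segment from \<open>x\<close> to \<open>y\<close>.
\<close>

definition transport :: "real \<times> real => real \<times> real => 'a => 'a"
 where "transport x y m = (THE n. EX s. lift_on (closed_segment x y) s & s x = m & s y = n)"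

lemma transport_lift:
 assumes s: "lift_on C s" and C: "convex C" "C Int lattice = {}" and xy: "x \<in> C" "y \<in> C"
 shows "transport x y (s x) = s y" unfolding transport_def
proof (rule the_equality)
 have seg: "closed_segment x y \<subseteq> C" using C(1) xy by (simp add: closed_segment_subset)
 thus "EX s'. lift_on (closed_segment x y) s' & s' x = s x & s' y = s y" using lift_on_subset[OF s] by blast
 fix n assume "EX s'. lift_on (closed_segment x y) s' & s' x = s x & s' y = n"
 then obtain s' where s': "lift_on (closed_segment x y) s'" "s' x = s x" "s' y = n" by blast
 have "s' y = s y" by (rule lift_unique[of "closed_segment x y" s' s x y])
    (use s' seg C(2) lift_on_subset[OF s seg] in \<open>auto simp: connected_segment\<close>)
 thus "n = s y" using s'(3) by simp
qed

lemma transport_triangle: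
 assumes m: "m \<in> topspace X" "p m = torus_class x" and C: "convex C" "C Int lattice = {}"
  and xyz: "x \<in> C" "y \<in> C" "z \<in> C"
 shows "transport y z (transport x y m) = transport x z m"
proof -
 let ?K = "convex hull {x, y, z}"
 have K: "?K \<subseteq> C" using xyz C(1) by (simp add: hull_minimal)
 have "compact ?K" by (simp add: finite_imp_compact_convex_hull)
 moreover have "?K Int lattice = {}" using K C(2) by blast
 moreover have "x \<in> ?K" by (simp add: hull_inc)
 ultimately obtain s where s: "lift_on ?K s" "s x = m" using lift_exists[OF _ convex_convex_hull _ _ m] by metis
 have "convex ?K" "?K Int lattice = {}" "x \<in> ?K" "y \<in> ?K" "z \<in> ?K" using K C(2) by (auto simp: hull_inc)
 thus ?thesis using transport_lift[OF s(1)] s(2) by metis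
qed

lemma transport_in:
 assumes m: "m \<in> topspace X" "p m = torus_class x" and C: "convex C" "C Int lattice = {}" "x \<in> C" "y \<in> C"
 shows "transport x y m \<in> topspace X" "p (transport x y m) = torus_class y"
proof -
 let ?K = "closed_segment x y"
 have K: "?K \<subseteq> C" using C by (simp add: closed_segment_subset)
 obtain s where s: "lift_on ?K s" "s x = m" using lift_segment[OF m C] by blast
 hence "transport x y m = s y" using transport_lift[of ?K s x y] K C(2) by auto
 thus "transport x y m \<in> topspace X" "p (transport x y m) = torus_class y" using lift_onD(2,3)[OF s(1), of y] by auto
qed

lemma transport_same:
 assumes m: "m \<in> topspace X" "p m = torus_class x" and "x \<notin> lattice"
 shows "transport x x m = m"
proof -
 obtain s where s: "lift_on {x} s" "s x = m" using lift_exists[of "{x}" x m] m assms(3) by auto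
 thus ?thesis using transport_lift[of "{x}" s x x] assms(3) by auto
qed

lemma transport_inverse:
 assumes m: "m \<in> topspace X" "p m = torus_class x" and C: "convex C" "C Int lattice = {}" "x \<in> C" "y \<in> C"
 shows "transport y x (transport x y m) = m" using transport_triangle[OF m C(1,2) C(3,4,3)] transport_same[OF m] C by auto

lemma transport_translate:
 assumes m: "m \<in> topspace X" "p m = torus_class x" and C: "convex C" "C Int lattice = {}" "x \<in> C" "y \<in> C"
  and v: "v \<in> lattice"
 shows "transport (x + v) (y + v) m = transport x y m"
proof -
 let ?K = "closed_segment x y"
 have K: "?K \<subseteq> C" using C by (simp add: closed_segment_subset)
 obtain s where s: "lift_on ?K s" "s x = m" using lift_segment[OF m C] by blast
 let ?K' = "closed_segment (x + v) (y + v)" and ?s = "s o (%z. z - v)"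
 have K': "z - v \<in> ?K" if "z \<in> ?K'" for z
  using that closed_segment_translation_eq[of "- v" "z" "x + v" "y + v"] by (simp add: algebra_simps)
 have "continuous_map (top_of_set ?K') (top_of_set ?K) (%z. z - v)" using K' by (auto intro!: continuous_intros)
 hence "continuous_map (top_of_set ?K') X ?s" using lift_onD(1)[OF s(1)] by (rule continuous_map_compose)
 moreover have "p (?s z) = torus_class z" if "z \<in> ?K'" for z
  using lift_onD(2)[OF s(1) K'[OF that]] torus_class_translate[OF v, of "z - v"] by simp
 ultimately have "lift_on ?K' ?s" by (simp add: lift_on_def)
 moreover have "?K' Int lattice = {}"
 proof (rule equals0I)
  fix z assume "z \<in> ?K' Int lattice"
  hence "z - v \<in> C" "z - v \<in> lattice" using K K'[of z] lattice_translate[OF v, of "z - v"] by auto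
  thus False using C(2) by blast
 qed
 ultimately have "transport (x + v) (y + v) (?s (x + v)) = ?s (y + v)"
  by (rule transport_lift[OF _ convex_closed_segment]) simp_all
 moreover have "?K Int lattice = {}" using K C(2) by blast
 hence "transport x y (s x) = s y" by (intro transport_lift[OF s(1)]) simp_all
 ultimately show ?thesis using s(2) by simp
qed

text \<open>An automorphism carries lifts to lifts, and lifts are unique.\<close>

lemma transport_equivariant:
 assumes g: "continuous_map X X g" "!!m. m \<in> topspace X ==> p (g m) = p m"
  and m: "m \<in> topspace X" "p m = torus_class x" and C: "convex C" "C Int lattice = {}" "x \<in> C" "y \<in> C"
 shows "transport x y (g m) = g (transport x y m)"
proof -
 let ?K = "closed_segment x y"
 have K: "?K \<subseteq> C" using C by (simp add: closed_segment_subset)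
 obtain s where s: "lift_on ?K s" "s x = m" using lift_segment[OF m C] by blast
 have "lift_on ?K (g o s)" using continuous_map_compose[OF lift_onD(1)[OF s(1)] g(1)] lift_onD(2,3)[OF s(1)] g(2)
  by (auto simp: lift_on_def)
 moreover have "?K Int lattice = {}" using K C(2) by blast
 ultimately show ?thesis using transport_lift[of ?K "g o s" x y] transport_lift[OF s(1), of x y] s(2) by simp
qed

text \<open>A point away from the vertices has a neighbourhood that is a lifted disc.\<close>

lemma sheet_at:
 assumes x: "x \<notin> lattice" and m: "m \<in> topspace X" "p m = torus_class x" and e: "0 < e"
 obtains d s where "0 < d" "d <= e" "d <= 1/2" "ball x d Int lattice = {}" "lift_on (ball x d) s" "s x = m"
  "openin X (s ` ball x d)"
  "!!c. [|cpath X c; c ` {0..1} \<subseteq> s ` ball x d|] ==>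
   EX c'. continuous_on {0..1} c' & c' ` {0..1} \<subseteq> ball x d & (ALL u:{0..1}. c u = s (c' u))"
proof -
 obtain W \<U> where xW: "x \<in> W" and W: "sheets W \<U>" using evenly_covered[OF x] by blast
 have "m \<in> \<Union>\<U>" unfolding sheetsD(3)[OF W, symmetric] using m xW by auto
 then obtain U where U: "U \<in> \<U>" "m \<in> U" by blast
 obtain s where s: "continuous_map (top_of_set W) X s" "!!w. w \<in> W ==> s w \<in> U & p (s w) = torus_class w"
  using sheetsD(6)[OF W U(1)] by blast
 have inj: "inj_on p U" by (rule sheetsD(5)[OF W U(1)])
 obtain d1 where d1: "0 < d1" "ball x d1 Int lattice = {}" by (rule small_ball_avoids_lattice[OF x])
 obtain d2 where d2: "0 < d2" "ball x d2 \<subseteq> W" using sheetsD(1)[OF W] xW open_contains_ball_eq by blast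
 define d where "d = min (min d1 d2) (min e (1/2))"
 have d: "0 < d" "d <= e" "d <= 1/2" "ball x d Int lattice = {}" "ball x d \<subseteq> W"
  using d1 d2 e subset_ball[of d d1 x] subset_ball[of d d2 x] by (auto simp: d_def)
 have sx: "s x = m" using inj_onD[OF inj, of "s x" m] s(2)[OF xW] U(2) m(2) by simp
 have lift: "lift_on (ball x d) s" using s d(5) continuous_map_from_subtopology_mono[OF s(1)] by (auto simp: lift_on_def)
 have img: "s ` ball x d = U Int {m \<in> topspace X. p m \<in> torus_class ` ball x d}"
 proof (rule Set.set_eqI, rule iffI)
  fix n assume "n \<in> s ` ball x d"
  then obtain z where z: "z \<in> ball x d" "n = s z" by blast
  have "z \<in> W" using z(1) d(5) by blast
  thus "n \<in> U Int {m \<in> topspace X. p m \<in> torus_class ` ball x d}"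
   using s(2)[of z] lift_onD(2,3)[OF lift z(1)] z by auto
 next
  fix n assume n: "n \<in> U Int {m \<in> topspace X. p m \<in> torus_class ` ball x d}"
  then obtain z where z: "z \<in> ball x d" "p n = torus_class z" by auto
  have "z \<in> W" using z(1) d(5) by blast
  hence "s z = n" using inj_onD[OF inj, of "s z" n] s(2)[of z] n z(2) by simp
  thus "n \<in> s ` ball x d" using z(1) by blast
 qed
 have op: "openin X (s ` ball x d)"
  unfolding img using sheetsD(4)[OF W U(1)] openin_continuous_map_preimage[OF continuous_p open_torus_class_image[OF open_ball]]
  by blast
 obtain g where g: "continuous_map (subtopology torus (torus_class ` ball x d)) (top_of_set (ball x d)) g"
  "!!z. z \<in> ball x d ==> g (torus_class z) = z" using torus_class_local_inverse[OF d(1,3)] by blast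
 have "EX c'. continuous_on {0..1} c' & c' ` {0..1} \<subseteq> ball x d & (ALL u:{0..1}. c u = s (c' u))"
  if c: "cpath X c" "c ` {0..1} \<subseteq> s ` ball x d" for c
 proof -
  have "cpath torus (p o c)" using c(1) continuous_p continuous_map_compose by blast
  hence "cpath (subtopology torus (torus_class ` ball x d)) (p o c)" using c(2) img by (auto simp: continuous_map_in_subtopology)
  hence cont: "cpath (top_of_set (ball x d)) (g o (p o c))" using g(1) continuous_map_compose by blast
  have "c u = s ((g o (p o c)) u)" if u: "u \<in> {0..1}" for u
  proof -
   have "c u \<in> s ` ball x d" using c(2) u by blast
   then obtain z where z: "z \<in> ball x d" "c u = s z" by (rule imageE) simp
   thus ?thesis using g(2)[OF z(1)] lift_onD(2)[OF lift z(1)] by simp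
  qed
  thus ?thesis using cont by (intro exI[of _ "g o (p o c)"]) auto
 qed
 thus ?thesis by (rule that[OF d(1-4) lift sx op])
qed

end

section \<open>Squares, labels and monodromy\<close>

definition e1 :: "real \<times> real" where "e1 = (1, 0)"
definition e2 :: "real \<times> real" where "e2 = (0, 1)"

lemma e_simps [simp]: "fst e1 = 1" "snd e1 = 0" "fst e2 = 0" "snd e2 = 1" "e1 \<in> lattice" "e2 \<in> lattice"
 by (auto simp: e1_def e2_def lattice_e)

definition hstrip :: "(real \<times> real) set" where "hstrip = UNIV \<times> {0<..<1}"
definition vstrip :: "(real \<times> real) set" where "vstrip = {0<..<1} \<times> UNIV"

lemma convex_strips: "convex hstrip" "convex vstrip" by (auto simp: hstrip_def vstrip_def intro!: convex_Times)

lemma not_Ints_between: "0 < (r::real) ==> r < 1 ==> r \<notin> \<int>" using Ints_nonzero_abs_less1[of r] by auto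

lemma strips_lattice: "hstrip Int lattice = {}" "vstrip Int lattice = {}"
 using not_Ints_between by (auto simp: hstrip_def vstrip_def lattice_def)

lemma square_lattice: "(unit_square - {0}) Int lattice = {}" using unit_square_lattice by blast

lemma mem_strips: "x \<in> hstrip \<longleftrightarrow> 0 < snd x & snd x < 1" "x \<in> vstrip \<longleftrightarrow> 0 < fst x & fst x < 1"
 by (auto simp: hstrip_def vstrip_def mem_Times_iff)

lemma mem_unit_square: "x \<in> unit_square \<longleftrightarrow> 0 <= fst x & fst x < 1 & 0 <= snd x & snd x < 1"
 by (auto simp: unit_square_def mem_Times_iff)

lemma center_simps [simp]: "fst center = 1/2" "snd center = 1/2" by (auto simp: center_def)

lemma prod_neq_0: "fst x ~= 0 | snd x ~= 0 ==> x ~= (0 :: real \<times> real)" by auto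

lemma abs_fst_snd_ball:
 fixes x y :: "real \<times> real"
 assumes "y \<in> ball x d"
 shows "\<bar>fst y - fst x\<bar> < d" "\<bar>snd y - snd x\<bar> < d"
proof -
 have "dist (fst y) (fst x) <= dist y x" "dist (snd y) (snd x) <= dist y x" by (simp_all add: dist_fst_le dist_snd_le)
 thus "\<bar>fst y - fst x\<bar> < d" "\<bar>snd y - snd x\<bar> < d" using assms by (auto simp: dist_commute dist_real_def)
qed

lemma ball_bounds:
 fixes x y :: "real \<times> real"
 assumes "y \<in> ball x d" "d <= 1/4"
 shows "fst y < fst x + 1/4" "fst x < fst y + 1/4" "snd y < snd x + 1/4" "snd x < snd y + 1/4"
 using abs_fst_snd_ball[OF assms(1)] assms(2) by linarith+

context torus_covering
begin

definition coord :: "'a => real \<times> real"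
 where "coord m = (THE x. x \<in> unit_square & torus_class x = p m)"

lemma coord_eq: "x \<in> unit_square ==> p m = torus_class x ==> coord m = x"
 unfolding coord_def by (rule the_equality) (auto intro: unit_square_unique)

lemma coord: assumes "m \<in> topspace X" shows "coord m \<in> unit_square" "p m = torus_class (coord m)"
proof -
 have "p m \<in> range torus_class" using surj_p assms by (auto simp: topspace_torus)
 then obtain y where "p m = torus_class y" by blast
 then obtain x where "x \<in> unit_square" "p m = torus_class x" using unit_square_exists[of y] by auto
 thus "coord m \<in> unit_square" "p m = torus_class (coord m)" using coord_eq by auto
qed

lemma coord_notin_lattice: "m \<in> topspace X ==> coord m ~= 0 ==> coord m \<notin> lattice"
 using coord unit_square_lattice by blast

definition fibre :: "'a set"
 where "fibre = {q \<in> topspace X. p q = torus_class center}"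

lemma fibreD: "q \<in> fibre ==> q \<in> topspace X" "q \<in> fibre ==> p q = torus_class center" by (auto simp: fibre_def)

text \<open>The square that contains \<open>m\<close>, named by its centre.\<close>

definition label :: "'a => 'a"
 where "label m = transport (coord m) center m"

definition place :: "'a => real \<times> real => 'a"
 where "place q x = transport center x q"

definition right :: "'a => 'a" where "right q = transport center (center + e1) q"
definition up :: "'a => 'a" where "up q = transport center (center + e2) q"

lemmas square_facts = convex_unit_square_minus_0 square_lattice
 and hstrip_facts = convex_strips(1) strips_lattice(1)
 and vstrip_facts = convex_strips(2) strips_lattice(2)

lemma center_strips [simp]: "center \<in> hstrip" "center \<in> vstrip" "center + e1 \<in> hstrip" "center + e2 \<in> vstrip"
 "center - e1 \<in> hstrip" "center - e2 \<in> vstrip" by (auto simp: mem_strips)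

lemma label_in_fibre: assumes "m \<in> topspace X" "coord m ~= 0" shows "label m \<in> fibre"
 using transport_in[OF assms(1) coord(2)[OF assms(1)] square_facts _ center_in] coord(1)[OF assms(1)] assms(2)
 by (auto simp: fibre_def label_def)

lemma place: assumes q: "q \<in> fibre" and x: "x \<in> unit_square - {0}"
 shows "place q x \<in> topspace X" "p (place q x) = torus_class x" "coord (place q x) = x" "label (place q x) = q"
proof -
 show 1: "place q x \<in> topspace X" "p (place q x) = torus_class x"
  using transport_in[OF fibreD[OF q] square_facts center_in x] by (auto simp: place_def)
 show 2: "coord (place q x) = x" using coord_eq 1(2) x by blast
 show "label (place q x) = q"
  using transport_inverse[OF fibreD[OF q] square_facts center_in x] 2 by (simp add: label_def place_def)
qed

lemma place_label: assumes "m \<in> topspace X" "coord m ~= 0" shows "place (label m) (coord m) = m"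
 using transport_inverse[OF assms(1) coord(2)[OF assms(1)] square_facts _ center_in] coord(1)[OF assms(1)] assms(2)
 by (auto simp: place_def label_def)

lemma monodromy_in_fibre: assumes "q \<in> fibre" shows "right q \<in> fibre" "up q \<in> fibre"
 using transport_in[OF fibreD[OF assms] hstrip_facts, of "center + e1"]
  transport_in[OF fibreD[OF assms] vstrip_facts, of "center + e2"] by (auto simp: right_def up_def fibre_def)

lemma right_alt: "q \<in> fibre ==> right q = transport (center - e1) center q"
 using transport_translate[OF _ _ hstrip_facts, of q "center - e1" center e1] torus_class_translate[of e1 "center - e1"]
 by (auto simp: right_def fibreD)

lemma up_alt: "q \<in> fibre ==> up q = transport (center - e2) center q"
 using transport_translate[OF _ _ vstrip_facts, of q "center - e2" center e2] torus_class_translate[of e2 "center - e2"]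
 by (auto simp: up_def fibreD)

lemma bij_monodromy: "bij_betw right fibre fibre" "bij_betw up fibre fibre"
proof -
 have A: "bij_betw f fibre fibre"
  if f: "!!q. q \<in> fibre ==> f q \<in> fibre" "!!q. q \<in> fibre ==> g q \<in> fibre"
   "!!q. q \<in> fibre ==> g (f q) = q" "!!q. q \<in> fibre ==> f (g q) = q" for f g
  by (rule bij_betw_byWitness[of _ g]) (use f in auto)
 show "bij_betw right fibre fibre"
 proof (rule A[of _ "transport (center + e1) center"])
  fix q assume q: "q \<in> fibre"
  have pq: "p q = torus_class (center + e1)" using fibreD(2)[OF q] by simp
  show "right q \<in> fibre" by (rule monodromy_in_fibre(1)[OF q])
  show "transport (center + e1) center q \<in> fibre"
   using transport_in[OF fibreD(1)[OF q] pq hstrip_facts, of center] by (simp add: fibre_def)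
  show "transport (center + e1) center (right q) = q"
   using transport_inverse[OF fibreD[OF q] hstrip_facts, of "center + e1"] by (simp add: right_def)
  show "right (transport (center + e1) center q) = q"
   using transport_inverse[OF fibreD(1)[OF q] pq hstrip_facts, of center] by (simp add: right_def)
 qed
 show "bij_betw up fibre fibre"
 proof (rule A[of _ "transport (center + e2) center"])
  fix q assume q: "q \<in> fibre"
  have pq: "p q = torus_class (center + e2)" using fibreD(2)[OF q] by simp
  show "up q \<in> fibre" by (rule monodromy_in_fibre(2)[OF q])
  show "transport (center + e2) center q \<in> fibre"
   using transport_in[OF fibreD(1)[OF q] pq vstrip_facts, of center] by (simp add: fibre_def)
  show "transport (center + e2) center (up q) = q"
   using transport_inverse[OF fibreD[OF q] vstrip_facts, of "center + e2"] by (simp add: up_def)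
  show "up (transport (center + e2) center q) = q"
   using transport_inverse[OF fibreD(1)[OF q] pq vstrip_facts, of center] by (simp add: up_def)
 qed
qed

lemma label_left_of_edge:
 assumes m: "m \<in> topspace X" "p m = torus_class x" and x: "x \<in> hstrip" "-1 < fst x" "fst x < 0"
 shows "coord m = x + e1" "right (label m) = transport x center m"
  "label m = transport x (center - e1) m"
proof -
 have c: "x + e1 \<in> unit_square - {0}" using x by (auto simp: mem_unit_square mem_strips intro!: prod_neq_0)
 show co: "coord m = x + e1" by (rule coord_eq) (use c m(2) in auto)
 have "label m = transport (x + e1) (center - e1 + e1) m" by (simp add: label_def co)
 also have "... = transport x (center - e1) m" by (rule transport_translate[OF m hstrip_facts x(1)]) auto
 finally show l: "label m = transport x (center - e1) m" .
 have "label m \<in> fibre" using label_in_fibre[OF m(1)] co c by simp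
 hence "right (label m) = transport (center - e1) center (label m)" by (rule right_alt)
 also have "... = transport x center m"
  unfolding l using transport_triangle[OF m hstrip_facts x(1), of "center - e1" center] by simp
 finally show "right (label m) = transport x center m" .
qed

lemma label_below_edge:
 assumes m: "m \<in> topspace X" "p m = torus_class x" and x: "x \<in> vstrip" "-1 < snd x" "snd x < 0"
 shows "coord m = x + e2" "up (label m) = transport x center m"
  "label m = transport x (center - e2) m"
proof -
 have c: "x + e2 \<in> unit_square - {0}" using x by (auto simp: mem_unit_square mem_strips intro!: prod_neq_0)
 show co: "coord m = x + e2" by (rule coord_eq) (use c m(2) in auto)
 have "label m = transport (x + e2) (center - e2 + e2) m" by (simp add: label_def co)
 also have "... = transport x (center - e2) m" by (rule transport_translate[OF m vstrip_facts x(1)]) auto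
 finally show l: "label m = transport x (center - e2) m" .
 have "label m \<in> fibre" using label_in_fibre[OF m(1)] co c by simp
 hence "up (label m) = transport (center - e2) center (label m)" by (rule up_alt)
 also have "... = transport x center m"
  unfolding l using transport_triangle[OF m vstrip_facts x(1), of "center - e2" center] by simp
 finally show "up (label m) = transport x center m" .
qed

text \<open>
  A lifted disc around a point away from the vertices that is so small that it meets at most one
  side of the square: the part with a negative coordinate lies in the neighbouring square.
\<close>

definition edge_sheet :: "'a => real => (real \<times> real => 'a) => bool"
 where "edge_sheet m0 d s \<longleftrightarrow> 0 < d & d <= 1/4 & ball (coord m0) d Int lattice = {} &
  lift_on (ball (coord m0) d) s & s (coord m0) = m0 & openin X (s ` ball (coord m0) d) &
  (ALL c. cpath X c & c ` {0..1} \<subseteq> s ` ball (coord m0) d -->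
   (EX c'. continuous_on {0..1} c' & c' ` {0..1} \<subseteq> ball (coord m0) d & (ALL u:{0..1}. c u = s (c' u)))) &
  (ALL x:ball (coord m0) d.
   (0 <= fst x & 0 <= snd x & x \<in> unit_square - {0} & coord (s x) = x & label (s x) = label m0) \<or>
   (fst x < 0 & fst (coord m0) = 0 & 0 < snd x & x \<in> hstrip & coord (s x) = x + e1 & right (label (s x)) = label m0) \<or>
   (snd x < 0 & snd (coord m0) = 0 & 0 < fst x & x \<in> vstrip & coord (s x) = x + e2 & up (label (s x)) = label m0))"

lemma edge_sheet_exists:
 assumes m0: "m0 \<in> topspace X" "coord m0 ~= 0"
 shows "EX d s. edge_sheet m0 d s"
proof -
 let ?x0 = "coord m0"
 note c0 = coord[OF m0(1)]
 have notl: "?x0 \<notin> lattice" by (rule coord_notin_lattice[OF m0])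
 define e where "e = Min ({1/4, 1 - fst ?x0, 1 - snd ?x0} Un ({fst ?x0, snd ?x0} Int {0<..}))"
 have e: "0 < e" using c0(1) by (auto simp: e_def mem_unit_square)
 have le: "e <= r" if "r \<in> {1/4, 1 - fst ?x0, 1 - snd ?x0} Un ({fst ?x0, snd ?x0} Int {0<..})" for r
  unfolding e_def by (rule Min_le) (use that in auto)
 obtain d s where d: "0 < d" "d <= e" "ball ?x0 d Int lattice = {}" and s: "lift_on (ball ?x0 d) s" "s ?x0 = m0"
  "openin X (s ` ball ?x0 d)"
  "!!c. [|cpath X c; c ` {0..1} \<subseteq> s ` ball ?x0 d|] ==>
   EX c'. continuous_on {0..1} c' & c' ` {0..1} \<subseteq> ball ?x0 d & (ALL u:{0..1}. c u = s (c' u))"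
  by (rule sheet_at[OF notl m0(1) c0(2) e]) blast
 have x0in: "?x0 \<in> unit_square - {0}" using c0(1) m0(2) by simp
 have cases: "(0 <= fst x & 0 <= snd x & x \<in> unit_square - {0} & coord (s x) = x & label (s x) = label m0) \<or>
   (fst x < 0 & fst ?x0 = 0 & 0 < snd x & x \<in> hstrip & coord (s x) = x + e1 & right (label (s x)) = label m0) \<or>
   (snd x < 0 & snd ?x0 = 0 & 0 < fst x & x \<in> vstrip & coord (s x) = x + e2 & up (label (s x)) = label m0)"
  if x: "x \<in> ball ?x0 d" for x
 proof -
  have b: "\<bar>fst x - fst ?x0\<bar> < e" "\<bar>snd x - snd ?x0\<bar> < e" using abs_fst_snd_ball[OF x] d(2) by auto
  have sx: "s x \<in> topspace X" "p (s x) = torus_class x" using lift_onD(2,3)[OF s(1) x] by auto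
  have x0b: "?x0 \<in> ball ?x0 d" using d(1) by simp
  have tr: "transport ?x0 x m0 = s x" using transport_lift[OF s(1) _ d(3) x0b x] s(2) by simp
  have tr': "transport x ?x0 (s x) = m0" using transport_lift[OF s(1) _ d(3) x x0b] s(2) by simp
  have up1: "fst x < 1" "snd x < 1" using b le[of "1 - fst ?x0"] le[of "1 - snd ?x0"] by auto
  have pf: "0 < fst x" if "fst ?x0 ~= 0" using b le[of "fst ?x0"] that x0in by (auto simp: mem_unit_square)
  have ps: "0 < snd x" if "snd ?x0 ~= 0" using b le[of "snd ?x0"] that x0in by (auto simp: mem_unit_square)
  have ge: "-1 < fst x" "-1 < snd x" using b le[of "1/4"] x0in by (auto simp: mem_unit_square)
  have nz: "fst ?x0 ~= 0 | snd ?x0 ~= 0" using m0(2) by (auto simp: prod_eq_iff)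
  consider (inside) "0 <= fst x" "0 <= snd x" | (l) "fst x < 0" | (b) "snd x < 0" by linarith
  thus ?thesis
  proof cases
   case inside
   have "x ~= 0" using nz pf ps by auto
   hence xin: "x \<in> unit_square - {0}" using inside up1 by (simp add: mem_unit_square)
   have co: "coord (s x) = x" by (rule coord_eq) (use xin sx in auto)
   have "label (s x) = transport x center (s x)" by (simp add: label_def co)
   also have "... = transport ?x0 center (transport x ?x0 (s x))"
    using transport_triangle[OF sx square_facts xin x0in center_in] by simp
   also have "... = label m0" by (simp add: tr' label_def)
   finally show ?thesis using inside co xin by blast
  next
   case l
   have f0: "fst ?x0 = 0" using pf l by force
   hence s0: "0 < snd x" using nz ps by blast
   have xh: "x \<in> hstrip" "?x0 \<in> hstrip" using s0 up1 f0 nz x0in by (auto simp: mem_strips mem_unit_square)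
   note ll = label_left_of_edge[OF sx xh(1) ge(1) l]
   have "right (label (s x)) = transport x center (s x)" by (rule ll(2))
   also have "... = transport ?x0 center (transport x ?x0 (s x))"
    using transport_triangle[OF sx hstrip_facts xh, of center] by simp
   also have "... = label m0" by (simp add: tr' label_def)
   finally have "right (label (s x)) = label m0" .
   thus ?thesis using l f0 s0 xh ll(1) by blast
  next
   case b
   have f0: "snd ?x0 = 0" using ps b by force
   hence s0: "0 < fst x" using nz pf by blast
   have xh: "x \<in> vstrip" "?x0 \<in> vstrip" using s0 up1 f0 nz x0in by (auto simp: mem_strips mem_unit_square)
   note ll = label_below_edge[OF sx xh(1) ge(2) b]
   have "up (label (s x)) = transport x center (s x)" by (rule ll(2))
   also have "... = transport ?x0 center (transport x ?x0 (s x))"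
    using transport_triangle[OF sx vstrip_facts xh, of center] by simp
   also have "... = label m0" by (simp add: tr' label_def)
   finally have "up (label (s x)) = label m0" .
   thus ?thesis using b f0 s0 xh ll(1) by blast
  qed
 qed
 have "d <= 1/4" using d(2) le[of "1/4"] by simp
 hence "edge_sheet m0 d s" unfolding edge_sheet_def using d(1,3) s cases by blast
 thus ?thesis by blast
qed

lemma edge_sheetD:
 assumes "edge_sheet m0 d s"
 shows "0 < d" "d <= 1/4" "ball (coord m0) d Int lattice = {}" "lift_on (ball (coord m0) d) s" "s (coord m0) = m0"
  "openin X (s ` ball (coord m0) d)" "coord m0 \<in> ball (coord m0) d" "m0 \<in> s ` ball (coord m0) d"
  "[|cpath X c; c ` {0..1} \<subseteq> s ` ball (coord m0) d|] ==>
   EX c'. continuous_on {0..1} c' & c' ` {0..1} \<subseteq> ball (coord m0) d & (ALL u:{0..1}. c u = s (c' u))"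
proof -
 show "0 < d" "d <= 1/4" "ball (coord m0) d Int lattice = {}" "lift_on (ball (coord m0) d) s" "s (coord m0) = m0"
  "openin X (s ` ball (coord m0) d)" using assms unfolding edge_sheet_def by simp_all
 thus "coord m0 \<in> ball (coord m0) d" "m0 \<in> s ` ball (coord m0) d"
  using image_eqI[of m0 s "coord m0" "ball (coord m0) d"] by simp_all
 show "[|cpath X c; c ` {0..1} \<subseteq> s ` ball (coord m0) d|] ==>
   EX c'. continuous_on {0..1} c' & c' ` {0..1} \<subseteq> ball (coord m0) d & (ALL u:{0..1}. c u = s (c' u))"
  using assms unfolding edge_sheet_def by blast
qed

lemma edge_sheet_cases:
 assumes "edge_sheet m0 d s" "x \<in> ball (coord m0) d"
 obtains (inside) "0 <= fst x" "0 <= snd x" "x \<in> unit_square - {0}" "coord (s x) = x" "label (s x) = label m0"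
 | (left) "fst x < 0" "fst (coord m0) = 0" "0 < snd x" "x \<in> hstrip" "coord (s x) = x + e1" "right (label (s x)) = label m0"
 | (below) "snd x < 0" "snd (coord m0) = 0" "0 < fst x" "x \<in> vstrip" "coord (s x) = x + e2" "up (label (s x)) = label m0"
 using assms unfolding edge_sheet_def by blast

lemma edge_sheet_coord: "edge_sheet m0 d s ==> coord m0 ~= 0" using edge_sheetD(3,7) lattice_0 by force

section \<open>The germ cocycle of a triple of functions on the fibre\<close>

text \<open>
  The four cases are the four quadrants around a vertex. The value is \<open>h\<close> of the
  square to the upper right, corrected by the jumps that lead to it from the square of
  \<open>q\<close>.
\<close>

definition corner :: "('a => complex) => ('a => complex) => ('a => complex) => real \<times> real => 'a => complex"
 where "corner a b h x q =
  (if fst x < 1/2 then (if snd x < 1/2 then h q else h (up q) - b q)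
   else (if snd x < 1/2 then h (right q) - a q else h (right (up q)) - a (up q) - b q))"

text \<open>
  Between neighbouring points the primitive is constant inside a square and changes by \<open>-
  a\<close> or \<open>- b\<close> when the right or the upper side of the square of the second
  point is crossed. The threshold 1/2 detects a crossing, since nearby points have coordinates
  that are close modulo 1.
\<close>

definition jump :: "('a => complex) => ('a => complex) => ('a => complex) => 'a => 'a => complex"
 where "jump a b h m m' =
  (if coord m = 0 then (if coord m' = 0 then 0 else corner a b h (coord m') (label m'))
   else (if 1/2 < fst (coord m') - fst (coord m) then - a (label m') else 0)
    + (if 1/2 < snd (coord m') - snd (coord m) then - b (label m') else 0))"

text \<open>
  The condition for the values of \<open>corner\<close> to be consistent in one turn around a
  vertex.
\<close>

definition balanced :: "('a => complex) => ('a => complex) => ('a => complex) => bool"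
 where "balanced a b h \<longleftrightarrow> (ALL q:fibre.
  h (up (right q)) - h (right (up q)) = (b (right q) - b q) - (a (up q) - a q))"

lemma jump_sheet:
 assumes s: "edge_sheet m0 d s" and x: "x \<in> ball (coord m0) d"
 shows "jump a b h m0 (s x) = (if fst x < 0 then - a (label (s x)) else if snd x < 0 then - b (label (s x)) else 0)"
proof -
 have "~ 1/2 < fst x - fst (coord m0)" "~ 1/2 < snd x - snd (coord m0)"
  "1/2 < fst x + 1 - fst (coord m0)" "1/2 < snd x + 1 - snd (coord m0)" using ball_bounds[OF x edge_sheetD(2)[OF s]] by linarith+
 note b = this
 from s x show ?thesis
 proof (cases rule: edge_sheet_cases)
  case inside
  thus ?thesis using b edge_sheet_coord[OF s] by (simp add: jump_def)
 next
  case left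
  thus ?thesis using b edge_sheet_coord[OF s] by (simp add: jump_def)
 next
  case below
  thus ?thesis using b edge_sheet_coord[OF s] by (simp add: jump_def)
 qed
qed

lemma nonvertex_sheet: "edge_sheet m0 d s ==> x \<in> ball (coord m0) d ==> coord (s x) ~= 0 & s x \<in> topspace X"
proof -
 assume s: "edge_sheet m0 d s" and x: "x \<in> ball (coord m0) d"
 have "p (s x) = torus_class x" "s x \<in> topspace X" using lift_onD(2,3)[OF edge_sheetD(4)[OF s] x] by auto
 moreover have "x \<notin> lattice" using edge_sheetD(3)[OF s] x by blast
 ultimately show ?thesis using coord(2)[of "s x"] lattice_minus[of "- x"] by (auto simp: torus_class_eq_iff)
qed

lemma small_difference_eq:
 assumes "torus_class x = torus_class y" "\<bar>fst x - fst y\<bar> < 1" "\<bar>snd x - snd y\<bar> < 1"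
 shows "x = y"
proof -
 have "fst x - fst y \<in> \<int>" "snd x - snd y \<in> \<int>" using assms(1) by (auto simp: torus_class_eq_iff lattice_def)
 hence "fst x - fst y = 0" "snd x - snd y = 0" using assms(2,3) Ints_nonzero_abs_less1 by blast+
 thus ?thesis by (simp add: prod_eq_iff)
qed

lemma jump_nonvertex:
 assumes s: "edge_sheet m0 d s" and y: "y \<in> s ` ball (coord m0) d"
 shows "EX N'. openin X N' & y \<in> N' & (ALL z:N'. jump a b h m0 z = jump a b h m0 y + jump a b h y z)"
proof -
 obtain x where x: "x \<in> ball (coord m0) d" "y = s x" using y by blast
 have yX: "y \<in> topspace X" "coord y ~= 0" using nonvertex_sheet[OF s x(1)] x(2) by auto
 obtain d' s' where s': "edge_sheet y d' s'" using edge_sheet_exists[OF yX] by blast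
 let ?N = "s' ` ball (coord y) d' Int s ` ball (coord m0) d"
 note bx = ball_bounds[OF x(1) edge_sheetD(2)[OF s]]
 have "jump a b h m0 z = jump a b h m0 y + jump a b h y z" if z: "z \<in> ?N" for z
 proof -
  obtain w where w: "w \<in> ball (coord m0) d" "z = s w" using z by blast
  obtain x' where x': "x' \<in> ball (coord y) d'" "z = s' x'" using z by blast
  note bw = ball_bounds[OF w(1) edge_sheetD(2)[OF s]] and bx' = ball_bounds[OF x'(1) edge_sheetD(2)[OF s']]
  have cl: "torus_class w = torus_class x'"
   using lift_onD(2)[OF edge_sheetD(4)[OF s] w(1)] lift_onD(2)[OF edge_sheetD(4)[OF s'] x'(1)] w(2) x'(2) by simp
  note j1 = jump_sheet[OF s w(1), of a b h, folded w(2)] and j2 = jump_sheet[OF s' x'(1), of a b h, folded x'(2)]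
   and j3 = jump_sheet[OF s x(1), of a b h, folded x(2)]
  from s x(1) show ?thesis
  proof (cases rule: edge_sheet_cases)
   case inside
   hence co: "coord y = x" using x(2) by simp
   have "w = x'" by (rule small_difference_eq[OF cl]; unfold abs_less_iff) (use bw bx' bx co in auto)
   thus ?thesis using j1 j2 j3 inside by simp
  next
   case left
   hence co: "coord y = x + e1" using x(2) by simp
   from s' x'(1) have in': "~ fst x' < 0 & ~ snd x' < 0 & x' \<in> unit_square - {0} & label z = label y"
    by (cases rule: edge_sheet_cases) (use co left(1,2,3) bx x'(2) in \<open>auto\<close>)
   hence jj: "jump a b h y z = 0" and lab: "label z = label y" and x'u: "x' \<in> unit_square - {0}" using j2 by simp_all
   have "torus_class w = torus_class (x' - e1)" using cl torus_class_translate[of e1 "x' - e1"] by simp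
   hence "w = x' - e1" by (rule small_difference_eq; unfold abs_less_iff) (use bw bx' bx co in auto)
   hence "fst w < 0" using x'u by (simp add: mem_unit_square)
   thus ?thesis using j1 j3 jj lab left by simp
  next
   case below
   hence co: "coord y = x + e2" using x(2) by simp
   from s' x'(1) have in': "~ fst x' < 0 & ~ snd x' < 0 & x' \<in> unit_square - {0} & label z = label y"
    by (cases rule: edge_sheet_cases) (use co below(1,2,3) bx x'(2) in \<open>auto\<close>)
   hence jj: "jump a b h y z = 0" and lab: "label z = label y" and x'u: "x' \<in> unit_square - {0}" using j2 by simp_all
   have "torus_class w = torus_class (x' - e2)" using cl torus_class_translate[of e2 "x' - e2"] by simp
   hence w': "w = x' - e2" by (rule small_difference_eq; unfold abs_less_iff) (use bw bx' bx co in auto)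
   hence "snd w < 0" using x'u by (simp add: mem_unit_square)
   moreover have "~ fst w < 0" using w' x'u by (simp add: mem_unit_square)
   moreover have "~ fst x < 0" using below by simp
   ultimately show ?thesis using j1 j3 jj lab below by simp
  qed
 qed
 moreover have "openin X ?N" by (rule openin_Int[OF edge_sheetD(6)[OF s'] edge_sheetD(6)[OF s]])
 moreover have "y \<in> ?N" using edge_sheetD(8)[OF s'] y by (rule IntI)
 ultimately show ?thesis by blast
qed

definition vertex_nbhd :: "real => 'a set"
 where "vertex_nbhd \<delta> = {m \<in> topspace X. p m \<in> torus_class ` ball 0 \<delta>}"

lemma open_vertex_nbhd: "openin X (vertex_nbhd \<delta>)" unfolding vertex_nbhd_def
 by (rule openin_continuous_map_preimage[OF continuous_p open_torus_class_image[OF open_ball]])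

lemma vertex_in_nbhd: "v \<in> topspace X ==> coord v = 0 ==> 0 < \<delta> ==> v \<in> vertex_nbhd \<delta>"
 using coord[of v] by (auto simp: vertex_nbhd_def intro!: image_eqI[of _ _ 0])

lemma vertex_nbhd_coord:
 assumes m: "m \<in> vertex_nbhd \<delta>" and \<delta>: "\<delta> <= 1/4"
 obtains z where "z \<in> ball 0 \<delta>" "fst (coord m) = (if fst z < 0 then fst z + 1 else fst z)"
  "snd (coord m) = (if snd z < 0 then snd z + 1 else snd z)"
proof -
 obtain z where z: "z \<in> ball 0 \<delta>" "p m = torus_class z" using m by (auto simp: vertex_nbhd_def)
 have b: "\<bar>fst z\<bar> < 1/4" "\<bar>snd z\<bar> < 1/4" using abs_fst_snd_ball[OF z(1)] \<delta> by auto
 define v where "v = ((if fst z < 0 then 1 else 0, if snd z < 0 then 1 else 0) :: real \<times> real)"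
 have v: "v \<in> lattice" by (auto simp: v_def lattice_def)
 have "coord m = z + v" by (rule coord_eq) (use b z(2) v in \<open>auto simp: mem_unit_square v_def\<close>)
 thus ?thesis using that z(1) by (auto simp: v_def)
qed

lemma vertex_nbhd_corners:
 assumes m: "m \<in> vertex_nbhd (1/4)"
 shows "fst (coord m) < 1/4 | 3/4 < fst (coord m)" "snd (coord m) < 1/4 | 3/4 < snd (coord m)"
proof -
 obtain z where z: "z \<in> ball 0 (1/4)" "fst (coord m) = (if fst z < 0 then fst z + 1 else fst z)"
  "snd (coord m) = (if snd z < 0 then snd z + 1 else snd z)" by (rule vertex_nbhd_coord[OF m order_refl])
 have "\<bar>fst z\<bar> < 1/4" "\<bar>snd z\<bar> < 1/4" using abs_fst_snd_ball[OF z(1)] by auto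
 thus "fst (coord m) < 1/4 | 3/4 < fst (coord m)" "snd (coord m) < 1/4 | 3/4 < snd (coord m)" unfolding z(2,3) by auto
qed

text \<open>
  Around a vertex the consistency of the four quadrants is exactly the balance condition.
\<close>

lemma jump_vertex:
 assumes bal: "balanced a b h" and v: "v \<in> topspace X" "coord v = 0" and y: "y \<in> vertex_nbhd (1/4)"
 shows "EX N'. openin X N' & y \<in> N' & (ALL z:N'. jump a b h v z = jump a b h v y + jump a b h y z)"
proof (cases "coord y = 0")
 case True
 hence "jump a b h v z = jump a b h v y + jump a b h y z" for z using v by (simp add: jump_def)
 thus ?thesis using open_vertex_nbhd y by blast
next
 case False
 have yX: "y \<in> topspace X" using y by (simp add: vertex_nbhd_def)
 obtain d s where s: "edge_sheet y d s" using edge_sheet_exists[OF yX False] by blast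
 let ?N = "s ` ball (coord y) d Int vertex_nbhd (1/4)"
 note cy = vertex_nbhd_corners[OF y]
 have "jump a b h v z = jump a b h v y + jump a b h y z" if z: "z \<in> ?N" for z
 proof -
  obtain x where x: "x \<in> ball (coord y) d" "z = s x" using z by blast
  have zX: "coord z ~= 0" "z \<in> topspace X" using nonvertex_sheet[OF s x(1)] x(2) by auto
  note cz = vertex_nbhd_corners[OF IntD2[OF z]]
  note bx = ball_bounds[OF x(1) edge_sheetD(2)[OF s]]
  have jv: "jump a b h v z = corner a b h (coord z) (label z)" "jump a b h v y = corner a b h (coord y) (label y)"
   using v zX False by (simp_all add: jump_def)
  note j = jump_sheet[OF s x(1), of a b h, folded x(2)]
  have lz: "label z \<in> fibre" by (rule label_in_fibre[OF zX(2,1)])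
  have rel: "h (up (right (label z))) - h (right (up (label z)))
   = (b (right (label z)) - b (label z)) - (a (up (label z)) - a (label z))" using bal lz unfolding balanced_def by blast
  from s x(1) show ?thesis
  proof (cases rule: edge_sheet_cases)
   case inside
   hence "coord z = x" "label z = label y" using x(2) by auto
   moreover have "fst x < 1/2 \<longleftrightarrow> fst (coord y) < 1/2" "snd x < 1/2 \<longleftrightarrow> snd (coord y) < 1/2"
    using cy cz bx \<open>coord z = x\<close> by auto
   ultimately show ?thesis using jv j inside by (simp add: corner_def)
  next
   case left
   hence co: "coord z = x + e1" and lab: "label y = right (label z)" using x(2) by auto
   have "~ fst (coord z) < 1/2" "fst (coord y) < 1/2" using co left bx by auto
   moreover have "snd (coord z) < 1/2 \<longleftrightarrow> snd (coord y) < 1/2" using cy cz bx co by auto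
   ultimately show ?thesis using jv j left(1) rel by (simp add: corner_def lab algebra_simps)
  next
   case below
   hence co: "coord z = x + e2" and lab: "label y = up (label z)" using x(2) by auto
   have "~ snd (coord z) < 1/2" "snd (coord y) < 1/2" using co below bx by auto
   moreover have "fst (coord z) < 1/2 \<longleftrightarrow> fst (coord y) < 1/2" using cy cz bx co by auto
   moreover have "~ fst x < 0" using below by simp
   ultimately show ?thesis using jv j below(1) by (simp add: corner_def lab algebra_simps)
  qed
 qed
 moreover have "openin X ?N" by (rule openin_Int[OF edge_sheetD(6)[OF s] open_vertex_nbhd])
 moreover have "y \<in> ?N" using edge_sheetD(8)[OF s] y by (rule IntI)
 ultimately show ?thesis by blast
qed

lemma germ_cocycle_jump:
 assumes "balanced a b h"
 shows "germ_cocycle X (jump a b h)" unfolding germ_cocycle_def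
proof
 fix m assume m: "m \<in> topspace X"
 show "EX N. openin X N & m \<in> N & (ALL y:N. EX N'. openin X N' & y \<in> N' &
   (ALL z:N'. jump a b h m z = jump a b h m y + jump a b h y z))"
 proof (cases "coord m = 0")
  case True
  thus ?thesis using jump_vertex[OF assms m True] open_vertex_nbhd vertex_in_nbhd[OF m True, of "1/4"]
   by (intro exI[of _ "vertex_nbhd (1/4)"]) auto
 next
  case False
  then obtain d s where s: "edge_sheet m d s" using edge_sheet_exists[OF m] by blast
  thus ?thesis using jump_nonvertex[OF s] edge_sheetD(6,8)[OF s] by (intro exI[of _ "s ` ball (coord m) d"]) blast
 qed
qed

end

section \<open>Every closed cochain comes from a balanced triple\<close>

lemma connectedin_locally_constant:
 assumes S: "connectedin X S" and xy: "x \<in> S" "y \<in> S"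
  and loc: "!!z. z \<in> S ==> EX N. openin X N & z \<in> N & (ALL w:N Int S. f w = f z)"
 shows "f x = f y"
proof (rule ccontr)
 assume neq: "f x ~= f y"
 let ?A = "\<Union>{N. openin X N & (ALL w:N Int S. f w = f x)}"
 let ?B = "\<Union>{N. openin X N & (ALL w:N Int S. f w ~= f x)}"
 have "z \<in> ?A Un ?B" if z: "z \<in> S" for z
 proof -
  obtain N where N: "openin X N" "z \<in> N" "ALL w:N Int S. f w = f z" using loc[OF z] by blast
  show ?thesis
  proof (cases "f z = f x")
   case True
   hence "N \<in> {N. openin X N & (ALL w:N Int S. f w = f x)}" using N by simp
   thus ?thesis using N(2) by blast
  next
   case False
   hence "N \<in> {N. openin X N & (ALL w:N Int S. f w ~= f x)}" using N by simp
   thus ?thesis using N(2) by blast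
  qed
 qed
 hence cov: "S \<subseteq> ?A Un ?B" by blast
 have op: "openin X ?A" "openin X ?B" by (rule openin_Union; simp)+
 have dis: "?A Int ?B Int S = {}" by blast
 have ne: "?A Int S ~= {}" "?B Int S ~= {}"
 proof -
  have "x \<in> ?A Un ?B" "x \<notin> ?B" using cov xy(1) by blast+
  thus "?A Int S ~= {}" using xy(1) by blast
  have "y \<in> ?A Un ?B" "y \<notin> ?A" using cov xy(2) neq by auto
  thus "?B Int S ~= {}" using xy(2) by blast
 qed
 have "EX E1 E2. openin X E1 & openin X E2 & S \<subseteq> E1 Un E2 & E1 Int E2 Int S = {} & E1 Int S ~= {} & E2 Int S ~= {}"
  by (intro exI[of _ ?A] exI[of _ ?B] conjI op cov dis ne)
 thus False using conjunct2[OF S[unfolded connectedin]] by contradiction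
qed

lemma path_int_local:
 assumes j: "germ_cocycle X j" and m: "m \<in> topspace X"
 shows "EX N. openin X N & m \<in> N & (ALL c. cpath X c --> c ` {0..1} \<subseteq> N -->
  c 0 = m --> path_int j c = j m (c 1))"
proof -
 obtain N where N: "openin X N" "m \<in> N"
  and N': "ALL y:N. EX N'. openin X N' & y \<in> N' & (ALL z:N'. j m z = j m y + j y z)"
  using bspec[OF j[unfolded germ_cocycle_def] m] by blast
 have "EX N'. openin X N' & m \<in> N' & (ALL z:N'. j m z = j m m + j m z)" by (rule bspec[OF N' N(2)])
 hence jmm: "j m m = 0" by auto
 have "path_int j c = j m (c 1)"
  if c: "cpath X c" and cN: "c ` {0..1} \<subseteq> N" and c0: "c 0 = m" for c
 proof -
  have "primitive_along j {0..1} c (%t. j m (c t))" unfolding primitive_along_def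
  proof
   fix t :: real assume t: "t \<in> {0..1}"
   hence ct: "c t \<in> N" using cN by blast
   obtain N1 where N1: "openin X N1" "c t \<in> N1" "ALL z:N1. j m z = j m (c t) + j (c t) z" using bspec[OF N' ct] by blast
   obtain e where "0 < e" "!!s. s \<in> {0..1} ==> dist t s < e ==> c s \<in> N1"
    using continuous_map_ball[OF c N1(1) t N1(2)] by blast
   thus "EX e>0. ALL s:{0..1}. dist t s < e --> j m (c s) - j m (c t) = j (c t) (c s)" using N1(3) by (intro exI[of _ e]) simp
  qed
  from path_int_eq[OF this] show ?thesis by (simp add: c0 jmm)
 qed
 thus ?thesis using N by blast
qed

context torus_covering
begin

lemma jump_indep: "coord m ~= 0 ==> jump a b h m m' = jump a b h' m m'" by (simp add: jump_def)

text \<open>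
  A single-valued function on \<open>D\<close>, away from the vertices, whose local increments are
  the jumps.
\<close>

definition germ_primitive :: "'a set => ('a => complex) => ('a => complex) => ('a => complex) => bool"
 where "germ_primitive D a b \<gamma> \<longleftrightarrow> (ALL m:D. coord m ~= 0 -->
  (EX N. openin X N & m \<in> N & (ALL m':N. \<gamma> m' - \<gamma> m = jump a b (%_. 0) m m')))"

lemma sheet_place:
 assumes s: "edge_sheet (place q x) d s" and q: "q \<in> fibre" and x: "x \<in> unit_square - {0}"
  and y: "y \<in> unit_square - {0}" "y \<in> ball x d"
 shows "place q y = s y"
proof -
 have co: "coord (place q x) = x" by (rule place(3)[OF q x])
 have "place q y = transport x y (place q x)"
  unfolding place_def using transport_triangle[OF fibreD[OF q] square_facts center_in x y(1)] by simp
 also have "... = transport x y (s x)" using edge_sheetD(5)[OF s] co by simp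
 also have "... = s y" using edge_sheetD(3,4,7)[OF s] y(2) unfolding co by (intro transport_lift[of "ball x d"]) auto
 finally show ?thesis .
qed

lemma sheet_sub_open:
 assumes s: "edge_sheet m0 d s" and e: "e <= d"
 shows "openin X (s ` ball (coord m0) e)"
proof -
 have "s ` ball (coord m0) e = s ` ball (coord m0) d Int {m \<in> topspace X. p m \<in> torus_class ` ball (coord m0) e}"
 proof (rule Set.set_eqI, rule iffI)
  fix z assume "z \<in> s ` ball (coord m0) e"
  then obtain x where x: "x \<in> ball (coord m0) e" "z = s x" by blast
  have "x \<in> ball (coord m0) d" using x(1) e by auto
  thus "z \<in> s ` ball (coord m0) d Int {m \<in> topspace X. p m \<in> torus_class ` ball (coord m0) e}"
   using lift_onD(2,3)[OF edge_sheetD(4)[OF s], of x] x by auto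
 next
  fix z assume z: "z \<in> s ` ball (coord m0) d Int {m \<in> topspace X. p m \<in> torus_class ` ball (coord m0) e}"
  then obtain x where x: "x \<in> ball (coord m0) d" "z = s x" by blast
  obtain w where w: "w \<in> ball (coord m0) e" "p z = torus_class w" using z by blast
  have wd: "w \<in> ball (coord m0) d" using w(1) e by auto
  have "torus_class x = torus_class w" using lift_onD(2)[OF edge_sheetD(4)[OF s] x(1)] x(2) w(2) by simp
  hence "x = w" by (rule small_difference_eq; unfold abs_less_iff)
     (use ball_bounds[OF x(1) edge_sheetD(2)[OF s]] ball_bounds[OF wd edge_sheetD(2)[OF s]] in \<open>auto\<close>)
  thus "z \<in> s ` ball (coord m0) e" using w(1) x(2) by blast
 qed
 thus ?thesis using edge_sheetD(6)[OF s] openin_continuous_map_preimage[OF continuous_p open_torus_class_image[OF open_ball]]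
  by (simp add: openin_Int)
qed

lemma sheet_radius:
 assumes s: "edge_sheet m0 d s" and N: "openin X N" "m0 \<in> N"
 obtains e where "0 < e" "e <= d" "s ` ball (coord m0) e \<subseteq> N"
proof -
 obtain e where e: "0 < e" "!!x. x \<in> ball (coord m0) d ==> dist (coord m0) x < e ==> s x \<in> N"
  using continuous_map_ball[OF lift_onD(1)[OF edge_sheetD(4)[OF s]] N(1) edge_sheetD(7)[OF s]] edge_sheetD(5)[OF s] N(2) by metis
 have "s x \<in> N" if "x \<in> ball (coord m0) (min e d)" for x using e(2)[of x] that by simp
 hence "s ` ball (coord m0) (min e d) \<subseteq> N" by (rule image_subsetI)
 thus ?thesis using that[of "min e d"] e(1) edge_sheetD(1)[OF s] by simp
qed

lemma germ_primitive_const: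
 assumes \<gamma>: "germ_primitive D a b \<gamma>" and q: "q \<in> fibre" and C: "convex C" "C \<subseteq> unit_square - {0}"
  and D: "!!x. x \<in> C ==> place q x \<in> D" and xy: "x \<in> C" "y \<in> C"
 shows "\<gamma> (place q x) = \<gamma> (place q y)"
proof (rule connected_local_const[OF convex_connected[OF C(1)] xy, where f = "%x. \<gamma> (place q x)"], intro ballI)
 fix z assume z: "z \<in> C"
 hence zu: "z \<in> unit_square - {0}" using C(2) by blast
 note pz = place[OF q zu]
 have nz: "coord (place q z) ~= 0" using pz(3) zu by simp
 obtain N where N: "openin X N" "place q z \<in> N"
  "ALL m':N. \<gamma> m' - \<gamma> (place q z) = jump a b (%_. 0) (place q z) m'"
  using \<gamma> D[OF z] nz unfolding germ_primitive_def by blast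
 obtain d s where s: "edge_sheet (place q z) d s" using edge_sheet_exists[OF pz(1) nz] by blast
 obtain e where e: "0 < e" "e <= d" "s ` ball (coord (place q z)) e \<subseteq> N" by (rule sheet_radius[OF s N(1,2)])
 have "\<gamma> (place q z) = \<gamma> (place q w)" if w: "w \<in> C" "dist w z < e" for w
 proof -
  have wu: "w \<in> unit_square - {0}" "w \<in> ball z e" using w C(2) by (auto simp: dist_commute)
  have wd: "w \<in> ball z d" using wu(2) e(2) by simp
  have sw: "place q w = s w" by (rule sheet_place[OF s q zu wu(1) wd])
  have "s w \<in> N" using e(3) wu(2) unfolding pz(3) by blast
  hence "\<gamma> (s w) - \<gamma> (place q z) = jump a b (%_. 0) (place q z) (s w)" using N(3) by blast
  also have "... = 0" using jump_sheet[OF s, of w] wd wu(1) unfolding pz(3) by (simp add: mem_unit_square)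
  finally show ?thesis by (simp add: sw)
 qed
 thus "\<forall>\<^sub>F b in at z within C. \<gamma> (place q z) = \<gamma> (place q b)"
  unfolding eventually_at using e(1) by blast
qed

lemma germ_primitive_cross_right:
 assumes \<gamma>: "germ_primitive D a b \<gamma>" and q: "q \<in> fibre" and y: "0 < y" "y < 1"
  and D: "place (right q) (0, y) \<in> D"
 obtains \<eta> where "0 < \<eta>" "!!t. 0 < t ==> t < \<eta> ==> \<gamma> (place q (1 - t, y)) = \<gamma> (place (right q) (0, y)) - a q"
proof -
 let ?m = "place (right q) (0, y)"
 have q': "right q \<in> fibre" by (rule monodromy_in_fibre(1)[OF q])
 have zu: "(0, y) \<in> unit_square - {0}" using y by (simp add: mem_unit_square prod_neq_0)
 note pz = place[OF q' zu]
 have nz: "coord ?m ~= 0" using pz(3) zu by simp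
 obtain N where N: "openin X N" "?m \<in> N" "ALL m':N. \<gamma> m' - \<gamma> ?m = jump a b (%_. 0) ?m m'"
  using \<gamma> D nz unfolding germ_primitive_def by blast
 obtain d s where s: "edge_sheet ?m d s" using edge_sheet_exists[OF pz(1) nz] by blast
 obtain e where e: "0 < e" "e <= d" "s ` ball (coord ?m) e \<subseteq> N" by (rule sheet_radius[OF s N(1,2)])
 have "\<gamma> (place q (1 - t, y)) = \<gamma> ?m - a q" if t: "0 < t" "t < e" for t
 proof -
  let ?x = "(- t, y)"
  have xe: "?x \<in> ball (0, y) e" using t by (simp add: dist_prod_def dist_real_def)
  have xd: "?x \<in> ball (coord ?m) d" using xe e(2) by (simp add: pz(3))
  have sx: "s ?x \<in> topspace X" "coord (s ?x) ~= 0" using nonvertex_sheet[OF s xd] by auto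
  have j: "jump a b (%_. 0) ?m (s ?x) = - a (label (s ?x))" using jump_sheet[OF s xd] t by simp
  from s xd have "coord (s ?x) = ?x + e1 & right (label (s ?x)) = right q"
   by (cases rule: edge_sheet_cases) (use t y pz(4) in \<open>auto simp: mem_unit_square\<close>)
  moreover have "?x + e1 = (1 - t, y)" by (simp add: e1_def)
  ultimately have co: "coord (s ?x) = (1 - t, y)" and r: "right (label (s ?x)) = right q" by auto
  have "label (s ?x) = q" using bij_betw_imp_inj_on[OF bij_monodromy(1)] r q label_in_fibre[OF sx] by (auto dest: inj_onD)
  hence "s ?x = place q (1 - t, y)" using place_label[OF sx] co by simp
  moreover have "s ?x \<in> N" using e(3) xe unfolding pz(3) by blast
  ultimately show ?thesis using N(3) j \<open>label (s ?x) = q\<close> by (metis diff_add_cancel uminus_add_conv_diff)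
 qed
 thus ?thesis using that e(1) by blast
qed

lemma germ_primitive_cross_up:
 assumes \<gamma>: "germ_primitive D a b \<gamma>" and q: "q \<in> fibre" and y: "0 < y" "y < 1"
  and D: "place (up q) (y, 0) \<in> D"
 obtains \<eta> where "0 < \<eta>" "!!t. 0 < t ==> t < \<eta> ==> \<gamma> (place q (y, 1 - t)) = \<gamma> (place (up q) (y, 0)) - b q"
proof -
 let ?m = "place (up q) (y, 0)"
 have q': "up q \<in> fibre" by (rule monodromy_in_fibre(2)[OF q])
 have zu: "(y, 0) \<in> unit_square - {0}" using y by (simp add: mem_unit_square prod_neq_0)
 note pz = place[OF q' zu]
 have nz: "coord ?m ~= 0" using pz(3) zu by simp
 obtain N where N: "openin X N" "?m \<in> N" "ALL m':N. \<gamma> m' - \<gamma> ?m = jump a b (%_. 0) ?m m'"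
  using \<gamma> D nz unfolding germ_primitive_def by blast
 obtain d s where s: "edge_sheet ?m d s" using edge_sheet_exists[OF pz(1) nz] by blast
 obtain e where e: "0 < e" "e <= d" "s ` ball (coord ?m) e \<subseteq> N" by (rule sheet_radius[OF s N(1,2)])
 have "\<gamma> (place q (y, 1 - t)) = \<gamma> ?m - b q" if t: "0 < t" "t < e" for t
 proof -
  let ?x = "(y, - t)"
  have xe: "?x \<in> ball (y, 0) e" using t by (simp add: dist_prod_def dist_real_def)
  have xd: "?x \<in> ball (coord ?m) d" using xe e(2) by (simp add: pz(3))
  have sx: "s ?x \<in> topspace X" "coord (s ?x) ~= 0" using nonvertex_sheet[OF s xd] by auto
  have j: "jump a b (%_. 0) ?m (s ?x) = - b (label (s ?x))" using jump_sheet[OF s xd] t y by simp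
  from s xd have "coord (s ?x) = ?x + e2 & up (label (s ?x)) = up q"
   by (cases rule: edge_sheet_cases) (use t y pz(4) in \<open>auto simp: mem_unit_square\<close>)
  moreover have "?x + e2 = (y, 1 - t)" by (simp add: e2_def)
  ultimately have co: "coord (s ?x) = (y, 1 - t)" and r: "up (label (s ?x)) = up q" by auto
  have "label (s ?x) = q" using bij_betw_imp_inj_on[OF bij_monodromy(2)] r q label_in_fibre[OF sx] by (auto dest: inj_onD)
  hence "s ?x = place q (y, 1 - t)" using place_label[OF sx] co by simp
  moreover have "s ?x \<in> N" using e(3) xe unfolding pz(3) by blast
  ultimately show ?thesis using N(3) j \<open>label (s ?x) = q\<close> by (metis diff_add_cancel uminus_add_conv_diff)
 qed
 thus ?thesis using that e(1) by blast
qed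

lemma sheet_path:
 assumes s: "edge_sheet m0 d s" and e: "e <= d" and x: "x \<in> ball (coord m0) e"
 shows "cpath X (s o linepath (coord m0) x)"
  "(s o linepath (coord m0) x) ` {0..1} \<subseteq> s ` ball (coord m0) e"
  "(s o linepath (coord m0) x) 0 = m0" "(s o linepath (coord m0) x) 1 = s x"
proof -
 have "coord m0 \<in> ball (coord m0) e" using x by (auto intro: le_less_trans[OF zero_le_dist])
 hence "closed_segment (coord m0) x \<subseteq> ball (coord m0) e" using x by (intro closed_segment_subset) auto
 hence 1: "linepath (coord m0) x ` {0..1} \<subseteq> ball (coord m0) e" by (simp add: linepath_image_01)
 hence "linepath (coord m0) x ` {0..1} \<subseteq> ball (coord m0) d" using e by (auto simp: image_subset_iff)
 hence "cpath (top_of_set (ball (coord m0) d)) (linepath (coord m0) x)" unfolding continuous_map_in_subtopology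
  by (simp add: continuous_on_linepath image_subset_iff_funcset[symmetric])
 thus "cpath X (s o linepath (coord m0) x)" using lift_onD(1)[OF edge_sheetD(4)[OF s]] by (rule continuous_map_compose)
 show "(s o linepath (coord m0) x) ` {0..1} \<subseteq> s ` ball (coord m0) e"
  using 1 by (simp only: image_comp[symmetric] image_mono)
 show "(s o linepath (coord m0) x) 0 = m0" "(s o linepath (coord m0) x) 1 = s x"
  using edge_sheetD(5)[OF s] by (simp_all add: linepath_def)
qed

lemma exact_imp_germ_primitive:
 fixes \<Psi> :: "(real => 'a) => complex"
 assumes D: "openin X D"
  and loc: "!!m. m \<in> topspace X ==> coord m ~= 0 ==> EX N. openin X N & m \<in> N &
   (ALL c. cpath X c --> c ` {0..1} \<subseteq> N --> c 0 = m --> \<Psi> c = jump a b (%_. 0) m (c 1))"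
  and ex: "!!c. cpath X c ==> c ` {0..1} \<subseteq> D ==> \<Psi> c = \<gamma> (c 1) - \<gamma> (c 0)"
 shows "germ_primitive D a b \<gamma>" unfolding germ_primitive_def
proof (intro ballI impI)
 fix m assume m: "m \<in> D" "coord m ~= 0"
 have mX: "m \<in> topspace X" using openin_subset[OF D] m(1) by blast
 obtain N where N: "openin X N" "m \<in> N"
  "!!c. cpath X c ==> c ` {0..1} \<subseteq> N ==> c 0 = m ==> \<Psi> c = jump a b (%_. 0) m (c 1)" using loc[OF mX m(2)] by blast
 obtain d s where s: "edge_sheet m d s" using edge_sheet_exists[OF mX m(2)] by blast
 have ND: "openin X (N Int D)" "m \<in> N Int D" using N D m(1) by auto
 obtain e where e: "0 < e" "e <= d" "s ` ball (coord m) e \<subseteq> N Int D" by (rule sheet_radius[OF s ND])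
 have "\<gamma> m' - \<gamma> m = jump a b (%_. 0) m m'" if "m' \<in> s ` ball (coord m) e" for m'
 proof -
  obtain x where x: "x \<in> ball (coord m) e" "m' = s x" using \<open>m' \<in> _\<close> by blast
  note sp = sheet_path[OF s e(2) x(1)]
  have "(s o linepath (coord m) x) ` {0..1} \<subseteq> N" "(s o linepath (coord m) x) ` {0..1} \<subseteq> D"
   using sp(2) e(3) by blast+
  with N(3)[OF sp(1)] ex[OF sp(1)] show ?thesis using sp(3,4) x(2) by simp
 qed
 moreover have "m \<in> s ` ball (coord m) e" using edge_sheetD(5)[OF s] e(1) by (intro image_eqI[of _ _ "coord m"]) auto
 ultimately show "EX N. openin X N & m \<in> N & (ALL m':N. \<gamma> m' - \<gamma> m = jump a b (%_. 0) m m')"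
  using sheet_sub_open[OF s e(2)] by blast
qed

subsection \<open>The potential of a closed cochain\<close>

text \<open>The value of the cochain on the lift through \<open>m\<close> of a segment.\<close>

definition seg_value :: "(((nat => real) => 'a) => complex) => real \<times> real => real \<times> real => 'a => complex"
 where "seg_value \<phi> x y n = \<phi> (simplex1 ((SOME s. lift_on (closed_segment x y) s & s x = n) o linepath x y))"

lemma seg_value_lift:
 assumes s: "lift_on C s" and C: "convex C" "C Int lattice = {}" and xy: "x \<in> C" "y \<in> C"
 shows "seg_value \<phi> x y (s x) = \<phi> (simplex1 (s o linepath x y))"
proof -
 let ?K = "closed_segment x y"
 define s' where "s' = (SOME s'. lift_on ?K s' & s' x = s x)"
 have K: "?K \<subseteq> C" using C(1) xy by (simp add: closed_segment_subset)
 have s': "lift_on ?K s'" "s' x = s x"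
  unfolding s'_def using someI[of "%s'. lift_on ?K s' & s' x = s x" s] lift_on_subset[OF s K] by auto
 have Kl: "?K Int lattice = {}" using K C(2) by blast
 have "s' z = s z" if "z \<in> ?K" for z
  by (rule lift_unique[OF connected_segment Kl s'(1) lift_on_subset[OF s K] ends_in_segment(1) s'(2) that])
 moreover have "linepath x y u \<in> ?K" if "u \<in> {0..1}" for u using that by (auto simp: linepath_image_01[symmetric])
 ultimately have "simplex1 (s' o linepath x y) = simplex1 (s o linepath x y)" by (intro simplex1_cong) simp
 thus ?thesis by (simp add: seg_value_def s'_def)
qed

lemma seg_value_triangle:
 assumes \<phi>: "closed_cochain X \<phi>" and m: "m \<in> topspace X" "p m = torus_class x"
  and C: "convex C" "C Int lattice = {}" and xyz: "x \<in> C" "y \<in> C" "z \<in> C"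
 shows "seg_value \<phi> x z m = seg_value \<phi> x y m + seg_value \<phi> y z (transport x y m)"
proof -
 let ?K = "convex hull {x, y, z}"
 have K: "?K \<subseteq> C" using xyz C(1) by (simp add: hull_minimal)
 have Kl: "?K Int lattice = {}" using K C(2) by blast
 have in': "x \<in> ?K" "y \<in> ?K" "z \<in> ?K" by (simp_all add: hull_inc)
 have "compact ?K" by (simp add: finite_imp_compact_convex_hull)
 then obtain s where s: "lift_on ?K s" "s x = m" using lift_exists[OF _ convex_convex_hull Kl in'(1) m] by metis
 have t: "transport x y m = s y" using transport_lift[OF s(1) convex_convex_hull Kl in'(1,2)] s(2) by simp
 note v = seg_value_lift[OF s(1) convex_convex_hull Kl]
 show ?thesis using v[OF in'(1,3), of \<phi>] v[OF in'(1,2), of \<phi>] v[OF in'(2,3), of \<phi>]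
   closed_cochain_triangle[OF \<phi> lift_onD(1)[OF s(1)] convex_convex_hull in'(1,2,3)] s(2) t by simp
qed

lemma seg_value_translate:
 assumes m: "m \<in> topspace X" "p m = torus_class x" and C: "convex C" "C Int lattice = {}" "x \<in> C" "y \<in> C"
  and v: "v \<in> lattice"
 shows "seg_value \<phi> (x + v) (y + v) m = seg_value \<phi> x y m"
proof -
 let ?K = "closed_segment x y"
 have K: "?K \<subseteq> C" using C by (simp add: closed_segment_subset)
 have Kl: "?K Int lattice = {}" using K C(2) by blast
 obtain s where s: "lift_on ?K s" "s x = m" using lift_segment[OF m C] by blast
 let ?K' = "closed_segment (x + v) (y + v)" and ?s = "s o (%z. z - v)"
 have K': "z - v \<in> ?K" if "z \<in> ?K'" for z
  using that closed_segment_translation_eq[of "- v" "z" "x + v" "y + v"] by (simp add: algebra_simps)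
 have "continuous_map (top_of_set ?K') (top_of_set ?K) (%z. z - v)" using K' by (auto intro!: continuous_intros)
 hence "continuous_map (top_of_set ?K') X ?s" using lift_onD(1)[OF s(1)] by (rule continuous_map_compose)
 moreover have "p (?s z) = torus_class z" if "z \<in> ?K'" for z
  using lift_onD(2)[OF s(1) K'[OF that]] torus_class_translate[OF v, of "z - v"] by simp
 ultimately have l: "lift_on ?K' ?s" by (simp add: lift_on_def)
 have K'l: "?K' Int lattice = {}"
 proof (rule equals0I)
  fix z assume "z \<in> ?K' Int lattice"
  hence "z - v \<in> ?K" "z - v \<in> lattice" using K'[of z] lattice_translate[OF v, of "z - v"] by auto
  thus False using Kl by blast
 qed
 have "seg_value \<phi> (x + v) (y + v) (?s (x + v)) = \<phi> (simplex1 (?s o linepath (x + v) (y + v)))"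
  by (rule seg_value_lift[OF l convex_closed_segment K'l]) auto
 moreover have "seg_value \<phi> x y (s x) = \<phi> (simplex1 (s o linepath x y))"
  by (rule seg_value_lift[OF s(1) convex_closed_segment Kl]) auto
 moreover have "?s o linepath (x + v) (y + v) = s o linepath x y"
  by (rule ext, simp add: linepath_def, rule arg_cong[where f = s], simp add: algebra_simps flip: scaleR_add_left)
 ultimately show ?thesis using s(2) by simp
qed

text \<open>
  The value of the cochain on the segment from the centre of the square to the point. Subtracting
  its increments leaves only the jumps across the sides.
\<close>

definition potential :: "(((nat => real) => 'a) => complex) => 'a => complex"
 where "potential \<phi> m = (if coord m = 0 then 0 else seg_value \<phi> center (coord m) (label m))"

abbreviation right_period :: "(((nat => real) => 'a) => complex) => 'a => complex"
 where "right_period \<phi> \<equiv> seg_value \<phi> center (center + e1)"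
abbreviation up_period :: "(((nat => real) => 'a) => complex) => 'a => complex"
 where "up_period \<phi> \<equiv> seg_value \<phi> center (center + e2)"

lemma sheet_value:
 assumes \<phi>: "closed_cochain X \<phi>" and s: "edge_sheet m0 d s" and x: "x \<in> ball (coord m0) d"
 shows "seg_value \<phi> (coord m0) x m0 =
  jump (right_period \<phi>) (up_period \<phi>) h m0 (s x) + potential \<phi> (s x) - potential \<phi> m0"
proof -
 let ?x0 = "coord m0"
 have nz: "?x0 ~= 0" by (rule edge_sheet_coord[OF s])
 have m0X: "m0 \<in> topspace X" using nonvertex_sheet[OF s edge_sheetD(7)[OF s]] edge_sheetD(5)[OF s] by simp
 have x0: "?x0 \<in> unit_square - {0}" using coord(1)[OF m0X] nz by simp
 have l0: "label m0 \<in> fibre" by (rule label_in_fibre[OF m0X nz])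
 note l0' = fibreD[OF l0]
 have ret: "transport center ?x0 (label m0) = m0" using place_label[OF m0X nz] by (simp add: place_def)
 have sx: "s x \<in> topspace X" "coord (s x) ~= 0" using nonvertex_sheet[OF s x] by auto
 have lx: "label (s x) \<in> fibre" by (rule label_in_fibre[OF sx])
 note lx' = fibreD[OF lx]
 note j = jump_sheet[OF s x, of "right_period \<phi>" "up_period \<phi>" h]
 from s x show ?thesis
 proof (cases rule: edge_sheet_cases)
  case inside
  have "potential \<phi> (s x) = seg_value \<phi> center x (label m0)" using inside sx(2) by (simp add: potential_def)
  also have "... = seg_value \<phi> center ?x0 (label m0) + seg_value \<phi> ?x0 x m0"
   using seg_value_triangle[OF \<phi> l0' square_facts center_in x0 inside(3)] by (simp add: ret)
  finally show ?thesis using j inside nz by (simp add: potential_def)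
 next
  case left
  have x0h: "?x0 \<in> hstrip" using left(2) x0 by (auto simp: mem_strips mem_unit_square prod_eq_iff)
  have tr: "transport (center - e1) center (label (s x)) = label m0" using left(6) right_alt[OF lx] by simp
  have plx: "p (label (s x)) = torus_class (center - e1)" using lx'(2) torus_class_translate[of e1 "center - e1"] by simp
  have "potential \<phi> (s x) = seg_value \<phi> (center - e1 + e1) (x + e1) (label (s x))"
   using left(5) sx(2) by (simp add: potential_def)
  also have "... = seg_value \<phi> (center - e1) x (label (s x))"
   by (rule seg_value_translate[OF lx'(1) plx hstrip_facts _ left(4)]) simp_all
  also have "... = seg_value \<phi> (center - e1) center (label (s x)) + seg_value \<phi> center x (label m0)"
   using seg_value_triangle[OF \<phi> lx'(1) plx hstrip_facts _ _ left(4), of center] by (simp add: tr)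
  also have "seg_value \<phi> (center - e1) center (label (s x)) = right_period \<phi> (label (s x))"
   using seg_value_translate[OF lx'(1) plx hstrip_facts, of center e1 \<phi>] by simp
  also have "seg_value \<phi> center x (label m0) = seg_value \<phi> center ?x0 (label m0) + seg_value \<phi> ?x0 x m0"
   using seg_value_triangle[OF \<phi> l0' hstrip_facts _ x0h left(4)] by (simp add: ret)
  finally show ?thesis using j left nz by (simp add: potential_def)
 next
  case below
  have x0h: "?x0 \<in> vstrip" using below(2) x0 by (auto simp: mem_strips mem_unit_square prod_eq_iff)
  have tr: "transport (center - e2) center (label (s x)) = label m0" using below(6) up_alt[OF lx] by simp
  have plx: "p (label (s x)) = torus_class (center - e2)" using lx'(2) torus_class_translate[of e2 "center - e2"] by simp
  have "potential \<phi> (s x) = seg_value \<phi> (center - e2 + e2) (x + e2) (label (s x))"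
   using below(5) sx(2) by (simp add: potential_def)
  also have "... = seg_value \<phi> (center - e2) x (label (s x))"
   by (rule seg_value_translate[OF lx'(1) plx vstrip_facts _ below(4)]) simp_all
  also have "... = seg_value \<phi> (center - e2) center (label (s x)) + seg_value \<phi> center x (label m0)"
   using seg_value_triangle[OF \<phi> lx'(1) plx vstrip_facts _ _ below(4), of center] by (simp add: tr)
  also have "seg_value \<phi> (center - e2) center (label (s x)) = up_period \<phi> (label (s x))"
   using seg_value_translate[OF lx'(1) plx vstrip_facts, of center e2 \<phi>] by simp
  also have "seg_value \<phi> center x (label m0) = seg_value \<phi> center ?x0 (label m0) + seg_value \<phi> ?x0 x m0"
   using seg_value_triangle[OF \<phi> l0' vstrip_facts _ x0h below(4)] by (simp add: ret)
  finally show ?thesis using j below nz by (simp add: potential_def)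
 qed
qed

text \<open>
  A short path in a sheet may be replaced by a straight one, and by the triangle relation its
  value is the difference of two potentials up to the period of a crossed side.
\<close>

lemma closed_cochain_nonvertex:
 assumes \<phi>: "closed_cochain X \<phi>" and m0: "m0 \<in> topspace X" "coord m0 ~= 0"
 shows "EX N. openin X N & m0 \<in> N &
   (ALL c. cpath X c --> c ` {0..1} \<subseteq> N --> c 0 = m0 -->
    \<phi> (simplex1 c) = jump (right_period \<phi>) (up_period \<phi>) h m0 (c 1) + potential \<phi> (c 1) - potential \<phi> m0)"
proof -
 obtain d s where s: "edge_sheet m0 d s" using edge_sheet_exists[OF m0] by blast
 have "\<phi> (simplex1 c) = jump (right_period \<phi>) (up_period \<phi>) h m0 (c 1) + potential \<phi> (c 1) - potential \<phi> m0"
  if c: "cpath X c" "c ` {0..1} \<subseteq> s ` ball (coord m0) d" "c 0 = m0" for c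
 proof -
  obtain c' where c': "continuous_on {0..1} c'" "c' ` {0..1} \<subseteq> ball (coord m0) d" "ALL u:{0..1}. c u = s (c' u)"
   using edge_sheetD(9)[OF s c(1,2)] by blast
  have c'0: "c' 0 \<in> ball (coord m0) d" "c' 1 \<in> ball (coord m0) d" using image_subset_iff[THEN iffD1, OF c'(2)] by simp_all
  have "torus_class (c' 0) = torus_class (coord m0)"
   using lift_onD(2)[OF edge_sheetD(4)[OF s] c'0(1)] c'(3) c(3) coord(2)[OF m0(1)] by simp
  hence c'00: "c' 0 = coord m0" by (rule small_difference_eq; unfold abs_less_iff)
     (use ball_bounds[OF c'0(1) edge_sheetD(2)[OF s]] in \<open>auto\<close>)
  have conv: "convex (ball (coord m0) d)" by simp
  have "simplex1 c = simplex1 (s o c')" by (rule simplex1_cong) (use c'(3) in simp)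
  hence "\<phi> (simplex1 c) = \<phi> (simplex1 (s o c'))" by simp
  also have "... = \<phi> (simplex1 (s o linepath (coord m0) (c' 1))) - \<phi> (simplex1 (s o linepath (coord m0) (c' 0)))"
   by (rule closed_cochain_convex_path[OF \<phi> lift_onD(1)[OF edge_sheetD(4)[OF s]] conv edge_sheetD(7)[OF s] c'(1,2)])
  also have "\<phi> (simplex1 (s o linepath (coord m0) (c' 0))) = 0"
  proof -
   have "s o linepath (coord m0) (c' 0) = (%_. m0)" using edge_sheetD(5)[OF s] by (simp add: c'00 linepath_refl o_def)
   thus ?thesis using closed_cochain_const[OF \<phi> m0(1)] by simp
  qed
  also have "\<phi> (simplex1 (s o linepath (coord m0) (c' 1))) = seg_value \<phi> (coord m0) (c' 1) m0"
   using seg_value_lift[OF edge_sheetD(4)[OF s] conv edge_sheetD(3)[OF s] edge_sheetD(7)[OF s] c'0(2), of \<phi>]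
    edge_sheetD(5)[OF s] by simp
  also have "... = jump (right_period \<phi>) (up_period \<phi>) h m0 (s (c' 1)) + potential \<phi> (s (c' 1)) - potential \<phi> m0"
   by (rule sheet_value[OF \<phi> s c'0(2)])
  finally show ?thesis using c'(3) by simp
 qed
 thus ?thesis using edge_sheetD(6,8)[OF s] by blast
qed

end

context torus_covering
begin

definition disc_chart :: "'a set => ('a => complex) => (complex => 'a) => bool"
 where "disc_chart U \<psi> g \<longleftrightarrow> openin X U & homeomorphic_maps (subtopology X U) (top_of_set (ball 0 1)) \<psi> g &
  (ALL m:U. coord m = 0 \<longleftrightarrow> \<psi> m = 0)"

lemma vertex_discs:
 obtains V \<U> where "openin torus V" "torus_class 0 \<in> V" "{m \<in> topspace X. p m \<in> V} = \<Union>\<U>" "pairwise disjnt \<U>"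
  "!!U. U \<in> \<U> ==> EX \<psi> g. disc_chart U \<psi> g"
proof -
 have "torus_class 0 \<in> topspace torus" by (simp add: topspace_torus)
 then obtain V \<psi> \<U> where V: "openin torus V" "torus_class 0 \<in> V"
  and \<psi>: "homeomorphic_map (subtopology torus V) (top_of_set (ball (0::complex) 1)) \<psi>"
  and \<U>: "{x \<in> topspace X. p x \<in> V} = \<Union>\<U>" "pairwise disjnt \<U>" and \<psi>0: "\<psi> (torus_class 0) = 0"
  and U: "ALL U:\<U>. openin X U & (EX \<phi> k. homeomorphic_map (subtopology X U) (top_of_set (ball (0::complex) 1)) \<phi> &
       (1::nat) <= k & (torus_class 0 \<notin> {torus_class 0} --> k = 1) & (ALL m:U. \<psi> (p m) = \<phi> m ^ k))"
  by (rule chart_at)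
 have injV: "inj_on \<psi> V" using homeomorphic_imp_injective_map[OF \<psi>] openin_subset[OF V(1)] by (simp add: inf.absorb2)
 have "EX \<phi> g. disc_chart U \<phi> g" if UU: "U \<in> \<U>" for U
 proof -
  obtain \<phi> k where opU: "openin X U"
   and \<phi>: "homeomorphic_map (subtopology X U) (top_of_set (ball (0::complex) 1)) \<phi>"
   and k: "1 <= (k::nat)" and eq: "!!m. m \<in> U ==> \<psi> (p m) = \<phi> m ^ k" using bspec[OF U UU] by auto
  obtain g where g: "homeomorphic_maps (subtopology X U) (top_of_set (ball 0 1)) \<phi> g"
   using \<phi> homeomorphic_map_maps by blast
  have "coord m = 0 \<longleftrightarrow> \<phi> m = 0" if m: "m \<in> U" for m
  proof -
   have mX: "m \<in> topspace X" and pV: "p m \<in> V" using \<U>(1) UU m by auto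
   have "coord m = 0 \<longleftrightarrow> p m = torus_class 0"
    using coord[OF mX] coord_eq[of 0 m] by (auto simp: mem_unit_square)
   also have "... \<longleftrightarrow> \<psi> (p m) = 0" using injV pV V(2) \<psi>0 by (metis inj_onD)
   also have "... \<longleftrightarrow> \<phi> m = 0" using eq[OF m] k by simp
   finally show ?thesis .
  qed
  thus ?thesis using opU g unfolding disc_chart_def by blast
 qed
 thus ?thesis by (rule that[OF V \<U>])
qed

lemma disc_chartD:
 assumes "disc_chart U \<psi> g"
 shows "openin X U" "continuous_map (top_of_set (ball 0 1)) X g" "continuous_map (subtopology X U) (top_of_set (ball 0 1)) \<psi>"
  "z \<in> ball 0 1 ==> g z \<in> U" "z \<in> ball 0 1 ==> \<psi> (g z) = z" "m \<in> U ==> \<psi> m \<in> ball 0 1" "m \<in> U ==> g (\<psi> m) = m"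
  "m \<in> U ==> coord m = 0 \<longleftrightarrow> \<psi> m = 0" "U \<subseteq> topspace X"
proof -
 have h: "homeomorphic_maps (subtopology X U) (top_of_set (ball 0 1)) \<psi> g"
  and c: "ALL m:U. coord m = 0 \<longleftrightarrow> \<psi> m = 0" and o: "openin X U"
  using assms by (simp_all add: disc_chart_def)
 show UX: "U \<subseteq> topspace X" by (rule openin_subset[OF o])
 have T: "topspace (subtopology X U) = U" using UX by auto
 show "openin X U" by (rule o)
 have gc: "continuous_map (top_of_set (ball 0 1)) (subtopology X U) g"
  and pc: "continuous_map (subtopology X U) (top_of_set (ball 0 1)) \<psi>"
  and inv: "!!m. m \<in> U ==> g (\<psi> m) = m" "!!z. z \<in> ball 0 1 ==> \<psi> (g z) = z"
  using h T by (auto simp: homeomorphic_maps_def)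
 show "continuous_map (top_of_set (ball 0 1)) X g" using gc by (simp add: continuous_map_in_subtopology)
 show "continuous_map (subtopology X U) (top_of_set (ball 0 1)) \<psi>" by (rule pc)
 show "z \<in> ball 0 1 ==> g z \<in> U" using continuous_map_image_subset_topspace[OF gc] T by auto
 show "m \<in> U ==> \<psi> m \<in> ball 0 1" using continuous_map_image_subset_topspace[OF pc] T by auto
 show "z \<in> ball 0 1 ==> \<psi> (g z) = z" "m \<in> U ==> g (\<psi> m) = m" "m \<in> U ==> coord m = 0 \<longleftrightarrow> \<psi> m = 0"
  using inv c by auto
qed

text \<open>
  The preimage of a small disc around the vertex of the torus is a disjoint union of discs, and on
  a disc a closed cochain is exact: integrate along radii in the chart.
\<close>

lemma vertex_primitive:
 assumes \<phi>: "closed_cochain X \<phi>"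
 obtains G \<delta> where "0 < \<delta>" "\<delta> <= 1/4" "!!v. v \<in> vertex_nbhd \<delta> ==> coord v = 0 ==> G v = 0"
  "!!c. cpath X c ==> c ` {0..1} \<subseteq> vertex_nbhd \<delta> ==>
   \<phi> (simplex1 c) = G (c 1) - G (c 0)"
proof -
 obtain V \<U> where V: "openin torus V" "torus_class 0 \<in> V" and \<U>: "{m \<in> topspace X. p m \<in> V} = \<Union>\<U>" "pairwise disjnt \<U>"
  and ch: "!!U. U \<in> \<U> ==> EX \<psi> g. disc_chart U \<psi> g" by (rule vertex_discs) blast
 have "ALL U:\<U>. EX \<psi> g. disc_chart U \<psi> g" using ch by blast
 then obtain \<psi> where "ALL U:\<U>. EX g. disc_chart U (\<psi> U) g" by (rule bchoice[THEN exE])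
 then obtain g where chart: "ALL U:\<U>. disc_chart U (\<psi> U) (g U)" by (rule bchoice[THEN exE])
 note ch = bspec[OF chart]
 define disc where "disc m = (THE U. U \<in> \<U> & m \<in> U)" for m
 have disc: "disc m = U" if "U \<in> \<U>" "m \<in> U" for m U unfolding disc_def
 proof (rule the_equality)
  show "U' = U" if "U' \<in> \<U> & m \<in> U'" for U'
   using \<U>(2) that \<open>U \<in> \<U>\<close> \<open>m \<in> U\<close> unfolding pairwise_def disjnt_def by blast
 qed (use that in simp)
 define G where "G m = \<phi> (simplex1 (g (disc m) o linepath 0 (\<psi> (disc m) m)))" for m
 have "open (torus_class -` V)" "0 \<in> torus_class -` V" using V by (simp_all add: openin_torus)
 then obtain e where e: "0 < e" "ball 0 e \<subseteq> torus_class -` V" using open_contains_ball_eq by blast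
 define \<delta> where "\<delta> = min e (1/4)"
 have \<delta>: "0 < \<delta>" "\<delta> <= 1/4" "\<delta> <= e" using e(1) by (auto simp: \<delta>_def)
 have DV: "vertex_nbhd \<delta> \<subseteq> \<Union>\<U>"
 proof
  fix m assume "m \<in> vertex_nbhd \<delta>"
  then obtain z where "m \<in> topspace X" "p m = torus_class z" "z \<in> ball 0 \<delta>" by (auto simp: vertex_nbhd_def)
  moreover have "z \<in> ball 0 e" using \<open>z \<in> ball 0 \<delta>\<close> \<delta>(3) by simp
  ultimately show "m \<in> \<Union>\<U>" unfolding \<U>(1)[symmetric] using e(2) by auto
 qed
 have 1: "G v = 0" if v: "v \<in> vertex_nbhd \<delta>" "coord v = 0" for v
 proof -
  obtain U where U: "U \<in> \<U>" "v \<in> U" using DV v(1) by blast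
  have "\<psi> U v = 0" using disc_chartD(8)[OF ch[OF U(1)] U(2)] v(2) by simp
  moreover have "g U (\<psi> U v) = v" by (rule disc_chartD(7)[OF ch[OF U(1)] U(2)])
  moreover have "v \<in> topspace X" using v(1) by (simp add: vertex_nbhd_def)
  ultimately show ?thesis using closed_cochain_const[OF \<phi>, of v] by (simp add: G_def disc[OF U] linepath_refl o_def)
 qed
 have 2: "\<phi> (simplex1 c) = G (c 1) - G (c 0)"
  if c: "cpath X c" "c ` {0..1} \<subseteq> vertex_nbhd \<delta>" for c
 proof -
  have conn: "connectedin X (c ` {0..1})" by (rule connectedin_continuous_map_image[OF c(1)]) (simp add: connectedin_subtopology)
  have "c 0 \<in> c ` {0..1}" by simp
  hence "c 0 \<in> \<Union>\<U>" using c(2) DV by blast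
  then obtain U where U: "U \<in> \<U>" "c 0 \<in> U" by blast
  have same: "disc (c 0) = disc (c u)" if u: "u \<in> {0..1}" for u
  proof (rule connectedin_locally_constant[OF conn])
   show "c 0 \<in> c ` {0..1}" "c u \<in> c ` {0..1}" using u by auto
   fix z assume "z \<in> c ` {0..1}"
   hence "z \<in> \<Union>\<U>" using c(2) DV by blast
   then obtain U' where U': "U' \<in> \<U>" "z \<in> U'" by blast
   have "disc w = disc z" if "w \<in> U'" for w using disc[OF U'] disc[OF U'(1) that] by simp
   thus "EX N. openin X N & z \<in> N & (ALL w:N Int c ` {0..1}. disc w = disc z)"
    using disc_chartD(1)[OF ch[OF U'(1)]] U'(2) by blast
  qed
  have cU: "c u \<in> U" if u: "u \<in> {0..1}" for u
  proof -
   have "c u \<in> \<Union>\<U>" using c(2) DV u by blast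
   then obtain U' where U': "U' \<in> \<U>" "c u \<in> U'" by blast
   thus ?thesis using same[OF u] disc[OF U'] disc[OF U] by simp
  qed
  note chU = ch[OF U(1)]
  have "cpath (subtopology X U) c" using c(1) cU by (auto simp: continuous_map_in_subtopology)
  hence "cpath (top_of_set (ball 0 1)) (\<psi> U o c)" using disc_chartD(3)[OF chU] by (rule continuous_map_compose)
  hence cc: "continuous_on {0..1} (\<psi> U o c)" "(\<psi> U o c) ` {0..1} \<subseteq> ball 0 1"
   by (auto simp: continuous_map_in_subtopology)
  have "simplex1 c = simplex1 (g U o (\<psi> U o c))" by (rule simplex1_cong) (use disc_chartD(7)[OF chU cU] in simp)
  hence "\<phi> (simplex1 c) = \<phi> (simplex1 (g U o linepath 0 ((\<psi> U o c) 1))) - \<phi> (simplex1 (g U o linepath 0 ((\<psi> U o c) 0)))"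
   using closed_cochain_convex_path[OF \<phi> disc_chartD(2)[OF chU] convex_ball _ cc, of 0] by simp
  also have "... = G (c 1) - G (c 0)" unfolding G_def using disc[OF U(1) cU[of 0]] disc[OF U(1) cU[of 1]] by simp
  finally show ?thesis .
 qed
 show ?thesis by (rule that[OF \<delta>(1,2) 1 2])
qed

text \<open>
  The jumps \<open>a\<close> and \<open>b\<close> are the values of the cochain across the sides.
  Near the vertices the cochain has a primitive, and its deviation from the potential is constant
  on each corner of a square: the values at the lower left corners form the function
  \<open>h\<close>, and comparing the four corners that meet gives the balance condition.
\<close>

theorem closed_cochain_normal_form:
 assumes \<phi>: "closed_cochain X \<phi>"
 obtains a b h f where "balanced a b h"
  "!!c. cpath X c ==>
   \<phi> (simplex1 c) = path_int (jump a b h) c + f (c 1) - f (c 0)"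
proof -
 obtain G \<delta> where \<delta>: "0 < \<delta>" "\<delta> <= 1/4" and G0: "!!v. v \<in> vertex_nbhd \<delta> ==> coord v = 0 ==> G v = 0"
  and G: "!!c. cpath X c ==> c ` {0..1} \<subseteq> vertex_nbhd \<delta> ==>
   \<phi> (simplex1 c) = G (c 1) - G (c 0)" by (rule vertex_primitive[OF \<phi>]) blast
 define A where "A = right_period \<phi>"
 define B where "B = up_period \<phi>"
 define f where "f = potential \<phi>"
 define \<gamma> where "\<gamma> m = G m - f m" for m
 let ?D = "vertex_nbhd \<delta>"
 have \<gamma>D: "germ_primitive ?D A B \<gamma>"
 proof (rule exact_imp_germ_primitive[OF open_vertex_nbhd, where \<Psi> = "%c. \<phi> (simplex1 c) - (f (c 1) - f (c 0))"])
  fix m assume m: "m \<in> topspace X" "coord m ~= 0"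
  obtain N where N: "openin X N" "m \<in> N" and N': "ALL c. cpath X c --> c ` {0..1} \<subseteq> N --> c 0 = m -->
    \<phi> (simplex1 c) = jump A B (%_. 0) m (c 1) + f (c 1) - f m"
   using closed_cochain_nonvertex[OF \<phi> m, of "%_. 0"] unfolding A_def B_def f_def by blast
  have "ALL c. cpath X c --> c ` {0..1} \<subseteq> N --> c 0 = m -->
    \<phi> (simplex1 c) - (f (c 1) - f (c 0)) = jump A B (%_. 0) m (c 1)" using N' by simp
  thus "EX N. openin X N & m \<in> N & (ALL c. cpath X c --> c ` {0..1} \<subseteq> N --> c 0 = m -->
    \<phi> (simplex1 c) - (f (c 1) - f (c 0)) = jump A B (%_. 0) m (c 1))" using N by blast
 next
  fix c :: "real => 'a"
  assume c: "cpath X c" "c ` {0..1} \<subseteq> ?D"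
  show "\<phi> (simplex1 c) - (f (c 1) - f (c 0)) = \<gamma> (c 1) - \<gamma> (c 0)" using G[OF c] by (simp add: \<gamma>_def)
 qed
 (* the point with both coordinates equal to this lies in the small disc, hence in the corner *)
 define \<epsilon> where "\<epsilon> = \<delta> / 3"
 have \<epsilon>: "0 < \<epsilon>" "\<epsilon> < 1/2" "3 * \<epsilon> = \<delta>" using \<delta> by (auto simp: \<epsilon>_def)
 define h where "h q = \<gamma> (place q (\<epsilon>, \<epsilon>))" for q
 define C where "C \<kappa> = (unit_square - {0}) Int ball \<kappa> \<delta>" for \<kappa> :: "real \<times> real"
 have CD: "place q x \<in> ?D" if q: "q \<in> fibre" and x: "x \<in> C \<kappa>" and \<kappa>: "\<kappa> \<in> lattice" for q x \<kappa>
 proof -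
  have xu: "x \<in> unit_square - {0}" using x by (simp add: C_def)
  have "torus_class (x - \<kappa>) = torus_class x" using torus_class_translate[OF \<kappa>, of "x - \<kappa>"] by simp
  moreover have "x - \<kappa> \<in> ball 0 \<delta>" using x by (simp add: C_def dist_norm norm_minus_commute)
  ultimately show ?thesis using place(1,2)[OF q xu] unfolding vertex_nbhd_def by (metis (mono_tags, lifting) image_eqI mem_Collect_eq)
 qed
 have const: "\<gamma> (place q x) = \<gamma> (place q y)"
  if "q \<in> fibre" "x \<in> C \<kappa>" "y \<in> C \<kappa>" "\<kappa> \<in> lattice" for q x y \<kappa>
 proof (rule germ_primitive_const[OF \<gamma>D that(1) _ _ _ that(2,3)])
  show "convex (C \<kappa>)" unfolding C_def by (intro convex_Int convex_unit_square_minus_0 convex_ball)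
  show "C \<kappa> \<subseteq> unit_square - {0}" by (auto simp: C_def)
  show "place q x \<in> ?D" if "x \<in> C \<kappa>" for x by (rule CD[OF \<open>q \<in> fibre\<close> that \<open>\<kappa> \<in> lattice\<close>])
 qed
 have memC: "(x, y) \<in> C (k, l)"
  if "0 <= x" "x < 1" "0 <= y" "y < 1" "x ~= 0 | y ~= 0" "\<bar>x - k\<bar> + \<bar>y - l\<bar> < \<delta>" for x y k l
 proof -
  have "dist (k, l) (x, y) <= \<bar>k - x\<bar> + \<bar>l - y\<bar>"
   unfolding dist_prod_def dist_real_def by (rule sqrt_sum_squares_le_sum_abs[THEN order_trans]) simp
  thus ?thesis using that by (auto simp: C_def mem_unit_square zero_prod_def abs_minus_commute)
 qed
 have SW: "\<gamma> (place q x) = h q" if "q \<in> fibre" "x \<in> C (0, 0)" for q x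
 proof -
  have "(\<epsilon>, \<epsilon>) \<in> C (0, 0)" using memC[of \<epsilon> \<epsilon> 0 0] \<epsilon> by simp
  thus ?thesis unfolding h_def by (rule const[OF that]) (simp add: lattice_def)
 qed
 have SE: "\<gamma> (place q x) = h (right q) - A q" if q: "q \<in> fibre" and x: "x \<in> C (1, 0)" for q x
 proof -
  have rq: "right q \<in> fibre" by (rule monodromy_in_fibre(1)[OF q])
  have z: "(0, \<epsilon>) \<in> C (0, 0)" using memC[of 0 \<epsilon> 0 0] \<epsilon> by simp
  have "place (right q) (0, \<epsilon>) \<in> ?D" by (rule CD[OF rq z]) (simp add: lattice_def)
  then obtain \<eta> where \<eta>: "0 < \<eta>" "!!t. 0 < t ==> t < \<eta> ==> \<gamma> (place q (1 - t, \<epsilon>)) = \<gamma> (place (right q) (0, \<epsilon>)) - A q"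
   using germ_primitive_cross_right[OF \<gamma>D q, of \<epsilon>] \<epsilon> by auto
  define t where "t = min \<eta> \<epsilon> / 2"
  have t: "0 < t" "t < \<eta>" "t < \<epsilon>" using \<eta>(1) \<epsilon> by (auto simp: t_def)
  have "(1 - t, \<epsilon>) \<in> C (1, 0)" using memC[of "1 - t" \<epsilon> 1 0] t \<epsilon> by simp
  hence "\<gamma> (place q x) = \<gamma> (place q (1 - t, \<epsilon>))" by (rule const[OF q x]) (simp add: lattice_def)
  thus ?thesis using \<eta>(2)[OF t(1,2)] SW[OF rq z] by simp
 qed
 have NW: "\<gamma> (place q x) = h (up q) - B q" if q: "q \<in> fibre" and x: "x \<in> C (0, 1)" for q x
 proof -
  have rq: "up q \<in> fibre" by (rule monodromy_in_fibre(2)[OF q])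
  have z: "(\<epsilon>, 0) \<in> C (0, 0)" using memC[of \<epsilon> 0 0 0] \<epsilon> by simp
  have "place (up q) (\<epsilon>, 0) \<in> ?D" by (rule CD[OF rq z]) (simp add: lattice_def)
  then obtain \<eta> where \<eta>: "0 < \<eta>" "!!t. 0 < t ==> t < \<eta> ==> \<gamma> (place q (\<epsilon>, 1 - t)) = \<gamma> (place (up q) (\<epsilon>, 0)) - B q"
   using germ_primitive_cross_up[OF \<gamma>D q, of \<epsilon>] \<epsilon> by auto
  define t where "t = min \<eta> \<epsilon> / 2"
  have t: "0 < t" "t < \<eta>" "t < \<epsilon>" using \<eta>(1) \<epsilon> by (auto simp: t_def)
  have "(\<epsilon>, 1 - t) \<in> C (0, 1)" using memC[of \<epsilon> "1 - t" 0 1] t \<epsilon> by simp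
  hence "\<gamma> (place q x) = \<gamma> (place q (\<epsilon>, 1 - t))" by (rule const[OF q x]) (simp add: lattice_def)
  thus ?thesis using \<eta>(2)[OF t(1,2)] SW[OF rq z] by simp
 qed
 have NE1: "\<gamma> (place q x) = h (right (up q)) - A (up q) - B q" if q: "q \<in> fibre" and x: "x \<in> C (1, 1)" for q x
 proof -
  have rq: "up q \<in> fibre" by (rule monodromy_in_fibre(2)[OF q])
  have z: "(1 - \<epsilon>, 0) \<in> C (1, 0)" using memC[of "1 - \<epsilon>" 0 1 0] \<epsilon> by simp
  have "place (up q) (1 - \<epsilon>, 0) \<in> ?D" by (rule CD[OF rq z]) (simp add: lattice_def)
  then obtain \<eta> where \<eta>: "0 < \<eta>" "!!t. 0 < t ==> t < \<eta> ==> \<gamma> (place q (1 - \<epsilon>, 1 - t)) = \<gamma> (place (up q) (1 - \<epsilon>, 0)) - B q"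
   using germ_primitive_cross_up[OF \<gamma>D q, of "1 - \<epsilon>"] \<epsilon> by auto
  define t where "t = min \<eta> \<epsilon> / 2"
  have t: "0 < t" "t < \<eta>" "t < \<epsilon>" using \<eta>(1) \<epsilon> by (auto simp: t_def)
  have "(1 - \<epsilon>, 1 - t) \<in> C (1, 1)" using memC[of "1 - \<epsilon>" "1 - t" 1 1] t \<epsilon> by simp
  hence "\<gamma> (place q x) = \<gamma> (place q (1 - \<epsilon>, 1 - t))" by (rule const[OF q x]) (simp add: lattice_def)
  thus ?thesis using \<eta>(2)[OF t(1,2)] SE[OF rq z] by simp
 qed
 have NE2: "\<gamma> (place q x) = h (up (right q)) - B (right q) - A q" if q: "q \<in> fibre" and x: "x \<in> C (1, 1)" for q x
 proof -
  have rq: "right q \<in> fibre" by (rule monodromy_in_fibre(1)[OF q])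
  have z: "(0, 1 - \<epsilon>) \<in> C (0, 1)" using memC[of 0 "1 - \<epsilon>" 0 1] \<epsilon> by simp
  have "place (right q) (0, 1 - \<epsilon>) \<in> ?D" by (rule CD[OF rq z]) (simp add: lattice_def)
  then obtain \<eta> where \<eta>: "0 < \<eta>" "!!t. 0 < t ==> t < \<eta> ==> \<gamma> (place q (1 - t, 1 - \<epsilon>)) = \<gamma> (place (right q) (0, 1 - \<epsilon>)) - A q"
   using germ_primitive_cross_right[OF \<gamma>D q, of "1 - \<epsilon>"] \<epsilon> by auto
  define t where "t = min \<eta> \<epsilon> / 2"
  have t: "0 < t" "t < \<eta>" "t < \<epsilon>" using \<eta>(1) \<epsilon> by (auto simp: t_def)
  have "(1 - t, 1 - \<epsilon>) \<in> C (1, 1)" using memC[of "1 - t" "1 - \<epsilon>" 1 1] t \<epsilon> by simp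
  hence "\<gamma> (place q x) = \<gamma> (place q (1 - t, 1 - \<epsilon>))" by (rule const[OF q x]) (simp add: lattice_def)
  thus ?thesis using \<eta>(2)[OF t(1,2)] NW[OF rq z] by simp
 qed
 have bal: "balanced A B h" unfolding balanced_def
 proof
  fix q assume q: "q \<in> fibre"
  have "(1 - \<epsilon> / 2, 1 - \<epsilon> / 2) \<in> C (1, 1)" using memC[of "1 - \<epsilon> / 2" "1 - \<epsilon> / 2" 1 1] \<epsilon> by simp
  from NE1[OF q this] NE2[OF q this]
  show "h (up (right q)) - h (right (up q)) = (B (right q) - B q) - (A (up q) - A q)" by (simp add: algebra_simps)
 qed
 have corner: "\<gamma> m = corner A B h (coord m) (label m)" if m: "m \<in> ?D" "coord m ~= 0" for m
 proof -
  have mX: "m \<in> topspace X" using m(1) by (simp add: vertex_nbhd_def)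
  have q: "label m \<in> fibre" by (rule label_in_fibre[OF mX m(2)])
  have pl: "place (label m) (coord m) = m" by (rule place_label[OF mX m(2)])
  obtain z where z: "z \<in> ball 0 \<delta>" "fst (coord m) = (if fst z < 0 then fst z + 1 else fst z)"
   "snd (coord m) = (if snd z < 0 then snd z + 1 else snd z)" by (rule vertex_nbhd_coord[OF m(1) \<delta>(2)])
  define \<kappa> where "\<kappa> = ((if fst z < 0 then 1 else 0, if snd z < 0 then 1 else 0) :: real \<times> real)"
  have "coord m = z + \<kappa>" using z(2,3) by (simp add: prod_eq_iff \<kappa>_def)
  hence "coord m \<in> C \<kappa>" using z(1) coord(1)[OF mX] m(2) by (simp add: C_def dist_norm)
  moreover have "\<bar>fst z\<bar> < 1/4" "\<bar>snd z\<bar> < 1/4" using abs_fst_snd_ball[OF z(1)] \<delta>(2) by auto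
  ultimately show ?thesis
   using SW[OF q, of "coord m"] SE[OF q, of "coord m"] NW[OF q, of "coord m"] NE1[OF q, of "coord m"] z(2,3)
   unfolding pl corner_def \<kappa>_def by (cases "fst z < 0"; cases "snd z < 0") auto
 qed
 show ?thesis
 proof (rule that[OF bal])
  fix c :: "real => 'a" assume c: "cpath X c"
  show "\<phi> (simplex1 c) = path_int (jump A B h) c + f (c 1) - f (c 0)"
  proof (rule closed_cochain_eq_path_int[OF \<phi> _ c])
   fix m assume m: "m \<in> topspace X"
   show "EX N. openin X N & m \<in> N & (ALL c. cpath X c --> c ` {0..1} \<subseteq> N --> c 0 = m -->
    \<phi> (simplex1 c) = jump A B h m (c 1) + f (c 1) - f m)"
   proof (cases "coord m = 0")
    case False
    thus ?thesis using closed_cochain_nonvertex[OF \<phi> m, of h] unfolding A_def B_def f_def by blast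
   next
    case True
    have mD: "m \<in> ?D" by (rule vertex_in_nbhd[OF m True \<delta>(1)])
    have fv: "f v = 0" if "coord v = 0" for v using that by (simp add: f_def potential_def)
    have "\<phi> (simplex1 c) = jump A B h m (c 1) + f (c 1) - f m"
     if c: "cpath X c" "c ` {0..1} \<subseteq> ?D" "c 0 = m" for c
    proof -
     have c1: "c 1 \<in> ?D" using c(2) by (simp add: image_subset_iff)
     have "\<phi> (simplex1 c) = G (c 1)" using G[OF c(1,2)] G0[OF mD True] c(3) by simp
     also have "... = jump A B h m (c 1) + f (c 1) - f m"
      using G0[OF c1] corner[OF c1] fv True by (cases "coord (c 1) = 0") (auto simp: jump_def \<gamma>_def diff_eq_eq)
     finally show ?thesis .
    qed
    thus ?thesis using open_vertex_nbhd mD by blast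
   qed
  qed
 qed
qed

subsection \<open>Exact triples\<close>

lemma place_center: "q \<in> fibre ==> place q center = q"
 using transport_same[of q center] square_lattice center_in by (auto simp: place_def fibreD)

text \<open>
  Inside a square the primitive \<open>f\<close> has no jumps, so it may be evaluated at the
  centres; the way from one centre to the next crosses one side.
\<close>

lemma exact_jump:
 assumes bal: "balanced a b h"
  and ex: "!!c. cpath X c ==> path_int (jump a b h) c = f (c 1) - f (c 0)"
  and q: "q \<in> fibre"
 shows "a q = f (right q) - f q" "b q = f (up q) - f q"
proof -
 have gp: "germ_primitive (topspace X) a b f"
 proof (rule exact_imp_germ_primitive[where \<Psi> = "path_int (jump a b h)"])
  show "openin X (topspace X)" by simp
  show "path_int (jump a b h) c = f (c 1) - f (c 0)" if "cpath X c" for c by (rule ex[OF that])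
  show "EX N. openin X N & m \<in> N & (ALL c. cpath X c --> c ` {0..1} \<subseteq> N --> c 0 = m -->
   path_int (jump a b h) c = jump a b (%_. 0) m (c 1))" if m: "m \<in> topspace X" "coord m ~= 0" for m
   using path_int_local[OF germ_cocycle_jump[OF bal] m(1)] unfolding jump_indep[OF m(2), of a b h _ "%_. 0"] .
 qed
 have const: "f (place q' x) = f q'" if q': "q' \<in> fibre" and x: "x \<in> unit_square - {0}" for q' x
  using germ_primitive_const[OF gp q' convex_unit_square_minus_0 subset_refl place(1)[OF q'] x center_in]
  by (simp add: place_center[OF q'])
 have rq: "right q \<in> fibre" "up q \<in> fibre" by (rule monodromy_in_fibre[OF q])+
 have half: "(0, 1/2) \<in> unit_square - {0}" "(1/2, 0) \<in> unit_square - {0}" by (auto simp: mem_unit_square zero_prod_def)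
 obtain \<eta> where \<eta>: "0 < \<eta>" "!!t. 0 < t ==> t < \<eta> ==> f (place q (1 - t, 1/2)) = f (place (right q) (0, 1/2)) - a q"
  using germ_primitive_cross_right[OF gp q, of "1/2"] place(1)[OF rq(1) half(1)] by auto
 define t where "t = min \<eta> 1 / 2"
 have t: "0 < t" "t < \<eta>" "t < 1" using \<eta>(1) by (auto simp: t_def)
 have "(1 - t, 1/2) \<in> unit_square - {0}" using t by (auto simp: mem_unit_square zero_prod_def)
 thus "a q = f (right q) - f q" using \<eta>(2)[OF t(1,2)] const[OF q] const[OF rq(1) half(1)] by simp
 obtain \<eta> where \<eta>: "0 < \<eta>" "!!t. 0 < t ==> t < \<eta> ==> f (place q (1/2, 1 - t)) = f (place (up q) (1/2, 0)) - b q"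
  using germ_primitive_cross_up[OF gp q, of "1/2"] place(1)[OF rq(2) half(2)] by auto
 define t where "t = min \<eta> 1 / 2"
 have t: "0 < t" "t < \<eta>" "t < 1" using \<eta>(1) by (auto simp: t_def)
 have "(1/2, 1 - t) \<in> unit_square - {0}" using t by (auto simp: mem_unit_square zero_prod_def)
 thus "b q = f (up q) - f q" using \<eta>(2)[OF t(1,2)] const[OF q] const[OF rq(2) half(2)] by simp
qed

text \<open>
  In a power chart the vertex is the origin of a disc, and a punctured disc is connected.
\<close>

lemma vertex_punctured:
 assumes v: "v \<in> topspace X" "coord v = 0" and N: "openin X N" "v \<in> N"
 obtains N' where "openin X N'" "v \<in> N'" "N' \<subseteq> N" "connectedin X (N' - {v})" "N' - {v} ~= {}"
  "!!m. m \<in> N' - {v} ==> coord m ~= 0"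
proof -
 obtain V \<U> where V: "openin torus V" "torus_class 0 \<in> V" and \<U>: "{m \<in> topspace X. p m \<in> V} = \<Union>\<U>"
  "pairwise disjnt \<U>" and ch: "!!U. U \<in> \<U> ==> EX \<psi> g. disc_chart U \<psi> g" by (rule vertex_discs) blast
 have "v \<in> \<Union>\<U>" unfolding \<U>(1)[symmetric] using v coord(2)[OF v(1)] V(2) by simp
 then obtain U where U: "U \<in> \<U>" "v \<in> U" by blast
 obtain \<psi> g where c: "disc_chart U \<psi> g" using ch[OF U(1)] by blast
 have \<psi>v: "\<psi> v = 0" using disc_chartD(8)[OF c U(2)] v(2) by simp
 hence g0: "g 0 = v" using disc_chartD(7)[OF c U(2)] by simp
 obtain e where e: "0 < e" "!!z. z \<in> ball 0 1 ==> dist 0 z < e ==> g z \<in> N"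
  using continuous_map_ball[OF disc_chartD(2)[OF c] N(1), of 0] N(2) g0 by auto
 define r where "r = min e 1"
 have r: "0 < r" "r <= 1" "r <= e" using e(1) by (auto simp: r_def)
 have rb: "z \<in> ball 0 1" if "z \<in> ball 0 r" for z :: complex using that r(2) by simp
 let ?N = "g ` ball 0 r"
 have Neq: "?N = {m \<in> U. \<psi> m \<in> ball 0 r}"
 proof (rule Set.set_eqI, rule iffI)
  fix m assume "m \<in> ?N"
  then obtain z where z: "z \<in> ball 0 r" "m = g z" by blast
  thus "m \<in> {m \<in> U. \<psi> m \<in> ball 0 r}" using disc_chartD(4,5)[OF c rb[OF z(1)]] by simp
 next
  fix m assume "m \<in> {m \<in> U. \<psi> m \<in> ball 0 r}"
  thus "m \<in> ?N" using disc_chartD(7)[OF c, of m] by (intro image_eqI[of _ _ "\<psi> m"]) auto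
 qed
 have open_sub: "openin (subtopology X U) {m \<in> topspace (subtopology X U). \<psi> m \<in> ball 0 r}"
  by (rule openin_continuous_map_preimage[OF disc_chartD(3)[OF c]]) (use rb in \<open>auto simp: openin_open_eq\<close>)
 have "{m \<in> topspace (subtopology X U). \<psi> m \<in> ball 0 r} = ?N" unfolding Neq using disc_chartD(9)[OF c] by auto
 hence 1: "openin X ?N" using openin_trans_full[OF open_sub disc_chartD(1)[OF c]] by simp
 have 2: "v \<in> ?N" using g0 r(1) by (intro image_eqI[of _ _ 0]) auto
 have 3: "?N \<subseteq> N" using e(2) rb r(3) by (auto intro!: e(2))
 have inj: "inj_on g (ball 0 1)" using disc_chartD(5)[OF c] by (metis inj_onI)
 have Nv: "?N - {v} = g ` (ball 0 r - {0})"
 proof -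
  have "g ` (ball 0 r - {0}) = g ` ball 0 r - g ` {0}" by (rule inj_on_image_set_diff[OF inj]) (use rb r in auto)
  thus ?thesis by (simp add: g0)
 qed
 have "connectedin (top_of_set (ball 0 1)) (ball 0 r - {0 :: complex})"
  using connected_punctured_ball[of "0::complex" r] rb by (auto simp: connectedin_subtopology DIM_complex)
 hence 4: "connectedin X (?N - {v})" unfolding Nv by (rule connectedin_continuous_map_image[OF disc_chartD(2)[OF c]])
 have "complex_of_real (r / 2) \<in> ball 0 r - {0}" using r(1) by simp
 hence 5: "?N - {v} ~= {}" unfolding Nv by blast
 have 6: "coord m ~= 0" if m: "m \<in> ?N - {v}" for m
 proof -
  obtain z where z: "z \<in> ball 0 r - {0}" "m = g z" using m unfolding Nv by blast
  have zb: "z \<in> ball 0 1" using z(1) rb by blast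
  show ?thesis using disc_chartD(8)[OF c disc_chartD(4)[OF c zb]] disc_chartD(5)[OF c zb] z by simp
 qed
 show ?thesis by (rule that[OF 1 2 3 4 5 6])
qed

text \<open>
  Without jumps across the sides the increments out of a vertex are locally constant on a
  punctured disc.
\<close>

lemma kernel_constant_at_vertex:
 assumes k: "balanced (%_. 0) (%_. 0) k" and v: "v \<in> topspace X" "coord v = 0"
 obtains N \<kappa> where "openin X N" "v \<in> N" "!!m. m \<in> N ==> m ~= v ==> coord m ~= 0"
  "!!m. m \<in> N ==> m ~= v ==> jump (%_. 0) (%_. 0) k v m = \<kappa>"
proof -
 let ?j = "jump (%_. 0) (%_. 0) k"
 obtain N where N: "openin X N" "v \<in> N"
  and N': "ALL y:N. EX N'. openin X N' & y \<in> N' & (ALL z:N'. ?j v z = ?j v y + ?j y z)"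
  using bspec[OF germ_cocycle_jump[OF k, unfolded germ_cocycle_def] v(1)] by blast
 obtain P where P: "openin X P" "v \<in> P" "P \<subseteq> N" "connectedin X (P - {v})" "P - {v} ~= {}"
  and Pn: "!!m. m \<in> P - {v} ==> coord m ~= 0" by (rule vertex_punctured[OF v N]) blast
 obtain w where w: "w \<in> P - {v}" using P(5) by blast
 have "?j v m = ?j v w" if m: "m \<in> P - {v}" for m
 proof (rule connectedin_locally_constant[OF P(4) m w])
  fix z assume z: "z \<in> P - {v}"
  hence "z \<in> N" using P(3) by blast
  then obtain N1 where N1: "openin X N1" "z \<in> N1" "ALL y:N1. ?j v y = ?j v z + ?j z y" using bspec[OF N'] by blast
  have "?j z y = 0" for y using Pn[OF z] by (simp add: jump_def)
  hence "ALL w:N1 Int (P - {v}). ?j v w = ?j v z" using N1(3) by simp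
  thus "EX N. openin X N & z \<in> N & (ALL w:N Int (P - {v}). ?j v w = ?j v z)" using N1(1,2) by blast
 qed
 thus ?thesis using that[OF P(1,2), of "?j v w"] Pn by blast
qed

text \<open>
  The constants at the vertices are the increments of a function supported on the vertices.
\<close>

lemma kernel_exact:
 assumes k: "balanced (%_. 0) (%_. 0) k"
 obtains f where "!!c. cpath X c ==>
  path_int (jump (%_. 0) (%_. 0) k) c = f (c 1) - f (c 0)"
proof -
 let ?j = "jump (%_. 0) (%_. 0) k"
 define good where "good v N \<kappa> \<longleftrightarrow> openin X N & v \<in> N & (ALL m:N. m ~= v --> coord m ~= 0) & (ALL m:N. m ~= v --> ?j v m = \<kappa>)"
  for v N \<kappa>
 define val where "val v = (SOME \<kappa>. EX N. good v N \<kappa>)" for v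
 have val: "EX N. good v N (val v)" if v: "v \<in> topspace X" "coord v = 0" for v
 proof -
  obtain N \<kappa> where "openin X N" "v \<in> N" "!!m. m \<in> N ==> m ~= v ==> coord m ~= 0"
   "!!m. m \<in> N ==> m ~= v ==> ?j v m = \<kappa>" by (rule kernel_constant_at_vertex[OF k v]) blast
  hence "good v N \<kappa>" by (simp add: good_def)
  hence "EX \<kappa> N. good v N \<kappa>" by blast
  thus ?thesis unfolding val_def by (rule someI_ex)
 qed
 define f where "f m = (if coord m = 0 then - val m else 0)" for m
 show ?thesis
 proof
  fix c :: "real => 'a" assume c: "cpath X c"
  have z: "germ_cocycle X (%_ _. 0)" unfolding germ_cocycle_def by auto
  have "path_int ?j c = path_int (%_ _. 0) c + f (c 1) - f (c 0)"
  proof (rule path_int_shift[OF z c])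
   fix x assume x: "x \<in> topspace X"
   show "EX N. openin X N & x \<in> N & (ALL y:N. ?j x y = 0 + f y - f x)"
   proof (cases "coord x = 0")
    case True
    obtain N where "good x N (val x)" using val[OF x True] by blast
    thus ?thesis using True unfolding good_def by (intro exI[of _ N]) (auto simp: f_def jump_def)
   next
    case False
    obtain d s where s: "edge_sheet x d s" using edge_sheet_exists[OF x False] by blast
    have "coord y ~= 0" if "y \<in> s ` ball (coord x) d" for y using nonvertex_sheet[OF s] that by blast
    hence "?j x y = 0 + f y - f x" if "y \<in> s ` ball (coord x) d" for y using False that by (simp add: f_def jump_def)
    thus ?thesis using edge_sheetD(6,8)[OF s] by blast
   qed
  qed
  moreover have "path_int (%_ _. 0) c = 0" using path_int_eq[of "%_ _. 0" c "%_. 0"] by (simp add: primitive_along_def gt_ex)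
  ultimately show "path_int ?j c = f (c 1) - f (c 0)" by simp
 qed
qed

text \<open>
  An invariant function on the fibre extends to a locally constant function on the connected
  surface.
\<close>

lemma invariant_constant:
 fixes g :: "'a => complex"
 assumes X: "connected_space X" and g: "!!q. q \<in> fibre ==> g (right q) = g q" "!!q. q \<in> fibre ==> g (up q) = g q"
  and q: "q \<in> fibre" "q' \<in> fibre"
 shows "g q = g q'"
proof -
 have bal: "balanced (%_. 0) (%_. 0) g" using g monodromy_in_fibre by (simp add: balanced_def)
 let ?j = "jump (%_. 0) (%_. 0) g"
 have jv: "?j v m = g (label m)" if "coord v = 0" "m \<in> topspace X" "coord m ~= 0" for v m
  using that g label_in_fibre[OF that(2,3)] monodromy_in_fibre[OF label_in_fibre[OF that(2,3)]] by (simp add: jump_def corner_def)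
 define good where "good v N \<kappa> \<longleftrightarrow> openin X N & v \<in> N & (ALL m:N. m ~= v --> coord m ~= 0) & (ALL m:N. m ~= v --> ?j v m = \<kappa>)"
  for v N \<kappa>
 define val where "val v = (SOME \<kappa>. EX N. good v N \<kappa>)" for v
 have val: "EX N. good v N (val v)" if v: "v \<in> topspace X" "coord v = 0" for v
 proof -
  obtain N \<kappa> where "openin X N" "v \<in> N" "!!m. m \<in> N ==> m ~= v ==> coord m ~= 0"
   "!!m. m \<in> N ==> m ~= v ==> ?j v m = \<kappa>" by (rule kernel_constant_at_vertex[OF bal v]) blast
  hence "good v N \<kappa>" by (simp add: good_def)
  hence "EX \<kappa> N. good v N \<kappa>" by blast
  thus ?thesis unfolding val_def by (rule someI_ex)
 qed
 define F where "F m = (if coord m = 0 then val m else g (label m))" for m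
 have "F q = F q'"
 proof (rule connectedin_locally_constant[where f = F and S = "topspace X" and X = X])
  show "connectedin X (topspace X)" using X by (simp add: connectedin_topspace)
  show "q \<in> topspace X" "q' \<in> topspace X" using q fibreD by auto
  fix x assume x: "x \<in> topspace X"
  show "EX N. openin X N & x \<in> N & (ALL w:N Int topspace X. F w = F x)"
  proof (cases "coord x = 0")
   case True
   obtain N where N: "good x N (val x)" using val[OF x True] by blast
   have "F w = F x" if "w \<in> N Int topspace X" for w
   proof (cases "w = x")
    case False
    hence "coord w ~= 0" "?j x w = val x" using N that by (auto simp: good_def)
    thus ?thesis using jv[OF True, of w] that True by (simp add: F_def)
   qed simp
   thus ?thesis using N unfolding good_def by blast
  next
   case False
   obtain d s where s: "edge_sheet x d s" using edge_sheet_exists[OF x False] by blast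
   have "F w = F x" if w: "w \<in> s ` ball (coord x) d" for w
   proof -
    obtain y where y: "y \<in> ball (coord x) d" "w = s y" using w by blast
    have wX: "w \<in> topspace X" "coord w ~= 0" using nonvertex_sheet[OF s y(1)] y(2) by auto
    note lw = label_in_fibre[OF wX]
    from s y(1) have "g (label w) = g (label x)" by (cases rule: edge_sheet_cases) (use g[OF lw] y(2) in auto)
    thus ?thesis using wX False by (simp add: F_def)
   qed
   thus ?thesis using edge_sheetD(6,8)[OF s] by blast
  qed
 qed
 moreover have "coord q'' ~= 0 & label q'' = q''" if "q'' \<in> fibre" for q''
  using place(3,4)[OF that center_in] place_center[OF that] center_in by simp
 ultimately show ?thesis using q by (simp add: F_def)
qed

lemma fibre_nonempty: "fibre ~= {}"
proof -
 have "torus_class center \<in> p ` topspace X" by (simp add: surj_p topspace_torus)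
 thus ?thesis by (auto simp: fibre_def)
qed

text \<open>The fibre is closed and discrete in a compact space.\<close>

lemma finite_fibre:
 assumes X: "compact_space X"
 shows "finite fibre"
proof -
 have c0: "coord q = center" "coord q ~= 0" if "q \<in> fibre" for q
  using place(3)[OF that center_in] place_center[OF that] center_in by auto
 have "EX N. openin X N & q \<in> N & N Int fibre \<subseteq> {q}" if q: "q \<in> fibre" for q
 proof -
  obtain d s where s: "edge_sheet q d s" using edge_sheet_exists[OF fibreD(1)[OF q] c0(2)[OF q]] by blast
  have "w = q" if w: "w \<in> s ` ball (coord q) d" "w \<in> fibre" for w
  proof -
   obtain y where y: "y \<in> ball (coord q) d" "w = s y" using w(1) by blast
   have "torus_class y = torus_class (coord q)"
    using lift_onD(2)[OF edge_sheetD(4)[OF s] y(1)] y(2) fibreD(2)[OF w(2)] c0(1)[OF q] by simp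
   hence "y = coord q" by (rule small_difference_eq; unfold abs_less_iff) (use ball_bounds[OF y(1) edge_sheetD(2)[OF s]] in auto)
   thus ?thesis using y(2) edge_sheetD(5)[OF s] by simp
  qed
  thus ?thesis using edge_sheetD(6,8)[OF s] by blast
 qed
 hence "ALL q:fibre. EX N. openin X N & q \<in> N & N Int fibre \<subseteq> {q}" by blast
 then obtain N where N: "ALL q:fibre. openin X (N q) & q \<in> N q & N q Int fibre \<subseteq> {q}" by (rule bchoice[THEN exE])
 define R where "R = {m \<in> topspace X. p m \<in> range torus_class - {torus_class center}}"
 have "open (torus_class -` (range torus_class - {torus_class center}))"
 proof -
  have eq: "torus_class -` (range torus_class - {torus_class center}) = - ((%x. center + x) ` lattice)"
  proof (rule Set.set_eqI)
   fix x
   have "x \<in> (%x. center + x) ` lattice \<longleftrightarrow> x - center \<in> lattice"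
    by (auto intro!: image_eqI[of _ _ "x - center"])
   thus "x \<in> torus_class -` (range torus_class - {torus_class center}) \<longleftrightarrow> x \<in> - ((%x. center + x) ` lattice)"
    by (auto simp: torus_class_eq_iff)
  qed
  show ?thesis unfolding eq by (simp add: open_Compl closed_translation closed_lattice)
 qed
 hence "openin torus (range torus_class - {torus_class center})" by (simp add: openin_torus)
 hence Ro: "openin X R" unfolding R_def by (rule openin_continuous_map_preimage[OF continuous_p])
 have pm: "p m \<in> range torus_class" if "m \<in> topspace X" for m using surj_p that by (auto simp: topspace_torus)
 have cov: "topspace X \<subseteq> \<Union>(insert R (N ` fibre))"
 proof
  fix m assume m: "m \<in> topspace X"
  show "m \<in> \<Union>(insert R (N ` fibre))"
  proof (cases "m \<in> fibre")
   case True thus ?thesis using N by blast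
  next
   case False thus ?thesis using m pm[OF m] by (simp add: R_def fibre_def)
  qed
 qed
 obtain \<F> where F: "finite \<F>" "\<F> \<subseteq> insert R (N ` fibre)" "topspace X \<subseteq> \<Union>\<F>"
 proof -
  have op: "ALL U:insert R (N ` fibre). openin X U" using Ro N by simp
  show ?thesis using spec[OF X[unfolded compact_space_alt], of "insert R (N ` fibre)"] op cov that by blast
 qed
 have "fibre \<subseteq> (\<Union>A\<in>\<F> - {R}. A Int fibre)"
 proof
  fix q assume q: "q \<in> fibre"
  then obtain A where "A \<in> \<F>" "q \<in> A" using F(3) fibreD(1) by blast
  moreover have "q \<notin> R" using q by (simp add: R_def fibre_def)
  ultimately show "q \<in> (\<Union>A\<in>\<F> - {R}. A Int fibre)" using q by blast
 qed
 moreover have "finite (A Int fibre)" if "A \<in> \<F> - {R}" for A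
 proof -
  obtain q where "q \<in> fibre" "A = N q" using F(2) \<open>A \<in> \<F> - {R}\<close> by blast
  hence "A Int fibre \<subseteq> {q}" using N by blast
  thus ?thesis by (rule finite_subset) simp
 qed
 hence "finite (\<Union>A\<in>\<F> - {R}. A Int fibre)" using F(1) by (intro finite_UN_I) auto
 ultimately show ?thesis by (rule finite_subset)
qed

end

section \<open>Finite-dimensional linear algebra\<close>

locale complex_space = vector_space scale
 for scale :: "complex => 'b::ab_group_add => 'b"
begin

sublocale endo: vector_space_pair scale scale ..
sublocale dual: vector_space_pair scale "(*) :: complex => complex => complex" ..

definition fin_dim :: "'b set => bool"
 where "fin_dim S \<longleftrightarrow> (EX B. finite B & S \<subseteq> span B)"

lemma fin_dim_subset: "fin_dim T ==> S \<subseteq> T ==> fin_dim S" unfolding fin_dim_def by blast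

lemma fin_dim_basis:
 assumes "fin_dim S" "subspace S"
 obtains B where "finite B" "B \<subseteq> S" "independent B" "span B = S" "dim S = card B"
proof -
 obtain B where B: "B \<subseteq> S" "independent B" "S \<subseteq> span B" "card B = dim S" using basis_exists[of S] by metis
 obtain C where C: "finite C" "S \<subseteq> span C" using assms(1) by (auto simp: fin_dim_def)
 have "finite B" using independent_span_bound[OF C(1) B(2)] B(1) C(2) by blast
 moreover have "span B = S" using B(1,3) assms(2) span_minimal by blast
 ultimately show ?thesis using that B by metis
qed

lemma fin_dim_extend_basis:
 assumes "fin_dim S" "subspace S" "independent A" "A \<subseteq> S"
 obtains B where "finite B" "A \<subseteq> B" "B \<subseteq> S" "independent B" "span B = S" "dim S = card B"
proof -
 obtain B where B: "A \<subseteq> B" "B \<subseteq> S" "independent B" "S \<subseteq> span B"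
  using maximal_independent_subset_extend[OF assms(4,3)] by metis
 obtain C where C: "finite C" "S \<subseteq> span C" using assms(1) by (auto simp: fin_dim_def)
 have fB: "finite B" using independent_span_bound[OF C(1) B(3)] B(2) C(2) by blast
 moreover have sB: "span B = S" using B(2,4) assms(2) span_minimal by blast
 moreover have "dim S = card B" using dim_eq_card_independent[OF B(3)] sB dim_span[of B] by simp
 ultimately show ?thesis using that B by metis
qed

lemma dim_subspace_mono:
 assumes "fin_dim T" "subspace T" "subspace S" "S \<subseteq> T"
 shows "dim S <= dim T" "dim S = dim T ==> S = T"
proof -
 obtain A where A: "finite A" "A \<subseteq> S" "independent A" "span A = S" "dim S = card A"
  by (rule fin_dim_basis[OF fin_dim_subset[OF assms(1,4)] assms(3)])
 obtain B where B: "finite B" "A \<subseteq> B" "B \<subseteq> T" "independent B" "span B = T" "dim T = card B"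
  by (rule fin_dim_extend_basis[OF assms(1,2) A(3)]) (use A(2) assms(4) in auto)
 show "dim S <= dim T" using A(5) B(1,2,6) card_mono by simp
 show "S = T" if "dim S = dim T" using card_subset_eq[OF B(1,2)] that A(4,5) B(5,6) by simp
qed

lemma projection_exists:
 assumes "subspace S"
 obtains P where "Vector_Spaces.linear scale scale P" "range P \<subseteq> S" "!!x. x \<in> S ==> P x = x"
 using endo.linear_exists_left_inverse_on[OF linear_id assms] by auto

text \<open>
  Maschke's theorem for a group that acts linearly on a subspace: averaging a linear projection
  over the group makes it equivariant.
\<close>

lemma maschke:
 fixes G :: "('g, 'm) monoid_scheme"
 assumes G: "group G" "finite (carrier G)" and S: "subspace S" and Y: "subspace Y" "Y \<subseteq> S"
  and act: "!!g x. g \<in> carrier G ==> x \<in> S ==> act g x \<in> S"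
  and add: "!!g x y. g \<in> carrier G ==> x \<in> S ==> y \<in> S ==> act g (x + y) = act g x + act g y"
  and scl: "!!g x a. g \<in> carrier G ==> x \<in> S ==> act g (scale a x) = scale a (act g x)"
  and one: "!!x. x \<in> S ==> act \<one>\<^bsub>G\<^esub> x = x"
  and mul: "!!g h x. g \<in> carrier G ==> h \<in> carrier G ==> x \<in> S ==> act (g \<otimes>\<^bsub>G\<^esub> h) x = act g (act h x)"
  and inv: "!!g x. g \<in> carrier G ==> x \<in> Y ==> act g x \<in> Y"
 obtains Y' where "subspace Y'" "Y' \<subseteq> S" "!!g x. g \<in> carrier G ==> x \<in> Y' ==> act g x \<in> Y'"
  "Y Int Y' = {0}" "!!x. x \<in> S ==> EX y:Y. EX y':Y'. x = y + y'"
proof -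
 interpret G: group G by (rule G(1))
 obtain P where P: "Vector_Spaces.linear scale scale P" "range P \<subseteq> Y" "!!x. x \<in> Y ==> P x = x"
  by (rule projection_exists[OF Y(1)]) blast
 have PY: "P x \<in> Y" for x using P(2) by blast
 have PS: "P x \<in> S" for x using PY Y(2) by blast
 define n where "n = (of_nat (card (carrier G)) :: complex)"
 have n: "n ~= 0" using G(2) G.one_closed by (auto simp: n_def)
 define A where "A x = (\<Sum>g\<in>carrier G. act g (P (act (inv\<^bsub>G\<^esub> g) x)))" for x
 have AY: "A x \<in> Y" for x unfolding A_def by (intro subspace_sum Y(1) inv PY)
 have Aadd: "A (x + y) = A x + A y" if "x \<in> S" "y \<in> S" for x y unfolding A_def sum.distrib[symmetric]
  by (rule sum.cong) (use that in \<open>auto simp: add act PS endo.linear_add[OF P(1)]\<close>)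
 have Ascl: "A (scale a x) = scale a (A x)" if "x \<in> S" for x a unfolding A_def scale_sum_right
  by (rule sum.cong) (use that in \<open>auto simp: scl act PS endo.linear_scale[OF P(1)]\<close>)
 have AYid: "A y = scale n y" if y: "y \<in> Y" for y
 proof -
  have "act g (P (act (inv\<^bsub>G\<^esub> g) y)) = y" if g: "g \<in> carrier G" for g
  proof -
   have "P (act (inv\<^bsub>G\<^esub> g) y) = act (inv\<^bsub>G\<^esub> g) y" using inv[OF G.inv_closed[OF g] y] by (rule P(3))
   thus ?thesis using mul[of g "inv\<^bsub>G\<^esub> g" y] one g y Y(2) by auto
  qed
  hence "A y = (\<Sum>g\<in>carrier G. y)" by (simp add: A_def)
  thus ?thesis by (simp add: n_def sum_constant_scale)
 qed
 have Aact: "A (act h x) = act h (A x)" if h: "h \<in> carrier G" and x: "x \<in> S" for h x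
 proof -
  have act_sum: "act h (\<Sum>i\<in>I. f i) = (\<Sum>i\<in>I. act h (f i))" if "finite I" "!!i. i \<in> I ==> f i \<in> S" for I and f :: "'g => 'b"
   using that
  proof (induction I rule: finite_induct)
   case empty
   have "act h (scale 0 0) = scale 0 (act h 0)" using subspace_0[OF S] by (rule scl[OF h])
   thus ?case by simp
  next
   case (insert i I)
   have "sum f I \<in> S" by (rule subspace_sum[OF S]) (use insert.prems in blast)
   moreover have "f i \<in> S" using insert.prems by blast
   ultimately
   show ?case using add[OF h] insert by simp
  qed
  have "A (act h x) = (\<Sum>g\<in>carrier G. act (h \<otimes>\<^bsub>G\<^esub> g) (P (act (inv\<^bsub>G\<^esub> (h \<otimes>\<^bsub>G\<^esub> g)) (act h x))))"
   unfolding A_def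
   by (rule sum.reindex_bij_witness[of _ "%g. h \<otimes>\<^bsub>G\<^esub> g" "%g. inv\<^bsub>G\<^esub> h \<otimes>\<^bsub>G\<^esub> g"])
     (use h in \<open>auto simp: G.m_assoc[symmetric]\<close>)
  also have "... = (\<Sum>g\<in>carrier G. act h (act g (P (act (inv\<^bsub>G\<^esub> g) x))))"
  proof (rule sum.cong[OF refl])
   fix g assume g: "g \<in> carrier G"
   have "act (inv\<^bsub>G\<^esub> (h \<otimes>\<^bsub>G\<^esub> g)) (act h x) = act (inv\<^bsub>G\<^esub> (h \<otimes>\<^bsub>G\<^esub> g) \<otimes>\<^bsub>G\<^esub> h) x"
    using mul[of "inv\<^bsub>G\<^esub> (h \<otimes>\<^bsub>G\<^esub> g)" h x] g h x by simp
   also have "inv\<^bsub>G\<^esub> (h \<otimes>\<^bsub>G\<^esub> g) \<otimes>\<^bsub>G\<^esub> h = inv\<^bsub>G\<^esub> g"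
    using g h by (simp add: G.inv_mult_group G.m_assoc)
   finally show "act (h \<otimes>\<^bsub>G\<^esub> g) (P (act (inv\<^bsub>G\<^esub> (h \<otimes>\<^bsub>G\<^esub> g)) (act h x))) = act h (act g (P (act (inv\<^bsub>G\<^esub> g) x)))"
    using mul[OF h g PS] by simp
  qed
  also have "... = act h (A x)" unfolding A_def by (rule act_sum[symmetric]) (use G(2) act PS in auto)
  finally show ?thesis .
 qed
 define Y' where "Y' = {x \<in> S. A x = 0}"
 have A0: "A 0 = 0" using Ascl[OF subspace_0[OF S], of 0] by simp
 show ?thesis
 proof
  show "subspace Y'" unfolding subspace_def Y'_def
   using A0 Aadd Ascl subspace_0[OF S] subspace_add[OF S] subspace_scale[OF S] by auto
  show "Y' \<subseteq> S" by (auto simp: Y'_def)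
  show "act g x \<in> Y'" if "g \<in> carrier G" "x \<in> Y'" for g x
  proof -
   have "act g (scale 0 0) = scale 0 (act g 0)" using that(1) subspace_0[OF S] by (rule scl)
   thus ?thesis using that Aact[of g x] act by (auto simp: Y'_def)
  qed
  show "Y Int Y' = {0}"
  proof
   show "Y Int Y' \<subseteq> {0}" using AYid n by (auto simp: Y'_def)
   show "{0} \<subseteq> Y Int Y'" using A0 subspace_0[OF S] subspace_0[OF Y(1)] by (auto simp: Y'_def)
  qed
  show "EX y:Y. EX y':Y'. x = y + y'" if x: "x \<in> S" for x
  proof -
   let ?y = "scale (inverse n) (A x)"
   have y: "?y \<in> Y" by (rule subspace_scale[OF Y(1) AY])
   hence yS: "?y \<in> S" using Y(2) by blast
   have "A (x + - ?y) = A x + A (- ?y)" by (rule Aadd[OF x subspace_neg[OF S yS]])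
   moreover have "A (- ?y) = - A ?y" using Ascl[OF yS, of "-1"] by simp
   ultimately have "A (x - ?y) = A x - A ?y" by simp
   also have "... = 0" using AYid[OF y] n by simp
   finally have "x - ?y \<in> Y'" using subspace_diff[OF S x yS] by (simp add: Y'_def)
   thus ?thesis using y by (intro bexI[of _ ?y] bexI[of _ "x - ?y"]) auto
  qed
 qed
qed

end

context vector_space_pair
begin

lemma rank_nullity:
 assumes f: "Vector_Spaces.linear s1 s2 f" and S: "vs1.subspace S" and fin: "finite C" "S \<subseteq> vs1.span C"
 shows "vs1.dim S = vs2.dim (f ` S) + vs1.dim {x \<in> S. f x = 0}"
proof -
 let ?K = "{x \<in> S. f x = 0}"
 have K: "vs1.subspace ?K" using S linear_0[OF f] linear_add[OF f] linear_scale[OF f] by (auto simp: vs1.subspace_def)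
 obtain A where A: "A \<subseteq> ?K" "vs1.independent A" "?K \<subseteq> vs1.span A" "card A = vs1.dim ?K"
  by (rule vs1.basis_exists[of ?K])
 have AS: "A \<subseteq> S" using A(1) by blast
 obtain B where B: "A \<subseteq> B" "B \<subseteq> S" "vs1.independent B" "S \<subseteq> vs1.span B"
  by (rule vs1.maximal_independent_subset_extend[OF AS A(2)])
 have fB: "finite B" using vs1.independent_span_bound[OF fin(1) B(3)] B(2) fin(2) by blast
 have sB: "vs1.span B = S" using B(2,4) S vs1.span_minimal by blast
 have dS: "vs1.dim S = card B" using vs1.dim_eq_card_independent[OF B(3)] sB vs1.dim_span[of B] by simp
 let ?D = "B - A"
 have zero: "x = 0" if x: "x \<in> vs1.span ?D" and fx: "f x = 0" for x
 proof -
  have "x \<in> S" using x vs1.span_mono[of ?D B] sB by blast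
  hence "x \<in> vs1.span A" using fx A(3) by blast
  then obtain u where u: "x = (\<Sum>v\<in>A. s1 (u v) v)" using vs1.span_finite[OF finite_subset[OF B(1) fB]] by auto
  obtain w where w: "x = (\<Sum>v\<in>?D. s1 (w v) v)" using x vs1.span_finite[OF finite_Diff[OF fB, of A]] by auto
  define c where "c v = (if v \<in> A then u v else - w v)" for v
  have "(\<Sum>v\<in>B. s1 (c v) v) = (\<Sum>v\<in>?D. s1 (c v) v) + (\<Sum>v\<in>A. s1 (c v) v)"
   by (rule sum.subset_diff[OF B(1) fB])
  also have "(\<Sum>v\<in>A. s1 (c v) v) = x" unfolding u by (rule sum.cong) (auto simp: c_def)
  also have "(\<Sum>v\<in>?D. s1 (c v) v) = - x" unfolding w sum_negf[symmetric] by (rule sum.cong) (auto simp: c_def)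
  finally have "(\<Sum>v\<in>B. s1 (c v) v) = 0" by simp
  hence cz: "c v = 0" if "v \<in> B" for v using vs1.independentD[OF B(3) fB subset_refl] that by blast
  have "u v = 0" if v: "v \<in> A" for v using cz[of v] v B(1) by (auto simp: c_def)
  thus ?thesis by (simp add: u)
 qed
 have inj: "inj_on f (vs1.span ?D)"
 proof (rule inj_onI)
  fix x y assume xy: "x \<in> vs1.span ?D" "y \<in> vs1.span ?D" "f x = f y"
  hence "f (x - y) = 0" by (simp add: linear_diff[OF f])
  hence "x - y = 0" using zero vs1.span_diff[OF xy(1,2)] by blast
  thus "x = y" by simp
 qed
 have ind: "vs2.independent (f ` ?D)" using linear_independent_injective_image[OF f _ inj] vs1.independent_mono[OF B(3)] by blast
 have "f ` S = vs2.span (f ` ?D)"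
 proof -
  have "f ` S = vs2.span (f ` B)" using linear_span_image[OF f, of B] sB by simp
  also have "f ` B \<subseteq> insert 0 (f ` ?D)" using A(1) by auto
  hence "vs2.span (f ` B) = vs2.span (f ` ?D)" by (metis Diff_subset image_mono subset_antisym vs2.span_insert_0 vs2.span_mono)
  finally show ?thesis .
 qed
 hence "vs2.dim (f ` S) = card (f ` ?D)" using vs2.dim_span_eq_card_independent[OF ind] by simp
 also have "... = card ?D" by (rule card_image) (use inj vs1.span_superset[of ?D] in \<open>blast intro: inj_on_subset\<close>)
 finally show ?thesis using dS A(4) B(1) fB finite_subset[OF B(1) fB] card_mono[OF fB B(1)] by (simp add: card_Diff_subset)
qed

end

section \<open>Functions as a complex vector space\<close>

definition fscale :: "complex => ('k => complex) => 'k => complex"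
 where "fscale c f = (%x. c * f x)"

interpretation fn: complex_space fscale by unfold_locales (auto simp: fscale_def algebra_simps fun_eq_iff)

interpretation fn_fn: vector_space_pair fscale fscale ..

lemma fscale_apply [simp]: "fscale c f x = c * f x" by (simp add: fscale_def)

definition funs_on :: "'k set => ('k => complex) set"
 where "funs_on S = {f. ALL x. x \<notin> S --> f x = 0}"

lemma subspace_funs_on: "fn.subspace (funs_on S)" by (auto simp: fn.subspace_def funs_on_def)

definition delta :: "'k => 'k => complex" where "delta q = (%x. if x = q then 1 else 0)"

lemma delta_in_funs_on: "q \<in> S ==> delta q \<in> funs_on S" by (auto simp: delta_def funs_on_def)

lemma sum_fun_apply: "(\<Sum>i\<in>I. f i) x = (\<Sum>i\<in>I. f i x)" for f :: "'i => 'k => complex"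
 by (induction I rule: infinite_finite_induct) auto

lemma funs_on_expand:
 assumes "finite S" "f \<in> funs_on S"
 shows "f = (\<Sum>q\<in>S. fscale (f q) (delta q))"
proof
 fix x
 show "f x = (\<Sum>q\<in>S. fscale (f q) (delta q)) x"
  using assms by (auto simp: sum_fun_apply delta_def funs_on_def if_distrib sum.delta cong: if_cong)
qed

lemma fin_dim_funs_on: assumes "finite S" shows "fn.fin_dim (funs_on S)"
proof -
 have "funs_on S \<subseteq> fn.span (delta ` S)"
 proof
  fix f assume "f \<in> funs_on S"
  hence "f = (\<Sum>q\<in>S. fscale (f q) (delta q))" by (rule funs_on_expand[OF assms])
  moreover have "... \<in> fn.span (delta ` S)" by (intro fn.span_sum fn.span_scale fn.span_base) auto
  ultimately show "f \<in> fn.span (delta ` S)" by simp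
 qed
 thus ?thesis using assms unfolding fn.fin_dim_def by blast
qed

section \<open>The group algebra\<close>

lemma complex_ring_simps [simp]: "carrier complex_ring = UNIV" "a \<oplus>\<^bsub>complex_ring\<^esub> b = a + b"
 "a \<otimes>\<^bsub>complex_ring\<^esub> b = a * b" "\<one>\<^bsub>complex_ring\<^esub> = 1" "\<zero>\<^bsub>complex_ring\<^esub> = 0"
 by (simp_all add: complex_ring_def)

definition lact :: "'g monoid => 'g => ('g => complex) => 'g => complex"
 where "lact G g x = (%k. if k \<in> carrier G then x (inv\<^bsub>G\<^esub> g \<otimes>\<^bsub>G\<^esub> k) else 0)"

text \<open>
  Convolution, the product of the group algebra, whose elements are functions on the group.
\<close>

definition conv :: "'g monoid => ('g => complex) => ('g => complex) => 'g => complex"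
 where "conv G x y = (\<Sum>g\<in>carrier G. fscale (x g) (lact G g y))"

definition galg :: "'g monoid => (complex, 'v) module => ('g => 'v => 'v) => ('g => complex) => 'v => 'v"
 where "galg G V \<rho> x v = finsum V (%g. x g \<odot>\<^bsub>V\<^esub> \<rho> g v) (carrier G)"

locale finite_group = group G for G :: "'g monoid" +
 assumes finite_carrier: "finite (carrier G)"
begin

abbreviation GA :: "('g => complex) set" where "GA \<equiv> funs_on (carrier G)"

lemma lact_in: "lact G g x \<in> GA" by (simp add: lact_def funs_on_def)

lemma lact_add: "lact G g (x + y) = lact G g x + lact G g y"
 and lact_scale: "lact G g (fscale a x) = fscale a (lact G g x)" by (auto simp: lact_def fun_eq_iff)

lemma lact_one: "x \<in> GA ==> lact G \<one>\<^bsub>G\<^esub> x = x" by (auto simp: lact_def funs_on_def fun_eq_iff)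

lemma lact_mult: "g \<in> carrier G ==> h \<in> carrier G ==> lact G (g \<otimes>\<^bsub>G\<^esub> h) x = lact G g (lact G h x)"
 by (auto simp: lact_def fun_eq_iff inv_mult_group m_assoc)

lemma lact_delta: "g \<in> carrier G ==> lact G g (delta \<one>\<^bsub>G\<^esub>) = delta g"
proof
 fix k assume g: "g \<in> carrier G"
 have "inv\<^bsub>G\<^esub> g \<otimes>\<^bsub>G\<^esub> k = \<one>\<^bsub>G\<^esub> \<longleftrightarrow> k = g" if "k \<in> carrier G"
  using g that inv_equality inv_inv l_inv by (metis inv_closed inv_solve_left' r_one)
 thus "lact G g (delta \<one>\<^bsub>G\<^esub>) k = delta g k" using g by (auto simp: lact_def delta_def)
qed

lemma conv_in: "conv G x y \<in> GA" unfolding conv_def by (intro fn.subspace_sum subspace_funs_on fn.subspace_scale lact_in)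

lemma conv_add_left: "conv G (x + y) z = conv G x z + conv G y z"
 unfolding conv_def by (simp add: fn.scale_left_distrib sum.distrib)

lemma conv_scale_left: "conv G (fscale a x) z = fscale a (conv G x z)" unfolding conv_def by (simp add: fn.scale_sum_right)

lemma conv_add_right: "conv G x (y + z) = conv G x y + conv G x z"
 unfolding conv_def by (simp add: lact_add fn.scale_right_distrib sum.distrib)

lemma conv_one: "x \<in> GA ==> conv G x (delta \<one>\<^bsub>G\<^esub>) = x"
 using funs_on_expand[OF finite_carrier, of x] by (simp add: conv_def lact_delta)

end

locale finite_rep = finite_group G for G :: "'g monoid" +
 fixes V :: "(complex, 'v) module" (structure) and \<rho> :: "'g => 'v => 'v"
 assumes rep: "representation G V \<rho>"
begin

sublocale V: module complex_ring V using rep by (simp add: representation_def)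

lemma rho_closed [simp]: "g \<in> carrier G ==> v \<in> carrier V ==> \<rho> g v \<in> carrier V"
 and rho_add: "g \<in> carrier G ==> v \<in> carrier V ==> w \<in> carrier V ==> \<rho> g (v \<oplus> w) = \<rho> g v \<oplus> \<rho> g w"
 and rho_smult: "g \<in> carrier G ==> v \<in> carrier V ==> \<rho> g (a \<odot> v) = a \<odot> \<rho> g v"
 and rho_one: "v \<in> carrier V ==> \<rho> \<one>\<^bsub>G\<^esub> v = v"
 and rho_mult: "g \<in> carrier G ==> h \<in> carrier G ==> v \<in> carrier V ==> \<rho> (g \<otimes>\<^bsub>G\<^esub> h) v = \<rho> g (\<rho> h v)"
 using rep unfolding representation_def linear_maps_def by (auto simp: Pi_iff)

abbreviation alg where "alg \<equiv> galg G V \<rho>"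

lemma term_in: "v \<in> carrier V ==> (%g. x g \<odot> \<rho> g v) \<in> carrier G \<rightarrow> carrier V"
 by (auto intro: V.smult_closed)

lemma alg_closed [simp]: "v \<in> carrier V ==> alg x v \<in> carrier V"
 unfolding galg_def by (rule V.M.finsum_closed[OF term_in])

lemma alg_add: assumes "v \<in> carrier V" shows "alg (x + y) v = alg x v \<oplus> alg y v"
proof -
 have "alg (x + y) v = finsum V (%g. x g \<odot> \<rho> g v \<oplus> y g \<odot> \<rho> g v) (carrier G)"
  unfolding galg_def using assms V.smult_l_distr by (intro V.M.finsum_cong') (auto intro!: V.smult_closed V.M.add.m_closed)
 also have "... = alg x v \<oplus> alg y v" unfolding galg_def by (rule V.M.finsum_addf[OF term_in[OF assms] term_in[OF assms]])
 finally show ?thesis .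
qed

lemma alg_scale: assumes "v \<in> carrier V" shows "alg (fscale a x) v = a \<odot> alg x v"
proof -
 have "a \<odot> alg x v = finsum V (%g. a \<odot> (x g \<odot> \<rho> g v)) (carrier G)"
  unfolding galg_def by (rule V.finsum_smult_ldistr[OF finite_carrier _ term_in[OF assms]]) simp
 also have "... = alg (fscale a x) v" unfolding galg_def using assms V.smult_assoc1
  by (intro V.M.finsum_cong') (auto intro!: V.smult_closed)
 finally show ?thesis by simp
qed

lemma alg_zero: "v \<in> carrier V ==> alg 0 v = \<zero>"
 using alg_scale[of v 0 0] V.smult_l_null[of "alg 0 v"] by (simp add: fn.scale_zero_left)

lemma alg_sum:
 assumes "v \<in> carrier V" "finite I"
 shows "alg (\<Sum>i\<in>I. x i) v = finsum V (%i. alg (x i) v) I" using assms(2)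
proof (induction I rule: finite_induct)
 case empty
 show ?case by (simp only: sum.empty V.M.finsum_empty alg_zero[OF assms(1)])
next
 case (insert i I)
 have "alg (\<Sum>i\<in>insert i I. x i) v = alg (x i) v \<oplus> alg (\<Sum>i\<in>I. x i) v"
  by (simp only: sum.insert[OF insert.hyps] alg_add[OF assms(1)])
 also have "... = finsum V (%i. alg (x i) v) (insert i I)"
  unfolding insert.IH by (rule V.M.finsum_insert[OF insert.hyps, symmetric]) (use assms(1) in auto)
 finally show ?case .
qed

lemma alg_delta: assumes "v \<in> carrier V" "g \<in> carrier G" shows "alg (delta g) v = \<rho> g v"
proof -
 have "alg (delta g) v = finsum V (%h. if g = h then \<rho> h v else \<zero>) (carrier G)" unfolding galg_def
  by (rule V.M.finsum_cong') (use assms V.smult_one V.smult_l_null in \<open>auto simp: delta_def\<close>)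
 also have "... = \<rho> g v" by (rule V.M.finsum_singleton[OF assms(2) finite_carrier]) (use assms in auto)
 finally show ?thesis .
qed

lemma rho_finsum:
 assumes g: "g \<in> carrier G" and "finite I" "f \<in> I \<rightarrow> carrier V"
 shows "\<rho> g (finsum V f I) = finsum V (%i. \<rho> g (f i)) I" using assms(2,3)
proof (induction I rule: finite_induct)
 case empty
 have "\<rho> g (0 \<odot> \<zero>) = 0 \<odot> \<rho> g \<zero>" by (rule rho_smult[OF g]) simp
 thus ?case using V.smult_l_null[of "\<rho> g \<zero>"] V.smult_l_null[of "\<zero>"] g by simp
next
 case (insert i I)
 have fi: "f i \<in> carrier V" "f \<in> I \<rightarrow> carrier V" using insert.prems by auto
 have "finsum V f I \<in> carrier V" by (rule V.M.finsum_closed[OF fi(2)])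
 moreover have "(%i. \<rho> g (f i)) \<in> I \<rightarrow> carrier V" using fi(2) rho_closed[OF g] by (auto simp: Pi_iff)
 ultimately show ?case using insert fi rho_add[OF g] g by simp
qed

lemma rho_alg:
 assumes g: "g \<in> carrier G" and v: "v \<in> carrier V"
 shows "\<rho> g (alg x v) = alg (lact G g x) v"
proof -
 have "\<rho> g (alg x v) = finsum V (%h. \<rho> g (x h \<odot> \<rho> h v)) (carrier G)"
  unfolding galg_def by (rule rho_finsum[OF g finite_carrier term_in[OF v]])
 also have "... = finsum V (%h. lact G g x (g \<otimes>\<^bsub>G\<^esub> h) \<odot> \<rho> (g \<otimes>\<^bsub>G\<^esub> h) v) (carrier G)"
 proof (rule V.M.finsum_cong')
  show "(%h. lact G g x (g \<otimes>\<^bsub>G\<^esub> h) \<odot> \<rho> (g \<otimes>\<^bsub>G\<^esub> h) v) \<in> carrier G \<rightarrow> carrier V"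
   using g v by (auto intro!: V.smult_closed)
  fix h assume h: "h \<in> carrier G"
  have "inv\<^bsub>G\<^esub> g \<otimes>\<^bsub>G\<^esub> (g \<otimes>\<^bsub>G\<^esub> h) = h" using g h by (simp add: m_assoc[symmetric])
  thus "\<rho> g (x h \<odot> \<rho> h v) = lact G g x (g \<otimes>\<^bsub>G\<^esub> h) \<odot> \<rho> (g \<otimes>\<^bsub>G\<^esub> h) v"
   using g h v by (simp add: rho_smult rho_mult lact_def)
 qed simp
 also have "... = finsum V (%k. lact G g x k \<odot> \<rho> k v) ((%h. g \<otimes>\<^bsub>G\<^esub> h) ` carrier G)"
  by (rule V.M.finsum_reindex[symmetric]) (use g v in \<open>auto intro!: V.smult_closed inj_onI\<close>)
 also have "(%h. g \<otimes>\<^bsub>G\<^esub> h) ` carrier G = carrier G" by (rule surj_const_mult[OF g])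
 finally show ?thesis by (simp add: galg_def)
qed

lemma alg_conv: assumes v: "v \<in> carrier V" shows "alg (conv G x y) v = alg x (alg y v)"
proof -
 have "alg (conv G x y) v = finsum V (%g. alg (fscale (x g) (lact G g y)) v) (carrier G)"
  unfolding conv_def by (rule alg_sum[OF v finite_carrier])
 also have "... = finsum V (%g. x g \<odot> \<rho> g (alg y v)) (carrier G)"
  by (rule V.M.finsum_cong') (use v in \<open>auto simp: alg_scale rho_alg[symmetric] intro!: V.smult_closed\<close>)
 finally show ?thesis by (simp add: galg_def)
qed

end

lemma intertwiner_alg:
 assumes V: "finite_rep G V \<rho>" and W: "finite_rep G W \<sigma>" and T: "T \<in> linear_maps V W"
  and eq: "!!g x. g \<in> carrier G ==> x \<in> carrier V ==> T (\<rho> g x) = \<sigma> g (T x)" and v: "v \<in> carrier V"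
 shows "T (galg G V \<rho> x v) = galg G W \<sigma> x (T v)"
proof -
 interpret V: finite_rep G V \<rho> by (rule V)
 interpret W: finite_rep G W \<sigma> by (rule W)
 have T1: "T y \<in> carrier W" if "y \<in> carrier V" for y using T that by (auto simp: linear_maps_def)
 have T2: "T (y \<oplus>\<^bsub>V\<^esub> z) = T y \<oplus>\<^bsub>W\<^esub> T z" if "y \<in> carrier V" "z \<in> carrier V" for y z
  using T that by (auto simp: linear_maps_def)
 have T3: "T (a \<odot>\<^bsub>V\<^esub> y) = a \<odot>\<^bsub>W\<^esub> T y" if "y \<in> carrier V" for y a
  using T that by (auto simp: linear_maps_def)
 have "T (finsum V f I) = finsum W (%i. T (f i)) I" if "finite I" "f \<in> I \<rightarrow> carrier V" for I and f :: "'a => 'b"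
  using that
 proof (induction I rule: finite_induct)
  case empty
  have "T (0 \<odot>\<^bsub>V\<^esub> \<zero>\<^bsub>V\<^esub>) = 0 \<odot>\<^bsub>W\<^esub> T \<zero>\<^bsub>V\<^esub>" by (rule T3) simp
  thus ?case using V.V.smult_l_null[of "\<zero>\<^bsub>V\<^esub>"] W.V.smult_l_null[of "T \<zero>\<^bsub>V\<^esub>"] T1 by simp
 next
  case (insert i I)
  have fi: "f i \<in> carrier V" "f \<in> I \<rightarrow> carrier V" using insert.prems by auto
  have "finsum V f I \<in> carrier V" by (rule V.V.M.finsum_closed[OF fi(2)])
  moreover have "(%i. T (f i)) \<in> I \<rightarrow> carrier W" using fi(2) T1 by auto
  ultimately show ?case using insert fi T2 T1 by simp
 qed
 from this[OF V.finite_carrier V.term_in[OF v]]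
 have "T (galg G V \<rho> x v) = finsum W (%g. T (x g \<odot>\<^bsub>V\<^esub> \<rho> g v)) (carrier G)" by (simp add: galg_def)
 also have "... = galg G W \<sigma> x (T v)" unfolding galg_def
  by (rule W.V.M.finsum_cong') (use v T1 in \<open>auto simp: T3 eq intro!: W.V.smult_closed\<close>)
 finally show ?thesis .
qed

section \<open>A primitive idempotent for an irreducible representation\<close>

context finite_rep
begin

lemma subrepresentationI:
 assumes "U \<subseteq> carrier V" "\<zero> \<in> U" "!!x y. x \<in> U ==> y \<in> U ==> x \<oplus> y \<in> U"
  "!!a x. x \<in> U ==> a \<odot> x \<in> U" "!!g x. g \<in> carrier G ==> x \<in> U ==> \<rho> g x \<in> U"
 shows "subrepresentation G V \<rho> U" unfolding subrepresentation_def
proof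
 show "submodule U complex_ring V"
 proof (rule V.submoduleI)
  fix a assume a: "a \<in> U"
  have "(- 1) \<odot> a \<in> U" by (rule assms(4)[OF a])
  moreover have "(- 1) \<odot> a = \<ominus> a"
  proof -
   have aV: "a \<in> carrier V" using a assms(1) by blast
   have "a \<oplus> (- 1) \<odot> a = 1 \<odot> a \<oplus> (- 1) \<odot> a" using V.smult_one[OF aV] by simp
   also have "... = (1 + (- 1)) \<odot> a" using V.smult_l_distr[of 1 "- 1" a] aV by simp
   also have "... = \<zero>" using V.smult_l_null[OF aV] by simp
   finally show ?thesis using aV V.M.minus_unique V.smult_closed[of "- 1" a]
    by (metis V.M.minus_equality V.M.a_comm complex_ring_simps(1) UNIV_I)
  qed
  ultimately show "\<ominus> a \<in> U" by simp
 qed (use assms in auto)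
 show "ALL g:carrier G. \<rho> g ` U \<subseteq> U" using assms(5) by auto
qed

lemma subrepresentationD:
 assumes "subrepresentation G V \<rho> U"
 shows "U \<subseteq> carrier V" "\<zero> \<in> U" "x \<in> U ==> y \<in> U ==> x \<oplus> y \<in> U"
  "x \<in> U ==> a \<odot> x \<in> U" "g \<in> carrier G ==> x \<in> U ==> \<rho> g x \<in> U" "x \<in> U ==> \<ominus> x \<in> U"
proof -
 have sub: "submodule U complex_ring V" using assms by (simp add: subrepresentation_def)
 note E = V.submoduleE[OF sub]
 show UV: "U \<subseteq> carrier V" by (rule E(1))
 obtain u where "u \<in> U" using E(2) by blast
 thus "\<zero> \<in> U" using E(4)[of 0 u] UV V.smult_l_null[of u] by auto
 show "x \<in> U ==> y \<in> U ==> x \<oplus> y \<in> U" "x \<in> U ==> a \<odot> x \<in> U" "x \<in> U ==> \<ominus> x \<in> U"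
  using E by auto
 show "g \<in> carrier G ==> x \<in> U ==> \<rho> g x \<in> U" using assms by (auto simp: subrepresentation_def)
qed

end

lemma finite_rep_eq_intro: "finite_group G ==> representation G V \<rho> ==> finite_rep G V \<rho>"
 by (simp add: finite_rep_def finite_rep_axioms_def)

lemma irreducible_finite_rep:
 "finite_group G ==> irreducible_representation G V \<rho> ==> finite_rep G V \<rho>"
 by (simp add: irreducible_representation_def finite_rep_eq_intro)

text \<open>Schur's lemma: the kernel and the image of an equivariant map are subrepresentations.\<close>

lemma equivariant_kernel:
 assumes V: "finite_rep G V \<rho>" and W: "finite_rep G W \<sigma>" and T: "T \<in> linear_maps V W"
  and eq: "!!g x. g \<in> carrier G ==> x \<in> carrier V ==> T (\<rho> g x) = \<sigma> g (T x)"
 shows "subrepresentation G V \<rho> {x \<in> carrier V. T x = \<zero>\<^bsub>W\<^esub>}" "subrepresentation G W \<sigma> (T ` carrier V)"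
proof -
 interpret V: finite_rep G V \<rho> by (rule V)
 interpret W: finite_rep G W \<sigma> by (rule W)
 have T1: "T y \<in> carrier W" if "y \<in> carrier V" for y using T that by (auto simp: linear_maps_def)
 have T2: "T (y \<oplus>\<^bsub>V\<^esub> z) = T y \<oplus>\<^bsub>W\<^esub> T z" if "y \<in> carrier V" "z \<in> carrier V" for y z
  using T that by (auto simp: linear_maps_def)
 have T3: "T (a \<odot>\<^bsub>V\<^esub> y) = a \<odot>\<^bsub>W\<^esub> T y" if "y \<in> carrier V" for y a
  using T that by (auto simp: linear_maps_def)
 have T0: "T \<zero>\<^bsub>V\<^esub> = \<zero>\<^bsub>W\<^esub>"
  using T3[of "\<zero>\<^bsub>V\<^esub>" 0] V.V.smult_l_null[of "\<zero>\<^bsub>V\<^esub>"] W.V.smult_l_null[of "T \<zero>\<^bsub>V\<^esub>"] T1 by simp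
 have s0: "\<sigma> g \<zero>\<^bsub>W\<^esub> = \<zero>\<^bsub>W\<^esub>" if "g \<in> carrier G" for g
  using W.rho_finsum[OF that, of "{} :: nat set" "%_. \<zero>\<^bsub>W\<^esub>"] by simp
 show "subrepresentation G V \<rho> {x \<in> carrier V. T x = \<zero>\<^bsub>W\<^esub>}"
  by (rule V.subrepresentationI) (auto simp: T0 T2 T3 eq s0 W.V.smult_r_null V.V.smult_closed)
 show "subrepresentation G W \<sigma> (T ` carrier V)"
 proof (rule W.subrepresentationI)
  show "\<zero>\<^bsub>W\<^esub> \<in> T ` carrier V" using T0 by (metis V.V.M.zero_closed imageI)
  show "x \<oplus>\<^bsub>W\<^esub> y \<in> T ` carrier V" if "x \<in> T ` carrier V" "y \<in> T ` carrier V" for x y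
   using that T2 V.V.M.add.m_closed by (metis (no_types, lifting) image_iff)
  show "a \<odot>\<^bsub>W\<^esub> x \<in> T ` carrier V" if "x \<in> T ` carrier V" for a x
   using that T3 V.V.smult_closed by (metis (no_types, lifting) image_iff complex_ring_simps(1) UNIV_I)
  show "\<sigma> g x \<in> T ` carrier V" if "g \<in> carrier G" "x \<in> T ` carrier V" for g x
   using that eq V.rho_closed by (metis (no_types, lifting) image_iff)
 qed (use T1 in auto)
qed

text \<open>
  The value of the polynomial \<open>p\<close> at the operator \<open>t\<close>, applied to a
  vector.
\<close>

definition poly_act :: "(('k => complex) => ('k => complex)) => complex poly => ('k => complex) => ('k => complex)"
 where "poly_act t p = fold_coeffs (%c f x. fscale c x + f (t x)) p (%_. 0)"

lemma poly_act_0: "poly_act t 0 x = 0" by (simp add: poly_act_def)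

lemma poly_act_pCons:
 "poly_act t (pCons c p) x = fscale c x + poly_act t p (t x)"
 by (cases "p = 0 & c = 0") (auto simp: poly_act_def fold_coeffs_def cCons_def coeffs_eq_Nil fscale_def fun_eq_iff)

lemma poly_act_add: "poly_act t (p + q) x = poly_act t p x + poly_act t q x" by (induction p q arbitrary: x rule: poly_induct2)
   (simp_all add: poly_act_0 poly_act_pCons fn.scale_left_distrib algebra_simps del: fscale_apply)

lemma poly_act_smult:
 "poly_act t (Polynomial.smult a p) x = fscale a (poly_act t p x)" by (induction p arbitrary: x)
   (simp_all add: poly_act_0 poly_act_pCons fn.scale_right_distrib fn.scale_zero_right del: fscale_apply)

lemma poly_act_step:
 "poly_act t ([:- a, 1:] * q) x = poly_act t q (t x) - fscale a (poly_act t q x)"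
proof -
 have "[:- a, 1:] * q = Polynomial.smult (- a) q + pCons 0 q" by simp
 hence "poly_act t ([:- a, 1:] * q) x = fscale (- a) (poly_act t q x) + (fscale 0 x + poly_act t q (t x))"
  by (simp only: poly_act_add poly_act_smult poly_act_pCons)
 thus ?thesis by (simp add: fn.scale_minus_left fn.scale_zero_left del: fscale_apply)
qed

lemma poly_act_monom: "poly_act t (Polynomial.monom c n) x = fscale c ((t ^^ n) x)"
proof (induction n arbitrary: x)
 case 0
 show ?case by (simp add: monom_0 poly_act_pCons poly_act_0 del: fscale_apply)
next
 case (Suc n)
 have "poly_act t (Polynomial.monom c (Suc n)) x = fscale 0 x + poly_act t (Polynomial.monom c n) (t x)"
  by (simp only: monom_Suc poly_act_pCons)
 also have "... = fscale c ((t ^^ Suc n) x)" by (simp only: Suc.IH fn.scale_zero_left add_0 funpow_Suc_right o_apply)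
 finally show ?case .
qed

lemma poly_act_sum: "poly_act t (\<Sum>i\<in>I. p i) x = (\<Sum>i\<in>I. poly_act t (p i) x)"
 by (induction I rule: infinite_finite_induct) (simp_all only: simp_thms sum.infinite sum.empty sum.insert poly_act_0 poly_act_add)

text \<open>Iterates of a map in a finite-dimensional space satisfy a polynomial relation.\<close>

lemma polynomial_relation:
 assumes S: "fn.fin_dim S" and t: "!!x. x \<in> S ==> t x \<in> S" and x: "x \<in> S"
 obtains p where "p ~= 0" "poly_act t p x = 0"
proof -
 obtain B where B: "finite B" "S \<subseteq> fn.span B" using S by (auto simp: fn.fin_dim_def)
 define n where "n = card B"
 have it: "(t ^^ k) x \<in> S" for k using x t by (induction k) auto
 show ?thesis
 proof (cases "inj_on (%k. (t ^^ k) x) {..n}")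
  case False
  then obtain k l where kl: "k ~= l" "(t ^^ k) x = (t ^^ l) x" by (auto simp: inj_on_def)
  have "poly_act t (Polynomial.monom 1 k + Polynomial.monom (- 1) l) x = 0"
   by (simp add: poly_act_add poly_act_monom kl(2) fn.scale_minus_left del: fscale_apply)
  moreover have "Polynomial.coeff (Polynomial.monom 1 k + Polynomial.monom (- 1) l) k = (1 :: complex)" using kl(1) by simp
  hence "Polynomial.monom 1 k + Polynomial.monom (- 1) l ~= (0 :: complex poly)" by (metis coeff_0 zero_neq_one)
  ultimately show ?thesis using that by blast
 next
  case True
  let ?I = "(%k. (t ^^ k) x) ` {..n}"
  have "card ?I = Suc n" using card_image[OF True] by simp
  hence dep: "fn.dependent ?I" using fn.independent_span_bound[OF B(1), of ?I] B(2) it n_def by fastforce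
  then obtain u v where u: "(\<Sum>v\<in>?I. fscale (u v) v) = 0" "v \<in> ?I" "u v ~= 0" using fn.dependent_finite[of ?I] by auto
  define p where "p = (\<Sum>k\<le>n. Polynomial.monom (u ((t ^^ k) x)) k)"
  have "poly_act t p x = (\<Sum>k\<le>n. fscale (u ((t ^^ k) x)) ((t ^^ k) x))" unfolding p_def poly_act_sum poly_act_monom ..
  also have "... = (\<Sum>v\<in>?I. fscale (u v) v)" by (simp only: sum.reindex[OF True] o_def)
  finally have "poly_act t p x = 0" using u(1) by simp
  moreover have "p ~= 0"
  proof -
   obtain k where k: "k <= n" "v = (t ^^ k) x" using u(2) by auto
   have "Polynomial.coeff p k = u v" using k by (simp add: p_def coeff_sum sum.delta if_distrib cong: if_cong)
   thus ?thesis using u(3) by auto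
  qed
  ultimately show ?thesis using that by blast
 qed
qed


lemma poly_act_linear:
 assumes "!!x y. t (x + y) = t x + t y" "!!a x. t (fscale a x) = fscale a (t x)"
 shows "poly_act t p (x + fscale a y) = poly_act t p x + fscale a (poly_act t p y)"
proof (induction p arbitrary: x y)
 case 0
 show ?case by (simp only: poly_act_0 fn.scale_zero_right add_0)
next
 case (pCons c p)
 show ?case
  by (simp only: poly_act_pCons assms pCons.IH fn.scale_right_distrib fn.scale_left_commute[of c a] add.assoc add.left_commute)
qed

lemma poly_act_root:
 assumes "!!x y. t (x + y) = t x + t y" "!!a x. t (fscale a x) = fscale a (t x)"
 shows "poly_act t ([:- a, 1:] * q) x = poly_act t q (t x + fscale (- a) x)"
 unfolding poly_act_step poly_act_linear[OF assms] by (simp only: fn.scale_minus_left diff_conv_add_uminus)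

context finite_rep
begin

lemma add_scale_eq_zero:
 assumes "x \<in> carrier V" "y \<in> carrier V" "x \<oplus> (- a) \<odot> y = \<zero>"
 shows "x = a \<odot> y"
proof -
 have c: "a \<odot> y \<in> carrier V" "(- a) \<odot> y \<in> carrier V" using assms(2) V.smult_closed by auto
 have "a \<odot> y \<oplus> (- a) \<odot> y = (a + - a) \<odot> y" using V.smult_l_distr[of a "- a" y] assms(2) by simp
 also have "... = \<zero>" using V.smult_l_null[OF assms(2)] by simp
 finally have "x \<oplus> (- a) \<odot> y = a \<odot> y \<oplus> (- a) \<odot> y" using assms(3) by simp
 thus ?thesis using V.M.add.right_cancel[OF c(2) assms(1) c(1)] by simp
qed

lemma smult_eq_zero:
 assumes "x \<in> carrier V" "a \<odot> x = \<zero>" "a ~= 0"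
 shows "x = \<zero>"
proof -
 have "x = (inverse a * a) \<odot> x" using assms(1,3) V.smult_one by simp
 also have "... = inverse a \<odot> (a \<odot> x)" using V.smult_assoc1[of "inverse a" a x] assms(1) by simp
 finally show ?thesis using assms(2) V.smult_r_null[of "inverse a"] by simp
qed

lemma alg_eq_iff:
 assumes v: "v \<in> carrier V"
 shows "alg x v = alg y v \<longleftrightarrow> alg (x - y) v = \<zero>"
proof -
 have "y + (x - y) = x" by simp
 hence "alg x v = alg y v \<oplus> alg (x - y) v" using alg_add[OF v, of y "x - y"] by (simp only:)
 thus ?thesis using v by (metis V.M.add.l_cancel_one V.M.r_zero alg_closed)
qed

lemma cyclic_vector:
 assumes irr: "irreducible_representation G V \<rho>" and v0: "v0 \<in> carrier V" "v0 ~= \<zero>" and v: "v \<in> carrier V"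
 shows "EX x:GA. v = alg x v0"
proof -
 let ?U = "(%x. alg x v0) ` GA"
 have "subrepresentation G V \<rho> ?U"
 proof (rule subrepresentationI)
  show "\<zero> \<in> ?U"
   by (rule image_eqI[where x = 0], rule alg_zero[OF v0(1), symmetric], rule fn.subspace_0[OF subspace_funs_on])
  show "x \<oplus> y \<in> ?U" if xy: "x \<in> ?U" "y \<in> ?U" for x y
  proof -
   obtain p q where pq: "p \<in> GA" "q \<in> GA" "x = alg p v0" "y = alg q v0" using xy by blast
   show ?thesis unfolding pq(3,4)
    by (rule image_eqI[where x = "p + q"], rule alg_add[OF v0(1), symmetric], rule fn.subspace_add[OF subspace_funs_on pq(1,2)])
  qed
  show "a \<odot> x \<in> ?U" if x: "x \<in> ?U" for a x
  proof -
   obtain p where p: "p \<in> GA" "x = alg p v0" using x by blast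
   show ?thesis unfolding p(2)
    by (rule image_eqI[where x = "fscale a p"], rule alg_scale[OF v0(1), symmetric], rule fn.subspace_scale[OF subspace_funs_on p(1)])
  qed
  show "\<rho> g x \<in> ?U" if g: "g \<in> carrier G" and x: "x \<in> ?U" for g x
  proof -
   obtain p where p: "x = alg p v0" using x by blast
   show ?thesis unfolding p by (rule image_eqI[where x = "lact G g p"], rule rho_alg[OF g v0(1)], rule lact_in)
  qed
 qed (use v0 in auto)
 hence "?U = {\<zero>} | ?U = carrier V" using irr by (simp add: irreducible_representation_def)
 moreover have "v0 \<in> ?U"
  by (rule image_eqI[where x = "delta \<one>\<^bsub>G\<^esub>"], simp add: alg_delta[OF v0(1)] rho_one[OF v0(1)], rule delta_in_funs_on[OF one_closed])
 ultimately show ?thesis using v0(2) v by blast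
qed

text \<open>
  The annihilator of a vector in the group algebra is a left ideal.  A complementary left ideal
  exists by Maschke's theorem, and the component in it of the unit is the idempotent.
\<close>

lemma annihilator_idempotent:
 assumes v0: "v0 \<in> carrier V"
 obtains e where "e \<in> GA" "conv G e e = e" "alg e v0 = v0"
  "!!x. x \<in> GA ==> alg x v0 = \<zero> ==> conv G x e = 0"
proof -
 define N where "N = {x \<in> GA. alg x v0 = \<zero>}"
 have sN: "fn.subspace N"
 proof (rule fn.subspaceI)
  show "0 \<in> N" using alg_zero[OF v0] fn.subspace_0[OF subspace_funs_on[of "carrier G"]] by (simp add: N_def)
  show "x + y \<in> N" if "x \<in> N" "y \<in> N" for x y
   using that alg_add[OF v0, of x y] fn.subspace_add[OF subspace_funs_on[of "carrier G"]] by (simp add: N_def)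
  show "fscale a x \<in> N" if "x \<in> N" for a x
   using that alg_scale[OF v0, of a x] fn.subspace_scale[OF subspace_funs_on[of "carrier G"]] V.smult_r_null by (simp add: N_def)
 qed
 have rho0: "\<rho> g \<zero> = \<zero>" if "g \<in> carrier G" for g
  using rho_finsum[OF that, of "{} :: nat set" "%_. \<zero>"] by simp
 have lN: "lact G g x \<in> N" if "g \<in> carrier G" "x \<in> N" for g x
  using that rho_alg[OF that(1) v0, of x] rho0 lact_in by (simp add: N_def)
 obtain J where J: "fn.subspace J" "J \<subseteq> GA" "!!g x. g \<in> carrier G ==> x \<in> J ==> lact G g x \<in> J"
  "N Int J = {0}" "!!x. x \<in> GA ==> EX y:N. EX y':J. x = y + y'"
 proof (rule fn.maschke[OF is_group finite_carrier subspace_funs_on[of "carrier G"] sN, of "lact G"])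
  show "N \<subseteq> GA" by (auto simp: N_def)
 qed (use lact_in lact_add lact_scale lact_one lact_mult lN in auto)
 obtain n e where ne: "n \<in> N" "e \<in> J" "delta \<one>\<^bsub>G\<^esub> = n + e"
  using J(5)[OF delta_in_funs_on[OF one_closed]] by blast
 have cJ: "conv G x e \<in> J" and cN: "conv G x n \<in> N" for x unfolding conv_def using J(3)[OF _ ne(2)] lN[OF _ ne(1)]
  by (auto intro!: fn.subspace_sum fn.subspace_scale J(1) sN simp del: sum_fun_apply)
 have split: "x = conv G x n + conv G x e" if "x \<in> GA" for x using conv_one[OF that] conv_add_right[of x n e] ne(3) by simp
 have eGA: "e \<in> GA" using ne(2) J(2) by blast
 show ?thesis
 proof
  show "e \<in> GA" by (rule eGA)
  have "conv G e n = e - conv G e e" using split[OF eGA] by (simp add: algebra_simps)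
  hence "conv G e n \<in> N Int J" using cN[of e] fn.subspace_diff[OF J(1) ne(2) cJ[of e]] by simp
  thus "conv G e e = e" using split[OF eGA] J(4) by simp
  have "v0 = alg n v0 \<oplus> alg e v0" using alg_add[OF v0, of n e] alg_delta[OF v0 one_closed] rho_one[OF v0] ne(3) by simp
  thus "alg e v0 = v0" using ne(1) v0 by (simp add: N_def)
  show "conv G x e = 0" if "x \<in> GA" "alg x v0 = \<zero>" for x
  proof -
   have x: "x \<in> N" using that by (simp add: N_def)
   have "conv G x e = x - conv G x n" using split[OF that(1)] by (simp add: algebra_simps)
   hence "conv G x e \<in> N Int J" using cJ[of x] fn.subspace_diff[OF sN x cN[of x]] by simp
   thus ?thesis using J(4) by simp
  qed
 qed
qed

end

text \<open>
  The map sends \<open>x v0\<close> to \<open>x u\<close>; the condition on the annihilators makes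
  it well defined.
\<close>

lemma cyclic_extension:
 assumes V: "finite_rep G V \<rho>" and U: "finite_rep G U \<tau>" and v0: "v0 \<in> carrier V" and u: "u \<in> carrier U"
  and cyc: "!!v. v \<in> carrier V ==> EX x:funs_on (carrier G). v = galg G V \<rho> x v0"
  and ann: "!!x. x \<in> funs_on (carrier G) ==> galg G V \<rho> x v0 = \<zero>\<^bsub>V\<^esub> ==> galg G U \<tau> x u = \<zero>\<^bsub>U\<^esub>"
 obtains T where "T \<in> linear_maps V U"
  "!!g x. g \<in> carrier G ==> x \<in> carrier V ==> T (\<rho> g x) = \<tau> g (T x)"
  "!!x. x \<in> funs_on (carrier G) ==> T (galg G V \<rho> x v0) = galg G U \<tau> x u"
proof -
 interpret V: finite_rep G V \<rho> by (rule V)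
 interpret U: finite_rep G U \<tau> by (rule U)
 define T where "T v = U.alg (SOME x. x \<in> V.GA & v = V.alg x v0) u" for v
 have T: "T (V.alg x v0) = U.alg x u" if x: "x \<in> V.GA" for x
 proof -
  let ?y = "SOME y. y \<in> V.GA & V.alg x v0 = V.alg y v0"
  have "?y \<in> V.GA & V.alg x v0 = V.alg ?y v0" by (rule someI[of _ x]) (use x in simp)
  hence y: "?y \<in> V.GA" "V.alg ?y v0 = V.alg x v0" by auto
  have "U.alg (?y - x) u = \<zero>\<^bsub>U\<^esub>"
   using ann[OF fn.subspace_diff[OF subspace_funs_on y(1) x]] y(2) V.alg_eq_iff[OF v0] by blast
  thus ?thesis using U.alg_eq_iff[OF u] by (simp add: T_def)
 qed
 show ?thesis
 proof
  show "T (V.alg x v0) = U.alg x u" if "x \<in> V.GA" for x using T that .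
  show "T (\<rho> g v) = \<tau> g (T v)" if g: "g \<in> carrier G" and v: "v \<in> carrier V" for g v
  proof -
   obtain x where x: "x \<in> V.GA" "v = V.alg x v0" using cyc[OF v] by blast
   show ?thesis unfolding x(2) V.rho_alg[OF g v0] T[OF x(1)] T[OF V.lact_in] by (rule U.rho_alg[OF g u, symmetric])
  qed
  show "T \<in> linear_maps V U" unfolding linear_maps_def mem_Collect_eq
  proof (intro conjI ballI allI)
   show "T \<in> carrier V \<rightarrow> carrier U" using u by (auto simp: T_def)
   fix v assume v: "v \<in> carrier V"
   obtain x where x: "x \<in> V.GA" "v = V.alg x v0" using cyc[OF v] by blast
   show "T (a \<odot>\<^bsub>V\<^esub> v) = a \<odot>\<^bsub>U\<^esub> T v" for a
    unfolding x(2) V.alg_scale[OF v0, symmetric] T[OF x(1)] T[OF fn.subspace_scale[OF subspace_funs_on x(1)]] by (rule U.alg_scale[OF u])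
   fix w assume w: "w \<in> carrier V"
   obtain y where y: "y \<in> V.GA" "w = V.alg y v0" using cyc[OF w] by blast
   show "T (v \<oplus>\<^bsub>V\<^esub> w) = T v \<oplus>\<^bsub>U\<^esub> T w"
    unfolding x(2) y(2) V.alg_add[OF v0, symmetric] T[OF x(1)] T[OF y(1)] T[OF fn.subspace_add[OF subspace_funs_on x(1) y(1)]]
    by (rule U.alg_add[OF u])
  qed
 qed
qed

lemma irreducibleD:
 "irreducible_representation G V \<rho> ==> subrepresentation G V \<rho> U ==> U = {\<zero>\<^bsub>V\<^esub>} | U = carrier V"
 unfolding irreducible_representation_def by blast

lemma schur_injective:
 assumes irr: "irreducible_representation G V \<rho>" and V: "finite_rep G V \<rho>" and W: "finite_rep G W \<sigma>" and T: "T \<in> linear_maps V W"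
  and eq: "!!g x. g \<in> carrier G ==> x \<in> carrier V ==> T (\<rho> g x) = \<sigma> g (T x)"
  and v: "v \<in> carrier V" "T v ~= \<zero>\<^bsub>W\<^esub>"
  and x: "x \<in> carrier V" "T x = \<zero>\<^bsub>W\<^esub>"
 shows "x = \<zero>\<^bsub>V\<^esub>"
proof -
 have "{x \<in> carrier V. T x = \<zero>\<^bsub>W\<^esub>} = {\<zero>\<^bsub>V\<^esub>} | {x \<in> carrier V. T x = \<zero>\<^bsub>W\<^esub>} = carrier V"
  by (rule irreducibleD[OF irr], rule equivariant_kernel(1)[OF V W T], rule eq)
 thus ?thesis using v x by blast
qed

lemma schur_isomorphic:
 assumes irrV: "irreducible_representation G V \<rho>" and irrW: "irreducible_representation G W \<sigma>"
  and G: "finite_group G" and T: "T \<in> linear_maps V W"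
  and eq: "!!g x. g \<in> carrier G ==> x \<in> carrier V ==> T (\<rho> g x) = \<sigma> g (T x)"
  and v: "v \<in> carrier V" "T v ~= \<zero>\<^bsub>W\<^esub>"
 shows "isomorphic_representations G V \<rho> W \<sigma>"
proof -
 have V: "finite_rep G V \<rho>" and W: "finite_rep G W \<sigma>" using irrV irrW G irreducible_finite_rep by blast+
 interpret V: finite_rep G V \<rho> by (rule V)
 interpret W: finite_rep G W \<sigma> by (rule W)
 have T1: "T y \<in> carrier W" if "y \<in> carrier V" for y using T that by (auto simp: linear_maps_def)
 have T2: "T (y \<oplus>\<^bsub>V\<^esub> a \<odot>\<^bsub>V\<^esub> z) = T y \<oplus>\<^bsub>W\<^esub> a \<odot>\<^bsub>W\<^esub> T z" if "y \<in> carrier V" "z \<in> carrier V" for y z a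
  using T that V.V.smult_closed[of a z] by (auto simp: linear_maps_def)
 have "T ` carrier V = {\<zero>\<^bsub>W\<^esub>} | T ` carrier V = carrier W"
  by (rule irreducibleD[OF irrW], rule equivariant_kernel(2)[OF V W T], rule eq)
 hence surj: "T ` carrier V = carrier W" using v by blast
 have inj: "inj_on T (carrier V)"
 proof (rule inj_onI)
  fix x y assume xy: "x \<in> carrier V" "y \<in> carrier V" "T x = T y"
  have c: "x \<oplus>\<^bsub>V\<^esub> (- 1) \<odot>\<^bsub>V\<^esub> y \<in> carrier V" using xy V.V.smult_closed by auto
  have "T y \<oplus>\<^bsub>W\<^esub> (- 1) \<odot>\<^bsub>W\<^esub> T y = \<zero>\<^bsub>W\<^esub>"
   using W.V.smult_l_distr[of 1 "- 1" "T y"] W.V.smult_l_null[of "T y"] W.V.smult_one[of "T y"] T1 xy by simp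
  hence "T (x \<oplus>\<^bsub>V\<^esub> (- 1) \<odot>\<^bsub>V\<^esub> y) = \<zero>\<^bsub>W\<^esub>" using T2[OF xy(1,2)] xy(3) by simp
  from schur_injective[OF irrV V W T eq v c this] have "x = 1 \<odot>\<^bsub>V\<^esub> y" by (intro V.add_scale_eq_zero xy)
  thus "x = y" using V.V.smult_one xy by simp
 qed
 show ?thesis unfolding isomorphic_representations_def using T eq surj inj by (auto simp: bij_betw_def)
qed

text \<open>
  An endomorphism of \<open>V\<close> that fixed no line through \<open>v0\<close> would have no eigenvalue; but
  finite-dimensionality gives a polynomial relation, which splits into linear factors over \<open>\<complex>\<close>.
\<close>

lemma schur_scalar:
 assumes irr: "irreducible_representation G V \<rho>" and V: "finite_rep G V \<rho>" and T: "T \<in> linear_maps V V"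
  and eq: "!!g x. g \<in> carrier G ==> x \<in> carrier V ==> T (\<rho> g x) = \<rho> g (T x)"
  and v0: "v0 \<in> carrier V"
 shows "EX a. T v0 = a \<odot>\<^bsub>V\<^esub> v0"
proof (rule ccontr)
 assume contra: "\<nexists>a. T v0 = a \<odot>\<^bsub>V\<^esub> v0"
 interpret finite_rep G V \<rho> by (rule V)
 have T1: "T y \<in> carrier V" if "y \<in> carrier V" for y using T that by (auto simp: linear_maps_def)
 have T2: "T (y \<oplus>\<^bsub>V\<^esub> z) = T y \<oplus>\<^bsub>V\<^esub> T z" if "y \<in> carrier V" "z \<in> carrier V" for y z
  using T that by (auto simp: linear_maps_def)
 have T3: "T (a \<odot>\<^bsub>V\<^esub> y) = a \<odot>\<^bsub>V\<^esub> T y" if "y \<in> carrier V" for y a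
  using T that by (auto simp: linear_maps_def)
 have nz: "v0 ~= \<zero>\<^bsub>V\<^esub>"
 proof
  assume z: "v0 = \<zero>\<^bsub>V\<^esub>"
  have "T v0 = 0 \<odot>\<^bsub>V\<^esub> T v0" using T3[OF v0, of 0] V.smult_l_null[OF v0] z by simp
  hence "T v0 = 0 \<odot>\<^bsub>V\<^esub> v0" using V.smult_l_null[OF v0] V.smult_l_null[OF T1[OF v0]] by simp
  thus False using contra by blast
 qed
 have inj: "x = \<zero>\<^bsub>V\<^esub>" if x: "x \<in> carrier V" and Tx: "T x \<oplus>\<^bsub>V\<^esub> (- a) \<odot>\<^bsub>V\<^esub> x = \<zero>\<^bsub>V\<^esub>" for a x
 proof (rule schur_injective[OF irr V V, of "%y. T y \<oplus>\<^bsub>V\<^esub> (- a) \<odot>\<^bsub>V\<^esub> y", OF _ _ v0 _ x Tx])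
  show "(%y. T y \<oplus>\<^bsub>V\<^esub> (- a) \<odot>\<^bsub>V\<^esub> y) \<in> linear_maps V V"
   unfolding linear_maps_def mem_Collect_eq
  proof (intro conjI ballI allI)
   show "(%y. T y \<oplus>\<^bsub>V\<^esub> (- a) \<odot>\<^bsub>V\<^esub> y) \<in> carrier V \<rightarrow> carrier V" using T1 V.smult_closed by auto
   fix y assume y: "y \<in> carrier V"
   show "T (c \<odot>\<^bsub>V\<^esub> y) \<oplus>\<^bsub>V\<^esub> (- a) \<odot>\<^bsub>V\<^esub> (c \<odot>\<^bsub>V\<^esub> y) = c \<odot>\<^bsub>V\<^esub> (T y \<oplus>\<^bsub>V\<^esub> (- a) \<odot>\<^bsub>V\<^esub> y)" for c
    using y T1 T3 V.smult_r_distr V.smult_closed V.smult_assoc1[of "- a" c y] V.smult_assoc1[of c "- a" y] by (simp add: mult.commute)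
   fix z assume z: "z \<in> carrier V"
   show "T (y \<oplus>\<^bsub>V\<^esub> z) \<oplus>\<^bsub>V\<^esub> (- a) \<odot>\<^bsub>V\<^esub> (y \<oplus>\<^bsub>V\<^esub> z) = (T y \<oplus>\<^bsub>V\<^esub> (- a) \<odot>\<^bsub>V\<^esub> y) \<oplus>\<^bsub>V\<^esub> (T z \<oplus>\<^bsub>V\<^esub> (- a) \<odot>\<^bsub>V\<^esub> z)"
    using y z T1 T2 V.smult_r_distr V.smult_closed by (simp add: V.M.add.m_ac)
  qed
  show "T (\<rho> g y) \<oplus>\<^bsub>V\<^esub> (- a) \<odot>\<^bsub>V\<^esub> \<rho> g y = \<rho> g (T y \<oplus>\<^bsub>V\<^esub> (- a) \<odot>\<^bsub>V\<^esub> y)"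
   if "g \<in> carrier G" "y \<in> carrier V" for g y
   using that eq rho_add[OF that(1)] rho_smult[OF that] T1 V.smult_closed by simp
  show "T v0 \<oplus>\<^bsub>V\<^esub> (- a) \<odot>\<^bsub>V\<^esub> v0 ~= \<zero>\<^bsub>V\<^esub>"
   using add_scale_eq_zero[OF T1[OF v0] v0] contra by blast
 qed
 obtain y where y: "y \<in> GA" "T v0 = alg y v0" using cyclic_vector[OF irr v0 nz T1[OF v0]] by blast
 define t where "t x = conv G x y" for x
 have t_lin: "t (x + x') = t x + t x'" "t (fscale a x) = fscale a (t x)" for x x' a
  by (simp_all only: t_def conv_add_left conv_scale_left)
 have "T (alg x v0) = alg x (T v0)" for x by (rule intertwiner_alg[OF V V T _ v0], rule eq)
 hence Talg: "T (alg x v0) = alg (t x) v0" for x using y(2) alg_conv[OF v0, of x y] by (simp add: t_def)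
 obtain p where p: "p ~= 0" "poly_act t p (delta \<one>\<^bsub>G\<^esub>) = 0"
 proof (rule polynomial_relation[OF fin_dim_funs_on[OF finite_carrier], of t "delta \<one>\<^bsub>G\<^esub>"])
  show "t x \<in> GA" for x by (simp add: t_def conv_in)
  show "delta \<one>\<^bsub>G\<^esub> \<in> GA" by (rule delta_in_funs_on) simp
 qed
 have key: "alg x v0 = \<zero>\<^bsub>V\<^esub>" if "p ~= 0" "poly_act t p x = 0" "x \<in> GA" for p x using that
 proof (induction "degree p" arbitrary: p x)
  case 0
  then obtain c where c: "p = [:c:]" by (metis degree_eq_zeroE)
  have "fscale c x + 0 = 0" using "0.prems"(2) unfolding c poly_act_pCons poly_act_0 .
  hence "fscale c x = 0" by (simp only: add_0_right)
  moreover have "c ~= 0" using "0.prems"(1) c by simp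
  ultimately have "x = 0" using fn.scale_eq_0_iff by blast
  show ?case unfolding \<open>x = 0\<close> by (rule alg_zero[OF v0])
 next
  case (Suc n)
  have "~ constant (poly p)" using Suc.hyps(2) by (simp add: constant_degree)
  then obtain a where "poly p a = 0" using fundamental_theorem_of_algebra by blast
  then obtain q where q: "p = [:- a, 1:] * q" using poly_eq_0_iff_dvd by (metis dvdE)
  hence q0: "q ~= 0" using Suc.prems(1) by auto
  hence dq: "n = degree q" using Suc.hyps(2) q by (simp add: degree_mult_eq del: mult_pCons_left)
  let ?x = "t x + fscale (- a) x"
  have x': "?x \<in> GA"
   using conv_in Suc.prems(3) by (intro fn.subspace_add fn.subspace_scale subspace_funs_on) (auto simp: t_def)
  have "poly_act t q ?x = 0" using Suc.prems(2) unfolding q poly_act_root[OF t_lin] .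
  from Suc.hyps(1)[OF dq q0 this x'] have "alg (t x) v0 \<oplus>\<^bsub>V\<^esub> (- a) \<odot>\<^bsub>V\<^esub> alg x v0 = \<zero>\<^bsub>V\<^esub>"
   by (simp only: alg_add[OF v0] alg_scale[OF v0])
  thus ?case using inj[of "alg x v0" a] Talg[of x] v0 by simp
 qed
 have "v0 = \<zero>\<^bsub>V\<^esub>"
  using key[OF p delta_in_funs_on[OF one_closed]] alg_delta[OF v0 one_closed] rho_one[OF v0] by simp
 thus False using nz by blast
qed

text \<open>
  The idempotent that generates a complement of the annihilator of a vector \<open>v0\<close>
  fixes \<open>v0\<close>. A vector \<open>u\<close> that it fixes in any representation is the
  image of \<open>v0\<close> under an equivariant map, so Schur\'s lemma decides everything: there
  is no such \<open>u \<noteq> 0\<close> in a representation of another type, and in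
  \<open>V\<close> itself \<open>u\<close> is a multiple of \<open>v0\<close>.
\<close>

lemma primitive_idempotent:
 fixes V :: "(complex, 'v) module"
 assumes G: "finite_group G" and irr: "irreducible_representation G V \<rho>"
 obtains e where "e \<in> funs_on (carrier G)" "conv G e e = e"
  "!!(U :: (complex, 'w) module) \<tau>. irreducible_representation G U \<tau> ==> isomorphic_representations G V \<rho> U \<tau> ==>
   EX b:carrier U. b ~= \<zero>\<^bsub>U\<^esub> & galg G U \<tau> e b = b & (ALL u:carrier U. EX a. galg G U \<tau> e u = a \<odot>\<^bsub>U\<^esub> b)"
  "!!(U :: (complex, 'w) module) \<tau> u. irreducible_representation G U \<tau> ==> ~ isomorphic_representations G V \<rho> U \<tau> ==>
   u \<in> carrier U ==> galg G U \<tau> e u = \<zero>\<^bsub>U\<^esub>"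
proof -
 have V: "finite_rep G V \<rho>" using irreducible_finite_rep G irr by blast
 interpret V: finite_rep G V \<rho> by (rule V)
 obtain v0 where v0: "v0 \<in> carrier V" "v0 ~= \<zero>\<^bsub>V\<^esub>"
  using irr V.V.M.zero_closed unfolding irreducible_representation_def by blast
 obtain e where e: "e \<in> V.GA" "conv G e e = e" "V.alg e v0 = v0"
  "!!x. x \<in> V.GA ==> V.alg x v0 = \<zero>\<^bsub>V\<^esub> ==> conv G x e = 0"
  by (rule V.annihilator_idempotent[OF v0(1)]) blast
 have cyc: "EX x:V.GA. v = V.alg x v0" if "v \<in> carrier V" for v by (rule V.cyclic_vector[OF irr v0 that])
 have eV: "EX a. V.alg e v = a \<odot>\<^bsub>V\<^esub> v0" if v: "v \<in> carrier V" for v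
 proof -
  let ?u = "V.alg e v"
  have u: "?u \<in> carrier V" "V.alg e ?u = ?u" using v V.alg_conv[OF v, of e e] e(2) by auto
  have ann: "V.alg x ?u = \<zero>\<^bsub>V\<^esub>" if "x \<in> V.GA" "V.alg x v0 = \<zero>\<^bsub>V\<^esub>" for x
   using V.alg_conv[OF v, of x e] e(4)[OF that] V.alg_zero[OF v] by simp
  obtain T where T: "T \<in> linear_maps V V"
   "!!g x. g \<in> carrier G ==> x \<in> carrier V ==> T (\<rho> g x) = \<rho> g (T x)"
   "!!x. x \<in> V.GA ==> T (V.alg x v0) = V.alg x ?u" by (rule cyclic_extension[OF V V v0(1) u(1) cyc ann]) auto
  have "EX a. T v0 = a \<odot>\<^bsub>V\<^esub> v0" by (rule schur_scalar[OF irr V T(1) _ v0(1)], rule T(2))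
  thus ?thesis using T(3)[OF e(1)] e(3) u(2) by simp
 qed
 show ?thesis
 proof
  show "e \<in> funs_on (carrier G)" "conv G e e = e" by (rule e(1), rule e(2))
  fix U :: "(complex, 'w) module" and \<tau>
  assume irrU: "irreducible_representation G U \<tau>"
  have U: "finite_rep G U \<tau>" using irreducible_finite_rep G irrU by blast
  interpret U: finite_rep G U \<tau> by (rule U)
  show "EX b:carrier U. b ~= \<zero>\<^bsub>U\<^esub> & U.alg e b = b & (ALL u:carrier U. EX a. U.alg e u = a \<odot>\<^bsub>U\<^esub> b)"
   if "isomorphic_representations G V \<rho> U \<tau>"
  proof -
   obtain S where S: "S \<in> linear_maps V U" "bij_betw S (carrier V) (carrier U)"
    "!!g x. g \<in> carrier G ==> x \<in> carrier V ==> S (\<rho> g x) = \<tau> g (S x)"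
    using \<open>isomorphic_representations G V \<rho> U \<tau>\<close> unfolding isomorphic_representations_def by blast
   have S3: "S (a \<odot>\<^bsub>V\<^esub> y) = a \<odot>\<^bsub>U\<^esub> S y" if "y \<in> carrier V" for y a
    using S(1) that by (auto simp: linear_maps_def)
   have SU: "S v \<in> carrier U" if "v \<in> carrier V" for v using S(1) that by (auto simp: linear_maps_def)
   have SA: "S (V.alg e v) = U.alg e (S v)" if "v \<in> carrier V" for v by (rule intertwiner_alg[OF V U S(1) _ that], rule S(3))
   have "S \<zero>\<^bsub>V\<^esub> = \<zero>\<^bsub>U\<^esub>"
    using S3[of "\<zero>\<^bsub>V\<^esub>" 0] V.V.smult_l_null[of "\<zero>\<^bsub>V\<^esub>"] U.V.smult_l_null[of "S \<zero>\<^bsub>V\<^esub>"] SU by simp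
   hence "S v0 ~= \<zero>\<^bsub>U\<^esub>" using S(2) v0 unfolding bij_betw_def by (metis V.V.M.zero_closed inj_onD)
   moreover have "U.alg e (S v0) = S v0" using SA[OF v0(1)] e(3) by simp
   moreover have "EX a. U.alg e u = a \<odot>\<^bsub>U\<^esub> S v0" if u: "u \<in> carrier U" for u
   proof -
    obtain v where v: "v \<in> carrier V" "u = S v" using u S(2) unfolding bij_betw_def by blast
    obtain a where "V.alg e v = a \<odot>\<^bsub>V\<^esub> v0" using eV[OF v(1)] by blast
    hence "U.alg e u = a \<odot>\<^bsub>U\<^esub> S v0" using SA[OF v(1)] v(2) S3[OF v0(1)] by simp
    thus ?thesis by blast
   qed
   ultimately show ?thesis using SU[OF v0(1)] by blast
  qed
  show "U.alg e u = \<zero>\<^bsub>U\<^esub>" if niso: "~ isomorphic_representations G V \<rho> U \<tau>" and u: "u \<in> carrier U" for u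
  proof (rule ccontr)
   assume nz: "U.alg e u ~= \<zero>\<^bsub>U\<^esub>"
   let ?u = "U.alg e u"
   have ann: "U.alg x ?u = \<zero>\<^bsub>U\<^esub>" if "x \<in> V.GA" "V.alg x v0 = \<zero>\<^bsub>V\<^esub>" for x
    using U.alg_conv[OF u, of x e] e(4)[OF that] U.alg_zero[OF u] by simp
   have uc: "?u \<in> carrier U" using u by simp
   obtain T where T: "T \<in> linear_maps V U"
    "!!g x. g \<in> carrier G ==> x \<in> carrier V ==> T (\<rho> g x) = \<tau> g (T x)"
    "!!x. x \<in> V.GA ==> T (V.alg x v0) = U.alg x ?u" by (rule cyclic_extension[OF V U v0(1) uc cyc ann]) auto
   have "T v0 = ?u" using T(3)[OF e(1)] e(2,3) U.alg_conv[OF u, of e e] by simp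
   hence Tv0: "T v0 ~= \<zero>\<^bsub>U\<^esub>" using nz by simp
   have "isomorphic_representations G V \<rho> U \<tau>" by (rule schur_isomorphic[OF irr irrU G T(1) _ v0(1) Tv0], rule T(2))
   thus False using niso by blast
  qed
 qed
qed

section \<open>Multiplicities\<close>

lemma (in complex_space) independent_family:
 assumes I: "finite I" and ind: "!!c. (\<Sum>i\<in>I. scale (c i) (f i)) = 0 ==> ALL i:I. c i = 0"
 shows "inj_on f I" "independent (f ` I)"
proof -
 show inj: "inj_on f I"
 proof (rule inj_onI, rule ccontr)
  fix i j assume ij: "i \<in> I" "j \<in> I" "f i = f j" "i ~= j"
  define c where "c k = (if k = i then 1 else if k = j then - 1 else 0 :: complex)" for k
  have "(\<Sum>k\<in>I. scale (c k) (f k)) = (\<Sum>k\<in>{i, j}. scale (c k) (f k))"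
   by (rule sum.mono_neutral_right[OF I]) (use ij in \<open>auto simp: c_def\<close>)
  also have "... = 0" using ij by (simp add: c_def)
  finally show False using ind[of c] ij(1) by (auto simp: c_def)
 qed
 show "independent (f ` I)"
 proof
  assume "dependent (f ` I)"
  then obtain u v where u: "(\<Sum>v\<in>f ` I. scale (u v) v) = 0" "v \<in> f ` I" "u v ~= 0"
   using dependent_finite[of "f ` I"] I by auto
  have "(\<Sum>i\<in>I. scale (u (f i)) (f i)) = 0" using u(1) sum.reindex[OF inj, of "%v. scale (u v) v"] by simp
  thus False using ind[of "%i. u (f i)"] u(2,3) by auto
 qed
qed

lemma (in finite_rep) subrepresentation_rep:
 assumes U: "subrepresentation G V \<rho> U"
 shows "finite_rep G (V\<lparr>carrier := U\<rparr>) \<rho>"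
proof (rule finite_rep_eq_intro[OF finite_group_axioms])
 have "module complex_ring (V\<lparr>carrier := U\<rparr>)"
  using U submodule.submodule_is_module V.module_axioms by (auto simp: subrepresentation_def)
 thus "representation G (V\<lparr>carrier := U\<rparr>) \<rho>"
  using subrepresentationD[OF U] by (auto simp: representation_def linear_maps_def rho_one rho_mult rho_add rho_smult subset_iff)
qed

lemma (in finite_rep) subrepresentation_trans:
 assumes U: "subrepresentation G V \<rho> U" and X: "subrepresentation G (V\<lparr>carrier := U\<rparr>) \<rho> X"
 shows "subrepresentation G V \<rho> X"
proof -
 interpret U: finite_rep G "V\<lparr>carrier := U\<rparr>" \<rho> by (rule subrepresentation_rep[OF U])
 note X' = U.subrepresentationD[OF X]
 show ?thesis by (rule subrepresentationI) (use X' subrepresentationD(1)[OF U] in auto)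
qed

lemma (in finite_rep) alg_subrepresentation:
 assumes U: "subrepresentation G V \<rho> U" and u: "u \<in> U"
 shows "galg G (V\<lparr>carrier := U\<rparr>) \<rho> x u = alg x u"
proof -
 have "(%u. u) (galg G (V\<lparr>carrier := U\<rparr>) \<rho> x u) = galg G V \<rho> x ((%u. u) u)"
  by (rule intertwiner_alg[OF subrepresentation_rep[OF U] finite_rep_axioms])
    (use subrepresentationD(1)[OF U] u in \<open>auto simp: linear_maps_def\<close>)
 thus ?thesis by simp
qed

text \<open>
  The carrier of \<open>W\<close> is identified by \<open>J\<close> with a finite-dimensional subspace of a complex vector
  space, where the theory of dimension is available.
\<close>

locale linear_model = finite_rep G W \<sigma> + complex_space scale
 for G :: "'g monoid" and W :: "(complex, 'w) module" (structure) and \<sigma>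
  and scale :: "complex => 'b::ab_group_add => 'b" +
 fixes J :: "'w => 'b"
 assumes J_add: "x \<in> carrier W ==> y \<in> carrier W ==> J (x \<oplus> y) = J x + J y"
  and J_scale: "x \<in> carrier W ==> J (a \<odot> x) = scale a (J x)"
  and J_inj: "inj_on J (carrier W)"
  and J_fin: "fin_dim (J ` carrier W)"
begin

lemma J_zero: "J \<zero> = 0" using J_scale[of "\<zero>" 0] V.smult_l_null[of "\<zero>"] by simp

lemma J_eq_0: "x \<in> carrier W ==> J x = 0 \<longleftrightarrow> x = \<zero>"
 using J_inj J_zero by (metis V.M.zero_closed inj_onD)

lemma J_finsum:
 assumes "finite I" "!!i. i \<in> I ==> u i \<in> carrier W"
 shows "J (finsum W u I) = (\<Sum>i\<in>I. J (u i))" using assms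
proof (induction I rule: finite_induct)
 case (insert i I)
 have "finsum W u (insert i I) = u i \<oplus> finsum W u I" by (rule V.M.finsum_insert) (use insert in auto)
 moreover have "finsum W u I \<in> carrier W" by (rule V.M.finsum_closed) (use insert.prems in auto)
 ultimately show ?case using insert J_add by simp
qed (simp add: J_zero)

lemma subspace_J:
 assumes U: "subrepresentation G W \<sigma> U"
 shows "subspace (J ` U)"
proof (rule subspaceI)
 note D = subrepresentationD[OF U]
 show "0 \<in> J ` U" using D(2) J_zero by (metis imageI)
 show "x + y \<in> J ` U" if xy: "x \<in> J ` U" "y \<in> J ` U" for x y
 proof -
  obtain a b where ab: "a \<in> U" "b \<in> U" "x = J a" "y = J b" using xy by blast
  have "x + y = J (a \<oplus> b)" using J_add[OF subsetD[OF D(1) ab(1)] subsetD[OF D(1) ab(2)]] ab(3,4) by simp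
  thus ?thesis using D(3)[OF ab(1,2)] by blast
 qed
 show "scale c x \<in> J ` U" if x: "x \<in> J ` U" for c x
 proof -
  obtain a where a: "a \<in> U" "x = J a" using x by blast
  have "scale c x = J (c \<odot> a)" using J_scale[OF subsetD[OF D(1) a(1)], of c] a(2) by simp
  thus ?thesis using D(4)[OF a(1)] by blast
 qed
qed

lemma J_alg:
 assumes "w \<in> carrier W"
 shows "J (alg x w) = (\<Sum>g\<in>carrier G. scale (x g) (J (\<sigma> g w)))" unfolding galg_def using assms
 by (subst J_finsum) (auto simp: finite_carrier J_scale intro!: V.smult_closed)

lemma J_alg_finsum:
 assumes "finite I" "!!i. i \<in> I ==> u i \<in> carrier W"
 shows "J (alg x (finsum W u I)) = (\<Sum>i\<in>I. J (alg x (u i)))"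
proof -
 have fc: "finsum W u I \<in> carrier W" by (rule V.M.finsum_closed) (use assms in auto)
 have "J (\<sigma> g (finsum W u I)) = (\<Sum>i\<in>I. J (\<sigma> g (u i)))" if g: "g \<in> carrier G" for g
  using rho_finsum[OF g assms(1), of u] J_finsum[OF assms(1), of "%i. \<sigma> g (u i)"] assms(2) g by auto
 hence "J (alg x (finsum W u I)) = (\<Sum>g\<in>carrier G. \<Sum>i\<in>I. scale (x g) (J (\<sigma> g (u i))))"
  unfolding J_alg[OF fc] by (intro sum.cong refl) (simp add: scale_sum_right)
 also have "... = (\<Sum>i\<in>I. J (alg x (u i)))"
  by (subst sum.swap) (use assms(2) in \<open>auto simp: J_alg intro!: sum.cong\<close>)
 finally show ?thesis .
qed

lemma minimal_subrepresentation:
 assumes X: "subrepresentation G W \<sigma> X" and nz: "X ~= {\<zero>}"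
 obtains Y where "subrepresentation G W \<sigma> Y" "Y \<subseteq> X" "irreducible_representation G (W\<lparr>carrier := Y\<rparr>) \<sigma>"
proof -
 let ?P = "%Y. subrepresentation G W \<sigma> Y & Y \<subseteq> X & Y ~= {\<zero>}"
 obtain Y where Y: "?P Y" and min: "!!Z. ?P Z ==> dim (J ` Y) <= dim (J ` Z)"
  using ex_has_least_nat[of ?P X "%Y. dim (J ` Y)"] X nz by auto
 have sY: "subrepresentation G W \<sigma> Y" using Y by blast
 note D = subrepresentationD[OF sY]
 have "irreducible_representation G (W\<lparr>carrier := Y\<rparr>) \<sigma>" unfolding irreducible_representation_def
 proof (intro conjI allI impI)
  show "Defs.representation G (W\<lparr>carrier := Y\<rparr>) \<sigma>"
   using subrepresentation_rep[OF sY] by (simp add: finite_rep_def finite_rep_axioms_def)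
  show "carrier (W\<lparr>carrier := Y\<rparr>) ~= {\<zero>\<^bsub>W\<lparr>carrier := Y\<rparr>\<^esub>}" using Y by simp
  fix Z assume Z: "subrepresentation G (W\<lparr>carrier := Y\<rparr>) \<sigma> Z"
  have sZ: "subrepresentation G W \<sigma> Z" by (rule subrepresentation_trans[OF sY Z])
  have ZY: "Z \<subseteq> Y" using finite_rep.subrepresentationD(1)[OF subrepresentation_rep[OF sY] Z] by simp
  have "Z = Y" if "Z ~= {\<zero>}"
  proof -
   have fY: "fin_dim (J ` Y)" by (rule fin_dim_subset[OF J_fin]) (use D(1) in auto)
   have JZY: "J ` Z \<subseteq> J ` Y" using ZY by blast
   have "dim (J ` Y) <= dim (J ` Z)" using min[of Z] sZ ZY Y that by blast
   hence "J ` Z = J ` Y" using dim_subspace_mono[OF fY subspace_J[OF sY] subspace_J[OF sZ] JZY] by simp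
   thus "Z = Y" using inj_on_image_eq_iff[OF J_inj, of Z Y] ZY D(1) by blast
  qed
  thus "Z = {\<zero>\<^bsub>W\<lparr>carrier := Y\<rparr>\<^esub>} | Z = carrier (W\<lparr>carrier := Y\<rparr>)" by auto
 qed
 thus ?thesis using that sY Y by blast
qed

lemma complement_subrepresentation:
 assumes X: "subrepresentation G W \<sigma> X" and Y: "subrepresentation G W \<sigma> Y" "Y \<subseteq> X"
 obtains X' where "subrepresentation G W \<sigma> X'" "X' \<subseteq> X" "Y Int X' = {\<zero>}"
  "!!x. x \<in> X ==> EX y:Y. EX x':X'. x = y \<oplus> x'"
proof -
 note DX = subrepresentationD[OF X] and DY = subrepresentationD[OF Y(1)]
 define K where "K = inv_into (carrier W) J"
 have K: "K (J w) = w" if "w \<in> carrier W" for w using that J_inj by (simp add: K_def)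
 have KX: "K v \<in> X" "J (K v) = v" if "v \<in> J ` X" for v using that K DX(1) by auto
 have DXc: "x \<in> carrier W" if "x \<in> X" for x using that DX(1) by blast
 define act where "act g v = J (\<sigma> g (K v))" for g v
 have JJ: "J ` Y \<subseteq> J ` X" using Y(2) by blast
 have act: "act g (J w) = J (\<sigma> g w)" if "w \<in> carrier W" for g w using K[OF that] by (simp add: act_def)
 obtain Y' where Y': "subspace Y'" "Y' \<subseteq> J ` X" "!!g x. g \<in> carrier G ==> x \<in> Y' ==> act g x \<in> Y'"
  "J ` Y Int Y' = {0}" "!!x. x \<in> J ` X ==> EX y:J ` Y. EX y':Y'. x = y + y'"
 proof (rule maschke[OF is_group finite_carrier subspace_J[OF X] subspace_J[OF Y(1)] JJ, of act])
  show "act g v \<in> J ` X" if g: "g \<in> carrier G" and v: "v \<in> J ` X" for g v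
   unfolding act_def by (rule imageI, rule DX(5)[OF g KX(1)[OF v]])
  show "act g (v + w) = act g v + act g w" if g: "g \<in> carrier G" and v: "v \<in> J ` X" and w: "w \<in> J ` X" for g v w
  proof -
   obtain x y where xy: "x \<in> X" "y \<in> X" "v = J x" "w = J y" using v w by blast
   have c: "x \<in> carrier W" "y \<in> carrier W" using xy DXc by auto
   have "act g (v + w) = act g (J (x \<oplus> y))" unfolding xy(3,4) by (simp only: J_add[OF c])
   also have "... = J (\<sigma> g (x \<oplus> y))" by (rule act) (use c in simp)
   finally show ?thesis using act c g xy(3,4) J_add rho_add by simp
  qed
  show "act g (scale a v) = scale a (act g v)" if g: "g \<in> carrier G" and v: "v \<in> J ` X" for g v a
  proof -
   obtain x where x: "x \<in> X" "v = J x" using v by blast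
   have c: "x \<in> carrier W" using x DXc by auto
   have "act g (scale a v) = act g (J (a \<odot> x))" unfolding x(2) by (simp only: J_scale[OF c])
   also have "... = J (\<sigma> g (a \<odot> x))" by (rule act) (use c V.smult_closed in simp)
   finally show ?thesis using act c g x(2) J_scale rho_smult by simp
  qed
  show "act \<one>\<^bsub>G\<^esub> v = v" if v: "v \<in> J ` X" for v using KX[OF v] rho_one DXc by (simp add: act_def)
  show "act (g \<otimes>\<^bsub>G\<^esub> h) v = act g (act h v)" if g: "g \<in> carrier G" "h \<in> carrier G" and v: "v \<in> J ` X" for g h v
   using KX[OF v] rho_mult g DXc K by (simp add: act_def)
  show "act g v \<in> J ` Y" if g: "g \<in> carrier G" and v: "v \<in> J ` Y" for g v
  proof -
   obtain y where y: "y \<in> Y" "v = J y" using v by blast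
   thus ?thesis using act[of y g] DY(1,5) g by auto
  qed
 qed blast
 define X' where "X' = {w \<in> X. J w \<in> Y'}"
 show ?thesis
 proof
  show "subrepresentation G W \<sigma> X'"
  proof (rule subrepresentationI)
   show "X' \<subseteq> carrier W" using DX(1) by (auto simp: X'_def)
   show "\<zero> \<in> X'" using DX(2) J_zero subspace_0[OF Y'(1)] by (simp add: X'_def)
   show "x \<oplus> y \<in> X'" if "x \<in> X'" "y \<in> X'" for x y
    using that DX(3) J_add DXc subspace_add[OF Y'(1)] by (simp add: X'_def)
   show "a \<odot> x \<in> X'" if "x \<in> X'" for a x using that DX(4) J_scale DXc subspace_scale[OF Y'(1)] by (simp add: X'_def)
   show "\<sigma> g x \<in> X'" if g: "g \<in> carrier G" and x: "x \<in> X'" for g x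
    using x DX(5)[OF g] Y'(3)[OF g, of "J x"] act DXc by (simp add: X'_def)
  qed
  show "X' \<subseteq> X" by (auto simp: X'_def)
  show "Y Int X' = {\<zero>}"
  proof
   show "Y Int X' \<subseteq> {\<zero>}"
   proof
    fix y assume y: "y \<in> Y Int X'"
    hence "J y \<in> J ` Y Int Y'" by (auto simp: X'_def)
    hence "J y = 0" using Y'(4) by blast
    thus "y \<in> {\<zero>}" using y DY(1) J_eq_0 by auto
   qed
   show "{\<zero>} \<subseteq> Y Int X'" using DX(2) DY(2) J_zero subspace_0[OF Y'(1)] by (auto simp: X'_def)
  qed
  show "EX y:Y. EX x':X'. x = y \<oplus> x'" if x: "x \<in> X" for x
  proof -
   obtain y v where yv: "y \<in> Y" "v \<in> Y'" "J x = J y + v" using Y'(5)[of "J x"] x by blast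
   obtain x' where x': "x' \<in> X" "v = J x'" using yv(2) Y'(2) by blast
   have "J x = J (y \<oplus> x')" using J_add[of y x'] yv x' DY(1) DXc by auto
   hence "x = y \<oplus> x'" using J_inj yv(1) x' x DY(1) DXc by (meson V.M.add.m_closed inj_onD subsetD)
   thus ?thesis using yv x' by (auto simp: X'_def)
  qed
 qed
qed

text \<open>
  Split off an irreducible subrepresentation and a complement, by induction on the dimension.
\<close>

lemma decomposition_exists_in:
 assumes "subrepresentation G W \<sigma> X"
 shows "EX m U. (ALL i<m. subrepresentation G W \<sigma> (U i) & irreducible_representation G (W\<lparr>carrier := U i\<rparr>) \<sigma> & U i \<subseteq> X) &
  (ALL w:X. EX! u. u \<in> (\<Pi>\<^sub>E i\<in>{..<m::nat}. U i) & w = finsum W u {..<m})" using assms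
proof (induction "dim (J ` X)" arbitrary: X rule: less_induct)
 case less
 note DX = subrepresentationD[OF less.prems]
 show ?case
 proof (cases "X = {\<zero>}")
  case True
  show ?thesis by (rule exI[of _ 0]) (use True in auto)
 next
  case False
  obtain Y where Y: "subrepresentation G W \<sigma> Y" "Y \<subseteq> X" "irreducible_representation G (W\<lparr>carrier := Y\<rparr>) \<sigma>"
   by (rule minimal_subrepresentation[OF less.prems False])
  note DY = subrepresentationD[OF Y(1)]
  obtain X' where X': "subrepresentation G W \<sigma> X'" "X' \<subseteq> X" "Y Int X' = {\<zero>}"
   "!!x. x \<in> X ==> EX y:Y. EX x':X'. x = y \<oplus> x'" by (rule complement_subrepresentation[OF less.prems Y(1,2)]) blast
  note DX' = subrepresentationD[OF X'(1)]
  have "Y ~= {\<zero>}" using Y(3) by (simp add: irreducible_representation_def)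
  hence ne: "X' ~= X" using X'(3) Y(2) by blast
  have fX: "fin_dim (J ` X)" by (rule fin_dim_subset[OF J_fin]) (use DX(1) in auto)
  have JX: "J ` X' \<subseteq> J ` X" using X'(2) by blast
  have "J ` X' ~= J ` X" using inj_on_image_eq_iff[OF J_inj DX'(1) DX(1)] ne by blast
  hence "dim (J ` X') < dim (J ` X)" using dim_subspace_mono[OF fX subspace_J[OF less.prems] subspace_J[OF X'(1)] JX] by linarith
  from less.hyps[OF this X'(1)] obtain m U where
   mU: "ALL i<m. subrepresentation G W \<sigma> (U i) & irreducible_representation G (W\<lparr>carrier := U i\<rparr>) \<sigma> & U i \<subseteq> X'"
   and ex1: "ALL w:X'. EX! u. u \<in> (\<Pi>\<^sub>E i\<in>{..<m::nat}. U i) & w = finsum W u {..<m}" by blast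
  define U' where "U' = U(m := Y)"
  have fs: "finsum W u {..<Suc m} = u m \<oplus> finsum W u {..<m}"
   if "!!i. i < Suc m ==> u i \<in> carrier W" for u unfolding lessThan_Suc by (rule V.M.finsum_insert) (use that in auto)
  have fsX: "finsum W u {..<m} \<in> X'" if "!!i. i < m ==> u i \<in> X'" for u
  proof -
   have "finsum W u {..<k} \<in> X'" if "k <= m" for k using that
   proof (induction k)
    case 0
    thus ?case using DX'(2) by simp
   next
    case (Suc k)
    have "finsum W u {..<Suc k} = u k \<oplus> finsum W u {..<k}" unfolding lessThan_Suc
     by (rule V.M.finsum_insert) (use \<open>!!i. i < m ==> u i \<in> X'\<close> Suc.prems DX'(1) in auto)
    thus ?case using Suc DX'(3) \<open>!!i. i < m ==> u i \<in> X'\<close> by simp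
   qed
   thus ?thesis by simp
  qed
  have "EX! u. u \<in> (\<Pi>\<^sub>E i\<in>{..<Suc m}. U' i) & w = finsum W u {..<Suc m}" if w: "w \<in> X" for w
  proof (rule ex_ex1I)
   obtain y x' where yx: "y \<in> Y" "x' \<in> X'" "w = y \<oplus> x'" using X'(4)[OF w] by blast
   obtain u where u: "u \<in> (\<Pi>\<^sub>E i\<in>{..<m}. U i)" "x' = finsum W u {..<m}" using ex1 yx(2) by blast
   let ?u = "u(m := y)"
   have mem: "?u \<in> (\<Pi>\<^sub>E i\<in>{..<Suc m}. U' i)" using u(1) yx(1) by (auto simp: U'_def PiE_iff extensional_def)
   have uX: "u i \<in> X'" if "i < m" for i using u(1) mU that by (auto simp: PiE_iff)
   have "finsum W ?u {..<m} = finsum W u {..<m}" by (rule V.M.finsum_cong') (use uX DX'(1) in auto)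
   moreover have "?u i \<in> carrier W" if "i < Suc m" for i using that uX DX'(1) DY(1) yx(1) by (auto simp: less_Suc_eq)
   note fs[of ?u, OF this]
   ultimately have "finsum W ?u {..<Suc m} = w" using yx(3) u(2) by simp
   thus "EX u. u \<in> (\<Pi>\<^sub>E i\<in>{..<Suc m}. U' i) & w = finsum W u {..<Suc m}" using mem by blast
  next
   fix u v assume u: "u \<in> (\<Pi>\<^sub>E i\<in>{..<Suc m}. U' i) & w = finsum W u {..<Suc m}"
    and v: "v \<in> (\<Pi>\<^sub>E i\<in>{..<Suc m}. U' i) & w = finsum W v {..<Suc m}"
   have parts: "f m \<in> Y" "!!i. i < m ==> f i \<in> U i" "!!i. i < m ==> f i \<in> X'" "f i = undefined | i < Suc m"
    if "f \<in> (\<Pi>\<^sub>E i\<in>{..<Suc m}. U' i)" for f i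
   proof -
    have *: "f i \<in> U' i" if "i < Suc m" for i
     using that \<open>f \<in> (\<Pi>\<^sub>E i\<in>{..<Suc m}. U' i)\<close> by (auto simp: PiE_iff)
    show "f m \<in> Y" using *[of m] by (simp add: U'_def)
    show U: "f i \<in> U i" if i: "i < m" for i using *[of i] i by (simp add: U'_def)
    show "f i \<in> X'" if i: "i < m" for i using U[OF i] mU i by blast
    show "f i = undefined | i < Suc m"
     using \<open>f \<in> (\<Pi>\<^sub>E i\<in>{..<Suc m}. U' i)\<close> by (auto simp: PiE_iff extensional_def)
   qed
   note pu = parts[OF conjunct1[OF u]] and pv = parts[OF conjunct1[OF v]]
   let ?su = "finsum W u {..<m}" and ?sv = "finsum W v {..<m}"
   have s: "?su \<in> X'" "?sv \<in> X'" using fsX pu(3) pv(3) by auto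
   have eq: "u m \<oplus> ?su = v m \<oplus> ?sv"
   proof -
    have "u i \<in> carrier W" "v i \<in> carrier W" if "i < Suc m" for i
     using that pu(1,3) pv(1,3) DY(1) DX'(1) by (auto simp: less_Suc_eq)
    from fs[of u, OF this(1)] fs[of v, OF this(2)] show ?thesis using u v by simp
   qed
   have c: "u m \<in> carrier W" "v m \<in> carrier W" "?su \<in> carrier W" "?sv \<in> carrier W"
    using pu(1) pv(1) DY(1) s DX'(1) by auto
   have dY: "u m \<oplus> (- 1) \<odot> v m \<in> Y" using DY(3,4) pu(1) pv(1) by blast
   have dX: "?sv \<oplus> (- 1) \<odot> ?su \<in> X'" using DX'(3,4) s by blast
   have "J (u m) + J ?su = J (v m) + J ?sv" using eq J_add c by metis
   hence "J (u m \<oplus> (- 1) \<odot> v m) = J (?sv \<oplus> (- 1) \<odot> ?su)"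
    using c V.smult_closed by (simp add: J_add J_scale algebra_simps)
   hence "u m \<oplus> (- 1) \<odot> v m = ?sv \<oplus> (- 1) \<odot> ?su"
    using J_inj dY dX DY(1) DX'(1) by (meson inj_onD subsetD)
   hence z: "u m \<oplus> (- 1) \<odot> v m = \<zero>" "?sv \<oplus> (- 1) \<odot> ?su = \<zero>" using dY dX X'(3) by auto
   have um: "u m = v m" using add_scale_eq_zero[OF c(1,2) z(1)] V.smult_one[OF c(2)] by simp
   have sum: "?sv = ?su" using add_scale_eq_zero[OF c(4,3) z(2)] V.smult_one[OF c(3)] by simp
   have r: "restrict f {..<m} \<in> (\<Pi>\<^sub>E i\<in>{..<m}. U i) & finsum W f {..<m} = finsum W (restrict f {..<m}) {..<m}"
    if "!!i. i < m ==> f i \<in> U i" "!!i. i < m ==> f i \<in> X'" for f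
   proof
    show "restrict f {..<m} \<in> (\<Pi>\<^sub>E i\<in>{..<m}. U i)" using that(1) by auto
    show "finsum W f {..<m} = finsum W (restrict f {..<m}) {..<m}" by (rule V.M.finsum_cong') (use that(2) DX'(1) in auto)
   qed
   have "restrict u {..<m} = restrict v {..<m}"
   proof -
    have "restrict u {..<m} \<in> (\<Pi>\<^sub>E i\<in>{..<m}. U i) & ?su = finsum W (restrict u {..<m}) {..<m}"
     by (rule r) (rule pu(2,3), assumption)+
    moreover have "restrict v {..<m} \<in> (\<Pi>\<^sub>E i\<in>{..<m}. U i) & ?su = finsum W (restrict v {..<m}) {..<m}"
     unfolding sum[symmetric] by (rule r) (rule pv(2,3), assumption)+
    ultimately show ?thesis using bspec[OF ex1 s(1)] by blast
   qed
   hence less: "u i = v i" if "i < m" for i using that by (metis lessThan_iff restrict_apply')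
   show "u = v"
   proof
    fix i show "u i = v i"
    proof (cases "i < Suc m")
     case True
     thus ?thesis using less[of i] um by (auto simp: less_Suc_eq)
    next
     case False
     thus ?thesis using pu(4)[of i] pv(4)[of i] by simp
    qed
   qed
  qed
  moreover have "ALL i<Suc m. subrepresentation G W \<sigma> (U' i) & irreducible_representation G (W\<lparr>carrier := U' i\<rparr>) \<sigma> & U' i \<subseteq> X"
   using mU Y X'(2) by (auto simp: U'_def less_Suc_eq)
  ultimately show ?thesis by blast
 qed
qed

lemma decomposition_exists: "EX m U. irreducible_decomposition G W \<sigma> m U"
proof -
 have "subrepresentation G W \<sigma> (carrier W)" by (rule subrepresentationI) (auto intro: V.smult_closed)
 from decomposition_exists_in[OF this] show ?thesis unfolding irreducible_decomposition_def by blast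
qed

text \<open>
  In each summand isomorphic to \<open>V\<close> a primitive idempotent \<open>e\<close> for \<open>V\<close> cuts out a line, and it
  kills the others.  So the multiplicity is the dimension of \<open>e W\<close>.
\<close>

lemma decomposition_basis:
 assumes dec: "irreducible_decomposition G W \<sigma> m U"
  and iso: "!!Y. irreducible_representation G (W\<lparr>carrier := Y\<rparr>) \<sigma> ==> isomorphic_representations G V \<rho> (W\<lparr>carrier := Y\<rparr>) \<sigma> ==>
   EX b:Y. b ~= \<zero> & galg G (W\<lparr>carrier := Y\<rparr>) \<sigma> e b = b & (ALL u:Y. EX a. galg G (W\<lparr>carrier := Y\<rparr>) \<sigma> e u = a \<odot> b)"
  and niso: "!!Y u. irreducible_representation G (W\<lparr>carrier := Y\<rparr>) \<sigma> ==> ~ isomorphic_representations G V \<rho> (W\<lparr>carrier := Y\<rparr>) \<sigma> ==>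
   u \<in> Y ==> galg G (W\<lparr>carrier := Y\<rparr>) \<sigma> e u = \<zero>"
  and I: "I = {i. i < m & isomorphic_representations G V \<rho> (W\<lparr>carrier := U i\<rparr>) \<sigma>}"
 obtains b where "!!i. i \<in> I ==> b i \<in> carrier W" "!!i. i \<in> I ==> b i ~= \<zero>" "!!i. i \<in> I ==> alg e (b i) = b i"
  "!!w. w \<in> carrier W ==> EX a. J (alg e w) = (\<Sum>i\<in>I. scale (a i) (J (b i)))"
  "dim (J ` alg e ` carrier W) = card I"
proof -
 have sub: "subrepresentation G W \<sigma> (U i)" and irr: "irreducible_representation G (W\<lparr>carrier := U i\<rparr>) \<sigma>" if "i < m" for i
  using dec that by (auto simp: irreducible_decomposition_def)
 have ex1: "EX! u. u \<in> (\<Pi>\<^sub>E i\<in>{..<m}. U i) & w = finsum W u {..<m}" if "w \<in> carrier W" for w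
  using dec that by (auto simp: irreducible_decomposition_def)
 have fI: "finite I" and Im: "!!i. i \<in> I ==> i < m" by (auto simp: I)
 have UW: "u \<in> carrier W" if "i < m" "u \<in> U i" for i u using subrepresentationD(1)[OF sub] that by blast
 have "EX b. b \<in> U i & b ~= \<zero> & alg e b = b & (ALL u:U i. EX a. alg e u = a \<odot> b)" if i: "i \<in> I" for i
 proof -
  have "isomorphic_representations G V \<rho> (W\<lparr>carrier := U i\<rparr>) \<sigma>" using i by (simp add: I)
  from iso[OF irr[OF Im[OF i]] this] show ?thesis using alg_subrepresentation[OF sub[OF Im[OF i]]] by auto
 qed
 then obtain b where b: "!!i. i \<in> I ==> b i \<in> U i & b i ~= \<zero> & alg e (b i) = b i & (ALL u:U i. EX a. alg e u = a \<odot> b i)"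
  by metis
 have bW: "b i \<in> carrier W" if "i \<in> I" for i using b[OF that] UW Im[OF that] by blast
 have expand: "EX a. J (alg e w) = (\<Sum>i\<in>I. scale (a i) (J (b i)))" if w: "w \<in> carrier W" for w
 proof -
  obtain u where u: "u \<in> (\<Pi>\<^sub>E i\<in>{..<m}. U i)" "w = finsum W u {..<m}" using ex1[OF w] by blast
  have uU: "u i \<in> U i" if "i < m" for i using u(1) that by (auto simp: PiE_iff)
  have "ALL i:I. EX a. alg e (u i) = a \<odot> b i" using b uU Im by blast
  then obtain a where a: "!!i. i \<in> I ==> alg e (u i) = a i \<odot> b i" by metis
  have z: "alg e (u i) = \<zero>" if i: "i < m" "i \<notin> I" for i
  proof -
   have "~ isomorphic_representations G V \<rho> (W\<lparr>carrier := U i\<rparr>) \<sigma>" using i by (simp add: I)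
   thus ?thesis using niso[OF irr[OF i(1)] _ uU[OF i(1)]] alg_subrepresentation[OF sub[OF i(1)] uU[OF i(1)]] by simp
  qed
  have "J (alg e w) = (\<Sum>i<m. J (alg e (u i)))" unfolding u(2) by (rule J_alg_finsum) (use uU UW in auto)
  also have "... = (\<Sum>i\<in>I. J (alg e (u i)))" by (rule sum.mono_neutral_right) (use Im z J_zero in auto)
  also have "... = (\<Sum>i\<in>I. scale (a i) (J (b i)))" by (rule sum.cong) (use a bW J_scale in auto)
  finally show ?thesis by blast
 qed
 have ind: "ALL i:I. c i = 0" if c: "(\<Sum>i\<in>I. scale (c i) (J (b i))) = 0" for c
 proof -
  define u where "u = (%i. if i < m then if i \<in> I then c i \<odot> b i else \<zero> else undefined)"
  define z where "z = (%i. if i < m then \<zero> else undefined)"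
  have uU: "u i \<in> U i" "z i \<in> U i" if "i < m" for i
   using that b subrepresentationD(2,4)[OF sub[OF that]] by (auto simp: u_def z_def)
  have uz: "u \<in> (\<Pi>\<^sub>E i\<in>{..<m}. U i)" "z \<in> (\<Pi>\<^sub>E i\<in>{..<m}. U i)"
   using uU by (auto simp: PiE_iff extensional_def u_def z_def)
  have uW: "finsum W u {..<m} \<in> carrier W" by (rule V.M.finsum_closed) (use uU UW in auto)
  have "J (finsum W u {..<m}) = (\<Sum>i<m. J (u i))" by (rule J_finsum) (use uU UW in auto)
  also have "... = (\<Sum>i\<in>I. J (u i))" by (rule sum.mono_neutral_right) (use Im J_zero in \<open>auto simp: u_def\<close>)
  also have "... = (\<Sum>i\<in>I. scale (c i) (J (b i)))" by (rule sum.cong) (use Im J_scale bW in \<open>auto simp: u_def\<close>)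
  finally have "finsum W u {..<m} = \<zero>" using c J_eq_0[OF uW] by simp
  moreover have "finsum W z {..<m} = finsum W (%i. \<zero>) {..<m}" by (rule V.M.finsum_cong') (auto simp: z_def)
  ultimately have "u \<in> (\<Pi>\<^sub>E i\<in>{..<m}. U i) & \<zero> = finsum W u {..<m}" "z \<in> (\<Pi>\<^sub>E i\<in>{..<m}. U i) & \<zero> = finsum W z {..<m}"
   using uz V.M.finsum_zero by simp_all
  hence uz_eq: "u = z" using ex1[OF V.M.zero_closed] by blast
  have "c i \<odot> b i = \<zero>" if i: "i \<in> I" for i
  proof -
   have "u i = z i" by (rule fun_cong[OF uz_eq])
   thus ?thesis using i Im[OF i] by (simp add: u_def z_def)
  qed
  thus ?thesis using smult_eq_zero[OF bW] b by blast
 qed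
 note fam = independent_family[OF fI, of "%i. J (b i)", OF ind]
 have "J ` alg e ` carrier W = span ((%i. J (b i)) ` I)"
 proof
  show "J ` alg e ` carrier W \<subseteq> span ((%i. J (b i)) ` I)"
  proof
   fix v assume "v \<in> J ` alg e ` carrier W"
   then obtain w where w: "w \<in> carrier W" "v = J (alg e w)" by blast
   obtain a where "v = (\<Sum>i\<in>I. scale (a i) (J (b i)))" using expand[OF w(1)] w(2) by blast
   thus "v \<in> span ((%i. J (b i)) ` I)" by (simp only:) (intro span_sum span_scale span_base imageI)
  qed
  show "span ((%i. J (b i)) ` I) \<subseteq> J ` alg e ` carrier W"
  proof
   fix v assume "v \<in> span ((%i. J (b i)) ` I)"
   then obtain a where "v = (\<Sum>x\<in>(%i. J (b i)) ` I. scale (a x) x)" using span_finite[of "(%i. J (b i)) ` I"] fI by auto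
   hence v: "v = (\<Sum>i\<in>I. scale (a (J (b i))) (J (b i)))" using sum.reindex[OF fam(1), of "%x. scale (a x) x"] by simp
   define w where "w = finsum W (%i. a (J (b i)) \<odot> b i) I"
   have wW: "w \<in> carrier W" unfolding w_def by (rule V.M.finsum_closed) (use bW V.smult_closed in auto)
   have ab: "alg e (c \<odot> b i) = c \<odot> b i" if i: "i \<in> I" for c i
   proof -
    have "(%w. c \<odot> w) (alg e (b i)) = alg e ((%w. c \<odot> w) (b i))"
     by (rule intertwiner_alg[OF finite_rep_axioms finite_rep_axioms])
       (use bW[OF i] in \<open>auto simp: linear_maps_def V.smult_closed V.smult_r_distr rho_smult V.smult_assoc1[symmetric] mult.commute[of c] \<close>)
    thus ?thesis using b[OF i] by simp
   qed
   have "J (alg e w) = (\<Sum>i\<in>I. J (alg e (a (J (b i)) \<odot> b i)))"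
    unfolding w_def by (rule J_alg_finsum[OF fI]) (use bW V.smult_closed in auto)
   also have "... = v" unfolding v by (rule sum.cong) (use bW J_scale ab in auto)
   finally show "v \<in> J ` alg e ` carrier W" using wW by blast
  qed
 qed
 hence "dim (J ` alg e ` carrier W) = card ((%i. J (b i)) ` I)"
  using dim_eq_card_independent[OF fam(2)] dim_span[of "(%i. J (b i)) ` I"] by simp
 hence "dim (J ` alg e ` carrier W) = card I" using card_image[OF fam(1)] by simp
 thus ?thesis using that[of b] bW b expand by blast
qed

lemma multiplicity_one_line:
 assumes irr: "irreducible_representation G V \<rho>" and one: "multiplicity_in G V \<rho> W \<sigma> = 1"
 obtains e w0 where "e \<in> GA" "conv G e e = e" "w0 \<in> carrier W" "w0 ~= \<zero>" "alg e w0 = w0"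
  "!!w. w \<in> carrier W ==> EX a. alg e w = a \<odot> w0"
proof -
 obtain e where e: "e \<in> GA" "conv G e e = e"
  "!!(U :: (complex, 'w) module) \<tau>. irreducible_representation G U \<tau> ==> isomorphic_representations G V \<rho> U \<tau> ==>
   EX b:carrier U. b ~= \<zero>\<^bsub>U\<^esub> & galg G U \<tau> e b = b & (ALL u:carrier U. EX a. galg G U \<tau> e u = a \<odot>\<^bsub>U\<^esub> b)"
  "!!(U :: (complex, 'w) module) \<tau> u. irreducible_representation G U \<tau> ==> ~ isomorphic_representations G V \<rho> U \<tau> ==>
   u \<in> carrier U ==> galg G U \<tau> e u = \<zero>\<^bsub>U\<^esub>"
  by (rule primitive_idempotent[OF finite_group_axioms irr, where 'w = 'w]) blast
 define I where "I m U = {i. i < m & isomorphic_representations G V \<rho> (W\<lparr>carrier := U i\<rparr>) \<sigma>}" for m :: nat and U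
 have iso: "EX b:Y. b ~= \<zero> & galg G (W\<lparr>carrier := Y\<rparr>) \<sigma> e b = b & (ALL u:Y. EX a. galg G (W\<lparr>carrier := Y\<rparr>) \<sigma> e u = a \<odot> b)"
  if "irreducible_representation G (W\<lparr>carrier := Y\<rparr>) \<sigma>" "isomorphic_representations G V \<rho> (W\<lparr>carrier := Y\<rparr>) \<sigma>" for Y
  using e(3)[OF that] by simp
 have niso: "galg G (W\<lparr>carrier := Y\<rparr>) \<sigma> e u = \<zero>"
  if "irreducible_representation G (W\<lparr>carrier := Y\<rparr>) \<sigma>" "~ isomorphic_representations G V \<rho> (W\<lparr>carrier := Y\<rparr>) \<sigma>" "u \<in> Y" for Y u
  using e(4)[OF that(1,2)] that(3) by simp
 have card: "card (I m U) = dim (J ` alg e ` carrier W)" if "irreducible_decomposition G W \<sigma> m U" for m U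
  by (rule decomposition_basis[OF that iso niso I_def]) auto
 obtain m U where dec: "irreducible_decomposition G W \<sigma> m U" using decomposition_exists by blast
 have "multiplicity_in G V \<rho> W \<sigma> = card (I m U)" unfolding multiplicity_in_def
 proof (rule the_equality)
  show "EX m' U'. irreducible_decomposition G W \<sigma> m' U' & card (I m U) =
    card {i. i < m' & isomorphic_representations G V \<rho> (W\<lparr>carrier := U' i\<rparr>) \<sigma>}"
   using dec unfolding I_def by blast
  fix n assume "EX m' U'. irreducible_decomposition G W \<sigma> m' U' &
    n = card {i. i < m' & isomorphic_representations G V \<rho> (W\<lparr>carrier := U' i\<rparr>) \<sigma>}"
  then obtain m' U' where "irreducible_decomposition G W \<sigma> m' U'" "n = card (I m' U')" unfolding I_def by blast
  thus "n = card (I m U)" using card dec by simp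
 qed
 then obtain i where i: "I m U = {i}" using one by (metis card_1_singletonE)
 obtain b where b: "!!i. i \<in> I m U ==> b i \<in> carrier W" "!!i. i \<in> I m U ==> b i ~= \<zero>"
  "!!i. i \<in> I m U ==> alg e (b i) = b i"
  "!!w. w \<in> carrier W ==> EX a. J (alg e w) = (\<Sum>i\<in>I m U. scale (a i) (J (b i)))"
  by (rule decomposition_basis[OF dec iso niso I_def]) auto
 have bi: "b i \<in> carrier W" using b(1) i by simp
 show ?thesis
 proof (rule that[OF e(1,2) bi])
  show "b i ~= \<zero>" "alg e (b i) = b i" using b(2,3) i by auto
  show "EX a. alg e w = a \<odot> b i" if w: "w \<in> carrier W" for w
  proof -
   obtain a where "J (alg e w) = scale (a i) (J (b i))" using b(4)[OF w] i by auto
   hence "J (alg e w) = J (a i \<odot> b i)" using J_scale[OF bi] by simp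
   from inj_onD[OF J_inj this] have "alg e w = a i \<odot> b i" using bi w V.smult_closed by simp
   thus ?thesis by blast
  qed
 qed
qed

end

section \<open>A commutator that moves a line\<close>

abbreviation "fn_linear \<equiv> Vector_Spaces.linear fscale fscale"

lemma fn_linearI:
 assumes "!!x y. f (x + y) = f x + f y" "!!c x. f (fscale c x) = fscale c (f x)"
 shows "fn_linear f"
 by (simp add: Vector_Spaces.linear_def module_hom_def module_hom_axioms_def assms fn.module_axioms fn.vector_space_axioms)

lemma fn_rank_nullity:
 assumes "fn_linear f" "fn.subspace S" "fn.fin_dim S"
 shows "fn.dim S = fn.dim (f ` S) + fn.dim {x \<in> S. f x = 0}"
proof -
 obtain C where C: "finite C" "S \<subseteq> fn.span C" using assms(3) by (auto simp: fn.fin_dim_def)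
 show ?thesis by (rule fn_fn.rank_nullity[OF assms(1,2) C])
qed

lemma fn_dim_zero: "fn.dim {0 :: 'k => complex} = 0"
proof -
 have "fn.dim {0 :: 'k => complex} = fn.dim (fn.span {} :: ('k => complex) set)" by (simp only: fn.span_empty)
 also have "... = fn.dim ({} :: ('k => complex) set)" by (rule fn.dim_span)
 also have "... = card ({} :: ('k => complex) set)" by (rule fn.dim_eq_card_independent[OF fn.independent_empty])
 finally show ?thesis by simp
qed

lemma fn_dim_inj:
 assumes "fn_linear f" "fn.subspace S" "fn.fin_dim S"
  and "!!x. x \<in> S ==> f x = 0 ==> x = 0"
 shows "fn.dim (f ` S) = fn.dim S"
proof -
 have "f 0 = 0" using fn_fn.linear_0[OF assms(1)] .
 hence "{x \<in> S. f x = 0} = {0}" using assms(4) fn.subspace_0[OF assms(2)] by blast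
 thus ?thesis using fn_rank_nullity[OF assms(1-3)] fn_dim_zero by simp
qed

lemma fn_dim_plus_line:
 assumes Y: "fn.subspace Y" "fn.fin_dim Y" and N: "fn.subspace N" "N \<subseteq> Y"
  and y0: "y0 \<in> Y" "y0 \<notin> N" and line: "!!y. y \<in> Y ==> EX c. y - fscale c y0 \<in> N"
 shows "fn.dim Y = fn.dim N + 1"
proof -
 obtain B where B: "finite B" "B \<subseteq> N" "fn.independent B" "fn.span B = N" "fn.dim N = card B"
  by (rule fn.fin_dim_basis[OF fn.fin_dim_subset[OF Y(2) N(2)] N(1)])
 have nB: "y0 \<notin> B" using B(2) y0(2) by blast
 have ind: "fn.independent (insert y0 B)" using fn.independent_insertI[of y0 B] y0(2) B(3,4) by simp
 have "fn.span (insert y0 B) = Y"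
 proof
  show "fn.span (insert y0 B) \<subseteq> Y" by (rule fn.span_minimal) (use B(2) N(2) y0(1) Y(1) in auto)
  show "Y \<subseteq> fn.span (insert y0 B)"
  proof
   fix y assume "y \<in> Y"
   then obtain c where "y - fscale c y0 \<in> N" using line by blast
   hence "y - fscale c y0 \<in> fn.span B" using B(4) by simp
   thus "y \<in> fn.span (insert y0 B)" using fn.span_breakdown_eq[of y y0 B] by blast
  qed
 qed
 hence "fn.dim Y = card (insert y0 B)" using fn.dim_eq_card_independent[OF ind] fn.dim_span by metis
 thus ?thesis using B(1,5) nB by simp
qed

text \<open>Pairs of functions are encoded as functions on \<open>bool \<times> 'q\<close>.\<close>

definition pr :: "('q => complex) => ('q => complex) => bool \<times> 'q => complex"
 where "pr a b = (%x. if fst x then a (snd x) else b (snd x))"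

definition p1 :: "(bool \<times> 'q => complex) => 'q => complex" where "p1 y = (%q. y (True, q))"
definition p2 :: "(bool \<times> 'q => complex) => 'q => complex" where "p2 y = (%q. y (False, q))"

definition sq :: "('q => complex) set => (bool \<times> 'q => complex) set"
 where "sq S = {y. p1 y \<in> S & p2 y \<in> S}"

lemma p_pr [simp]: "p1 (pr a b) = a" "p2 (pr a b) = b" by (auto simp: p1_def p2_def pr_def)

lemma pr_p [simp]: "pr (p1 y) (p2 y) = y" by (auto simp: p1_def p2_def pr_def fun_eq_iff)

lemma pr_eqI:
 assumes "p1 x = p1 y" "p2 x = p2 y"
 shows "x = y"
proof -
 have "x = pr (p1 x) (p2 x)" by simp
 also have "... = pr (p1 y) (p2 y)" by (simp only: assms)
 finally show ?thesis by simp
qed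

lemma p_add: "p1 (x + y) = p1 x + p1 y" "p2 (x + y) = p2 x + p2 y"
 and p_scale: "p1 (fscale c x) = fscale c (p1 x)" "p2 (fscale c x) = fscale c (p2 x)"
 and p_diff: "p1 (x - y) = p1 x - p1 y" "p2 (x - y) = p2 x - p2 y"
 and p_zero: "p1 0 = 0" "p2 0 = 0" by (auto simp: p1_def p2_def fun_eq_iff)

lemma linear_p: "fn_linear p1" "fn_linear p2" by (rule fn_linearI, rule p_add, rule p_scale)+

lemma subspace_sq: "fn.subspace S ==> fn.subspace (sq S)" by (rule fn.subspaceI)
   (simp_all only: sq_def mem_Collect_eq p_add p_scale p_zero fn.subspace_0 fn.subspace_add fn.subspace_scale)

lemma fin_dim_sq:
 assumes "finite Q" "S \<subseteq> funs_on Q"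
 shows "fn.fin_dim (sq S)"
proof (rule fn.fin_dim_subset[OF fin_dim_funs_on[of "UNIV \<times> Q"]])
 show "finite ((UNIV :: bool set) \<times> Q)" using assms(1) by simp
 show "sq S \<subseteq> funs_on (UNIV \<times> Q)"
 proof
  fix y assume "y \<in> sq S"
  hence "p1 y \<in> funs_on Q" "p2 y \<in> funs_on Q" using assms(2) by (auto simp: sq_def)
  hence z: "y (True, q) = 0" "y (False, q) = 0" if "q \<notin> Q" for q using that by (auto simp: funs_on_def p1_def p2_def)
  have "y (i, q) = 0" if "q \<notin> Q" for i q using z[OF that] by (cases i) auto
  thus "y \<in> funs_on (UNIV \<times> Q)" by (auto simp: funs_on_def)
 qed
qed

lemma dim_sq:
 assumes Q: "finite Q" "S \<subseteq> funs_on Q" and S: "fn.subspace S"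
 shows "fn.dim (sq S) = 2 * fn.dim S"
proof -
 let ?K = "{y \<in> sq S. p1 y = 0}"
 have K: "fn.subspace ?K" by (rule fn.subspaceI)
    (use subspace_sq[OF S] fn.subspace_0 fn.subspace_add fn.subspace_scale in \<open>auto simp only: mem_Collect_eq p_add p_scale p_zero add_0 fn.scale_zero_right\<close>)
 have z: "0 \<in> S" by (rule fn.subspace_0[OF S])
 have i1: "p1 ` sq S = S"
 proof
  show "S \<subseteq> p1 ` sq S"
  proof
   fix a assume "a \<in> S"
   hence "pr a 0 \<in> sq S" "a = p1 (pr a 0)" using z by (simp_all only: sq_def p_pr mem_Collect_eq simp_thms)
   thus "a \<in> p1 ` sq S" by blast
  qed
 qed (auto simp: sq_def)
 have i2: "p2 ` ?K = S"
 proof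
  show "S \<subseteq> p2 ` ?K"
  proof
   fix a assume "a \<in> S"
   hence "pr 0 a \<in> ?K" "a = p2 (pr 0 a)" using z by (simp_all only: sq_def p_pr mem_Collect_eq simp_thms)
   thus "a \<in> p2 ` ?K" by blast
  qed
 qed (auto simp: sq_def)
 have inj: "y = 0" if "y \<in> ?K" "p2 y = 0" for y using that by (intro pr_eqI) (simp_all only: p_zero mem_Collect_eq)
 have fK: "fn.fin_dim ?K" by (rule fn.fin_dim_subset[OF fin_dim_sq[OF Q]]) auto
 show ?thesis using fn_rank_nullity[OF linear_p(1) subspace_sq[OF S] fin_dim_sq[OF Q]] i1
   fn_dim_inj[OF linear_p(2) K fK inj] i2 by simp
qed

definition pull :: "'q set => ('q => 'q) => ('q => complex) => 'q => complex"
 where "pull Q p f = (%q. if q \<in> Q then f (p q) else 0)"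

definition cst :: "'q set => complex => 'q => complex"
 where "cst Q c = (%q. if q \<in> Q then c else 0)"

lemma pull_in: "pull Q p f \<in> funs_on Q" by (simp add: pull_def funs_on_def)

lemma linear_pull: "fn_linear (pull Q p)" by (rule fn_linearI) (auto simp: pull_def fun_eq_iff)

lemmas pull_add = fn_fn.linear_add[OF linear_pull] and pull_scale = fn_fn.linear_scale[OF linear_pull]
 and pull_diff = fn_fn.linear_diff[OF linear_pull] and pull_zero = fn_fn.linear_0[OF linear_pull]

text \<open>
  The setting: two permutations \<open>r\<close> and \<open>u\<close> of a finite set generating a transitive group, and a
  projection \<open>P\<close> on the functions on the set that commutes with both of them.
\<close>

locale commuting_projection =
 fixes Q :: "'q set" and r u :: "'q => 'q" and P :: "('q => complex) => 'q => complex"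
 assumes Q: "finite Q" "Q ~= {}" and r: "bij_betw r Q Q" and u: "bij_betw u Q Q"
  and linear_P: "fn_linear P"
  and P_in: "P f \<in> funs_on Q"
  and P_idem: "P (P f) = P f"
  and P_r: "f \<in> funs_on Q ==> P (pull Q r f) = pull Q r (P f)"
  and P_u: "f \<in> funs_on Q ==> P (pull Q u f) = pull Q u (P f)"
  and P_sum: "f \<in> funs_on Q ==> (\<Sum>q\<in>Q. f q) = 0 ==> (\<Sum>q\<in>Q. P f q) = 0"
  and trans: "f \<in> funs_on Q ==> pull Q r f = f ==> pull Q u f = f ==> EX c. f = cst Q c"
begin

abbreviation "R \<equiv> pull Q r"
abbreviation "U \<equiv> pull Q u"
abbreviation "E \<equiv> funs_on Q"

definition "A = {f \<in> E. P f = f}"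
definition "A0 = {f \<in> A. (\<Sum>q\<in>Q. f q) = 0}"
definition "K = {f \<in> A. EX c. f = cst Q c}"
text \<open>
  The obstruction of a pair of jumps to be balanced with \<open>h = 0\<close>; \<open>cb g\<close>
  is the pair of jumps of a coboundary, and \<open>bd (cb g)\<close> is the commutator of
  \<open>R\<close> and \<open>U\<close> applied to \<open>g\<close>.
\<close>

definition "bd y = (R (p2 y) - p2 y) - (U (p1 y) - p1 y)"
definition "cb g = pr (R g - g) (U g - g)"
definition "mean f = cst Q ((\<Sum>q\<in>Q. f q) / of_nat (card Q))"

lemmas P_add = fn_fn.linear_add[OF linear_P] and P_scale = fn_fn.linear_scale[OF linear_P]
 and P_diff = fn_fn.linear_diff[OF linear_P] and P_zero = fn_fn.linear_0[OF linear_P]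

lemma subspace_E: "fn.subspace E" by (rule subspace_funs_on)

lemma subspace_A: "fn.subspace A" by (rule fn.subspaceI)
   (use subspace_E fn.subspace_0 fn.subspace_add fn.subspace_scale in \<open>auto simp only: A_def mem_Collect_eq P_add P_scale P_zero\<close>)

lemma A_E: "A \<subseteq> E" by (auto simp: A_def)

lemma A_ops: "f \<in> A ==> R f \<in> A" "f \<in> A ==> U f \<in> A" "P f \<in> A"
 using P_r[of f] P_u[of f] P_idem P_in pull_in by (auto simp: A_def)

lemma fin_dim_A: "fn.fin_dim A" by (rule fn.fin_dim_subset[OF fin_dim_funs_on[OF Q(1)] A_E])

lemma sum_pull: "bij_betw p Q Q ==> (\<Sum>q\<in>Q. pull Q p f q) = (\<Sum>q\<in>Q. f q)"
 using sum.reindex_bij_betw[of p Q Q f] by (simp add: pull_def)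

lemma pull_cst: "bij_betw p Q Q ==> pull Q p (cst Q c) = cst Q c" by (auto simp: pull_def cst_def fun_eq_iff dest: bij_betwE)

lemma card_Q: "of_nat (card Q) ~= (0 :: complex)" using Q by simp

lemma cst_in: "cst Q c \<in> E" by (simp add: cst_def funs_on_def)

lemma mean_cst: "mean (cst Q c) = cst Q c" using card_Q by (simp add: mean_def cst_def)

lemma linear_mean: "fn_linear mean" by (rule fn_linearI)
   (auto simp: mean_def cst_def fun_eq_iff sum.distrib add_divide_distrib sum_distrib_left[symmetric])

lemmas mean_add = fn_fn.linear_add[OF linear_mean] and mean_diff = fn_fn.linear_diff[OF linear_mean]

lemma mean_eq_0: "mean f = 0 \<longleftrightarrow> (\<Sum>q\<in>Q. f q) = 0"
proof
 assume "mean f = 0"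
 moreover obtain q where "q \<in> Q" using Q(2) by blast
 ultimately have "(\<Sum>q\<in>Q. f q) / of_nat (card Q) = 0" by (metis cst_def mean_def zero_fun_apply)
 thus "(\<Sum>q\<in>Q. f q) = 0" using card_Q by simp
qed (auto simp: mean_def cst_def fun_eq_iff)

lemma P_cst: "EX d. P (cst Q c) = cst Q d"
 by (rule trans) (use P_r[OF cst_in, of c] P_u[OF cst_in, of c] P_in pull_cst r u in auto)

lemma mean_in_K: assumes "f \<in> A" shows "mean f \<in> K"
proof -
 have f: "f \<in> E" "P f = f" using assms by (auto simp: A_def)
 have mE: "mean f \<in> E" by (simp add: mean_def cst_in)
 have "mean (mean f) = mean f" by (simp only: mean_def[of f] mean_cst)
 hence "mean (f - mean f) = 0" by (simp only: mean_diff diff_self)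
 hence "(\<Sum>q\<in>Q. (f - mean f) q) = 0" using mean_eq_0 by blast
 hence "(\<Sum>q\<in>Q. P (f - mean f) q) = 0" by (rule P_sum[OF fn.subspace_diff[OF subspace_E f(1) mE]])
 hence "mean (P (f - mean f)) = 0" using mean_eq_0 by blast
 hence "mean f - mean (P (mean f)) = 0" by (simp only: P_diff mean_diff f(2))
 moreover obtain d where d: "P (mean f) = cst Q d" using P_cst by (auto simp: mean_def)
 ultimately have "P (mean f) = mean f" by (simp only: mean_cst right_minus_eq)
 thus ?thesis using mE unfolding K_def A_def mean_def by blast
qed

lemma subspace_K: "fn.subspace K"
proof -
 have "K = mean ` A"
 proof
  show "K \<subseteq> mean ` A"
  proof
   fix f assume f: "f \<in> K"
   hence "f = mean f" using mean_cst by (auto simp: K_def)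
   thus "f \<in> mean ` A" using f by (auto simp: K_def)
  qed
 qed (use mean_in_K in auto)
 thus ?thesis using fn_fn.linear_subspace_image[OF linear_mean subspace_A] by simp
qed

lemma K_E: "K \<subseteq> E" and K_A: "K \<subseteq> A" using A_E by (auto simp: K_def)

lemma subspace_A0: "A0 = {f \<in> A. mean f = 0}" by (simp add: A0_def mean_eq_0)

lemma dim_A: "fn.dim A = fn.dim K + fn.dim A0"
proof -
 have "mean ` A = K"
 proof
  show "K \<subseteq> mean ` A"
  proof
   fix f assume f: "f \<in> K"
   hence "f = mean f" using mean_cst by (auto simp: K_def)
   thus "f \<in> mean ` A" using f by (auto simp: K_def)
  qed
 qed (use mean_in_K in auto)
 thus ?thesis using fn_rank_nullity[OF linear_mean subspace_A fin_dim_A] subspace_A0 by simp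
qed

lemma linear_bd: "fn_linear bd"
proof (rule fn_linearI)
 fix x y :: "bool \<times> 'q => complex" and c
 show "bd (x + y) = bd x + bd y" unfolding bd_def p_add pull_add by (simp add: fun_eq_iff)
 show "bd (fscale c x) = fscale c (bd x)" unfolding bd_def p_scale pull_scale fn.scale_right_diff_distrib ..
qed

lemma linear_cb: "fn_linear cb"
proof (rule fn_linearI)
 fix x y :: "'q => complex" and c
 show "cb (x + y) = cb x + cb y" by (rule pr_eqI) (simp_all add: cb_def p_add pull_add)
 show "cb (fscale c x) = fscale c (cb x)"
  by (rule pr_eqI) (simp_all only: cb_def p_scale p_pr pull_scale fn.scale_right_diff_distrib)
qed

lemmas bd_add = fn_fn.linear_add[OF linear_bd] and bd_diff = fn_fn.linear_diff[OF linear_bd]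

lemma bd_cb: "bd (cb g) = R (U g) - U (R g)" unfolding bd_def cb_def p_pr pull_diff by (simp add: fun_eq_iff)

text \<open>
  By transitivity every function with sum 0 is a combination of differences \<open>R b - b\<close> and
  \<open>U a - a\<close>: the points that such combinations can connect form an invariant set.
\<close>

lemma bd_onto_sum_zero:
 assumes f: "f \<in> E" "(\<Sum>q\<in>Q. f q) = 0"
 shows "EX y:sq E. f = bd y"
proof -
 let ?I = "bd ` sq E"
 have sI: "fn.subspace ?I" by (rule fn_fn.linear_subspace_image[OF linear_bd subspace_sq[OF subspace_E]])
 obtain q0 where q0: "q0 \<in> Q" using Q(2) by blast
 have dl: "pull Q p (delta (p q)) = delta q" if "bij_betw p Q Q" "q \<in> Q" for p q
  using that by (auto simp: pull_def delta_def fun_eq_iff bij_betw_def inj_on_eq_iff)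
 have dE: "delta q \<in> E" if "q \<in> Q" for q by (rule delta_in_funs_on[OF that])
 have rQ: "r q \<in> Q" and uQ: "u q \<in> Q" if "q \<in> Q" for q using that r u by (auto dest: bij_betwE)
 have Rstep: "delta q - delta (r q) \<in> ?I" if q: "q \<in> Q" for q
 proof (rule image_eqI)
  show "delta q - delta (r q) = bd (pr 0 (delta (r q)))" unfolding bd_def p_pr pull_zero dl[OF r q] by simp
  show "pr 0 (delta (r q)) \<in> sq E" using dE[OF rQ[OF q]] fn.subspace_0[OF subspace_E] by (simp only: sq_def mem_Collect_eq p_pr simp_thms)
 qed
 have Ustep: "delta q - delta (u q) \<in> ?I" if q: "q \<in> Q" for q
 proof (rule image_eqI)
  show "delta q - delta (u q) = bd (pr (- delta (u q)) 0)"
   unfolding bd_def p_pr pull_zero fn_fn.linear_neg[OF linear_pull] dl[OF u q] by simp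
  show "pr (- delta (u q)) 0 \<in> sq E"
   using fn.subspace_neg[OF subspace_E dE[OF uQ[OF q]]] fn.subspace_0[OF subspace_E] by (simp only: sq_def mem_Collect_eq p_pr simp_thms)
 qed
 define T where "T = {q \<in> Q. delta q - delta q0 \<in> ?I}"
 have stepT: "q \<in> T \<longleftrightarrow> p q \<in> T" if d: "delta q - delta (p q) \<in> ?I" and q: "q \<in> Q" "p q \<in> Q" for p q
 proof
  assume "p q \<in> T"
  hence "(delta q - delta (p q)) + (delta (p q) - delta q0) \<in> ?I" using fn.subspace_add[OF sI d] by (simp only: T_def mem_Collect_eq)
  moreover have "(delta q - delta (p q)) + (delta (p q) - delta q0) = delta q - delta q0" by (simp only: add_diff_eq diff_add_cancel)
  ultimately have "delta q - delta q0 \<in> ?I" by (simp only:)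
  thus "q \<in> T" using q(1) by (simp only: T_def mem_Collect_eq simp_thms)
 next
  assume "q \<in> T"
  hence "delta q - delta q0 \<in> ?I" by (simp only: T_def mem_Collect_eq)
  from fn.subspace_diff[OF sI this d] have "delta (p q) - delta q0 \<in> ?I" by (simp add: algebra_simps)
  thus "p q \<in> T" using q(2) by (simp only: T_def mem_Collect_eq simp_thms)
 qed
 let ?ind = "%q. if q \<in> T then 1 else 0 :: complex"
 have tr: "q \<in> T \<longleftrightarrow> r q \<in> T" "q \<in> T \<longleftrightarrow> u q \<in> T" if q: "q \<in> Q" for q
  by (rule stepT[where p = r, OF Rstep[OF q] q rQ[OF q]], rule stepT[where p = u, OF Ustep[OF q] q uQ[OF q]])
 have TQ: "q \<in> Q" if "q \<in> T" for q using that unfolding T_def by blast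
 have "EX c. ?ind = cst Q c"
 proof (rule trans)
  show "?ind \<in> E" using TQ by (auto simp: funs_on_def)
  show "R ?ind = ?ind"
  proof
   fix q show "R ?ind q = ?ind q" using tr(1)[of q] TQ[of q] by (auto simp: pull_def)
  qed
  show "U ?ind = ?ind"
  proof
   fix q show "U ?ind q = ?ind q" using tr(2)[of q] TQ[of q] by (auto simp: pull_def)
  qed
 qed
 then obtain c where c: "?ind = cst Q c" by blast
 have "q0 \<in> T" using q0 fn.subspace_0[OF sI] by (simp only: T_def mem_Collect_eq diff_self simp_thms)
 hence "c = 1" using fun_cong[OF c, of q0] q0 by (simp add: cst_def)
 hence T: "q \<in> T" if "q \<in> Q" for q using fun_cong[OF c, of q] that by (simp add: cst_def split: if_splits)
 have "f = (\<Sum>q\<in>Q. fscale (f q) (delta q))" by (rule funs_on_expand[OF Q(1) f(1)])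
 also have "... = (\<Sum>q\<in>Q. fscale (f q) (delta q - delta q0)) + fscale (\<Sum>q\<in>Q. f q) (delta q0)"
  unfolding fn.scale_sum_left sum.distrib[symmetric]
  by (intro sum.cong refl) (simp only: fn.scale_right_diff_distrib diff_add_cancel)
 also have "... = (\<Sum>q\<in>Q. fscale (f q) (delta q - delta q0))" unfolding f(2) fn.scale_zero_left by (rule add_0_right)
 also have "... \<in> ?I" by (intro fn.subspace_sum fn.subspace_scale sI) (use T in \<open>simp only: T_def mem_Collect_eq\<close>)
 finally show ?thesis by blast
qed

lemma bd_sq_A: "bd ` sq A = A0"
proof
 show "bd ` sq A \<subseteq> A0"
 proof
  fix f assume "f \<in> bd ` sq A"
  then obtain y where y: "p1 y \<in> A" "p2 y \<in> A" "f = bd y" by (auto simp: sq_def)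
  have "f \<in> A" unfolding y(3) bd_def by (intro fn.subspace_diff subspace_A A_ops y)
  moreover have "(\<Sum>q\<in>Q. f q) = 0" unfolding y(3) bd_def by (simp add: sum_subtractf sum_pull r u)
  ultimately show "f \<in> A0" by (simp add: A0_def)
 qed
 show "A0 \<subseteq> bd ` sq A"
 proof
  fix f assume f: "f \<in> A0"
  then obtain y where y: "y \<in> sq E" "f = bd y" using bd_onto_sum_zero[of f] A_E by (auto simp: A0_def)
  have "P f = bd (pr (P (p1 y)) (P (p2 y)))"
   using y(1) unfolding y(2) bd_def p_pr P_diff sq_def mem_Collect_eq by (simp only: P_r P_u)
  moreover have "P f = f" using f by (simp add: A0_def A_def)
  ultimately show "f \<in> bd ` sq A" using A_ops(3) by (metis (mono_tags, lifting) image_eqI mem_Collect_eq p_pr sq_def)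
 qed
qed

text \<open>
  The pairs of jumps of cocycles, and among them those of coboundaries and of cocycles of the
  torus.
\<close>

definition "Y = {y \<in> sq A. EX g:A. bd y = bd (cb g)}"
definition "N = {y. EX g:A. EX k:sq K. y = cb g + k}"

lemma cb_in: "g \<in> A ==> cb g \<in> sq A"
 by (simp only: cb_def sq_def mem_Collect_eq p_pr) (intro conjI fn.subspace_diff subspace_A A_ops)

lemma bd_K: assumes "k \<in> sq K" shows "bd k = 0"
proof -
 have "pull Q p f = f" if "bij_betw p Q Q" "f \<in> K" for p f using that pull_cst by (auto simp: K_def)
 hence "R (p2 k) = p2 k" "U (p1 k) = p1 k" using assms r u by (auto simp: sq_def)
 thus ?thesis by (simp add: bd_def)
qed

lemma cb_mean_zero: "mean (p1 (cb g)) = 0" "mean (p2 (cb g)) = 0"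
 unfolding mean_eq_0 cb_def p_pr by (simp_all add: sum_subtractf sum_pull r u)

lemma N_Y: "N \<subseteq> Y"
proof
 fix y assume "y \<in> N"
 then obtain g k where gk: "g \<in> A" "k \<in> sq K" "y = cb g + k" by (auto simp: N_def)
 have "k \<in> sq A" using gk(2) K_A by (auto simp: sq_def)
 hence "y \<in> sq A" unfolding gk(3) by (intro fn.subspace_add subspace_sq subspace_A cb_in gk)
 moreover have "bd y = bd (cb g)" unfolding gk(3) bd_add bd_K[OF gk(2)] by simp
 ultimately show "y \<in> Y" using gk(1) by (auto simp: Y_def)
qed

lemma subspace_Y: "fn.subspace Y"
proof -
 let ?S = "bd ` cb ` A"
 have S: "fn.subspace ?S" by (intro fn_fn.linear_subspace_image linear_bd linear_cb subspace_A)
 have "Y = sq A Int bd -` ?S" by (auto simp: Y_def)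
 thus ?thesis using fn.subspace_inter[OF subspace_sq[OF subspace_A] fn_fn.linear_subspace_vimage[OF linear_bd S]] by simp
qed

lemma subspace_N: "fn.subspace N"
proof -
 have "N = {x + y |x y. x \<in> cb ` A & y \<in> sq K}" by (auto simp: N_def)
 thus ?thesis using fn.subspace_sums[OF fn_fn.linear_subspace_image[OF linear_cb subspace_A] subspace_sq[OF subspace_K]] by simp
qed

lemma fin_dim_sq_A: "fn.fin_dim (sq A)" by (rule fin_dim_sq[OF Q(1) A_E])

lemma Y_sq: "Y \<subseteq> sq A" by (auto simp: Y_def)

lemma dim_Y: "fn.dim Y + fn.dim A0 = fn.dim (bd ` cb ` A) + 2 * fn.dim A"
proof -
 have "bd ` Y = bd ` cb ` A"
 proof
  show "bd ` cb ` A \<subseteq> bd ` Y" using cb_in by (auto simp: Y_def)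
 qed (auto simp: Y_def)
 moreover have "{y \<in> Y. bd y = 0} = {y \<in> sq A. bd y = 0}"
 proof
  show "{y \<in> sq A. bd y = 0} \<subseteq> {y \<in> Y. bd y = 0}"
  proof
   fix y assume y: "y \<in> {y \<in> sq A. bd y = 0}"
   have "bd (cb 0) = 0" by (simp only: fn_fn.linear_0[OF linear_bd] fn_fn.linear_0[OF linear_cb])
   thus "y \<in> {y \<in> Y. bd y = 0}" using y fn.subspace_0[OF subspace_A] unfolding Y_def by (metis (mono_tags, lifting) mem_Collect_eq)
  qed
 qed (auto simp: Y_def)
 ultimately show ?thesis using fn_rank_nullity[OF linear_bd subspace_Y fn.fin_dim_subset[OF fin_dim_sq_A Y_sq]]
   fn_rank_nullity[OF linear_bd subspace_sq[OF subspace_A] fin_dim_sq_A] bd_sq_A dim_sq[OF Q(1) A_E subspace_A] by simp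
qed

lemma dim_cb: "fn.dim A = fn.dim (cb ` A) + fn.dim K"
proof -
 have "{g \<in> A. cb g = 0} = K"
 proof
  show "{g \<in> A. cb g = 0} \<subseteq> K"
  proof
   fix g assume g: "g \<in> {g \<in> A. cb g = 0}"
   hence "p1 (cb g) = 0" "p2 (cb g) = 0" by (simp_all only: mem_Collect_eq p_zero)
   hence "R g = g" "U g = g" unfolding cb_def p_pr by (simp_all only: right_minus_eq)
   hence "EX c. g = cst Q c" using trans[of g] g A_E by blast
   thus "g \<in> K" using g by (auto simp: K_def)
  qed
  show "K \<subseteq> {g \<in> A. cb g = 0}"
  proof
   fix g assume g: "g \<in> K"
   hence "R g = g" "U g = g" using pull_cst r u by (auto simp: K_def)
   hence "cb g = 0" by (intro pr_eqI) (simp_all only: cb_def p_pr p_zero diff_self)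
   thus "g \<in> {g \<in> A. cb g = 0}" using g K_A by blast
  qed
 qed
 thus ?thesis using fn_rank_nullity[OF linear_cb subspace_A fin_dim_A] by simp
qed

lemma dim_N: "fn.dim N = 2 * fn.dim K + fn.dim (cb ` A)"
proof -
 define m where "m y = pr (mean (p1 y)) (mean (p2 y))" for y :: "bool \<times> 'q => complex"
 have lin: "fn_linear m"
 proof (rule fn_linearI)
  fix x y :: "bool \<times> 'q => complex" and c
  show "m (x + y) = m x + m y" by (rule pr_eqI) (simp_all only: m_def p_add p_pr mean_add)
  show "m (fscale c x) = fscale c (m x)" by (rule pr_eqI) (simp_all only: m_def p_scale p_pr fn_fn.linear_scale[OF linear_mean])
 qed
 have mK: "m k = k" if "k \<in> sq K" for k
 proof -
  have "mean f = f" if "f \<in> K" for f using that mean_cst by (auto simp: K_def)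
  thus ?thesis using that by (simp add: m_def sq_def)
 qed
 have mcb: "m (cb g) = 0" for g by (rule pr_eqI) (simp_all only: m_def p_pr cb_mean_zero p_zero)
 have mN: "m (cb g + k) = k" if "k \<in> sq K" for g k unfolding fn_fn.linear_add[OF lin] mcb mK[OF that] by (rule add_0_left)
 have z: "0 \<in> sq K" by (rule fn.subspace_0[OF subspace_sq[OF subspace_K]])
 have z': "cb 0 = 0" "0 \<in> A" using fn_fn.linear_0[OF linear_cb] fn.subspace_0[OF subspace_A] by auto
 have "m ` N = sq K"
 proof
  show "m ` N \<subseteq> sq K" using mN by (auto simp: N_def)
  show "sq K \<subseteq> m ` N"
  proof
   fix k assume k: "k \<in> sq K"
   have "cb 0 + k \<in> N" using k z'(2) unfolding N_def by blast
   thus "k \<in> m ` N" using mN[OF k, of 0] by (metis imageI)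
  qed
 qed
 moreover have "{y \<in> N. m y = 0} = cb ` A"
 proof
  show "{y \<in> N. m y = 0} \<subseteq> cb ` A"
  proof
   fix y assume y: "y \<in> {y \<in> N. m y = 0}"
   then obtain g k where gk: "g \<in> A" "k \<in> sq K" "y = cb g + k" by (auto simp: N_def)
   hence "k = 0" using mN[OF gk(2), of g] y by simp
   hence "y = cb g" unfolding gk(3) by (simp only: add_0_right)
   thus "y \<in> cb ` A" using gk(1) by blast
  qed
  show "cb ` A \<subseteq> {y \<in> N. m y = 0}"
  proof
   fix y assume "y \<in> cb ` A"
   then obtain g where g: "g \<in> A" "y = cb g" by blast
   have "y = cb g + 0" unfolding g(2) by (rule add_0_right[symmetric])
   hence "y \<in> N" using g(1) z unfolding N_def by blast
   thus "y \<in> {y \<in> N. m y = 0}" using mcb g(2) by simp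
  qed
 qed
 ultimately show ?thesis
  using fn_rank_nullity[OF lin subspace_N] fn.fin_dim_subset[OF fin_dim_sq_A] N_Y Y_sq dim_sq[OF Q(1) K_E subspace_K] by auto
qed

text \<open>
  With \<open>n = dim A\<close> and \<open>k = dim K\<close>, the kernel of \<open>bd\<close> on
  pairs has dimension \<open>2 n - (n - k) = n + k\<close>, and \<open>N\<close> has the same
  dimension \<open>2 k + (n - k)\<close>. So \<open>Y\<close> exceeds \<open>N\<close> by the
  dimension of the commutator image.
\<close>

lemma commutator_rank_one:
 assumes "y0 \<in> Y" "y0 \<notin> N" "!!y. y \<in> Y ==> EX c. y - fscale c y0 \<in> N"
 shows "fn.dim (bd ` cb ` A) = 1"
 using fn_dim_plus_line[OF subspace_Y fn.fin_dim_subset[OF fin_dim_sq_A Y_sq] subspace_N N_Y assms]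
  dim_Y dim_N dim_cb dim_A by linarith

end

text \<open>
  Both sides are the determinant of the block matrix with rows \<open>1, W\<close> and \<open>- V,
  1\<close>, factored from the two sides.
\<close>

lemma matrix_determinant_lemma:
 fixes W V :: "complex mat"
 assumes W: "W \<in> carrier_mat n 1" and V: "V \<in> carrier_mat 1 n"
 shows "det (1\<^sub>m n + W * V) = 1 + (V * W) $$ (0, 0)"
proof -
 let ?M = "four_block_mat (1\<^sub>m n) W (- V) (1\<^sub>m 1)"
 have WV: "W * V \<in> carrier_mat n n" and VW: "V * W \<in> carrier_mat 1 1" using W V by auto
 have "four_block_mat (1\<^sub>m n) (0\<^sub>m n 1) V (1\<^sub>m 1) * ?M =
   four_block_mat (1\<^sub>m n * 1\<^sub>m n + 0\<^sub>m n 1 * (- V)) (1\<^sub>m n * W + 0\<^sub>m n 1 * 1\<^sub>m 1)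
    (V * 1\<^sub>m n + 1\<^sub>m 1 * (- V)) (V * W + 1\<^sub>m 1 * 1\<^sub>m 1)" by (rule mult_four_block_mat) (use W V in auto)
 also have "... = four_block_mat (1\<^sub>m n) W (0\<^sub>m 1 n) (V * W + 1\<^sub>m 1)"
  using W V by (intro arg_cong4[where f = four_block_mat]) (auto intro!: eq_matI)
 finally have e1: "four_block_mat (1\<^sub>m n) (0\<^sub>m n 1) V (1\<^sub>m 1) * ?M = ..." .
 have "four_block_mat (1\<^sub>m n + W * V) W (0\<^sub>m 1 n) (1\<^sub>m 1) * four_block_mat (1\<^sub>m n) (0\<^sub>m n 1) (- V) (1\<^sub>m 1) =
   four_block_mat ((1\<^sub>m n + W * V) * 1\<^sub>m n + W * (- V)) ((1\<^sub>m n + W * V) * 0\<^sub>m n 1 + W * 1\<^sub>m 1)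
    (0\<^sub>m 1 n * 1\<^sub>m n + 1\<^sub>m 1 * (- V)) (0\<^sub>m 1 n * 0\<^sub>m n 1 + 1\<^sub>m 1 * 1\<^sub>m 1)"
  by (rule mult_four_block_mat) (use W V in auto)
 also have "... = ?M"
 proof (intro arg_cong4[where f = four_block_mat])
  have "(1\<^sub>m n + W * V) * 1\<^sub>m n + W * (- V) = 1\<^sub>m n + W * V + - (W * V)"
   using W V WV by (simp add: uminus_mult_right_mat)
  also have "... = 1\<^sub>m n"
  proof -
   have "1\<^sub>m n + X + - X = 1\<^sub>m n" if "X \<in> carrier_mat n n" for X :: "complex mat"
    by (rule eq_matI) (use that in auto)
   thus ?thesis using WV by blast
  qed
  finally show "(1\<^sub>m n + W * V) * 1\<^sub>m n + W * (- V) = 1\<^sub>m n" .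
 qed (use W V WV in \<open>auto intro!: eq_matI\<close>)
 finally have e2: "four_block_mat (1\<^sub>m n + W * V) W (0\<^sub>m 1 n) (1\<^sub>m 1) * four_block_mat (1\<^sub>m n) (0\<^sub>m n 1) (- V) (1\<^sub>m 1) = ?M" .
 have "det (four_block_mat (1\<^sub>m n) (0\<^sub>m n 1) V (1\<^sub>m 1) * ?M) = det (four_block_mat (1\<^sub>m n) (0\<^sub>m n 1) V (1\<^sub>m 1)) * det ?M"
  by (rule det_mult[of _ "n + 1"]) (use W V in auto)
 also have "det (four_block_mat (1\<^sub>m n) (0\<^sub>m n 1) V (1\<^sub>m 1)) = det (1\<^sub>m n :: complex mat) * det (1\<^sub>m 1 :: complex mat)"
  by (rule det_four_block_mat_upper_right_zero[OF one_carrier_mat refl V one_carrier_mat])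
 also have "det (four_block_mat (1\<^sub>m n) (0\<^sub>m n 1) V (1\<^sub>m 1) * ?M) = det (1\<^sub>m n :: complex mat) * det (V * W + 1\<^sub>m 1)"
  unfolding e1 by (rule det_four_block_mat_lower_left_zero[OF one_carrier_mat W refl]) (use VW in auto)
 finally have dM: "det ?M = det (V * W + 1\<^sub>m 1)" by simp
 have "det ?M = det (four_block_mat (1\<^sub>m n + W * V) W (0\<^sub>m 1 n) (1\<^sub>m 1)) * det (four_block_mat (1\<^sub>m n) (0\<^sub>m n 1) (- V) (1\<^sub>m 1))"
  unfolding e2[symmetric] by (rule det_mult[of _ "n + 1"]) (use W V in auto)
 also have "det (four_block_mat (1\<^sub>m n + W * V) W (0\<^sub>m 1 n) (1\<^sub>m 1)) = det (1\<^sub>m n + W * V) * det (1\<^sub>m 1 :: complex mat)"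
  by (rule det_four_block_mat_lower_left_zero[OF _ W refl one_carrier_mat]) (use WV in auto)
 also have "det (four_block_mat (1\<^sub>m n) (0\<^sub>m n 1) (- V) (1\<^sub>m 1)) = det (1\<^sub>m n :: complex mat) * det (1\<^sub>m 1 :: complex mat)"
  by (rule det_four_block_mat_upper_right_zero[OF one_carrier_mat refl _ one_carrier_mat]) (use V in auto)
 finally have "det ?M = det (1\<^sub>m n + W * V)" by simp
 thus ?thesis using dM VW W V by (simp add: det_single add.commute)
qed

text \<open>The matrix of an operator on the functions on \<open>Q\<close>, for an enumeration of \<open>Q\<close>.\<close>

definition mt :: "nat => (nat => 'q) => (('q => complex) => 'q => complex) => complex mat"
 where "mt n qs T = Matrix.mat n n (%(i, j). T (delta (qs j)) (qs i))"

context commuting_projection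
begin

lemma linear_expand:
 assumes "fn_linear S" "f \<in> E" and qs: "bij_betw qs {..<n} Q"
 shows "S f x = (\<Sum>k<n. f (qs k) * S (delta (qs k)) x)"
proof -
 have "S f = S (\<Sum>q\<in>Q. fscale (f q) (delta q))" using funs_on_expand[OF Q(1) assms(2)] by simp
 also have "... = (\<Sum>q\<in>Q. fscale (f q) (S (delta q)))"
  unfolding fn_fn.linear_sum[OF assms(1)] fn_fn.linear_scale[OF assms(1)] ..
 finally have "S f x = (\<Sum>q\<in>Q. f q * S (delta q) x)" by (simp add: sum_fun_apply)
 thus ?thesis using sum.reindex_bij_betw[OF qs, of "%q. f q * S (delta q) x"] by simp
qed

lemma mt_comp:
 assumes S: "fn_linear S" and T: "!!f. f \<in> E ==> T f \<in> E" and qs: "bij_betw qs {..<n} Q"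
 shows "mt n qs (%f. S (T f)) = mt n qs S * mt n qs T"
proof (rule eq_matI)
 fix i j assume ij: "i < dim_row (mt n qs S * mt n qs T)" "j < dim_col (mt n qs S * mt n qs T)"
 hence n: "i < n" "j < n" by (auto simp: mt_def)
 have "qs j \<in> Q" using qs n by (auto dest: bij_betwE)
 hence "T (delta (qs j)) \<in> E" by (intro T delta_in_funs_on)
 from linear_expand[OF S this qs, of "qs i"]
 show "mt n qs (%f. S (T f)) $$ (i, j) = (mt n qs S * mt n qs T) $$ (i, j)"
  using n by (simp add: mt_def scalar_prod_def atLeast0LessThan mult.commute)
qed (auto simp: mt_def)

text \<open>
  The operator that is \<open>T\<close> on the range of \<open>P\<close> and the identity on its
  kernel, so that determinants can be taken on all functions.
\<close>

definition "tilde T f = T (P f) + (f - P f)"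

lemma linear_tilde:
 assumes "fn_linear T"
 shows "fn_linear (tilde T)" by (rule fn_linearI)
   (auto simp: tilde_def P_add P_scale fn_fn.linear_add[OF assms] fn_fn.linear_scale[OF assms] fun_eq_iff algebra_simps)

lemma tilde_in: "(!!f. f \<in> A ==> T f \<in> E) ==> f \<in> E ==> tilde T f \<in> E"
 unfolding tilde_def by (intro fn.subspace_add fn.subspace_diff subspace_E P_in) (use A_ops(3) in auto)

lemma tilde_comp:
 assumes "!!f. f \<in> A ==> S f \<in> A"
 shows "tilde T (tilde S f) = tilde (%f. T (S f)) f"
proof -
 have "P (S (P f)) = S (P f)" using assms[OF A_ops(3)] by (simp add: A_def)
 hence "P (tilde S f) = S (P f)" unfolding tilde_def P_add P_diff P_idem by simp
 thus ?thesis by (simp add: tilde_def[of _ "tilde S f"]) (simp add: tilde_def fun_eq_iff)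
qed

lemma pull_inv:
 assumes "bij_betw p Q Q" "f \<in> E"
 shows "pull Q p (pull Q (inv_into Q p) f) = f" "pull Q (inv_into Q p) (pull Q p f) = f"
 using assms bij_betw_inv_into_left[OF assms(1)] bij_betw_inv_into_right[OF assms(1)]
  bij_betwE[OF assms(1)] bij_betwE[OF bij_betw_inv_into[OF assms(1)]] by (auto simp: pull_def funs_on_def fun_eq_iff)

lemma pull_inv_A:
 assumes p: "bij_betw p Q Q" and comm: "!!f. f \<in> E ==> P (pull Q p f) = pull Q p (P f)" and f: "f \<in> A"
 shows "pull Q (inv_into Q p) f \<in> A"
proof -
 let ?g = "pull Q (inv_into Q p) f"
 have fE: "f \<in> E" "P f = f" using f by (auto simp: A_def)
 have "pull Q p (P ?g) = P (pull Q p ?g)" by (rule comm[OF pull_in, symmetric])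
 also have "... = f" using pull_inv(1)[OF p fE(1)] fE(2) by simp
 finally have "pull Q (inv_into Q p) (pull Q p (P ?g)) = ?g" by simp
 hence "P ?g = ?g" using pull_inv(2)[OF p P_in] by simp
 thus ?thesis using pull_in by (simp add: A_def)
qed

text \<open>
  The commutator of two invertible operators has determinant 1.  If it moves every vector along
  a fixed line, it is therefore a transvection, and unless it is the identity, its powers take
  infinitely many values on some function; but the operator only permutes values.
\<close>

lemma commutator_not_rank_one: "fn.dim (bd ` cb ` A) ~= 1"
proof
 assume one: "fn.dim (bd ` cb ` A) = 1"
 let ?L = "bd ` cb ` A"
 have sL: "fn.subspace ?L" by (intro fn_fn.linear_subspace_image linear_bd linear_cb subspace_A)
 have LA: "?L \<subseteq> A" using cb_in bd_sq_A by (auto simp: A0_def)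
 obtain B where B: "finite B" "B \<subseteq> ?L" "fn.independent B" "fn.span B = ?L" "fn.dim ?L = card B"
  by (rule fn.fin_dim_basis[OF fn.fin_dim_subset[OF fin_dim_A LA] sL])
 obtain w where Bw: "B = {w}" using B(5) one by (metis card_1_singletonE)
 have w: "w \<in> A" "w ~= 0" using B(2,3) LA Bw fn.dependent_zero[of B] by auto
 have line: "EX c. x = fscale c w" if "x \<in> ?L" for x using that B(4) Bw fn.span_singleton[of w] by auto
 obtain q1 where q1: "w q1 ~= 0" using w(2) by (auto simp: fun_eq_iff)
 hence q1Q: "q1 \<in> Q" using w(1) by (auto simp: A_def funs_on_def)
 let ?r' = "inv_into Q r" and ?u' = "inv_into Q u"
 define \<kappa> where "\<kappa> q = ?u' (?r' (u (r q)))" for q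
 define C where "C = pull Q \<kappa>"
 have rQ: "r q \<in> Q" "u q \<in> Q" "?r' q \<in> Q" "?u' q \<in> Q" if "q \<in> Q" for q
  using that bij_betwE[OF r] bij_betwE[OF u] bij_betwE[OF bij_betw_inv_into[OF r]] bij_betwE[OF bij_betw_inv_into[OF u]] by auto
 have CUR: "C (U (R f)) = R (U f)" for f using rQ bij_betw_inv_into_right[OF r] bij_betw_inv_into_right[OF u]
  by (auto simp: C_def pull_def \<kappa>_def fun_eq_iff)
 define \<mu> where "\<mu> f = (C f q1 - f q1) / w q1" for f
 have Cf: "C f = f + fscale (\<mu> f) w" if f: "f \<in> A" for f
 proof -
  let ?g = "pull Q ?r' (pull Q ?u' f)"
  have g: "?g \<in> A" by (intro pull_inv_A r u P_r P_u f)
  have f': "f = U (R ?g)" using pull_inv(1)[OF r pull_in] pull_inv(1)[OF u] f by (simp add: A_def)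
  have "C f - f = bd (cb ?g)" using CUR[of ?g] f' bd_cb[of ?g] by simp
  then obtain c where c: "C f - f = fscale c w" using line[of "C f - f"] g by blast
  have "C f q1 - f q1 = (C f - f) q1" by simp
  also have "... = c * w q1" by (subst c) simp
  finally have "c = \<mu> f" using q1 by (simp add: \<mu>_def)
  thus ?thesis using c by (simp add: algebra_simps fun_eq_iff)
 qed
 have CA: "C f \<in> A" if "f \<in> A" for f unfolding Cf[OF that] by (intro fn.subspace_add fn.subspace_scale subspace_A that w)
 have "\<mu> w = 0"
 proof -
  obtain qs :: "nat => 'q" and n where qs: "bij_betw qs {..<n} Q"
   using ex_bij_betw_nat_finite[OF Q(1)] by (auto simp: atLeast0LessThan)
  let ?d = "%T. det (mt n qs (tilde T))"
  have lin: "fn_linear (tilde C)" "fn_linear (tilde R)"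
   "fn_linear (tilde U)"
   "fn_linear (tilde (pull Q ?r'))" "fn_linear (tilde (pull Q ?u'))" unfolding C_def by (intro linear_tilde linear_pull)+
  have dcomp: "?d (%f. S (T f)) = ?d S * ?d T"
   if "fn_linear (tilde S)" "!!f. f \<in> A ==> T f \<in> A" for S T
  proof -
   have "mt n qs (tilde (%f. S (T f))) = mt n qs (%f. tilde S (tilde T f))" using tilde_comp[of T S] that(2) by simp
   also have "... = mt n qs (tilde S) * mt n qs (tilde T)" by (rule mt_comp[OF that(1) tilde_in qs]) (use that(2) A_E in auto)
   finally show ?thesis using det_mult[of "mt n qs (tilde S)" n "mt n qs (tilde T)"] by (simp add: mt_def)
  qed
  have dcong: "?d S = ?d T" if "!!f. f \<in> A ==> S f = T f" for S T
  proof -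
   have "tilde S = tilde T" using that[OF A_ops(3)] by (simp add: tilde_def fun_eq_iff)
   thus ?thesis by simp
  qed
  have did: "?d (%f. f) = 1"
  proof -
   have "qs i = qs j \<longleftrightarrow> i = j" if "i < n" "j < n" for i j
    using that qs by (auto simp: bij_betw_def inj_on_eq_iff)
   hence "mt n qs (tilde (%f. f)) = 1\<^sub>m n" by (auto simp: mt_def tilde_def delta_def intro!: eq_matI)
   thus ?thesis by simp
  qed
  have inv: "pull Q ?r' (R f) = f" "pull Q ?u' (U f) = f" if "f \<in> A" for f using that pull_inv(2) r u A_E by blast+
  have "?d (pull Q ?r') * ?d R = 1" "?d (pull Q ?u') * ?d U = 1"
   using dcomp[OF lin(4), of R] dcomp[OF lin(5), of U] A_ops dcong[of "%f. pull Q ?r' (R f)" "%f. f"]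
    dcong[of "%f. pull Q ?u' (U f)" "%f. f"] did inv by auto
  hence nz: "?d R ~= 0" "?d U ~= 0" by auto
  have "?d (%f. C (U (R f))) = ?d C * (?d U * ?d R)" using dcomp[OF lin(1), of "%f. U (R f)"] dcomp[OF lin(3), of R] A_ops by simp
  moreover have "?d (%f. C (U (R f))) = ?d R * ?d U" using dcomp[OF lin(2), of U] A_ops(2) CUR by simp
  ultimately have dC: "?d C = 1" using nz by simp
  let ?W = "Matrix.mat n 1 (%(i, j). w (qs i))" and ?V = "Matrix.mat 1 n (%(i, j). \<mu> (P (delta (qs j))))"
  have tC: "tilde C f = f + fscale (\<mu> (P f)) w" for f unfolding tilde_def Cf[OF A_ops(3)] by (simp add: fun_eq_iff)
  have "qs i = qs j \<longleftrightarrow> i = j" if "i < n" "j < n" for i j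
   using that qs by (auto simp: bij_betw_def inj_on_eq_iff)
  hence "mt n qs (tilde C) = 1\<^sub>m n + ?W * ?V"
   unfolding tC by (auto simp: mt_def tC delta_def scalar_prod_def intro!: eq_matI)
  hence "1 + (?V * ?W) $$ (0, 0) = 1" using matrix_determinant_lemma[of ?W n ?V] dC by simp
  hence "(\<Sum>k<n. \<mu> (P (delta (qs k))) * w (qs k)) = 0" by (simp add: scalar_prod_def atLeast0LessThan)
  moreover have "\<mu> w = (\<Sum>k<n. \<mu> (P (delta (qs k))) * w (qs k))"
  proof -
   define L where "L f = C (P f) - P f" for f
   have "fn_linear L" unfolding L_def C_def by (rule fn_linearI) (auto simp: P_add P_scale pull_def fun_eq_iff algebra_simps)
   from linear_expand[OF this, of w qs n q1] w(1) qs
   have "L w q1 = (\<Sum>k<n. w (qs k) * L (delta (qs k)) q1)" by (simp add: A_def)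
   moreover have "L f q1 = \<mu> (P f) * w q1" for f using q1 by (simp add: L_def \<mu>_def)
   moreover have "P w = w" using w(1) by (simp add: A_def)
   ultimately have "\<mu> w * w q1 = (\<Sum>k<n. \<mu> (P (delta (qs k))) * w (qs k)) * w q1"
    by (simp add: sum_distrib_right mult.assoc mult.left_commute)
   thus ?thesis using q1 by simp
  qed
  ultimately show ?thesis by simp
 qed
 hence Cw: "C w = w" using Cf[OF w(1)] by simp
 have C_lin: "C (f + fscale a g) = C f + fscale a (C g)" for f g a by (simp add: C_def pull_def fun_eq_iff)
 have pow: "(C ^^ k) f = f + fscale (of_nat k * \<mu> f) w" if f: "f \<in> A" for k f
 proof (induction k)
  case (Suc k)
  have "(C ^^ Suc k) f = C ((C ^^ k) f)" by simp
  also have "... = C f + fscale (of_nat k * \<mu> f) w" unfolding Suc.IH C_lin Cw ..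
  finally have "(C ^^ Suc k) f = C f + fscale (of_nat k * \<mu> f) w" .
  thus ?case unfolding Cf[OF f] by (simp add: fun_eq_iff algebra_simps)
 qed simp
 have \<kappa>Q: "\<kappa> q \<in> Q" if "q \<in> Q" for q using that rQ by (simp add: \<kappa>_def)
 have val: "(C ^^ k) f q \<in> f ` Q" if "q \<in> Q" for k f q using that
 proof (induction k arbitrary: q)
  case (Suc k)
  thus ?case using \<kappa>Q by (simp add: C_def pull_def)
 qed simp
 have \<mu>0: "\<mu> f = 0" if f: "f \<in> A" for f
 proof (rule ccontr)
  assume nz: "\<mu> f ~= 0"
  (* the value of the k-th power at q1 is a value of f, of which there are finitely many *)
  have "inj (%k :: nat. f q1 + of_nat k * \<mu> f * w q1)" using nz q1 by (auto simp: inj_on_def)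
  moreover have "range (%k :: nat. f q1 + of_nat k * \<mu> f * w q1) \<subseteq> f ` Q"
   using val[OF q1Q, of _ f] pow[OF f] by auto
  ultimately show False using Q(1) by (meson finite_imageI finite_imageD finite_subset infinite_UNIV_nat)
 qed
 have "w \<in> ?L" using B(2) Bw by blast
 then obtain g where g: "g \<in> A" "w = R (U g) - U (R g)" using bd_cb by auto
 have "U (R g) \<in> A" by (intro A_ops g)
 hence "C (U (R g)) = U (R g)" using Cf \<mu>0 by simp
 hence "w = 0" using g(2) CUR by simp
 thus False using w(2) by simp
qed

lemma no_line:
 assumes abh: "a0 \<in> A" "b0 \<in> A" "h0 \<in> A" "R (U h0) - U (R h0) = (R b0 - b0) - (U a0 - a0)"
  and notin: "~ (EX g:A. EX s t. a0 = R g - g + cst Q s & b0 = U g - g + cst Q t)"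
  and line: "!!a b h. a \<in> A ==> b \<in> A ==> h \<in> A ==> R (U h) - U (R h) = (R b - b) - (U a - a) ==>
   EX c. EX g:A. EX s t. cst Q s \<in> A & cst Q t \<in> A &
    a - fscale c a0 = R g - g + cst Q s & b - fscale c b0 = U g - g + cst Q t"
 shows False
proof -
 have "pr a0 b0 \<in> Y"
 proof -
  have "bd (pr a0 b0) = bd (cb h0)" unfolding bd_cb abh(4) by (simp only: bd_def p_pr)
  thus ?thesis using abh(1-3) unfolding Y_def sq_def by auto
 qed
 moreover have "pr a0 b0 \<notin> N"
 proof
  assume "pr a0 b0 \<in> N"
  then obtain g k where gk: "g \<in> A" "k \<in> sq K" "pr a0 b0 = cb g + k" by (auto simp: N_def)
  obtain s t where st: "p1 k = cst Q s" "p2 k = cst Q t" using gk(2) by (auto simp: sq_def K_def)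
  have "a0 = p1 (cb g + k)" "b0 = p2 (cb g + k)" using p_pr[of a0 b0] gk(3) by metis+
  hence "a0 = R g - g + cst Q s" "b0 = U g - g + cst Q t" by (simp_all only: p_add cb_def p_pr st)
  thus False using notin gk(1) by blast
 qed
 moreover have "EX c. y - fscale c (pr a0 b0) \<in> N" if y: "y \<in> Y" for y
 proof -
  obtain g where g: "p1 y \<in> A" "p2 y \<in> A" "g \<in> A" "bd y = bd (cb g)" using y by (auto simp: Y_def sq_def)
  have "R (U g) - U (R g) = (R (p2 y) - p2 y) - (U (p1 y) - p1 y)" using g(4) bd_cb[of g] by (simp add: bd_def)
  from line[OF g(1-3) this] obtain c f s t where f: "f \<in> A" "cst Q s \<in> A" "cst Q t \<in> A"
   "p1 y - fscale c a0 = R f - f + cst Q s" "p2 y - fscale c b0 = U f - f + cst Q t" by blast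
  have "y - fscale c (pr a0 b0) = cb f + pr (cst Q s) (cst Q t)"
   by (rule pr_eqI) (simp_all only: p_diff p_scale p_add p_pr cb_def f)
  moreover have "pr (cst Q s) (cst Q t) \<in> sq K" using f(2,3) by (auto simp: sq_def K_def)
  ultimately show ?thesis using f(1) unfolding N_def by blast
 qed
 ultimately show False using commutator_rank_one commutator_not_rank_one by blast
qed

end

section \<open>Periods\<close>

lemma eval_fin_cong_paths:
 assumes z: "z \<in> cchains 1 X"
  and eq: "!!c. cpath X c ==> \<phi> (simplex1 c) = \<psi> (simplex1 c)"
 shows "eval_fin \<phi> z = eval_fin \<psi> z"
proof (rule eval_fin_cong)
 fix \<sigma> assume "\<sigma> \<in> Poly_Mapping.keys z"
 hence s: "singular_simplex 1 X \<sigma>" using z by (auto simp: cchains_def)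
 show "\<phi> \<sigma> = \<psi> \<sigma>" using eq[OF continuous_path_of[OF s]] simplex1_path_of[OF s] by simp
qed

lemma simplex_map_simplex1: "simplex_map 1 g (simplex1 c) = simplex1 (g o c)"
 by (auto simp: simplex_map_def simplex1_def fun_eq_iff restrict_def)

lemma path_int_pointwise_cong:
 assumes k: "germ_cocycle X k" and c: "cpath X c"
  and eq: "!!x y. x \<in> topspace X ==> y \<in> topspace X ==> j x y = k x y"
 shows "path_int j c = path_int k c"
proof -
 have "path_int j c = path_int k c + (%_. 0) (c 1) - (%_. 0) (c 0)"
  by (rule path_int_shift[OF k c]) (use eq in \<open>auto intro!: exI[of _ "topspace X"]\<close>)
 thus ?thesis by simp
qed

text \<open>
  The torus covers itself, so the whole theory applies to it; the charts are those of the base in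
  the given covering.
\<close>

lemma torus_covering_id:
 assumes "torus_covering X p"
 shows "torus_covering torus (%x. x)"
proof -
 have ram: "ramified_covering_outside X torus p {torus_class 0}" using assms by (simp add: torus_covering_def)
 show ?thesis unfolding torus_covering_def ramified_covering_outside_def
 proof (intro conjI ballI)
  show "continuous_map torus torus (%x. x)" "(%x. x) ` topspace torus = topspace torus" by simp_all
  fix y assume y: "y \<in> topspace torus"
  have "EX V \<psi>. openin torus V & y \<in> V & homeomorphic_map (subtopology torus V) (top_of_set (ball (0::complex) 1)) \<psi> & \<psi> y = 0"
   using bspec[OF conjunct2[OF conjunct2[OF ram[unfolded ramified_covering_outside_def]]] y]
   by (elim exE conjE) (rule exI, rule exI, intro conjI, assumption+)
  then obtain V \<psi> where V: "openin torus V" "y \<in> V"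
   "homeomorphic_map (subtopology torus V) (top_of_set (ball (0::complex) 1)) \<psi>" "\<psi> y = 0" by blast
  have eq: "{x \<in> topspace torus. x \<in> V} = \<Union>{V}" using openin_subset[OF V(1)] by auto
  have "EX \<phi> k. homeomorphic_map (subtopology torus V) (top_of_set (ball (0::complex) 1)) \<phi> &
       (1::nat) <= k & (y \<notin> {torus_class 0} --> k = 1) & (ALL x:V. \<psi> x = \<phi> x ^ k)"
   using V(3) by (intro exI[of _ \<psi>] exI[of _ 1]) simp
  thus "EX V \<psi> \<U>. openin torus V & y \<in> V &
    homeomorphic_map (subtopology torus V) (top_of_set (ball (0::complex) 1)) \<psi> & \<psi> y = 0 &
    {x \<in> topspace torus. x \<in> V} = \<Union>\<U> & pairwise disjnt \<U> &
    (ALL U:\<U>. openin torus U &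
     (EX \<phi> k. homeomorphic_map (subtopology torus U) (top_of_set (ball (0::complex) 1)) \<phi> &
       (1::nat) <= k & (y \<notin> {torus_class 0} --> k = 1) & (ALL x:U. \<psi> x = \<phi> x ^ k)))"
   using V eq by (intro exI[of _ V] exI[of _ \<psi>] exI[of _ "{V}"]) simp
 qed
qed

context torus_covering
begin

definition period :: "('a => complex) => ('a => complex) => ('a => complex) => 'a cchain => complex"
 where "period a b h = eval_fin (germ_cochain (jump a b h))"

lemma fin_functional_period: "fin_functional (period a b h)" unfolding period_def by (rule fin_functional_eval_fin)

lemma jump_cong:
 assumes "!!q. q \<in> fibre ==> a q = a' q & b q = b' q & h q = h' q" and m: "m \<in> topspace X" "m' \<in> topspace X"
 shows "jump a b h m m' = jump a' b' h' m m'"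
proof (cases "coord m' = 0")
 case True
 have "0 <= fst (coord m)" "0 <= snd (coord m)" using coord(1)[OF m(1)] by (simp_all add: mem_unit_square)
 thus ?thesis using True by (simp add: jump_def)
next
 case False
 have l: "label m' \<in> fibre" by (rule label_in_fibre[OF m(2) False])
 note f = l monodromy_in_fibre[OF l] monodromy_in_fibre(1)[OF monodromy_in_fibre(2)[OF l]]
 thus ?thesis using assms(1) by (simp add: jump_def corner_def)
qed

lemma balanced_cong:
 assumes "!!q. q \<in> fibre ==> a q = a' q & b q = b' q & h q = h' q"
 shows "balanced a b h \<longleftrightarrow> balanced a' b' h'"
 unfolding balanced_def using assms monodromy_in_fibre by (intro ball_cong refl) simp

lemma period_cong:
 assumes eq: "!!q. q \<in> fibre ==> a q = a' q & b q = b' q & h q = h' q" and bal: "balanced a' b' h'"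
  and z: "z \<in> cchains 1 X"
 shows "period a b h z = period a' b' h' z" unfolding period_def
proof (rule eval_fin_cong_paths[OF z], unfold germ_cochain_simplex1)
 fix c :: "real => 'a" assume "cpath X c"
 thus "path_int (jump a b h) c = path_int (jump a' b' h') c"
  by (rule path_int_pointwise_cong[OF germ_cocycle_jump[OF bal]]) (rule jump_cong[OF eq])
qed

lemma jump_linear:
 "jump (%q. a q + c * a' q) (%q. b q + c * b' q) (%q. h q + c * h' q) m m' = jump a b h m m' + c * jump a' b' h' m m'"
 by (simp add: jump_def corner_def algebra_simps)

lemma balanced_linear:
 assumes "balanced a b h" "balanced a' b' h'"
 shows "balanced (%q. a q + c * a' q) (%q. b q + c * b' q) (%q. h q + c * h' q)" unfolding balanced_def
proof
 fix q assume q: "q \<in> fibre"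
 have "h (up (right q)) + c * h' (up (right q)) - (h (right (up q)) + c * h' (right (up q))) =
   (h (up (right q)) - h (right (up q))) + c * (h' (up (right q)) - h' (right (up q)))" by (simp add: algebra_simps)
 also have "... = ((b (right q) - b q) - (a (up q) - a q)) + c * ((b' (right q) - b' q) - (a' (up q) - a' q))"
  using assms q by (simp add: balanced_def)
 finally show "h (up (right q)) + c * h' (up (right q)) - (h (right (up q)) + c * h' (right (up q))) =
   (b (right q) + c * b' (right q) - (b q + c * b' q)) - (a (up q) + c * a' (up q) - (a q + c * a' q))"
  by (simp add: algebra_simps)
qed

lemma balanced_zero: "balanced (%_. 0) (%_. 0) (%_. 0)" by (simp add: balanced_def)

lemma balanced_const: "balanced (%_. s) (%_. t) (%_. k)" by (simp add: balanced_def)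

lemma period_linear:
 assumes bal: "balanced a b h" "balanced a' b' h'" and z: "z \<in> cchains 1 X"
 shows "period (%q. a q + c * a' q) (%q. b q + c * b' q) (%q. h q + c * h' q) z = period a b h z + c * period a' b' h' z"
proof -
 note g = germ_cocycle_jump[OF bal(1)] germ_cocycle_jump[OF bal(2)]
 have "jump (%q. 0 + c * a' q) (%q. 0 + c * b' q) (%q. 0 + c * h' q) = (%m m'. c * jump a' b' h' m m')"
  using jump_linear[of "%_. 0" c a' "%_. 0" b' "%_. 0" h'] by (simp add: jump_def corner_def fun_eq_iff)
 hence gc: "germ_cocycle X (%m m'. c * jump a' b' h' m m')"
  using germ_cocycle_jump[OF balanced_linear[OF balanced_zero bal(2), of c]] by simp
 have "period (%q. a q + c * a' q) (%q. b q + c * b' q) (%q. h q + c * h' q) z =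
   eval_fin (%\<sigma>. germ_cochain (jump a b h) \<sigma> + c * germ_cochain (jump a' b' h') \<sigma>) z" unfolding period_def
 proof (rule eval_fin_cong_paths[OF z], unfold germ_cochain_simplex1)
  fix d :: "real => 'a" assume d: "cpath X d"
  have "jump (%q. a q + c * a' q) (%q. b q + c * b' q) (%q. h q + c * h' q) = (%m m'. jump a b h m m' + c * jump a' b' h' m m')"
   by (intro ext jump_linear)
  thus "path_int (jump (%q. a q + c * a' q) (%q. b q + c * b' q) (%q. h q + c * h' q)) d =
    path_int (jump a b h) d + c * path_int (jump a' b' h') d" using path_int_add[OF g(1) gc d] path_int_scale[OF g(2) d] by simp
 qed
 thus ?thesis by (simp add: eval_fin_fun_add eval_fin_fun_scale period_def)
qed

lemma period_exact:
 assumes z: "z \<in> ccycles 1 X"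
  and ex: "!!c. cpath X c ==> path_int (jump a b h) c = f (c 1) - f (c 0)"
 shows "period a b h z = 0"
proof -
 have zc: "z \<in> cchains 1 X" using z by (simp add: ccycles_def)
 have "period a b h z = eval_fin (%\<sigma>. f (path_of \<sigma> 1) - f (path_of \<sigma> 0)) z" unfolding period_def
  by (rule eval_fin_cong_paths[OF zc]) (simp add: germ_cochain_simplex1 ex path_of_simplex1)
 thus ?thesis using eval_fin_exact_cycle[OF z] by simp
qed

lemma period_boundary:
 assumes "balanced a b h" "z \<in> cboundaries 1 X"
 shows "period a b h z = 0"
 unfolding period_def by (rule closed_cochain_imp_eval_0[OF closed_germ_cochain[OF germ_cocycle_jump[OF assms(1)]] assms(2)])

text \<open>
  The primitive takes the value \<open>g q\<close> on the square \<open>q\<close> and 0 at the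
  vertices.
\<close>

lemma period_coboundary:
 assumes z: "z \<in> ccycles 1 X"
 shows "period (%q. g (right q) - g q) (%q. g (up q) - g q) g z = 0"
proof (rule period_exact[OF z])
 fix c :: "real => 'a" assume c: "cpath X c"
 let ?j = "jump (%q. g (right q) - g q) (%q. g (up q) - g q) g"
 let ?f = "%m. if coord m = 0 then 0 else g (label m)"
 have z: "germ_cocycle X (%_ _. 0)" unfolding germ_cocycle_def by auto
 have "path_int ?j c = path_int (%_ _. 0) c + ?f (c 1) - ?f (c 0)"
 proof (rule path_int_shift[OF z c])
  fix x assume x: "x \<in> topspace X"
  show "EX N. openin X N & x \<in> N & (ALL y:N. ?j x y = 0 + ?f y - ?f x)"
  proof (cases "coord x = 0")
   case True
   have "?j x y = 0 + ?f y - ?f x" for y using True by (simp add: jump_def corner_def)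
   thus ?thesis using x by (intro exI[of _ "topspace X"]) simp
  next
   case False
   obtain d s where s: "edge_sheet x d s" using edge_sheet_exists[OF x False] by blast
   have "?j x (s y) = 0 + ?f (s y) - ?f x" if y: "y \<in> ball (coord x) d" for y
   proof -
    have "coord (s y) ~= 0" using nonvertex_sheet[OF s y] by blast
    moreover have "?j x (s y) = g (label (s y)) - g (label x)"
     using s y by (cases rule: edge_sheet_cases) (simp_all add: jump_sheet[OF s y])
    ultimately show ?thesis using False by simp
   qed
   thus ?thesis using edge_sheetD(6,8)[OF s] by (intro exI[of _ "s ` ball (coord x) d"]) auto
  qed
 qed
 moreover have "path_int (%_ _. 0) c = 0" using path_int_eq[of "%_ _. 0" c "%_. 0"] by (simp add: primitive_along_def gt_ex)
 ultimately show "path_int ?j c = ?f (c 1) - ?f (c 0)" by simp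
qed

text \<open>The periods with respect to the balanced triples separate the homology classes.\<close>

lemma boundary_if_periods_zero:
 assumes z: "z \<in> ccycles 1 X"
  and per: "!!a b h. a \<in> funs_on fibre ==> b \<in> funs_on fibre ==> h \<in> funs_on fibre ==> balanced a b h ==> period a b h z = 0"
 shows "z \<in> cboundaries 1 X"
proof (rule ccontr)
 assume nb: "z \<notin> cboundaries 1 X"
 interpret fc: complex_space "scale_fin :: complex => 'a cchain => 'a cchain" by unfold_locales
 obtain P where P: "fin_linear P" "range P \<subseteq> cboundaries 1 X" "!!x. x \<in> cboundaries 1 X ==> P x = x"
  by (rule fc.projection_exists[OF subspace_cboundaries]) blast
 have "z - P z ~= 0" using nb P(2) by auto
 then obtain x where x: "Poly_Mapping.lookup (z - P z) x ~= 0" by (metis lookup_zero poly_mapping_eqI)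
 define \<mu> where "\<mu> y = Poly_Mapping.lookup (y - P y) x" for y
 have \<mu>: "fin_functional \<mu>" by (rule fin_functionalI)
    (simp_all add: \<mu>_def fin_fin.linear_add[OF P(1)] fin_fin.linear_scale[OF P(1)] lookup_add lookup_minus algebra_simps)
 have "closed_cochain X (%\<sigma>. \<mu> (Poly_Mapping.single \<sigma> 1))"
  by (rule closed_cochainI[OF \<mu>]) (simp add: \<mu>_def P(3))
 then obtain a b h f where bal: "balanced a b h"
  and nf: "!!c. cpath X c ==>
   \<mu> (Poly_Mapping.single (simplex1 c) 1) = path_int (jump a b h) c + f (c 1) - f (c 0)"
  by (rule closed_cochain_normal_form) blast
 have zc: "z \<in> cchains 1 X" using z by (simp add: ccycles_def)
 have "\<mu> z = eval_fin (%\<sigma>. \<mu> (Poly_Mapping.single \<sigma> 1)) z" by (rule fin_functional_eq_eval_fin[OF \<mu>])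
 also have "... = eval_fin (%\<sigma>. germ_cochain (jump a b h) \<sigma> + (f (path_of \<sigma> 1) - f (path_of \<sigma> 0))) z"
  by (rule eval_fin_cong_paths[OF zc]) (simp add: germ_cochain_simplex1 nf path_of_simplex1)
 also have "... = period a b h z" unfolding eval_fin_fun_add eval_fin_exact_cycle[OF z] period_def by simp
 also have "... = 0"
 proof -
  let ?r = "%g q. if q \<in> fibre then g q else 0 :: complex"
  have "balanced a b h \<longleftrightarrow> balanced (?r a) (?r b) (?r h)" by (rule balanced_cong) simp
  hence bal': "balanced (?r a) (?r b) (?r h)" using bal by blast
  have "period a b h z = period (?r a) (?r b) (?r h) z" by (rule period_cong[OF _ bal' zc]) simp
  also have "... = 0" by (rule per[OF _ _ _ bal']) (auto simp: funs_on_def)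
  finally show ?thesis .
 qed
 finally show False using x by (simp add: \<mu>_def)
qed

subsection \<open>Automorphisms\<close>

lemma coord_eq_if: "p m' = p m ==> coord m' = coord m" by (simp add: coord_def)

context
 fixes g assumes g: "continuous_map X X g" "!!m. m \<in> topspace X ==> p (g m) = p m"
begin

lemma automorphism_in: "m \<in> topspace X ==> g m \<in> topspace X" using g(1) by (auto simp: continuous_map_def)

lemma automorphism_fibre: "q \<in> fibre ==> g q \<in> fibre" using automorphism_in g(2) by (simp add: fibre_def)

lemma automorphism_label:
 assumes m: "m \<in> topspace X" "coord m ~= 0"
 shows "label (g m) = g (label m)"
proof -
 have "coord m \<in> unit_square - {0}" using coord(1)[OF m(1)] m(2) by simp
 thus ?thesis using transport_equivariant[OF g m(1) coord(2)[OF m(1)] square_facts _ center_in] coord_eq_if[OF g(2)[OF m(1)]]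
  by (simp add: label_def)
qed

lemma automorphism_monodromy:
 assumes q: "q \<in> fibre"
 shows "right (g q) = g (right q)" "up (g q) = g (up q)" unfolding right_def up_def
 by (rule transport_equivariant[OF g fibreD[OF q] convex_strips(1) strips_lattice(1)]; simp)
   (rule transport_equivariant[OF g fibreD[OF q] convex_strips(2) strips_lattice(2)]; simp)

lemma balanced_automorphism:
 assumes "balanced a b h"
 shows "balanced (a o g) (b o g) (h o g)" unfolding balanced_def
proof
 fix q assume q: "q \<in> fibre"
 note m = monodromy_in_fibre[OF q]
 show "(h o g) (up (right q)) - (h o g) (right (up q)) =
   ((b o g) (right q) - (b o g) q) - ((a o g) (up q) - (a o g) q)"
  using bspec[OF assms[unfolded balanced_def] automorphism_fibre[OF q]] by (simp add: automorphism_monodromy q m)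
qed

lemma period_automorphism:
 assumes bal: "balanced a b h" and z: "z \<in> cchains 1 X"
 shows "period a b h (cchain_map 1 g z) = period (a o g) (b o g) (h o g) z" unfolding period_def eval_fin_cchain_map
proof (rule eval_fin_cong_paths[OF z], unfold simplex_map_simplex1 germ_cochain_simplex1 path_int_compose)
 fix c :: "real => 'a" assume c: "cpath X c"
 show "path_int (%x y. jump a b h (g x) (g y)) c = path_int (jump (a o g) (b o g) (h o g)) c"
 proof (rule path_int_pointwise_cong[OF germ_cocycle_jump[OF balanced_automorphism[OF bal]] c])
  fix x y assume xy: "x \<in> topspace X" "y \<in> topspace X"
  note cg = coord_eq_if[OF g(2)[OF xy(1)]] coord_eq_if[OF g(2)[OF xy(2)]]
  show "jump a b h (g x) (g y) = jump (a o g) (b o g) (h o g) x y"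
  proof (cases "coord y = 0")
   case True
   have "0 <= fst (coord x)" "0 <= snd (coord x)" using coord(1)[OF xy(1)] by (simp_all add: mem_unit_square)
   thus ?thesis using True by (simp add: jump_def cg)
  next
   case False
   have l: "label y \<in> fibre" by (rule label_in_fibre[OF xy(2) False])
   show ?thesis using monodromy_in_fibre[OF l] l
    by (simp add: jump_def corner_def cg automorphism_label[OF xy(2) False] automorphism_monodromy)
  qed
 qed
qed

end

subsection \<open>Periods that descend to the torus\<close>

text \<open>
  Constant jumps depend only on the coordinates, so the cocycle is the pullback of one on the
  torus.
\<close>

lemma period_const:
 assumes z: "z \<in> cchains 1 X"
 shows "period (%_. s) (%_. t) (%_. k) z = torus_covering.period torus (%x. x) (%_. s) (%_. t) (%_. k) (cchain_map 1 p z)"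
proof -
 interpret T: torus_covering torus "%x. x" by (rule torus_covering_id) (rule torus_covering_axioms)
 have c: "T.coord (p m) = coord m" for m by (simp add: T.coord_def coord_def)
 have "(%x y. T.jump (%_. s) (%_. t) (%_. k) (p x) (p y)) = jump (%_. s) (%_. t) (%_. k)"
  by (intro ext) (simp add: T.jump_def jump_def T.corner_def corner_def c)
 thus ?thesis unfolding period_def T.period_def eval_fin_cchain_map
  by (intro eval_fin_cong_paths[OF z]) (simp only: simplex_map_simplex1 germ_cochain_simplex1 path_int_compose)
qed

lemma period_const_zero:
 assumes z: "z \<in> cchains 1 X" "cchain_map 1 p z \<in> cboundaries 1 torus"
 shows "period (%_. s) (%_. t) (%_. k) z = 0"
proof -
 interpret T: torus_covering torus "%x. x" by (rule torus_covering_id) (rule torus_covering_axioms)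
 show ?thesis unfolding period_const[OF z(1)] by (rule T.period_boundary[OF T.balanced_const z(2)])
qed

text \<open>
  A functional that vanishes on the cycles that die in the torus factors through the homology of
  the torus. There the fibre is one point, so its jumps are constants \<open>s\<close> and
  \<open>t\<close>; the difference vanishes on all cycles and is exact.
\<close>

lemma period_zero_imp_coboundary:
 assumes bal: "balanced a b h"
  and per: "!!z. z \<in> ccycles 1 X ==> cchain_map 1 p z \<in> cboundaries 1 torus ==> period a b h z = 0"
 shows "EX s t F. ALL q:fibre. a q = F (right q) - F q + s & b q = F (up q) - F q + t"
proof -
 interpret T: torus_covering torus "%x. x" by (rule torus_covering_id) (rule torus_covering_axioms)
 have "EX \<mu>. fin_functional \<mu> & (ALL x:ccycles 1 X. \<mu> (cchain_map 1 p x) = period a b h x) & (ALL y:cboundaries 1 torus. \<mu> y = 0)"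
 proof (rule functional_factors_through[OF fin_linear_cchain_map[of 1 p] subspace_ccycles[of 1 X] subspace_cboundaries[of 1 torus]
   fin_functional_period[of a b h]])
  show "period a b h x = 0" if "x \<in> ccycles 1 X" "cchain_map 1 p x \<in> cboundaries 1 torus" for x by (rule per[OF that])
  fix \<mu> assume "fin_functional \<mu>" "!!x. x \<in> ccycles 1 X ==> \<mu> (cchain_map 1 p x) = period a b h x"
   "!!y. y \<in> cboundaries 1 torus ==> \<mu> y = 0"
  thus "EX \<mu>. fin_functional \<mu> & (ALL x:ccycles 1 X. \<mu> (cchain_map 1 p x) = period a b h x) & (ALL y:cboundaries 1 torus. \<mu> y = 0)"
   by (intro exI[of _ \<mu>] conjI ballI)
 qed
 then obtain \<mu> where "fin_functional \<mu> & (ALL x:ccycles 1 X. \<mu> (cchain_map 1 p x) = period a b h x) & (ALL y:cboundaries 1 torus. \<mu> y = 0)"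
  by (rule exE)
 hence \<mu>: "fin_functional \<mu>" "!!x. x \<in> ccycles 1 X ==> \<mu> (cchain_map 1 p x) = period a b h x"
  "!!y. y \<in> cboundaries 1 torus ==> \<mu> y = 0" by simp_all
 have "closed_cochain torus (%\<sigma>. \<mu> (Poly_Mapping.single \<sigma> 1))" by (rule closed_cochainI[OF \<mu>(1,3)])
 then obtain a' b' h' f where bal': "T.balanced a' b' h'"
  and nf: "!!c. cpath torus c ==>
   \<mu> (Poly_Mapping.single (simplex1 c) 1) = path_int (T.jump a' b' h') c + f (c 1) - f (c 0)"
  by (rule T.closed_cochain_normal_form) blast
 let ?q = "torus_class center"
 let ?s = "a' ?q" and ?t = "b' ?q" and ?k = "h' ?q"
 have eq: "a' q = ?s & b' q = ?t & h' q = ?k" if "q \<in> T.fibre" for q using that by (simp add: T.fibre_def)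
 have per_eq: "period a b h x = period (%_. ?s) (%_. ?t) (%_. ?k) x" if x: "x \<in> ccycles 1 X" for x
 proof -
  have xc: "x \<in> cchains 1 X" using x by (simp add: ccycles_def)
  have px: "cchain_map 1 p x \<in> ccycles 1 torus" by (rule cchain_map_in_ccycles[OF continuous_p x])
  hence pxc: "cchain_map 1 p x \<in> cchains 1 torus" by (simp add: ccycles_def)
  have "period a b h x = \<mu> (cchain_map 1 p x)" using \<mu>(2)[OF x] by simp
  also have "... = eval_fin (%\<sigma>. \<mu> (Poly_Mapping.single \<sigma> 1)) (cchain_map 1 p x)"
   by (rule fin_functional_eq_eval_fin[OF \<mu>(1)])
  also have "... = eval_fin (%\<sigma>. germ_cochain (T.jump a' b' h') \<sigma> + (f (path_of \<sigma> 1) - f (path_of \<sigma> 0))) (cchain_map 1 p x)"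
   by (rule eval_fin_cong_paths[OF pxc]) (simp add: germ_cochain_simplex1 nf path_of_simplex1)
  also have "... = T.period a' b' h' (cchain_map 1 p x)"
   unfolding eval_fin_fun_add eval_fin_exact_cycle[OF px] T.period_def by simp
  also have "... = T.period (%_. ?s) (%_. ?t) (%_. ?k) (cchain_map 1 p x)" by (rule T.period_cong[OF eq T.balanced_const pxc])
  finally show ?thesis unfolding period_const[OF xc] .
 qed
 let ?a = "%q. a q + (- 1) * ?s" and ?b = "%q. b q + (- 1) * ?t" and ?h = "%q. h q + (- 1) * ?k"
 have balD: "balanced ?a ?b ?h" by (rule balanced_linear[OF bal balanced_const])
 have zero: "eval_fin (germ_cochain (jump ?a ?b ?h)) x = 0" if x: "x \<in> ccycles 1 X" for x
 proof -
  have xc: "x \<in> cchains 1 X" using x by (simp add: ccycles_def)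
  show ?thesis using period_linear[OF bal balanced_const xc, of "- 1" ?s ?t ?k] per_eq[OF x] by (simp add: period_def)
 qed
 obtain F where F: "!!\<sigma>. singular_simplex 1 X \<sigma> ==> germ_cochain (jump ?a ?b ?h) \<sigma> = F (path_of \<sigma> 1) - F (path_of \<sigma> 0)"
  by (rule exact_if_zero_on_cycles[OF zero]) auto
 have ex: "path_int (jump ?a ?b ?h) c = F (c 1) - F (c 0)" if "cpath X c" for c
  using F[OF singular_simplex1[OF that]] by (simp add: germ_cochain_simplex1 path_of_simplex1)
 have "a q = F (right q) - F q + ?s & b q = F (up q) - F q + ?t" if q: "q \<in> fibre" for q
 proof -
  have "?a q = F (right q) - F q" "?b q = F (up q) - F q" by (rule exact_jump[OF balD ex q], assumption)+
  thus ?thesis by (simp add: algebra_simps)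
 qed
 thus ?thesis by blast
qed

end

section \<open>The automorphism group\<close>

text \<open>
  The points of the fibre where two automorphisms agree form a set that is invariant under the
  monodromy. Agreement spreads from the fibre to all squares by transport, and to the vertices by
  continuity.
\<close>

lemma (in torus_covering) automorphism_determined:
 assumes X: "Hausdorff_space X" "connected_space X"
  and f: "continuous_map X X f" "!!m. m \<in> topspace X ==> p (f m) = p m"
  and g: "continuous_map X X g" "!!m. m \<in> topspace X ==> p (g m) = p m"
  and q0: "q0 \<in> fibre" "f q0 = g q0" and m: "m \<in> topspace X"
 shows "f m = g m"
proof -
 have fib: "f q = g q" if q: "q \<in> fibre" for q
 proof -
  let ?i = "%q. if f q = g q then 1 else 0 :: complex"
  have r: "?i (right q) = ?i q" "?i (up q) = ?i q" if q: "q \<in> fibre" for q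
  proof -
   note in_fibre = automorphism_fibre[OF f q] automorphism_fibre[OF g q]
   have "right (f q) = right (g q) \<longleftrightarrow> f q = g q" "up (f q) = up (g q) \<longleftrightarrow> f q = g q"
    using inj_on_eq_iff[OF bij_betw_imp_inj_on[OF bij_monodromy(1)] in_fibre]
     inj_on_eq_iff[OF bij_betw_imp_inj_on[OF bij_monodromy(2)] in_fibre] by auto
   thus "?i (right q) = ?i q" "?i (up q) = ?i q"
    by (simp_all add: automorphism_monodromy[OF f q, symmetric] automorphism_monodromy[OF g q, symmetric])
  qed
  have "?i q = ?i q0" by (rule invariant_constant[OF X(2) r q q0(1)])
  thus ?thesis using q0(2) by (simp split: if_splits)
 qed
 have nv: "f m = g m" if m: "m \<in> topspace X" "coord m ~= 0" for m
 proof -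
  have l: "label (f m) = label (g m)"
   using automorphism_label[OF f m] automorphism_label[OF g m] fib[OF label_in_fibre[OF m]] by simp
  have c: "coord (f m) = coord m" "coord (g m) = coord m" using f(2)[OF m(1)] g(2)[OF m(1)] by (auto intro: coord_eq_if)
  have "f m = place (label (f m)) (coord (f m))" by (rule place_label[symmetric]) (use automorphism_in[OF f m(1)] c m(2) in auto)
  also have "... = place (label (g m)) (coord (g m))" by (simp only: l c)
  also have "... = g m" by (rule place_label) (use automorphism_in[OF g m(1)] c m(2) in auto)
  finally show ?thesis .
 qed
 show ?thesis
 proof (cases "coord m = 0")
  case True
  show ?thesis
  proof (rule ccontr)
   assume ne: "f m ~= g m"
   have "closedin X {x \<in> topspace X. f x = g x}" by (rule closedin_continuous_maps_eq[OF X(1) f(1) g(1)])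
   hence "openin X (topspace X - {x \<in> topspace X. f x = g x})" by blast
   moreover have "m \<in> topspace X - {x \<in> topspace X. f x = g x}" using ne m by blast
   ultimately obtain N' where N': "N' \<subseteq> topspace X - {x \<in> topspace X. f x = g x}" "N' - {m} ~= {}"
    "!!x. x \<in> N' - {m} ==> coord x ~= 0" by (rule vertex_punctured[OF m True]) blast
   then obtain x where "x \<in> N' - {m}" by blast
   thus False using N'(1) N'(3) nv[of x] by blast
  qed
 qed (use nv m in blast)
qed

locale origami_surface =
 fixes M :: "'a topology" and \<pi> :: "'a => (real \<times> real) set"
 assumes origami: "origami M \<pi>"
begin

sublocale torus_covering M \<pi> using origami by (simp add: origami_def torus_covering_def)

lemma spaces: "Hausdorff_space M" "connected_space M" "compact_space M" using origami by (auto simp: origami_def surface_def)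

abbreviation "\<Gamma> \<equiv> origami_Aut M \<pi>"

lemma automorphismD:
 assumes "g \<in> carrier \<Gamma>"
 shows "g \<in> Bij (topspace M)" "homeomorphic_map M M g" "continuous_map M M g" "m \<in> topspace M ==> \<pi> (g m) = \<pi> m"
 using assms by (auto simp: origami_Aut_def homeomorphic_imp_continuous_map)

lemma group_automorphisms: "group \<Gamma>"
proof -
 let ?S = "topspace M"
 let ?H = "{f \<in> Bij ?S. homeomorphic_map M M f & (ALL x:?S. \<pi> (f x) = \<pi> x)}"
 interpret B: group "BijGroup ?S" by (rule group_BijGroup)
 have "subgroup ?H (BijGroup ?S)"
 proof (rule B.subgroupI)
  show "?H \<subseteq> carrier (BijGroup ?S)" by (auto simp: BijGroup_def)
  have "homeomorphic_map M M (\<lambda>x\<in>?S. x)" by (rule homeomorphic_map_eq[of M M id]) auto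
  hence "(\<lambda>x\<in>?S. x) \<in> ?H" by (simp add: id_Bij)
  thus "?H ~= {}" by blast
  fix f assume f: "f \<in> ?H"
  obtain g where g: "homeomorphic_maps M M f g" using f by (auto simp: homeomorphic_map_maps)
  have gf: "f (g x) = x" "g x \<in> ?S" if "x \<in> ?S" for x
   using g that by (auto simp: homeomorphic_maps_def continuous_map_def)
  have inj: "inj_on f ?S" using f by (simp add: Bij_def bij_betw_def)
  have ig: "inv_into ?S f x = g x" if "x \<in> ?S" for x using inv_into_f_f[OF inj gf(2)[OF that]] gf(1)[OF that] by simp
  have "homeomorphic_map M M (\<lambda>x\<in>?S. inv_into ?S f x)"
   by (rule homeomorphic_map_eq[of M M g]) (use g ig in \<open>auto simp: homeomorphic_maps_map\<close>)
  moreover have "\<pi> (inv_into ?S f x) = \<pi> x" if x: "x \<in> ?S" for x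
  proof -
   have "\<pi> (f (g x)) = \<pi> (g x)" using f gf(2)[OF x] by blast
   thus ?thesis using ig[OF x] gf(1)[OF x] by simp
  qed
  moreover have fB: "f \<in> Bij ?S" by (rule conjunct1[OF f[unfolded mem_Collect_eq]])
  have cB: "carrier (BijGroup ?S) = Bij ?S" by (simp add: BijGroup_def)
  have ieq: "m_inv (BijGroup ?S) f = (\<lambda>x\<in>?S. inv_into ?S f x)" by (rule inv_BijGroup[OF fB])
  moreover have "m_inv (BijGroup ?S) f \<in> Bij ?S" using B.inv_closed[unfolded cB, OF fB] .
  moreover have "(\<lambda>x\<in>?S. inv_into ?S f x) x = inv_into ?S f x" if "x \<in> ?S" for x using that by (rule restrict_apply')
  ultimately show "m_inv (BijGroup ?S) f \<in> ?H" unfolding mem_Collect_eq by (intro conjI ballI) (simp_all only:)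
  fix h assume h: "h \<in> ?H"
  note fH = f[unfolded mem_Collect_eq] and hH = h[unfolded mem_Collect_eq]
  note hom = conjunct1[OF conjunct2[OF hH]] conjunct1[OF conjunct2[OF fH]]
  note bij = conjunct1[OF fH] conjunct1[OF hH]
  have hS: "h x \<in> ?S" if "x \<in> ?S" for x using bij(2) that by (auto simp: Bij_def bij_betw_def)
  have "homeomorphic_map M M (compose ?S f h)"
   by (rule homeomorphic_map_eq[OF homeomorphic_map_compose[OF hom]]) (simp only: compose_eq o_apply)
  moreover have "\<pi> (compose ?S f h x) = \<pi> x" if x: "x \<in> ?S" for x
  proof -
   have "\<pi> (f (h x)) = \<pi> (h x)" by (rule bspec[OF conjunct2[OF conjunct2[OF fH]] hS[OF x]])
   also have "... = \<pi> x" by (rule bspec[OF conjunct2[OF conjunct2[OF hH]] x])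
   finally show ?thesis by (simp only: compose_eq[OF x])
  qed
  moreover have "compose ?S f h \<in> Bij ?S" by (rule compose_Bij[OF bij])
  moreover have "f \<otimes>\<^bsub>BijGroup ?S\<^esub> h = compose ?S f h" using bij by (simp add: BijGroup_def)
  ultimately show "f \<otimes>\<^bsub>BijGroup ?S\<^esub> h \<in> ?H" by (simp only: mem_Collect_eq) blast
 qed
 thus ?thesis using subgroup.subgroup_is_group[of ?H "BijGroup ?S"] B.group_axioms by (simp add: origami_Aut_def)
qed

lemma automorphism_mult:
 assumes "g \<in> carrier \<Gamma>" "h \<in> carrier \<Gamma>"
 shows "g \<otimes>\<^bsub>\<Gamma>\<^esub> h = compose (topspace M) g h"
 using automorphismD(1)[OF assms(1)] automorphismD(1)[OF assms(2)] by (simp add: origami_Aut_def BijGroup_def)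

lemma automorphism_one: "\<one>\<^bsub>\<Gamma>\<^esub> = (\<lambda>x\<in>topspace M. x)"
 by (simp add: origami_Aut_def BijGroup_def)

lemma finite_automorphisms: "finite (carrier \<Gamma>)"
proof -
 obtain q0 where q0: "q0 \<in> fibre" using fibre_nonempty by blast
 have inj: "inj_on (%g. g q0) (carrier \<Gamma>)"
 proof (rule inj_onI)
  fix g h assume gh: "g \<in> carrier \<Gamma>" "h \<in> carrier \<Gamma>" "g q0 = h q0"
  have "g m = h m" if "m \<in> topspace M" for m
   by (rule automorphism_determined[OF spaces(1,2) automorphismD(3,4)[OF gh(1)] automorphismD(3,4)[OF gh(2)] q0 gh(3) that])
  moreover have "g \<in> extensional (topspace M)" "h \<in> extensional (topspace M)"
   using automorphismD(1) gh by (auto simp: Bij_def)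
  ultimately show "g = h" using extensionalityI by blast
 qed
 have "g q0 \<in> fibre" if g: "g \<in> carrier \<Gamma>" for g
  by (rule automorphism_fibre[OF automorphismD(3)[OF g] automorphismD(4)[OF g] q0])
 hence "(%g. g q0) ` carrier \<Gamma> \<subseteq> fibre" by blast
 thus ?thesis using finite_fibre[OF spaces(3)] inj by (meson finite_imageD finite_subset)
qed

sublocale Gam: finite_group \<Gamma>
 by (simp add: finite_group_def finite_group_axioms_def group_automorphisms finite_automorphisms)

section \<open>The homology module\<close>

abbreviation "B \<equiv> cboundaries 1 M"
abbreviation "BT \<equiv> cboundaries 1 torus"
abbreviation "W \<equiv> origami_H10 M \<pi>"

text \<open>The elements of the homology module are cosets of the boundaries.\<close>

definition "hclass z = (%b. z + b) ` B"
definition "Z0 = {z \<in> ccycles 1 M. cchain_map 1 \<pi> z \<in> BT}"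

lemma subspace_Z0: "fin.subspace Z0"
proof -
 have "Z0 = ccycles 1 M Int cchain_map 1 \<pi> -` BT" by (auto simp: Z0_def)
 thus ?thesis
  using fin.subspace_inter[OF subspace_ccycles fin_fin.linear_subspace_vimage[OF fin_linear_cchain_map subspace_cboundaries]]
  by simp
qed

lemma Z0_chains: "z \<in> Z0 ==> z \<in> cchains 1 M" by (simp add: Z0_def ccycles_def)

lemma mem_hclass: "x \<in> hclass z \<longleftrightarrow> x - z \<in> B"
 by (force simp: hclass_def intro: image_eqI[of _ _ "x - z"])

lemma hclass_eq_iff: "hclass z = hclass z' \<longleftrightarrow> z - z' \<in> B"
proof
 have "z \<in> hclass z" by (simp add: mem_hclass fin.subspace_0[OF subspace_cboundaries])
 thus "hclass z = hclass z' ==> z - z' \<in> B" by (simp add: mem_hclass)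
 assume d: "z - z' \<in> B"
 show "hclass z = hclass z'"
 proof (rule Set.set_eqI)
  fix x
  have "x - z' \<in> B" if "x - z \<in> B" using fin.subspace_add[OF subspace_cboundaries that d] by simp
  moreover have "x - z \<in> B" if "x - z' \<in> B" using fin.subspace_diff[OF subspace_cboundaries that d] by simp
  ultimately show "x \<in> hclass z \<longleftrightarrow> x \<in> hclass z'" unfolding mem_hclass by blast
 qed
qed

lemma coset_map:
 assumes f: "fin_linear f" "!!b. b \<in> B ==> f b \<in> B'" and B': "fin.subspace B'"
 shows "{f x + b |x b. x \<in> hclass z & b \<in> B'} = (%b. f z + b) ` B'"
proof
 show "{f x + b |x b. x \<in> hclass z & b \<in> B'} \<subseteq> (%b. f z + b) ` B'"
 proof
  fix y assume "y \<in> {f x + b |x b. x \<in> hclass z & b \<in> B'}"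
  then obtain c b where cb: "c \<in> B" "b \<in> B'" "y = f (z + c) + b" by (auto simp: hclass_def)
  hence "y = f z + (f c + b)" by (simp add: fin_fin.linear_add[OF f(1)] add.assoc)
  thus "y \<in> (%b. f z + b) ` B'" using fin.subspace_add[OF B' f(2)[OF cb(1)] cb(2)] by blast
 qed
 have "z \<in> hclass z" by (simp add: mem_hclass fin.subspace_0[OF subspace_cboundaries])
 thus "(%b. f z + b) ` B' \<subseteq> {f x + b |x b. x \<in> hclass z & b \<in> B'}" by blast
qed

lemma map_hclass:
 assumes "continuous_map M Y g"
 shows "chomology_map 1 Y g (hclass z) = (%b. cchain_map 1 g z + b) ` cboundaries 1 Y" unfolding chomology_map_def
 by (rule coset_map[OF fin_linear_cchain_map cchain_map_in_cboundaries[OF assms] subspace_cboundaries])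

lemma carrier_W: "carrier W = hclass ` Z0"
proof -
 have "chomology_map 1 torus \<pi> (hclass z) = BT \<longleftrightarrow> cchain_map 1 \<pi> z \<in> BT" for z
 proof -
  let ?c = "cchain_map 1 \<pi> z"
  have "(%b. ?c + b) ` BT = BT" if c: "?c \<in> BT"
  proof
   show "(%b. ?c + b) ` BT \<subseteq> BT" using fin.subspace_add[OF subspace_cboundaries c] by blast
   show "BT \<subseteq> (%b. ?c + b) ` BT"
   proof
    fix y assume "y \<in> BT"
    hence "y - ?c \<in> BT" by (rule fin.subspace_diff[OF subspace_cboundaries _ c])
    thus "y \<in> (%b. ?c + b) ` BT" by (rule image_eqI[rotated]) simp
   qed
  qed
  moreover have "?c \<in> BT" if "(%b. ?c + b) ` BT = BT"
   using imageI[OF fin.subspace_0[OF subspace_cboundaries[of 1 torus]], of "%b. ?c + b"] that by simp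
  ultimately show ?thesis unfolding map_hclass[OF continuous_p] by blast
 qed
 thus ?thesis by (auto simp: origami_H10_def chomology_def Z0_def hclass_def)
qed

lemma W_ops: "\<zero>\<^bsub>W\<^esub> = hclass 0" "hclass x \<oplus>\<^bsub>W\<^esub> hclass y = hclass (x + y)" "a \<odot>\<^bsub>W\<^esub> hclass x = hclass (scale_fin a x)"
proof -
 show "\<zero>\<^bsub>W\<^esub> = hclass 0" by (simp add: origami_H10_def chomology_def hclass_def)
 have "hclass x \<oplus>\<^bsub>W\<^esub> hclass y = {u + v |u v. u \<in> hclass x & v \<in> hclass y}" by (simp add: origami_H10_def chomology_def)
 also have "... = hclass (x + y)"
 proof
  show "{u + v |u v. u \<in> hclass x & v \<in> hclass y} \<subseteq> hclass (x + y)"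
  proof
   fix w assume "w \<in> {u + v |u v. u \<in> hclass x & v \<in> hclass y}"
   then obtain u v where uv: "u - x \<in> B" "v - y \<in> B" "w = u + v" by (auto simp: mem_hclass)
   thus "w \<in> hclass (x + y)" using fin.subspace_add[OF subspace_cboundaries uv(1,2)] by (simp add: mem_hclass algebra_simps)
  qed
  show "hclass (x + y) \<subseteq> {u + v |u v. u \<in> hclass x & v \<in> hclass y}"
  proof
   fix w assume "w \<in> hclass (x + y)"
   hence "x \<in> hclass x" "w - x \<in> hclass y" "w = x + (w - x)"
    by (simp_all add: mem_hclass fin.subspace_0[OF subspace_cboundaries] algebra_simps)
   thus "w \<in> {u + v |u v. u \<in> hclass x & v \<in> hclass y}" by blast
  qed
 qed
 finally show "hclass x \<oplus>\<^bsub>W\<^esub> hclass y = hclass (x + y)" .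
 have l: "fin_linear (scale_fin a)" by (rule fin_linearI) (simp_all add: fin.scale_right_distrib mult.commute)
 have "a \<odot>\<^bsub>W\<^esub> hclass x = {scale_fin a u + b |u b. u \<in> hclass x & b \<in> B}" by (simp add: origami_H10_def chomology_def)
 also have "... = hclass (scale_fin a x)" unfolding hclass_def[of "scale_fin a x"]
  by (rule coset_map[OF l fin.subspace_scale[OF subspace_cboundaries] subspace_cboundaries])
 finally show "a \<odot>\<^bsub>W\<^esub> hclass x = hclass (scale_fin a x)" .
qed

lemma module_W: "module complex_ring W"
proof (rule moduleI)
 show "cring complex_ring" using field_complex_ring by (simp add: field_def domain_def)
 note ops = W_ops carrier_W
 have cl: "hclass (x + y) \<in> hclass ` Z0" "hclass (scale_fin a x) \<in> hclass ` Z0" if "x \<in> Z0" "y \<in> Z0" for x y a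
  using fin.subspace_add[OF subspace_Z0 that] fin.subspace_scale[OF subspace_Z0 that(1)] by blast+
 show "abelian_group W"
 proof (rule abelian_groupI)
  fix x assume "x \<in> carrier W"
  then obtain z where z: "z \<in> Z0" "x = hclass z" by (auto simp: carrier_W)
  show "EX y:carrier W. y \<oplus>\<^bsub>W\<^esub> x = \<zero>\<^bsub>W\<^esub>"
   by (rule bexI[of _ "hclass (- z)"]) (use z fin.subspace_neg[OF subspace_Z0] in \<open>auto simp: ops\<close>)
 qed (use cl fin.subspace_0[OF subspace_Z0] in \<open>auto simp: ops ac_simps\<close>)
qed (use W_ops carrier_W fin.subspace_scale[OF subspace_Z0] in
  \<open>auto simp: fin.scale_left_distrib fin.scale_right_distrib\<close>)

lemma automorphism_Z0:
 assumes g: "g \<in> carrier \<Gamma>" and z: "z \<in> Z0"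
 shows "cchain_map 1 g z \<in> Z0"
proof -
 have "cchain_map 1 \<pi> (cchain_map 1 g z) = cchain_map 1 (\<pi> o g) z" by (simp add: cchain_map_compose)
 also have "... = cchain_map 1 \<pi> z" by (rule cchain_map_cong[OF Z0_chains[OF z]]) (use automorphismD(4)[OF g] in simp)
 finally show ?thesis using z cchain_map_in_ccycles[OF automorphismD(3)[OF g]] by (simp add: Z0_def)
qed

lemma automorphism_hclass: "g \<in> carrier \<Gamma> ==> chomology_map 1 M g (hclass z) = hclass (cchain_map 1 g z)"
 unfolding map_hclass[OF automorphismD(3)] by (simp add: hclass_def)

lemma representation_W: "representation \<Gamma> W (chomology_map 1 M)" unfolding representation_def
proof (intro conjI ballI)
 show "module complex_ring W" by (rule module_W)
 show "chomology_map 1 M g \<in> linear_maps W W" if g: "g \<in> carrier \<Gamma>" for g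
  using automorphism_Z0[OF g] fin.subspace_add[OF subspace_Z0] fin.subspace_scale[OF subspace_Z0]
  by (auto simp: linear_maps_def carrier_W W_ops automorphism_hclass[OF g]
   fin_fin.linear_add[OF fin_linear_cchain_map] fin_fin.linear_scale[OF fin_linear_cchain_map] simp del: One_nat_def)
 fix x assume "x \<in> carrier W"
 then obtain z where z: "z \<in> Z0" "x = hclass z" by (auto simp: carrier_W)
 have "cchain_map 1 \<one>\<^bsub>\<Gamma>\<^esub> z = z" by (rule cchain_map_id[OF Z0_chains[OF z(1)]]) (simp add: automorphism_one)
 thus "chomology_map 1 M \<one>\<^bsub>\<Gamma>\<^esub> x = x" using z automorphism_hclass[OF Gam.one_closed] by simp
 fix g h assume gh: "g \<in> carrier \<Gamma>" "h \<in> carrier \<Gamma>"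
 have "cchain_map 1 (g \<otimes>\<^bsub>\<Gamma>\<^esub> h) z = cchain_map 1 (g o h) z"
  by (rule cchain_map_cong[OF Z0_chains[OF z(1)]]) (simp add: automorphism_mult[OF gh] compose_def)
 thus "chomology_map 1 M (g \<otimes>\<^bsub>\<Gamma>\<^esub> h) x = chomology_map 1 M g (chomology_map 1 M h x)"
  using z gh automorphism_hclass Gam.m_closed[OF gh] by (simp add: cchain_map_compose)
qed

subsection \<open>Finite dimension\<close>

lemma period_diff_boundary:
 assumes "balanced a b h" "z - z' \<in> B"
 shows "period a b h z = period a b h z'"
 using period_boundary[OF assms] fin_cplx.linear_diff[OF fin_functional_period, of a b h z z'] by simp

end

interpretation fin_fn: vector_space_pair scale_fin fscale ..
interpretation fc: complex_space scale_fin ..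

lemma fin_dim_if_injective:
 assumes f: "Vector_Spaces.linear scale_fin fscale f" and S: "fin.subspace S" and inj: "!!x. x \<in> S ==> f x = 0 ==> x = 0"
  and T: "f ` S \<subseteq> T" "fn.fin_dim T"
 shows "fc.fin_dim S"
proof -
 obtain C where C: "finite C" "T \<subseteq> fn.span C" using T(2) by (auto simp: fn.fin_dim_def)
 obtain A where A: "A \<subseteq> S" "fin.independent A" "S \<subseteq> fin.span A" "card A = fin.dim S"
  by (rule fin.basis_exists[of S])
 have sA: "fin.span A = S" using A(1,3) S fin.span_minimal by blast
 have inj': "inj_on f (fin.span A)"
 proof (rule inj_onI)
  fix x y assume xy: "x \<in> fin.span A" "y \<in> fin.span A" "f x = f y"
  hence "f (x - y) = 0" by (simp add: fin_fn.linear_diff[OF f])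
  hence "x - y = 0" using inj[of "x - y"] fin.span_diff[OF xy(1,2)] sA by blast
  thus "x = y" by simp
 qed
 have "fn.independent (f ` A)" by (rule fin_fn.linear_independent_injective_image[OF f A(2) inj'])
 hence "finite (f ` A)" using fn.independent_span_bound[OF C(1), of "f ` A"] A(1) T(1) C(2) by blast
 hence "finite A" using inj' fin.span_superset[of A] by (meson finite_imageD inj_on_subset)
 thus ?thesis using A(3) by (auto simp: fc.fin_dim_def)
qed

context origami_surface
begin

definition "tr t i = (%q. t (i, q))" for t :: "nat \<times> 'a => complex"
definition "triples = {t \<in> funs_on ({0, 1, 2} \<times> fibre). balanced (tr t 0) (tr t 1) (tr t 2)}"
definition "period_tr t = period (tr t 0) (tr t 1) (tr t 2)"

lemma tr_linear: "tr (t + fscale c t') i = (%q. tr t i q + c * tr t' i q)" by (simp add: tr_def)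

lemma triples_linear: "t \<in> triples ==> t' \<in> triples ==> t + fscale c t' \<in> triples"
 using balanced_linear fn.subspace_add[OF subspace_funs_on[of "{0, 1, 2 :: nat} \<times> fibre"]]
  fn.subspace_scale[OF subspace_funs_on[of "{0, 1, 2 :: nat} \<times> fibre"]]
 by (simp add: triples_def tr_linear del: fscale_apply plus_fun_apply One_nat_def)

lemma zero_triple: "0 \<in> triples" using fn.subspace_0[OF subspace_funs_on] balanced_zero by (simp add: triples_def tr_def)

lemma subspace_if_linear:
 assumes "0 \<in> S" "!!x y c. x \<in> S ==> y \<in> S ==> x + fscale c y \<in> S"
 shows "fn.subspace S"
proof (rule fn.subspaceI)
 show "x + y \<in> S" if "x \<in> S" "y \<in> S" for x y using assms(2)[OF that, of 1] unfolding fn.scale_one .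
 show "fscale c x \<in> S" if "x \<in> S" for c x using assms(2)[OF assms(1) that, of c] unfolding add_0_left .
qed (rule assms(1))

lemma period_tr_linear:
 "t \<in> triples ==> t' \<in> triples ==> z \<in> cchains 1 M ==> period_tr (t + fscale c t') z = period_tr t z + c * period_tr t' z"
 using period_linear by (simp add: triples_def period_tr_def tr_linear del: fscale_apply plus_fun_apply)

lemma subspace_triples_zero:
 assumes z: "z \<in> cchains 1 M"
 shows "fn.subspace {t \<in> triples. period_tr t z = 0}"
proof (rule subspace_if_linear)
 have "period_tr (0 + fscale (- 1) 0) z = period_tr 0 z + (- 1) * period_tr 0 z"
  by (rule period_tr_linear[OF zero_triple zero_triple z])
 hence "period_tr 0 z = 0" unfolding fn.scale_zero_right add_0_left by simp
 thus "0 \<in> {t \<in> triples. period_tr t z = 0}" using zero_triple by simp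
qed (use triples_linear period_tr_linear z in auto)

text \<open>
  Finitely many periods, those for a basis of the balanced triples, determine a homology class.
\<close>

lemma fin_dim_projected:
 assumes P: "fin_linear P" "range P \<subseteq> B" "!!x. x \<in> B ==> P x = x"
 shows "fc.fin_dim ((%z. z - P z) ` Z0)"
proof -
 have fT: "fn.fin_dim triples" by (rule fn.fin_dim_subset[OF fin_dim_funs_on[of "{0, 1, 2 :: nat} \<times> fibre"]])
    (use finite_fibre[OF spaces(3)] in \<open>auto simp: triples_def\<close>)
 have sT: "fn.subspace triples" by (rule subspace_if_linear[OF zero_triple triples_linear])
 obtain Bs where Bs: "finite Bs" "Bs \<subseteq> triples" "fn.span Bs = triples" by (rule fn.fin_dim_basis[OF fT sT]) blast
 define \<Theta> where "\<Theta> z = (%t. if t \<in> Bs then period_tr t z else 0)" for z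
 have lin: "Vector_Spaces.linear scale_fin fscale \<Theta>"
 proof -
  have "\<Theta> (x + y) = \<Theta> x + \<Theta> y" "\<Theta> (scale_fin c x) = fscale c (\<Theta> x)" for x y c
   by (auto simp: \<Theta>_def fun_eq_iff period_tr_def
    fin_cplx.linear_add[OF fin_functional_period] fin_cplx.linear_scale[OF fin_functional_period])
  thus ?thesis by (simp add: Vector_Spaces.linear_def module_hom_def module_hom_axioms_def
    fn.module_axioms fn.vector_space_axioms fin.module_axioms fin.vector_space_axioms)
 qed
 have linN: "fin_linear (%z. z - P z)"
  by (rule fin_linearI) (simp_all add: fin_fin.linear_add[OF P(1)] fin_fin.linear_scale[OF P(1)] fin.scale_right_diff_distrib)
 show ?thesis
 proof (rule fin_dim_if_injective[OF lin fin_fin.linear_subspace_image[OF linN subspace_Z0]])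
  show "\<Theta> ` (%z. z - P z) ` Z0 \<subseteq> funs_on Bs" by (auto simp: \<Theta>_def funs_on_def)
  show "fn.fin_dim (funs_on Bs)" by (rule fin_dim_funs_on[OF Bs(1)])
  fix y assume y: "y \<in> (%z. z - P z) ` Z0" "\<Theta> y = 0"
  then obtain z where z: "z \<in> Z0" "y = z - P z" by blast
  have "period_tr t z = 0" if t: "t \<in> Bs" for t
  proof -
   have bal: "balanced (tr t 0) (tr t 1) (tr t 2)" using t Bs(2) by (auto simp: triples_def)
   have "\<Theta> y t = 0" using y(2) by simp
   hence "period_tr t y = 0" using t by (simp add: \<Theta>_def)
   moreover have "z - y \<in> B" using z(2) P(2) by auto
   ultimately show ?thesis using period_diff_boundary[OF bal, of z y] by (simp add: period_tr_def)
  qed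
  hence "Bs \<subseteq> {t \<in> triples. period_tr t z = 0}" using Bs(2) by blast
  hence all: "triples \<subseteq> {t \<in> triples. period_tr t z = 0}"
   using fn.span_minimal[OF _ subspace_triples_zero[OF Z0_chains[OF z(1)]]] Bs(3) by blast
  have zB: "z \<in> B"
  proof (rule boundary_if_periods_zero)
   show "z \<in> ccycles 1 M" using z(1) by (simp add: Z0_def)
   fix a b h assume abh: "a \<in> funs_on fibre" "b \<in> funs_on fibre" "h \<in> funs_on fibre" "balanced a b h"
   define t where "t = (%x :: nat \<times> 'a. if fst x = 0 then a (snd x) else if fst x = 1 then b (snd x) else if fst x = 2 then h (snd x) else 0)"
   have "tr t 0 = a" "tr t 1 = b" "tr t 2 = h" by (simp_all add: tr_def t_def)
   moreover have "t \<in> funs_on ({0, 1, 2} \<times> fibre)" using abh(1-3) by (auto simp: funs_on_def t_def)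
   ultimately have "t \<in> triples" "period_tr t z = period a b h z" using abh(4) by (simp_all add: triples_def period_tr_def)
   thus "period a b h z = 0" using all by auto
  qed
  thus "y = 0" using P(3) z(2) by simp
 qed
qed

text \<open>
  Subtracting a projection to the boundaries picks one representative in each homology class,
  linearly.
\<close>

lemma linear_model_W:
 assumes P: "fin_linear P" "range P \<subseteq> B" "!!x. x \<in> B ==> P x = x"
 shows "EX J. linear_model \<Gamma> W (chomology_map 1 M) scale_fin J & (ALL z. J (hclass z) = z - P z)"
proof -
 define J where "J S = (let z = SOME z. z \<in> S in z - P z)" for S :: "'a cchain set"
 have J: "J (hclass z) = z - P z" for z
 proof -
  let ?z = "SOME x. x \<in> hclass z"
  have "z \<in> hclass z" by (simp add: mem_hclass fin.subspace_0[OF subspace_cboundaries])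
  hence "?z \<in> hclass z" by (rule someI)
  hence "?z - z \<in> B" by (simp add: mem_hclass)
  hence "P (?z - z) = ?z - z" by (rule P(3))
  hence "P ?z - P z = ?z - z" by (simp add: fin_fin.linear_diff[OF P(1)])
  thus ?thesis by (simp add: J_def Let_def algebra_simps)
 qed
 have inj: "inj_on J (carrier W)"
 proof (rule inj_onI)
  fix x y assume xy: "x \<in> carrier W" "y \<in> carrier W" "J x = J y"
  obtain u v where uv: "x = hclass u" "y = hclass v" using xy by (auto simp: carrier_W)
  hence "u - v = P u - P v" using xy(3) J by (simp add: algebra_simps)
  moreover have "P u - P v \<in> B" by (rule fin.subspace_diff[OF subspace_cboundaries]) (use P(2) in auto)
  ultimately have "u - v \<in> B" by simp
  thus "x = y" using uv hclass_eq_iff by simp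
 qed
 have img: "J ` carrier W = (%z. z - P z) ` Z0" by (simp add: carrier_W image_image J)
 have add: "J (x \<oplus>\<^bsub>W\<^esub> y) = J x + J y" if "x \<in> carrier W" "y \<in> carrier W" for x y
  using that by (auto simp: carrier_W W_ops J fin_fin.linear_add[OF P(1)])
 have scale: "J (a \<odot>\<^bsub>W\<^esub> x) = scale_fin a (J x)" if "x \<in> carrier W" for x a
  using that by (auto simp: carrier_W W_ops J fin_fin.linear_scale[OF P(1)] fin.scale_right_diff_distrib)
 have "linear_model \<Gamma> W (chomology_map 1 M) scale_fin J" unfolding linear_model_def linear_model_axioms_def
  using finite_rep_eq_intro[OF Gam.finite_group_axioms representation_W] fc.complex_space_axioms
   add scale inj img fin_dim_projected[OF P] by simp
 thus ?thesis using J by (intro exI[of _ J]) simp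
qed

end

section \<open>No multiplicity is 1\<close>

context torus_covering
begin

lemma balanced_coboundary: "balanced (%q. g (right q) - g q) (%q. g (up q) - g q) g" by (simp add: balanced_def)

lemma period_sum:
 assumes "finite I" and bal: "!!i. i \<in> I ==> balanced (a i) (b i) (h i)" and z: "z \<in> cchains 1 X"
 shows "balanced (%q. \<Sum>i\<in>I. c i * a i q) (%q. \<Sum>i\<in>I. c i * b i q) (%q. \<Sum>i\<in>I. c i * h i q) &
  period (%q. \<Sum>i\<in>I. c i * a i q) (%q. \<Sum>i\<in>I. c i * b i q) (%q. \<Sum>i\<in>I. c i * h i q) z =
   (\<Sum>i\<in>I. c i * period (a i) (b i) (h i) z)" using assms(1) bal
proof (induction I rule: finite_induct)
 case empty
 have "period (%_. 0) (%_. 0) (%_. 0) z = period (%_. 0) (%_. 0) (%_. 0) z + (- 1) * period (%_. 0) (%_. 0) (%_. 0) z"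
  using period_linear[OF balanced_zero balanced_zero z, of "- 1"] by simp
 thus ?case by (simp add: balanced_zero)
next
 case (insert i I)
 hence IH: "balanced (%q. \<Sum>i\<in>I. c i * a i q) (%q. \<Sum>i\<in>I. c i * b i q) (%q. \<Sum>i\<in>I. c i * h i q)"
  "period (%q. \<Sum>i\<in>I. c i * a i q) (%q. \<Sum>i\<in>I. c i * b i q) (%q. \<Sum>i\<in>I. c i * h i q) z =
   (\<Sum>i\<in>I. c i * period (a i) (b i) (h i) z)" by simp_all
 have bi: "balanced (a i) (b i) (h i)" using insert.prems by simp
 show ?case using balanced_linear[OF IH(1) bi, of "c i"] period_linear[OF IH(1) bi z, of "c i"] IH(2) insert.hyps
  by (simp add: add.commute)
qed

end

context origami_surface
begin

text \<open>
  The action of an element of the group algebra on chains, and the dual action on functions on the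
  fibre.
\<close>

definition "group_ring_chain e z = (\<Sum>g\<in>carrier \<Gamma>. scale_fin (e g) (cchain_map 1 g z))"

definition "group_ring_fun e f = (%q. if q \<in> fibre then \<Sum>g\<in>carrier \<Gamma>. e g * f (g q) else 0)"

lemma group_ring_chain_Z0: "z \<in> Z0 ==> group_ring_chain e z \<in> Z0" unfolding group_ring_chain_def
 by (intro fin.subspace_sum fin.subspace_scale subspace_Z0 automorphism_Z0)

text \<open>
  Automorphisms act on chains by composition and hence on the triples by composition as well; the
  group algebra action follows by linearity.
\<close>

lemma period_group_ring:
 assumes bal: "balanced a b h" and z: "z \<in> cchains 1 M"
 shows "balanced (group_ring_fun e a) (group_ring_fun e b) (group_ring_fun e h)"
  "period a b h (group_ring_chain e z) = period (group_ring_fun e a) (group_ring_fun e b) (group_ring_fun e h) z"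
proof -
 have balg: "balanced (a o g) (b o g) (h o g)" if g: "g \<in> carrier \<Gamma>" for g
  by (rule balanced_automorphism[OF automorphismD(3)[OF g] automorphismD(4)[OF g] bal])
 note ps = period_sum[OF finite_automorphisms, of "%g. a o g" "%g. b o g" "%g. h o g" z e, OF balg z]
 have eq: "group_ring_fun e f q = (\<Sum>g\<in>carrier \<Gamma>. e g * (f o g) q)" if "q \<in> fibre" for f q
  using that by (simp add: group_ring_fun_def)
 show bal': "balanced (group_ring_fun e a) (group_ring_fun e b) (group_ring_fun e h)"
  using ps balanced_cong[of "group_ring_fun e a" "%q. \<Sum>g\<in>carrier \<Gamma>. e g * (a o g) q" "group_ring_fun e b"
   "%q. \<Sum>g\<in>carrier \<Gamma>. e g * (b o g) q" "group_ring_fun e h" "%q. \<Sum>g\<in>carrier \<Gamma>. e g * (h o g) q"] eq by simp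
 have "period a b h (group_ring_chain e z) = (\<Sum>g\<in>carrier \<Gamma>. e g * period a b h (cchain_map 1 g z))"
  unfolding group_ring_chain_def fin_cplx.linear_sum[OF fin_functional_period] fin_cplx.linear_scale[OF fin_functional_period] ..
 also have "... = (\<Sum>g\<in>carrier \<Gamma>. e g * period (a o g) (b o g) (h o g) z)"
 proof (rule sum.cong[OF refl])
  fix g assume g: "g \<in> carrier \<Gamma>"
  show "e g * period a b h (cchain_map 1 g z) = e g * period (a o g) (b o g) (h o g) z"
   using period_automorphism[OF automorphismD(3)[OF g] automorphismD(4)[OF g] bal z] by simp
 qed
 also have "... = period (%q. \<Sum>g\<in>carrier \<Gamma>. e g * (a o g) q) (%q. \<Sum>g\<in>carrier \<Gamma>. e g * (b o g) q)
   (%q. \<Sum>g\<in>carrier \<Gamma>. e g * (h o g) q) z" by (rule conjunct2[OF ps, symmetric])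
 also have "... = period (group_ring_fun e a) (group_ring_fun e b) (group_ring_fun e h) z"
  by (rule period_cong[OF _ bal' z]) (simp add: eq)
 finally show "period a b h (group_ring_chain e z) = period (group_ring_fun e a) (group_ring_fun e b) (group_ring_fun e h) z" .
qed

lemma galg_hclass:
 assumes z: "z \<in> Z0"
 shows "galg \<Gamma> W (chomology_map 1 M) e (hclass z) = hclass (group_ring_chain e z)"
proof -
 obtain P where P: "fin_linear P" "range P \<subseteq> B" "!!x. x \<in> B ==> P x = x"
  by (rule fc.projection_exists[OF subspace_cboundaries[of 1 M]]) blast
 from linear_model_W[OF P] obtain J where "linear_model \<Gamma> W (chomology_map 1 M) scale_fin J & (ALL z. J (hclass z) = z - P z)"
  by (rule exE)
 hence J: "linear_model \<Gamma> W (chomology_map 1 M) scale_fin J" "J (hclass z) = z - P z" for z by simp_all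
 interpret LM: linear_model \<Gamma> W "chomology_map 1 M" scale_fin J by (rule J(1))
 have zW: "hclass z \<in> carrier W" using z by (simp add: carrier_W)
 have linN: "fin_linear (%z. z - P z)"
  by (rule fin_linearI) (simp_all add: fin_fin.linear_add[OF P(1)] fin_fin.linear_scale[OF P(1)] fin.scale_right_diff_distrib)
 have "J (LM.alg e (hclass z)) = (\<Sum>g\<in>carrier \<Gamma>. scale_fin (e g) (J (chomology_map 1 M g (hclass z))))"
  by (rule LM.J_alg[OF zW])
 also have "... = (\<Sum>g\<in>carrier \<Gamma>. scale_fin (e g) (cchain_map 1 g z - P (cchain_map 1 g z)))"
  by (rule sum.cong[OF refl]) (simp only: automorphism_hclass J(2))
 also have "... = group_ring_chain e z - P (group_ring_chain e z)"
  unfolding group_ring_chain_def fin_fin.linear_sum[OF linN] fin_fin.linear_scale[OF linN] ..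
 also have "... = J (hclass (group_ring_chain e z))" by (simp only: J(2))
 finally have eq: "J (LM.alg e (hclass z)) = J (hclass (group_ring_chain e z))" .
 have "hclass (group_ring_chain e z) \<in> carrier W" unfolding carrier_W by (rule imageI, rule group_ring_chain_Z0[OF z])
 thus ?thesis by (rule inj_onD[OF LM.J_inj eq LM.alg_closed[OF zW]])
qed

lemma balanced_pull_iff:
 assumes "a \<in> funs_on fibre" "b \<in> funs_on fibre"
 shows "balanced a b h \<longleftrightarrow>
  pull fibre right (pull fibre up h) - pull fibre up (pull fibre right h) = (pull fibre right b - b) - (pull fibre up a - a)"
proof -
 have z: "a q = 0" "b q = 0" if "q \<notin> fibre" for q using that assms by (auto simp: funs_on_def)
 show ?thesis unfolding balanced_def fun_eq_iff by (auto simp: pull_def z monodromy_in_fibre)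
qed

lemma commuting_projection_group_ring:
 assumes e: "conv \<Gamma> e e = e"
 shows "commuting_projection fibre right up (group_ring_fun e)"
proof (rule commuting_projection.intro)
 show "finite fibre" "fibre ~= {}" "bij_betw right fibre fibre" "bij_betw up fibre fibre"
  using finite_fibre[OF spaces(3)] fibre_nonempty bij_monodromy by auto
 show "fn_linear (group_ring_fun e)" by (rule fn_linearI)
    (auto simp: group_ring_fun_def fun_eq_iff algebra_simps sum.distrib sum_distrib_left)
 fix f :: "'a => complex"
 have gf: "g q \<in> fibre" if "g \<in> carrier \<Gamma>" "q \<in> fibre" for g q
  by (rule automorphism_fibre[OF automorphismD(3)[OF that(1)] automorphismD(4)[OF that(1)] that(2)])
 have gm: "right (g q) = g (right q)" "up (g q) = g (up q)" if "g \<in> carrier \<Gamma>" "q \<in> fibre" for g q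
 proof -
  show "right (g q) = g (right q)"
   by (rule automorphism_monodromy(1)[OF automorphismD(3)[OF that(1)] automorphismD(4)[OF that(1)] that(2)])
  show "up (g q) = g (up q)"
   by (rule automorphism_monodromy(2)[OF automorphismD(3)[OF that(1)] automorphismD(4)[OF that(1)] that(2)])
 qed
 show "group_ring_fun e f \<in> funs_on fibre" by (simp add: group_ring_fun_def funs_on_def)
 show "group_ring_fun e (group_ring_fun e f) = group_ring_fun e f"
 proof
  fix q show "group_ring_fun e (group_ring_fun e f) q = group_ring_fun e f q"
  proof (cases "q \<in> fibre")
   case True
   have qM: "q \<in> topspace M" by (rule fibreD(1)[OF True])
   have ev: "(\<Sum>k\<in>carrier \<Gamma>. lact \<Gamma> g e k * f (k q)) = (\<Sum>h\<in>carrier \<Gamma>. e h * f (g (h q)))" if g: "g \<in> carrier \<Gamma>" for g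
   proof (rule sum.reindex_bij_witness[of _ "%h. g \<otimes>\<^bsub>\<Gamma>\<^esub> h" "%k. inv\<^bsub>\<Gamma>\<^esub> g \<otimes>\<^bsub>\<Gamma>\<^esub> k"])
    fix k assume k: "k \<in> carrier \<Gamma>"
    show "g \<otimes>\<^bsub>\<Gamma>\<^esub> (inv\<^bsub>\<Gamma>\<^esub> g \<otimes>\<^bsub>\<Gamma>\<^esub> k) = k" "inv\<^bsub>\<Gamma>\<^esub> g \<otimes>\<^bsub>\<Gamma>\<^esub> k \<in> carrier \<Gamma>"
     "inv\<^bsub>\<Gamma>\<^esub> g \<otimes>\<^bsub>\<Gamma>\<^esub> (g \<otimes>\<^bsub>\<Gamma>\<^esub> k) = k" "g \<otimes>\<^bsub>\<Gamma>\<^esub> k \<in> carrier \<Gamma>"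
     using g k by (simp_all add: Gam.m_assoc[symmetric])
    have "g ((inv\<^bsub>\<Gamma>\<^esub> g \<otimes>\<^bsub>\<Gamma>\<^esub> k) q) = (g \<otimes>\<^bsub>\<Gamma>\<^esub> (inv\<^bsub>\<Gamma>\<^esub> g \<otimes>\<^bsub>\<Gamma>\<^esub> k)) q"
     unfolding automorphism_mult[OF g Gam.m_closed[OF Gam.inv_closed[OF g] k]] by (rule compose_eq[OF qM, symmetric])
    also have "g \<otimes>\<^bsub>\<Gamma>\<^esub> (inv\<^bsub>\<Gamma>\<^esub> g \<otimes>\<^bsub>\<Gamma>\<^esub> k) = k" using g k by (simp add: Gam.m_assoc[symmetric])
    finally show "e (inv\<^bsub>\<Gamma>\<^esub> g \<otimes>\<^bsub>\<Gamma>\<^esub> k) * f (g ((inv\<^bsub>\<Gamma>\<^esub> g \<otimes>\<^bsub>\<Gamma>\<^esub> k) q)) = lact \<Gamma> g e k * f (k q)"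
     using k by (simp add: lact_def)
   qed
   have "group_ring_fun e f q = (\<Sum>k\<in>carrier \<Gamma>. conv \<Gamma> e e k * f (k q))" using True e by (simp add: group_ring_fun_def)
   also have "... = (\<Sum>k\<in>carrier \<Gamma>. \<Sum>g\<in>carrier \<Gamma>. e g * (lact \<Gamma> g e k * f (k q)))"
    unfolding conv_def sum_fun_apply fscale_apply sum_distrib_right mult.assoc ..
   also have "... = (\<Sum>g\<in>carrier \<Gamma>. e g * (\<Sum>k\<in>carrier \<Gamma>. lact \<Gamma> g e k * f (k q)))"
    unfolding sum_distrib_left by (rule sum.swap)
   also have "... = (\<Sum>g\<in>carrier \<Gamma>. e g * (\<Sum>h\<in>carrier \<Gamma>. e h * f (g (h q))))"
    by (rule sum.cong[OF refl]) (simp add: ev)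
   also have "... = (\<Sum>h\<in>carrier \<Gamma>. e h * (\<Sum>g\<in>carrier \<Gamma>. e g * f (g (h q))))"
    unfolding sum_distrib_left by (subst sum.swap) (simp add: mult.left_commute)
   also have "... = group_ring_fun e (group_ring_fun e f) q" using True gf by (simp add: group_ring_fun_def)
   finally show ?thesis ..
  qed (simp add: group_ring_fun_def)
 qed
 assume f: "f \<in> funs_on fibre"
 show "group_ring_fun e (pull fibre right f) = pull fibre right (group_ring_fun e f)"
  "group_ring_fun e (pull fibre up f) = pull fibre up (group_ring_fun e f)"
  using gf gm monodromy_in_fibre by (auto simp: group_ring_fun_def pull_def fun_eq_iff intro!: sum.cong)
 show "(\<Sum>q\<in>fibre. group_ring_fun e f q) = 0" if s: "(\<Sum>q\<in>fibre. f q) = 0"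
 proof -
  have "(\<Sum>q\<in>fibre. f (g q)) = 0" if g: "g \<in> carrier \<Gamma>" for g
  proof -
   have "inj_on g fibre" using automorphismD(1)[OF g] fibreD(1) by (auto simp: Bij_def bij_betw_def inj_on_def)
   moreover have "g ` fibre \<subseteq> fibre" using gf[OF g] by blast
   ultimately have "bij_betw g fibre fibre" using endo_inj_surj[OF finite_fibre[OF spaces(3)]] by (simp add: bij_betw_def)
   thus ?thesis using sum.reindex_bij_betw[of g fibre fibre f] s by simp
  qed
  hence "(\<Sum>g\<in>carrier \<Gamma>. e g * (\<Sum>q\<in>fibre. f (g q))) = 0" by simp
  moreover have "(\<Sum>q\<in>fibre. group_ring_fun e f q) = (\<Sum>g\<in>carrier \<Gamma>. e g * (\<Sum>q\<in>fibre. f (g q)))"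
   unfolding sum_distrib_left by (subst sum.swap) (simp add: group_ring_fun_def)
  ultimately show ?thesis by simp
 qed
 show "EX c. f = cst fibre c" if inv: "pull fibre right f = f" "pull fibre up f = f"
 proof -
  obtain q0 where q0: "q0 \<in> fibre" using fibre_nonempty by blast
  have i: "f (right q) = f q" "f (up q) = f q" if "q \<in> fibre" for q
   using fun_cong[OF inv(1), of q] fun_cong[OF inv(2), of q] that by (simp_all add: pull_def)
  have "f q = f q0" if "q \<in> fibre" for q by (rule invariant_constant[OF spaces(2) i that q0])
  hence "f = cst fibre (f q0)" using f by (auto simp: cst_def funs_on_def fun_eq_iff)
  thus ?thesis by blast
 qed
qed

text \<open>
  The line \<open>e W\<close> is spanned by the class of \<open>z0\<close>. The period over
  \<open>z0\<close> is a nonzero functional on the balanced triples in the range of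
  \<open>e\<close>, and its kernel consists of the triples whose periods vanish on all of
  \<open>W\<close>. These are the coboundaries and the constants, which is the situation of
  \<open>no_line\<close>.
\<close>

lemma multiplicity_not_one:
 assumes irr: "irreducible_representation \<Gamma> V \<rho>"
 shows "multiplicity_in \<Gamma> V \<rho> W (chomology_map 1 M) ~= 1"
proof
 assume one: "multiplicity_in \<Gamma> V \<rho> W (chomology_map 1 M) = 1"
 obtain PB where PB: "fin_linear PB" "range PB \<subseteq> B" "!!x. x \<in> B ==> PB x = x"
  by (rule fc.projection_exists[OF subspace_cboundaries[of 1 M]]) blast
 from linear_model_W[OF PB] obtain J where
  "linear_model \<Gamma> W (chomology_map 1 M) scale_fin J & (ALL z. J (hclass z) = z - PB z)" by (rule exE)
 hence J: "linear_model \<Gamma> W (chomology_map 1 M) scale_fin J" by (rule conjunct1)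
 interpret LM: linear_model \<Gamma> W "chomology_map 1 M" scale_fin J by (rule J)
 obtain e w0 where e: "conv \<Gamma> e e = e" and w0: "w0 \<in> carrier W" "w0 ~= \<zero>\<^bsub>W\<^esub>" "LM.alg e w0 = w0"
  and line: "!!w. w \<in> carrier W ==> EX a. LM.alg e w = a \<odot>\<^bsub>W\<^esub> w0"
  by (rule LM.multiplicity_one_line[OF irr one]) blast
 obtain z0 where z0: "z0 \<in> Z0" "w0 = hclass z0" using w0(1) by (auto simp: carrier_W)
 note z0c = Z0_chains[OF z0(1)]
 have z0Z: "z0 \<in> ccycles 1 M" using z0(1) by (simp add: Z0_def)
 have z0B: "z0 \<notin> B" using w0(2) hclass_eq_iff[of z0 0] z0(2) W_ops(1) by simp
 define P where "P = group_ring_fun e"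
 interpret CP: commuting_projection fibre right up P unfolding P_def by (rule commuting_projection_group_ring[OF e])
 have ez0: "group_ring_chain e z0 - z0 \<in> B"
 proof -
  have "hclass (group_ring_chain e z0) = hclass z0" using w0(3) galg_hclass[OF z0(1), of e] z0(2) by simp
  thus ?thesis using hclass_eq_iff by blast
 qed
 have ez: "EX x. group_ring_chain e z - scale_fin x z0 \<in> B" if z: "z \<in> Z0" for z
 proof -
  have "hclass z \<in> carrier W" using z by (simp add: carrier_W)
  then obtain x where "LM.alg e (hclass z) = x \<odot>\<^bsub>W\<^esub> w0" using line by blast
  hence "hclass (group_ring_chain e z) = hclass (scale_fin x z0)" using galg_hclass[OF z, of e] by (simp add: z0(2) W_ops)
  thus ?thesis using hclass_eq_iff by blast
 qed
 have AD: "f \<in> funs_on fibre" "P f = f" if "f \<in> CP.A" for f using that by (auto simp: CP.A_def)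
 have perA: "period a b h (group_ring_chain e z) = period a b h z"
  if "balanced a b h" "a \<in> CP.A" "b \<in> CP.A" "h \<in> CP.A" "z \<in> cchains 1 M" for a b h z
  using period_group_ring(2)[OF that(1,5), of e] AD(2)[OF that(2)] AD(2)[OF that(3)] AD(2)[OF that(4)] by (simp add: P_def)
 obtain a b h where abh: "balanced a b h" "period a b h z0 ~= 0" using boundary_if_periods_zero[OF z0Z] z0B by blast
 define a0 b0 h0 where "a0 = P a" and "b0 = P b" and "h0 = P h"
 have A0: "a0 \<in> CP.A" "b0 \<in> CP.A" "h0 \<in> CP.A" unfolding a0_def b0_def h0_def by (rule CP.A_ops(3))+
 have bal0: "balanced a0 b0 h0" unfolding a0_def b0_def h0_def P_def by (rule period_group_ring(1)[OF abh(1) z0c])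
 have per0: "period a0 b0 h0 z0 ~= 0" using period_group_ring(2)[OF abh(1) z0c, of e] period_diff_boundary[OF abh(1) ez0] abh(2)
  by (simp add: a0_def b0_def h0_def P_def)
 have bal_iff: "balanced a b h \<longleftrightarrow> CP.R (CP.U h) - CP.U (CP.R h) = (CP.R b - b) - (CP.U a - a)"
  if "a \<in> CP.A" "b \<in> CP.A" for a b h by (rule balanced_pull_iff[OF AD(1)[OF that(1)] AD(1)[OF that(2)]])
 show False
 proof (rule CP.no_line[OF A0])
  show "CP.R (CP.U h0) - CP.U (CP.R h0) = (CP.R b0 - b0) - (CP.U a0 - a0)" using bal_iff[OF A0(1,2)] bal0 by blast
  show "~ (EX g:CP.A. EX s t. a0 = CP.R g - g + cst fibre s & b0 = CP.U g - g + cst fibre t)"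
  proof
   assume "EX g:CP.A. EX s t. a0 = CP.R g - g + cst fibre s & b0 = CP.U g - g + cst fibre t"
   then obtain g s t where g: "a0 = CP.R g - g + cst fibre s" "b0 = CP.U g - g + cst fibre t" by blast
   let ?a = "%q. a0 q + (- 1) * (g (right q) - g q)" and ?b = "%q. b0 q + (- 1) * (g (up q) - g q)"
    and ?h = "%q. h0 q + (- 1) * g q"
   let ?a' = "%q. ?a q + (- 1) * s" and ?b' = "%q. ?b q + (- 1) * t" and ?h' = "%q. ?h q + (- 1) * 0"
   have bal1: "balanced ?a ?b ?h" by (rule balanced_linear[OF bal0 balanced_coboundary])
   have bal2: "balanced ?a' ?b' ?h'" by (rule balanced_linear[OF bal1 balanced_const])
   have zero: "?a' q = 0 & ?b' q = 0 & ?h' q = ?h q" if "q \<in> fibre" for q using that by (simp add: g pull_def cst_def)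
   have balk: "balanced (%_. 0) (%_. 0) ?h" using balanced_cong[of ?a' "%_. 0" ?b' "%_. 0" ?h' ?h] zero bal2 by blast
   have "period ?a' ?b' ?h' z0 = period (%_. 0) (%_. 0) ?h z0" by (rule period_cong[OF zero balk z0c])
   also have "... = 0"
   proof -
    obtain f where f: "!!c. cpath M c ==>
     path_int (jump (%_. 0) (%_. 0) ?h) c = f (c 1) - f (c 0)" by (rule kernel_exact[OF balk]) blast
    show ?thesis by (rule period_exact[OF z0Z f])
   qed
   finally have "period ?a' ?b' ?h' z0 = 0" .
   moreover have "period ?a' ?b' ?h' z0 = period ?a ?b ?h z0 + (- 1) * period (%_. s) (%_. t) (%_. 0) z0"
    by (rule period_linear[OF bal1 balanced_const z0c])
   moreover have "period (%_. s) (%_. t) (%_. 0) z0 = 0"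
    by (rule period_const_zero[OF z0c]) (use z0(1) in \<open>simp add: Z0_def\<close>)
   moreover have "period ?a ?b ?h z0 = period a0 b0 h0 z0 + (- 1) * period (%q. g (right q) - g q) (%q. g (up q) - g q) g z0"
    by (rule period_linear[OF bal0 balanced_coboundary z0c])
   ultimately show False using period_coboundary[OF z0Z] per0 by simp
  qed
  fix a b h assume A: "a \<in> CP.A" "b \<in> CP.A" "h \<in> CP.A"
   and "CP.R (CP.U h) - CP.U (CP.R h) = (CP.R b - b) - (CP.U a - a)"
  hence bal: "balanced a b h" using bal_iff by blast
  (* this multiple makes the period of the difference over z0 vanish *)
  define c where "c = period a b h z0 / period a0 b0 h0 z0"
  define a1 b1 h1 where "a1 = a - fscale c a0" and "b1 = b - fscale c b0" and "h1 = h - fscale c h0"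
  have A1: "a1 \<in> CP.A" "b1 \<in> CP.A" "h1 \<in> CP.A"
   unfolding a1_def b1_def h1_def by (intro fn.subspace_diff fn.subspace_scale CP.subspace_A A A0)+
  have e1: "a1 = (%q. a q + (- c) * a0 q)" "b1 = (%q. b q + (- c) * b0 q)" "h1 = (%q. h q + (- c) * h0 q)"
   by (auto simp: a1_def b1_def h1_def fun_eq_iff)
  have bal1: "balanced a1 b1 h1" unfolding e1 by (rule balanced_linear[OF bal bal0])
  have "period a1 b1 h1 z0 = period a b h z0 + (- c) * period a0 b0 h0 z0" unfolding e1 by (rule period_linear[OF bal bal0 z0c])
  hence per1: "period a1 b1 h1 z0 = 0" using per0 by (simp add: c_def)
  have "period a1 b1 h1 z = 0" if z: "z \<in> ccycles 1 M" "cchain_map 1 \<pi> z \<in> BT" for z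
  proof -
   have zZ: "z \<in> Z0" using z by (simp add: Z0_def)
   obtain x where x: "group_ring_chain e z - scale_fin x z0 \<in> B" using ez[OF zZ] by blast
   have "period a1 b1 h1 z = period a1 b1 h1 (group_ring_chain e z)" by (rule perA[OF bal1 A1 Z0_chains[OF zZ], symmetric])
   also have "... = period a1 b1 h1 (scale_fin x z0)" by (rule period_diff_boundary[OF bal1 x])
   also have "... = 0" using fin_cplx.linear_scale[OF fin_functional_period, of a1 b1 h1 x z0] per1 by simp
   finally show ?thesis .
  qed
  from period_zero_imp_coboundary[OF bal1 this] obtain s t F where
   F: "!!q. q \<in> fibre ==> a1 q = F (right q) - F q + s & b1 q = F (up q) - F q + t" by blast
  define G where "G = (%q. if q \<in> fibre then F q else 0)"
  have GE: "G \<in> funs_on fibre" by (simp add: G_def funs_on_def)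
  have z: "a1 q = 0" "b1 q = 0" if "q \<notin> fibre" for q using that AD(1)[OF A1(1)] AD(1)[OF A1(2)] by (auto simp: funs_on_def)
  have a1: "a1 = CP.R G - G + cst fibre s" and b1: "b1 = CP.U G - G + cst fibre t"
   using F z monodromy_in_fibre by (auto simp: fun_eq_iff pull_def G_def cst_def)
  obtain s' t' where st: "P (cst fibre s) = cst fibre s'" "P (cst fibre t) = cst fibre t'" using CP.P_cst by blast
  have "a1 = P a1" "b1 = P b1" using AD(2) A1 by simp_all
  hence "a1 = CP.R (P G) - P G + cst fibre s'" "b1 = CP.U (P G) - P G + cst fibre t'"
   unfolding a1 b1 CP.P_add CP.P_diff CP.P_r[OF GE] CP.P_u[OF GE] st by simp_all
  moreover have "cst fibre s' \<in> CP.A" "cst fibre t' \<in> CP.A" using CP.A_ops(3) st by metis+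
  ultimately show "EX c. EX g:CP.A. EX s t. cst fibre s \<in> CP.A & cst fibre t \<in> CP.A &
    a - fscale c a0 = CP.R g - g + cst fibre s & b - fscale c b0 = CP.U g - g + cst fibre t"
   using CP.A_ops(3)[of G] unfolding a1_def b1_def by blast
 qed
qed

end

theorem theorem1p2:
  fixes M :: "'a topology" and \<pi> :: "'a \<Rightarrow> (real \<times> real) set"
    and V :: "(complex, 'v) module" and \<rho> :: "('a \<Rightarrow> 'a) \<Rightarrow> 'v \<Rightarrow> 'v"
  assumes "origami M \<pi>"
    and "irreducible_representation (origami_Aut M \<pi>) V \<rho>"
  shows "multiplicity_in (origami_Aut M \<pi>) V \<rho> (origami_H10 M \<pi>) (chomology_map 1 M) \<noteq> 1"
  by (rule origami_surface.multiplicity_not_one) (simp_all add: origami_surface_def assms)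

end
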